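(* Let $\{Q^s\mid s>s_0\}$ be a chain of Banach manifolds with a compatible weak Riemannian metric $\gamma$, and let $\Phi:G\times Q^s\to Q^s$ be a free action of a finite dimensional Lie group $G$ satisfying all the hypotheses listed in the context. Let $s>s_0+2$, let $\omega,\upsilon\in Q^s/G$, and let $(\mathcal U_1,\mathcal B_{q_\omega})$, $(\mathcal U_2,\mathcal B_{q_\upsilon})$ be two charts of $Q^s/G$ (at $\omega$ and $\upsilon$, with $q_\omega\in\pi^{-1}(\omega)$, $q_\upsilon\in\pi^{-1}(\upsilon)$) such that $\mathcal U_1\cap\mathcal U_2\neq\varnothing$. Then the change of charts $$F:=\mathcal B_{q_\upsilon}\circ\mathcal B_{q_\omega}^{-1}:\mathcal B_{q_\omega}(\mathcal U_1\cap\mathcal U_2)\subset N^s_{q_\omega}\longrightarrow\mathcal B_{q_\upsilon}(\mathcal U_1\cap\mathcal U_2)\subset N^s_{q_\upsilon}$$ is $C^1$ as a map with values in $N^{s-1}_{q_\upsilon}$.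
   Context: Chain of Banach manifolds: a collection $\{Q^s\mid s>s_0\}$ of smooth Banach manifolds such that for all $r>s>s_0$ there is a smooth inclusion $j_{(r,s)}:Q^r\hookrightarrow Q^s$ with dense range, such that for all $q\in Q^r$ the range of $T_qj_{(r,s)}:T_qQ^r\to T_qQ^s$ is dense in $T_qQ^s$, and such that for each chart $\varphi^s:U^s\to T_qQ^s$ of $Q^s$ at a point $q\in Q^r$, $r>s$, the map $\varphi^r:=\varphi^s|_{U^s\cap Q^r}$ takes values in $T_qQ^r$ and is a chart of $Q^r$. (One regards $Q^r\subset Q^s$ and $T_qQ^r\subset T_qQ^s$.) Each $Q^s$ carries a weak Riemannian metric $\gamma_s$ with $j_{(r,s)}^*\gamma_s=\gamma_r$; it is denoted simply $\gamma$. Hypotheses on the action: $G$ is a finite dimensional Lie group with Lie algebra $\mathfrak g$; for every $s>s_0$ there is an action $\Phi:G\times Q^s\to Q^s$, $\Phi(g,q)=\Phi_g(q)=\Phi^q(g)$, which is continuous; proper (whenever $(q_n)$ and $(\Phi_{g_n}(q_n))$ converge in $Q^s$, $(g_n)$ has a convergent subsequence in $G$); compatible (each $\Phi_g$ commutes with all $j_{(r,s)}$); and such that (1) for all $s>s_0$ and $g\in G$, $\Phi_g:Q^s\to Q^s$ is smooth; (2) for all $s>s_0+1$ and $q\in Q^s$, $\Phi^q:G\to Q^{s-1}$ is $C^1$. $\pi:Q^s\to Q^s/G$ is the orbit projection. Charts of $Q^s/G$ ($\Phi$ free, $s>s_0+1$): let $(e_1,\dots,e_n)$ be a basis of $\mathfrak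 g$ and $E_i(q):=T_e\Phi^q(e_i)\in T_qQ^{s-1}$ for $q\in Q^s$. Put $N^s_q:=\{v\in T_qQ^s\mid\gamma(q)(v,E_i(q))=0,\ i=1,\dots,n\}$ and $N^{s-1}_q:=\{v\in T_qQ^{s-1}\mid\gamma(q)(v,E_i(q))=0,\ i=1,\dots,n\}$. Let $\varphi^{s-1}$ be a chart of $Q^{s-1}$ at $q$ with $\varphi^{s-1}(q)=0$, $T_q\varphi^{s-1}=\mathrm{id}$, and let $\varphi^s$ be its restriction to $Q^s$, a chart of $Q^s$ at $q$. There are neighborhoods $V(e)$ of $e$ in $G$, $U$ of $q$ in $Q^s$ and a $C^1$ map $\beta_q:U\to V(e)$ such that for $g\in V(e)$, $r\in U$: $\varphi^s(\Phi_g(r))\in N^s_q\iff g=\beta_q(r)$. Put $B_q(r):=\varphi^s(\Phi_{\beta_q(r)}(r))\in N^s_q$. For $U$ small, $B_q$ takes equal values at points of $U$ in the same orbit, so with $\mathcal U:=\pi(U)$ there is a map $\mathcal B_q:\mathcal U\to N^s_q$ with $\mathcal B_q\circ\pi=B_q$; and $U$ is taken small enough that $\mathcal B_q$ is a homeomorphism of $\mathcal U$ onto an open subset of $N^s_q$ with inverse $\pi\circ(\varphi^s)^{-1}$. The pairs $(\mathcal U,\mathcal B_q)$ are the charts of the topological manifold $Q^s/G$. *)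

theory Defs
  imports "HOL-Analysis.Analysis" "HOL-Algebra.Group_Action"
begin

section \<open>Banach spaces on a carrier, and Frechet calculus\<close>

text \<open>
  The Banach spaces below form families indexed by a real number and by a point of a manifold,
  and spaces with different norms are nested in each other. They are therefore linear subspaces
  of one real vector space, each with a norm of its own, and not types. The norm is only
  meaningful on \<open>sp E\<close>.
\<close>

record 'e nspace =
  sp :: "'e set"
  nrm :: "'e \<Rightarrow> real"

definition ndist :: "'e::real_vector nspace \<Rightarrow> 'e \<Rightarrow> 'e \<Rightarrow> real" where
  "ndist E x y = (if x \<in> sp E \<and> y \<in> sp E then nrm E (x - y) else 0)"

definition ntop :: "'e::real_vector nspace \<Rightarrow> 'e topology" where
  "ntop E = Metric_space.mtopology (sp E) (ndist E)"

definition normed_space :: "'e::real_vector nspace \<Rightarrow> bool" where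
  "normed_space E \<longleftrightarrow>
     subspace (sp E) \<and>
     (\<forall>x\<in>sp E. 0 \<le> nrm E x \<and> (nrm E x = 0 \<longleftrightarrow> x = 0)) \<and>
     (\<forall>a. \<forall>x\<in>sp E. nrm E (a *\<^sub>R x) = \<bar>a\<bar> * nrm E x) \<and>
     (\<forall>x\<in>sp E. \<forall>y\<in>sp E. nrm E (x + y) \<le> nrm E x + nrm E y)"

definition banach_space :: "'e::real_vector nspace \<Rightarrow> bool" where
  "banach_space E \<longleftrightarrow> normed_space E \<and> Metric_space.mcomplete (sp E) (ndist E)"

definition prod_nspace :: "'a nspace \<Rightarrow> 'b nspace \<Rightarrow> ('a \<times> 'b) nspace" where
  "prod_nspace E F = \<lparr> sp = sp E \<times> sp F, nrm = (\<lambda>(x, y). max (nrm E x) (nrm F y)) \<rparr>"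

definition real_nspace :: "real nspace" where
  "real_nspace = \<lparr> sp = UNIV, nrm = abs \<rparr>"

definition bounded_linear_on ::
    "'e::real_vector nspace \<Rightarrow> 'f::real_vector nspace \<Rightarrow> ('e \<Rightarrow> 'f) \<Rightarrow> bool" where
  "bounded_linear_on E F A \<longleftrightarrow>
     (\<forall>x\<in>sp E. A x \<in> sp F) \<and>
     (\<forall>x\<in>sp E. \<forall>y\<in>sp E. A (x + y) = A x + A y) \<and>
     (\<forall>a. \<forall>x\<in>sp E. A (a *\<^sub>R x) = a *\<^sub>R A x) \<and>
     (\<exists>K. \<forall>x\<in>sp E. nrm F (A x) \<le> K * nrm E x)"

definition has_fderiv_on ::
    "'e::real_vector nspace \<Rightarrow> 'f::real_vector nspace \<Rightarrow> 'e set \<Rightarrow> ('e \<Rightarrow> 'f) \<Rightarrow> ('e \<Rightarrow> 'f) \<Rightarrow> 'e \<Rightarrow> bool"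
  where
  "has_fderiv_on E F U f f' x \<longleftrightarrow>
     x \<in> U \<and> bounded_linear_on E F f' \<and>
     (\<forall>\<epsilon>>0. \<exists>\<delta>>0. \<forall>h\<in>sp E. nrm E h < \<delta> \<and> x + h \<in> U \<longrightarrow>
        nrm F (f (x + h) - f x - f' h) \<le> \<epsilon> * nrm E h)"

text \<open>For open \<open>U\<close> the Frechet derivative is unique as a map on \<open>sp E\<close>; off \<open>sp E\<close> it is arbitrary.\<close>

definition fderiv ::
    "'e::real_vector nspace \<Rightarrow> 'f::real_vector nspace \<Rightarrow> 'e set \<Rightarrow> ('e \<Rightarrow> 'f) \<Rightarrow> 'e \<Rightarrow> 'e \<Rightarrow> 'f" where
  "fderiv E F U f x = (SOME f'. has_fderiv_on E F U f f' x)"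

text \<open>
  Bounded \<open>j\<close>-linear maps from \<open>E\<close> to \<open>F\<close>, as functions on lists of length \<open>j\<close>; in this form the
  iterated derivatives of all orders have one type.
\<close>

definition bounded_multilinear_on ::
    "nat \<Rightarrow> 'e::real_vector nspace \<Rightarrow> 'f::real_vector nspace \<Rightarrow> ('e list \<Rightarrow> 'f) \<Rightarrow> bool" where
  "bounded_multilinear_on j E F A \<longleftrightarrow>
     (\<forall>vs. length vs = j \<and> set vs \<subseteq> sp E \<longrightarrow> A vs \<in> sp F) \<and>
     (\<forall>us ws. Suc (length us + length ws) = j \<and> set us \<subseteq> sp E \<and> set ws \<subseteq> sp E \<longrightarrow>
        (\<forall>x\<in>sp E. \<forall>y\<in>sp E. A (us @ (x + y) # ws) = A (us @ x # ws) + A (us @ y # ws)) \<and>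
        (\<forall>a. \<forall>x\<in>sp E. A (us @ (a *\<^sub>R x) # ws) = a *\<^sub>R A (us @ x # ws))) \<and>
     (\<exists>K. \<forall>vs. length vs = j \<and> set vs \<subseteq> sp E \<longrightarrow> nrm F (A vs) \<le> K * prod_list (map (nrm E) vs))"

definition unit_args :: "nat \<Rightarrow> 'e nspace \<Rightarrow> 'e list set" where
  "unit_args j E = {vs. length vs = j \<and> set vs \<subseteq> sp E \<and> (\<forall>v\<in>set vs. nrm E v \<le> 1)}"

text \<open>
  \<open>Ck_on k E F U f\<close>: \<open>f\<close> maps the open set \<open>U\<close> of \<open>E\<close> to \<open>F\<close> and is \<open>k\<close> times continuously Frechet
  differentiable. Here \<open>D j x\<close> is the \<open>j\<close>-th derivative at \<open>x\<close>; each \<open>D j\<close> with \<open>j < k\<close> is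
  differentiable with derivative \<open>D (Suc j)\<close>, and \<open>D k\<close> is continuous, both with respect to the
  operator norm on \<open>j\<close>-linear (resp. \<open>k\<close>-linear) maps.
\<close>

definition Ck_on ::
    "nat \<Rightarrow> 'e::real_vector nspace \<Rightarrow> 'f::real_vector nspace \<Rightarrow> 'e set \<Rightarrow> ('e \<Rightarrow> 'f) \<Rightarrow> bool" where
  "Ck_on k E F U f \<longleftrightarrow>
     openin (ntop E) U \<and>
     (\<exists>D :: nat \<Rightarrow> 'e \<Rightarrow> 'e list \<Rightarrow> 'f.
        (\<forall>x\<in>U. D 0 x [] = f x) \<and>
        (\<forall>j\<le>k. \<forall>x\<in>U. bounded_multilinear_on j E F (D j x)) \<and>
        (\<forall>j<k. \<forall>x\<in>U. \<forall>\<epsilon>>0. \<exists>\<delta>>0. \<forall>h\<in>sp E. nrm E h < \<delta> \<and> x + h \<in> U \<longrightarrow>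
           (\<forall>vs\<in>unit_args j E.
              nrm F (D j (x + h) vs - D j x vs - D (Suc j) x (h # vs)) \<le> \<epsilon> * nrm E h)) \<and>
        (\<forall>x\<in>U. \<forall>\<epsilon>>0. \<exists>\<delta>>0. \<forall>y\<in>U. nrm E (y - x) < \<delta> \<longrightarrow>
           (\<forall>vs\<in>unit_args k E. nrm F (D k y vs - D k x vs) \<le> \<epsilon>)))"

definition smooth_on ::
    "'e::real_vector nspace \<Rightarrow> 'f::real_vector nspace \<Rightarrow> 'e set \<Rightarrow> ('e \<Rightarrow> 'f) \<Rightarrow> bool" where
  "smooth_on E F U f \<longleftrightarrow> (\<forall>k. Ck_on k E F U f)"


section \<open>Banach manifolds\<close>

record ('p, 'e) chart =
  cdom :: "'p set"
  cmap :: "'p \<Rightarrow> 'e"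

text \<open>
  The smooth structure of \<open>M\<close> is given by an atlas, which need not be maximal, whose charts carry
  a base point: \<open>charts M p\<close> is the set of charts at \<open>p\<close>, with values in the Banach space
  \<open>tangent M p\<close>. This Banach space is identified with the abstract tangent space at \<open>p\<close> (classes
  of pairs of a chart and a vector, or of curves) by means of one of these charts, \<open>ref M p\<close>. So
  the tangent map of any map is the derivative of its representative in reference charts, and
  \<open>ref M p\<close> has tangent map \<open>id\<close> at \<open>p\<close>, but the other charts at \<open>p\<close> need not.
\<close>

record ('p, 'e) manifold =
  mtop :: "'p topology"
  tangent :: "'p \<Rightarrow> 'e nspace"
  charts :: "'p \<Rightarrow> ('p, 'e) chart set"
  ref :: "'p \<Rightarrow> ('p, 'e) chart"

abbreviation points :: "('p, 'e) manifold \<Rightarrow> 'p set" where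
  "points M \<equiv> topspace (mtop M)"

definition cinv :: "('p, 'e) chart \<Rightarrow> 'e \<Rightarrow> 'p" where
  "cinv c = inv_into (cdom c) (cmap c)"

text \<open>The representative of \<open>f\<close>, defined on \<open>W\<close>, in the charts \<open>c\<close> and \<open>d\<close>.\<close>

definition rep_dom :: "('p, 'e) chart \<Rightarrow> ('r, 'f) chart \<Rightarrow> 'p set \<Rightarrow> ('p \<Rightarrow> 'r) \<Rightarrow> 'e set" where
  "rep_dom c d W f = cmap c ` {x \<in> cdom c \<inter> W. f x \<in> cdom d}"

definition rep :: "('p, 'e) chart \<Rightarrow> ('r, 'f) chart \<Rightarrow> ('p \<Rightarrow> 'r) \<Rightarrow> 'e \<Rightarrow> 'f" where
  "rep c d f = cmap d \<circ> f \<circ> cinv c"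

definition banach_manifold :: "('p, 'e::real_vector) manifold \<Rightarrow> bool" where
  "banach_manifold M \<longleftrightarrow>
     Hausdorff_space (mtop M) \<and>
     (\<forall>p\<in>points M. banach_space (tangent M p) \<and> ref M p \<in> charts M p \<and>
        (\<forall>c\<in>charts M p.
           openin (mtop M) (cdom c) \<and> p \<in> cdom c \<and>
           openin (ntop (tangent M p)) (cmap c ` cdom c) \<and>
           homeomorphic_map (subtopology (mtop M) (cdom c))
             (subtopology (ntop (tangent M p)) (cmap c ` cdom c)) (cmap c))) \<and>
     (\<forall>p\<in>points M. \<forall>p'\<in>points M. \<forall>c\<in>charts M p. \<forall>c'\<in>charts M p'.
        smooth_on (tangent M p) (tangent M p') (cmap c ` (cdom c \<inter> cdom c')) (cmap c' \<circ> cinv c))"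

definition Ck_map_on ::
    "nat \<Rightarrow> ('p, 'e::real_vector) manifold \<Rightarrow> ('r, 'f::real_vector) manifold \<Rightarrow> 'p set \<Rightarrow> ('p \<Rightarrow> 'r) \<Rightarrow> bool"
  where
  "Ck_map_on k M N W f \<longleftrightarrow>
     openin (mtop M) W \<and> continuous_map (subtopology (mtop M) W) (mtop N) f \<and>
     (\<forall>p\<in>points M. \<forall>p'\<in>points N. \<forall>c\<in>charts M p. \<forall>d\<in>charts N p'.
        Ck_on k (tangent M p) (tangent N p') (rep_dom c d W f) (rep c d f))"

definition Ck_map ::
    "nat \<Rightarrow> ('p, 'e::real_vector) manifold \<Rightarrow> ('r, 'f::real_vector) manifold \<Rightarrow> ('p \<Rightarrow> 'r) \<Rightarrow> bool" where
  "Ck_map k M N f \<longleftrightarrow> Ck_map_on k M N (points M) f"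

definition smooth_map ::
    "('p, 'e::real_vector) manifold \<Rightarrow> ('r, 'f::real_vector) manifold \<Rightarrow> ('p \<Rightarrow> 'r) \<Rightarrow> bool" where
  "smooth_map M N f \<longleftrightarrow> (\<forall>k. Ck_map k M N f)"

definition tangent_map ::
    "('p, 'e::real_vector) manifold \<Rightarrow> ('r, 'f::real_vector) manifold \<Rightarrow> ('p \<Rightarrow> 'r) \<Rightarrow> 'p \<Rightarrow> 'e \<Rightarrow> 'f" where
  "tangent_map M N f p =
     fderiv (tangent M p) (tangent N (f p))
       (rep_dom (ref M p) (ref N (f p)) (points M) f)
       (rep (ref M p) (ref N (f p)) f) (cmap (ref M p) p)"

text \<open>
  For a chart \<open>c\<close> at \<open>p\<close> and \<open>y \<in> cdom c\<close>: the tangent map of \<open>c\<close> at \<open>y\<close>, from \<open>tangent M y\<close> to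
  \<open>tangent M p\<close>, and the tangent map of its inverse at \<open>cmap c y\<close>.
\<close>

definition chart_tangent ::
    "('p, 'e::real_vector) manifold \<Rightarrow> 'p \<Rightarrow> ('p, 'e) chart \<Rightarrow> 'p \<Rightarrow> 'e \<Rightarrow> 'e" where
  "chart_tangent M p c y =
     fderiv (tangent M y) (tangent M p) (cmap (ref M y) ` (cdom (ref M y) \<inter> cdom c))
       (cmap c \<circ> cinv (ref M y)) (cmap (ref M y) y)"

definition chart_inv_tangent ::
    "('p, 'e::real_vector) manifold \<Rightarrow> 'p \<Rightarrow> ('p, 'e) chart \<Rightarrow> 'p \<Rightarrow> 'e \<Rightarrow> 'e" where
  "chart_inv_tangent M p c y =
     fderiv (tangent M p) (tangent M y) (cmap c ` (cdom c \<inter> cdom (ref M y)))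
       (cmap (ref M y) \<circ> cinv c) (cmap c y)"

definition prod_chart :: "('p, 'e) chart \<Rightarrow> ('r, 'f) chart \<Rightarrow> ('p \<times> 'r, 'e \<times> 'f) chart" where
  "prod_chart c d = \<lparr> cdom = cdom c \<times> cdom d, cmap = map_prod (cmap c) (cmap d) \<rparr>"

definition prod_manifold ::
    "('p, 'e) manifold \<Rightarrow> ('r, 'f) manifold \<Rightarrow> ('p \<times> 'r, 'e \<times> 'f) manifold" where
  "prod_manifold M N =
     \<lparr> mtop = prod_topology (mtop M) (mtop N),
       tangent = (\<lambda>(p, r). prod_nspace (tangent M p) (tangent N r)),
       charts = (\<lambda>(p, r). {prod_chart c d | c d. c \<in> charts M p \<and> d \<in> charts N r}),
       ref = (\<lambda>(p, r). prod_chart (ref M p) (ref N r)) \<rparr>"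

text \<open>
  A weak Riemannian metric: \<open>\<gamma> p\<close> need not induce the topology of the tangent space. Smoothness is
  that of \<open>\<gamma>\<close> as a function on the Whitney sum of two copies of the tangent bundle, read in the
  charts of the atlas.
\<close>

definition weak_riemannian_metric ::
    "('p, 'e::real_vector) manifold \<Rightarrow> ('p \<Rightarrow> 'e \<Rightarrow> 'e \<Rightarrow> real) \<Rightarrow> bool" where
  "weak_riemannian_metric M \<gamma> \<longleftrightarrow>
     (\<forall>p\<in>points M.
        (\<forall>u\<in>sp (tangent M p). \<forall>v\<in>sp (tangent M p). \<forall>w\<in>sp (tangent M p). \<forall>a b.
           \<gamma> p (a *\<^sub>R u + b *\<^sub>R v) w = a * \<gamma> p u w + b * \<gamma> p v w) \<and>
        (\<forall>v\<in>sp (tangent M p). \<forall>w\<in>sp (tangent M p). \<gamma> p v w = \<gamma> p w v) \<and>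
        (\<forall>v\<in>sp (tangent M p). v \<noteq> 0 \<longrightarrow> \<gamma> p v v > 0)) \<and>
     (\<forall>p\<in>points M. \<forall>c\<in>charts M p.
        smooth_on (prod_nspace (tangent M p) (prod_nspace (tangent M p) (tangent M p))) real_nspace
          ((cmap c ` cdom c) \<times> sp (tangent M p) \<times> sp (tangent M p))
          (\<lambda>(x, v, w). let y = cinv c x in
             \<gamma> y (chart_inv_tangent M p c y v) (chart_inv_tangent M p c y w)))"


section \<open>Finite dimensional Lie groups\<close>

definition lie_group :: "'g monoid \<Rightarrow> ('g, 'l::real_vector) manifold \<Rightarrow> bool" where
  "lie_group G L \<longleftrightarrow>
     group G \<and> banach_manifold L \<and> points L = carrier G \<and>
     (\<forall>g\<in>carrier G. \<exists>B. finite B \<and> sp (tangent L g) = span B) \<and>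
     smooth_map (prod_manifold L L) L (\<lambda>(g, h). g \<otimes>\<^bsub>G\<^esub> h) \<and>
     smooth_map L L (\<lambda>g. inv\<^bsub>G\<^esub> g)"

text \<open>A basis of the Lie algebra, i.e. of the tangent space at the identity.\<close>

definition lie_algebra_basis ::
    "'g monoid \<Rightarrow> ('g, 'l::real_vector) manifold \<Rightarrow> 'l list \<Rightarrow> bool" where
  "lie_algebra_basis G L es \<longleftrightarrow>
     distinct es \<and> independent (set es) \<and> span (set es) = sp (tangent L \<one>\<^bsub>G\<^esub>)"


section \<open>Chains of Banach manifolds and actions on them\<close>

text \<open>
  The spaces \<open>Q r\<close> and \<open>Q s\<close> with \<open>r > s\<close> are literally nested, with different topologies, and so
  are their tangent spaces: the inclusion of points is \<open>\<lambda>q. q\<close>, and its tangent map is the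
  inclusion \<open>v \<mapsto> v\<close>. The chart condition refers to the charts of the given atlases, not to all
  compatible charts, for which it would fail already for linear charts (unless the tangent spaces
  of \<open>Q r\<close> and \<open>Q s\<close> coincide).
\<close>

definition banach_manifold_chain :: "real \<Rightarrow> (real \<Rightarrow> ('q, 'e::real_vector) manifold) \<Rightarrow> bool" where
  "banach_manifold_chain s0 Q \<longleftrightarrow>
     (\<forall>s>s0. banach_manifold (Q s)) \<and>
     (\<forall>s>s0. \<forall>r>s.
        points (Q r) \<subseteq> points (Q s) \<and>
        smooth_map (Q r) (Q s) (\<lambda>q. q) \<and>
        (mtop (Q s)) closure_of (points (Q r)) = points (Q s) \<and>
        (\<forall>q\<in>points (Q r).
           sp (tangent (Q r) q) \<subseteq> sp (tangent (Q s) q) \<and>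
           (\<forall>v\<in>sp (tangent (Q r) q). tangent_map (Q r) (Q s) (\<lambda>q. q) q v = v) \<and>
           (ntop (tangent (Q s) q)) closure_of (sp (tangent (Q r) q)) = sp (tangent (Q s) q) \<and>
           (\<forall>c\<in>charts (Q s) q.
              cmap c ` (cdom c \<inter> points (Q r)) \<subseteq> sp (tangent (Q r) q) \<and>
              \<lparr> cdom = cdom c \<inter> points (Q r), cmap = cmap c \<rparr> \<in> charts (Q r) q)))"

text \<open>
  Since the tangent maps of the inclusions are inclusions, a family of metrics on the \<open>Q s\<close> that
  are pulled back to each other is the same as one \<open>\<gamma>\<close> that restricts to a metric on each \<open>Q s\<close>.
\<close>

definition chain_metric ::
    "real \<Rightarrow> (real \<Rightarrow> ('q, 'e::real_vector) manifold) \<Rightarrow> ('q \<Rightarrow> 'e \<Rightarrow> 'e \<Rightarrow> real) \<Rightarrow> bool" where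
  "chain_metric s0 Q \<gamma> \<longleftrightarrow> (\<forall>s>s0. weak_riemannian_metric (Q s) \<gamma>)"

text \<open>
  Likewise a family of actions on the \<open>Q s\<close> that commute with the inclusions is the same as one
  map \<open>\<Phi>\<close> that restricts to an action on each \<open>Q s\<close>.
\<close>

definition chain_action ::
    "real \<Rightarrow> (real \<Rightarrow> ('q, 'e::real_vector) manifold) \<Rightarrow> 'g monoid \<Rightarrow> ('g, 'l::real_vector) manifold \<Rightarrow>
     ('g \<Rightarrow> 'q \<Rightarrow> 'q) \<Rightarrow> bool" where
  "chain_action s0 Q G L \<Phi> \<longleftrightarrow>
     (\<forall>s>s0.
        (\<forall>g\<in>carrier G. \<forall>q\<in>points (Q s). \<Phi> g q \<in> points (Q s)) \<and>
        (\<forall>q\<in>points (Q s). \<Phi> \<one>\<^bsub>G\<^esub> q = q) \<and>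
        (\<forall>g\<in>carrier G. \<forall>h\<in>carrier G. \<forall>q\<in>points (Q s). \<Phi> (g \<otimes>\<^bsub>G\<^esub> h) q = \<Phi> g (\<Phi> h q)) \<and>
        continuous_map (prod_topology (mtop L) (mtop (Q s))) (mtop (Q s)) (\<lambda>(g, q). \<Phi> g q) \<and>
        (\<forall>gs qs a b.
           range gs \<subseteq> carrier G \<and> range qs \<subseteq> points (Q s) \<and>
           limitin (mtop (Q s)) qs a sequentially \<and>
           limitin (mtop (Q s)) (\<lambda>n. \<Phi> (gs n) (qs n)) b sequentially \<longrightarrow>
           (\<exists>g \<sigma>. strict_mono (\<sigma> :: nat \<Rightarrow> nat) \<and> limitin (mtop L) (gs \<circ> \<sigma>) g sequentially)) \<and>
        (\<forall>g\<in>carrier G. smooth_map (Q s) (Q s) (\<Phi> g))) \<and>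
     (\<forall>s>s0 + 1. \<forall>q\<in>points (Q s). Ck_map 1 L (Q (s - 1)) (\<lambda>g. \<Phi> g q))"

definition free_on_chain ::
    "real \<Rightarrow> (real \<Rightarrow> ('q, 'e) manifold) \<Rightarrow> 'g monoid \<Rightarrow> ('g \<Rightarrow> 'q \<Rightarrow> 'q) \<Rightarrow> bool" where
  "free_on_chain s0 Q G \<Phi> \<longleftrightarrow>
     (\<forall>s>s0. \<forall>q\<in>points (Q s). \<forall>g\<in>carrier G. \<Phi> g q = q \<longrightarrow> g = \<one>\<^bsub>G\<^esub>)"


section \<open>The orbit space and its charts\<close>

definition orbit_space ::
    "('q, 'e) manifold \<Rightarrow> 'g monoid \<Rightarrow> ('g \<Rightarrow> 'q \<Rightarrow> 'q) \<Rightarrow> 'q set topology" where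
  "orbit_space M G \<Phi> =
     topology (\<lambda>S. S \<subseteq> orbit G \<Phi> ` points M \<and> openin (mtop M) {q \<in> points M. orbit G \<Phi> q \<in> S})"

text \<open>For \<open>q\<close> in \<open>Q s\<close> and \<open>e\<close> in the Lie algebra, \<open>fund_vec Q G L \<Phi> s e q\<close> is tangent to \<open>Q (s - 1)\<close>.\<close>

definition fund_vec ::
    "(real \<Rightarrow> ('q, 'e::real_vector) manifold) \<Rightarrow> 'g monoid \<Rightarrow> ('g, 'l::real_vector) manifold \<Rightarrow>
     ('g \<Rightarrow> 'q \<Rightarrow> 'q) \<Rightarrow> real \<Rightarrow> 'l \<Rightarrow> 'q \<Rightarrow> 'e" where
  "fund_vec Q G L \<Phi> s e q = tangent_map L (Q (s - 1)) (\<lambda>g. \<Phi> g q) \<one>\<^bsub>G\<^esub> e"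

text \<open>
  The vectors in the tangent space of \<open>Q t\<close> at \<open>q\<close> that are \<open>\<gamma>\<close>-orthogonal to the orbit, with the
  norm of that tangent space. Used for \<open>q\<close> in \<open>Q s\<close>, with \<open>t = s\<close> and \<open>t = s - 1\<close>.
\<close>

definition orbit_normal_space ::
    "(real \<Rightarrow> ('q, 'e::real_vector) manifold) \<Rightarrow> 'g monoid \<Rightarrow> ('g, 'l::real_vector) manifold \<Rightarrow>
     ('g \<Rightarrow> 'q \<Rightarrow> 'q) \<Rightarrow> ('q \<Rightarrow> 'e \<Rightarrow> 'e \<Rightarrow> real) \<Rightarrow> 'l list \<Rightarrow> real \<Rightarrow> real \<Rightarrow> 'q \<Rightarrow> 'e nspace" where
  "orbit_normal_space Q G L \<Phi> \<gamma> es s t q =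
     \<lparr> sp = {v \<in> sp (tangent (Q t) q). \<forall>e\<in>set es. \<gamma> q v (fund_vec Q G L \<Phi> s e q) = 0},
       nrm = nrm (tangent (Q t) q) \<rparr>"

text \<open>
  \<open>(\<U>, \<B>)\<close> is a chart of the orbit space of \<open>Q s\<close> constructed at \<open>q\<close> in \<open>Q s\<close>: \<open>c\<close> is the chart
  of \<open>Q (s - 1)\<close> at \<open>q\<close>, \<open>V\<close> and \<open>U\<close> are the neighborhoods of the identity and of \<open>q\<close>, and
  \<open>\<beta> : U \<rightarrow> V\<close> is the \<open>C\<^sup>1\<close> map that moves points of \<open>U\<close> into the normal space.
\<close>

definition quotient_chart ::
    "(real \<Rightarrow> ('q, 'e::real_vector) manifold) \<Rightarrow> 'g monoid \<Rightarrow> ('g, 'l::real_vector) manifold \<Rightarrow>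
     ('g \<Rightarrow> 'q \<Rightarrow> 'q) \<Rightarrow> ('q \<Rightarrow> 'e \<Rightarrow> 'e \<Rightarrow> real) \<Rightarrow> 'l list \<Rightarrow> real \<Rightarrow> 'q \<Rightarrow>
     'q set set \<Rightarrow> ('q set \<Rightarrow> 'e) \<Rightarrow> bool" where
  "quotient_chart Q G L \<Phi> \<gamma> es s q \<U> \<B> \<longleftrightarrow>
     q \<in> points (Q s) \<and>
     (\<exists>c V U \<beta>.
        c \<in> charts (Q (s - 1)) q \<and> cmap c q = 0 \<and>
        (\<forall>v\<in>sp (tangent (Q (s - 1)) q). chart_tangent (Q (s - 1)) q c q v = v) \<and>
        openin (mtop L) V \<and> \<one>\<^bsub>G\<^esub> \<in> V \<and>
        openin (mtop (Q s)) U \<and> q \<in> U \<and>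
        Ck_map_on 1 (Q s) L U \<beta> \<and> \<beta> ` U \<subseteq> V \<and>
        (\<forall>g\<in>V. \<forall>r\<in>U. \<Phi> g r \<in> cdom c \<and>
           (cmap c (\<Phi> g r) \<in> sp (orbit_normal_space Q G L \<Phi> \<gamma> es s s q) \<longleftrightarrow> g = \<beta> r)) \<and>
        \<U> = orbit G \<Phi> ` U \<and>
        (\<forall>r\<in>U. \<B> (orbit G \<Phi> r) = cmap c (\<Phi> (\<beta> r) r)) \<and>
        openin (ntop (orbit_normal_space Q G L \<Phi> \<gamma> es s s q)) (\<B> ` \<U>) \<and>
        homeomorphic_maps
          (subtopology (orbit_space (Q s) G \<Phi>) \<U>)
          (subtopology (ntop (orbit_normal_space Q G L \<Phi> \<gamma> es s s q)) (\<B> ` \<U>))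
          \<B> (orbit G \<Phi> \<circ> inv_into (cdom c \<inter> points (Q s)) (cmap c)))"


section \<open>Consistency with the library notions\<close>

lemma Metric_space_ndist: "normed_space E \<Longrightarrow> Metric_space (sp E) (ndist E)"
proof
  assume E: "normed_space E"
  have sub: "x - y \<in> sp E" if "x \<in> sp E" "y \<in> sp E" for x y
    using E that by (auto simp: normed_space_def intro: subspace_diff)
  have scale: "nrm E (a *\<^sub>R x) = \<bar>a\<bar> * nrm E x" if "x \<in> sp E" for a x
    using E that by (simp add: normed_space_def)
  have tri: "nrm E (x + y) \<le> nrm E x + nrm E y" if "x \<in> sp E" "y \<in> sp E" for x y
    using E that by (simp add: normed_space_def)
  have pos: "0 \<le> nrm E x" and zero: "nrm E x = 0 \<longleftrightarrow> x = 0" if "x \<in> sp E" for x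
    using E that by (simp_all add: normed_space_def)
  show "0 \<le> ndist E x y" for x y
    using pos sub by (simp add: ndist_def)
  show "ndist E x y = ndist E y x" for x y
  proof (cases "x \<in> sp E \<and> y \<in> sp E")
    case True
    have "nrm E ((-1) *\<^sub>R (x - y)) = \<bar>-1\<bar> * nrm E (x - y)"
      using scale sub True by blast
    then show ?thesis using True by (simp add: ndist_def)
  qed (auto simp: ndist_def)
  show "ndist E x y = 0 \<longleftrightarrow> x = y" if "x \<in> sp E" "y \<in> sp E" for x y
    using zero[OF sub[OF that]] that by (simp add: ndist_def)
  show "ndist E x z \<le> ndist E x y + ndist E y z" if "x \<in> sp E" "y \<in> sp E" "z \<in> sp E" for x y z
  proof -
    have "nrm E ((x - y) + (y - z)) \<le> nrm E (x - y) + nrm E (y - z)"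
      using tri sub that by blast
    then show ?thesis using that by (simp add: ndist_def)
  qed
qed

definition type_nspace :: "'e::real_normed_vector nspace" where
  "type_nspace = \<lparr> sp = UNIV, nrm = norm \<rparr>"

lemma bounded_linear_on_type_nspace:
  "bounded_linear_on type_nspace type_nspace A \<longleftrightarrow> bounded_linear A"
proof
  assume A: "bounded_linear_on type_nspace type_nspace A"
  then obtain K where "\<And>x. norm (A x) \<le> norm x * K"
    unfolding bounded_linear_on_def type_nspace_def by (auto simp: mult.commute)
  then show "bounded_linear A"
    using A unfolding bounded_linear_on_def type_nspace_def
    by (intro bounded_linear_intro[where K = K]) auto
next
  assume A: "bounded_linear A"
  then obtain K where "\<And>x. norm (A x) \<le> norm x * K"
    using bounded_linear.bounded by blast
  then show "bounded_linear_on type_nspace type_nspace A"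
    using A unfolding bounded_linear_on_def type_nspace_def
    by (auto simp: linear_simps mult.commute)
qed

lemma has_fderiv_on_type_nspace:
  "has_fderiv_on type_nspace type_nspace U f f' x \<longleftrightarrow> x \<in> U \<and> (f has_derivative f') (at x within U)"
  (is "?l \<longleftrightarrow> ?r")
proof -
  have "(\<exists>\<delta>>0. \<forall>h. norm h < \<delta> \<and> x + h \<in> U \<longrightarrow> norm (f (x + h) - f x - f' h) \<le> \<epsilon> * norm h) \<longleftrightarrow>
        (\<exists>\<delta>>0. \<forall>y\<in>U. norm (y - x) < \<delta> \<longrightarrow> norm (f y - f x - f' (y - x)) \<le> \<epsilon> * norm (y - x))" for \<epsilon>
  proof -
    have "(\<forall>h. norm h < \<delta> \<and> x + h \<in> U \<longrightarrow> norm (f (x + h) - f x - f' h) \<le> \<epsilon> * norm h) \<longleftrightarrow>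
          (\<forall>y\<in>U. norm (y - x) < \<delta> \<longrightarrow> norm (f y - f x - f' (y - x)) \<le> \<epsilon> * norm (y - x))" for \<delta>
    proof (intro iffI ballI allI impI)
      fix y
      assume "\<forall>h. norm h < \<delta> \<and> x + h \<in> U \<longrightarrow> norm (f (x + h) - f x - f' h) \<le> \<epsilon> * norm h"
        and "y \<in> U" "norm (y - x) < \<delta>"
      then show "norm (f y - f x - f' (y - x)) \<le> \<epsilon> * norm (y - x)"
        by (elim allE[of _ "y - x"]) simp
    next
      fix h
      assume "\<forall>y\<in>U. norm (y - x) < \<delta> \<longrightarrow> norm (f y - f x - f' (y - x)) \<le> \<epsilon> * norm (y - x)"
        and "norm h < \<delta> \<and> x + h \<in> U"
      then show "norm (f (x + h) - f x - f' h) \<le> \<epsilon> * norm h"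
        by (elim conjE ballE[of _ _ "x + h"]) simp_all
    qed
    then show ?thesis by simp
  qed
  then show ?thesis
    using bounded_linear_on_type_nspace[of f']
    unfolding has_fderiv_on_def has_derivative_within_alt
    by (auto simp: type_nspace_def)
qed

lemma istopology_orbit_space:
  "istopology (\<lambda>S. S \<subseteq> orbit G \<Phi> ` points M \<and> openin (mtop M) {q \<in> points M. orbit G \<Phi> q \<in> S})"
proof -
  have 1: "{q \<in> points M. orbit G \<Phi> q \<in> S \<inter> T} =
        {q \<in> points M. orbit G \<Phi> q \<in> S} \<inter> {q \<in> points M. orbit G \<Phi> q \<in> T}" for S T
    by auto
  have 2: "{q \<in> points M. orbit G \<Phi> q \<in> \<Union>\<K>} = (\<Union>S\<in>\<K>. {q \<in> points M. orbit G \<Phi> q \<in> S})" for \<K>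
    by auto
  show ?thesis
    unfolding istopology_def 1 2 by (auto intro!: openin_Union)
qed

lemma quotient_map_orbit_space: "quotient_map (mtop M) (orbit_space M G \<Phi>) (orbit G \<Phi>)"
proof -
  have *: "openin (orbit_space M G \<Phi>) S \<longleftrightarrow>
      S \<subseteq> orbit G \<Phi> ` points M \<and> openin (mtop M) {q \<in> points M. orbit G \<Phi> q \<in> S}" for S
    unfolding orbit_space_def using istopology_orbit_space[of G \<Phi> M]
    by (simp add: topology_inverse')
  have "{q \<in> points M. orbit G \<Phi> q \<in> orbit G \<Phi> ` points M} = points M" by auto
  then have "openin (orbit_space M G \<Phi>) (orbit G \<Phi> ` points M)" by (simp add: *)
  then have "topspace (orbit_space M G \<Phi>) = orbit G \<Phi> ` points M"
    using * by (metis openin_subset openin_topspace subset_antisym)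
  then show ?thesis unfolding quotient_map_def using * by auto
qed

end

theory Submission
  imports Defs
begin

text \<open>
  Near a point of its domain the change of charts sends \<open>x\<close> to the chart value of
  \<open>\<Phi> (\<beta> z) z\<close>, where \<open>z = \<Phi> g y\<close>, \<open>y\<close> is the point of \<open>Q s\<close> with coordinate \<open>x\<close>, \<open>g\<close> is a fixed
  group element that moves \<open>y\<close> into the domain of the second slice, and \<open>\<beta>\<close> is the \<open>C\<^sup>1\<close> map that
  belongs to this slice. As \<open>\<Phi> g\<close> is smooth on \<open>Q s\<close>, the theorem follows by the chain rule once
  \<open>(g, x) \<mapsto> \<Phi> g x\<close> is known to be \<open>C\<^sup>1\<close> as a map from \<open>G \<times> Q s\<close> to \<open>Q (s - 1)\<close>, and the group law
  allows to consider only points \<open>(\<one>, q)\<close> (\<open>slice_map_strict\<close>, \<open>action_compose_strict\<close>).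

  Joint differentiability is the heart of the matter, because the hypotheses are separate ones:
  each \<open>\<Phi> g\<close> is smooth on each \<open>Q t\<close>, and each single orbit map is \<open>C\<^sup>1\<close> into \<open>Q (s - 1)\<close>. Let \<open>\<bar>g\<bar>\<close>
  be the distance of \<open>g\<close> from \<open>\<one>\<close> in a chart. What must be shown is that the displacement
  \<open>\<Phi> g x - x\<close> changes by at most \<open>O(\<bar>g\<bar>)\<close> times the distance of \<open>x\<close> from \<open>q\<close> when \<open>q\<close> is replaced
  by \<open>x\<close>, where distances of points are measured in \<open>Q s\<close> and displacements in \<open>Q (s - 1)\<close>. This
  is part of \<open>two_norm_estimate\<close>, and \<open>action_strict\<close> derives the differentiability from it.

  The estimate rests on two applications of Baire's theorem and on an averaging argument. Baire's
  theorem on \<open>G\<close>, followed by a translation in \<open>G\<close>, bounds first and second order differences of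
  \<open>\<Phi> g\<close> uniformly for \<open>g\<close> near \<open>\<one>\<close>, on \<open>Q s\<close> and on \<open>Q (s - 1)\<close> (\<open>uniform_tame\<close>). Baire's theorem
  on \<open>Q s\<close> makes the bound \<open>\<Phi> g x - x = O(\<bar>g\<bar>)\<close>, which holds for each \<open>x\<close>, uniform on some
  small ball (\<open>orbit_Lipschitz_on_ball\<close>), but the centre of this ball need not be \<open>q\<close>. To get from
  there to \<open>q\<close>, let \<open>T\<close> be the derivative of \<open>\<Phi> g\<close> at \<open>q\<close>, and let \<open>K\<close> be the mean over \<open>k < N\<close> of
  the maps \<open>\<Phi> (g [^] k)\<close>, normalized to have the value \<open>0\<close> and the derivative \<open>id\<close> at \<open>q\<close>, with \<open>N\<close>
  about \<open>1 / \<bar>g\<bar>\<close>. The sum telescopes under composition with \<open>\<Phi> g\<close>, so that \<open>K\<close> conjugates \<open>\<Phi> g\<close>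
  to \<open>T\<close> up to half of the displacement, which can be absorbed, and an error of order \<open>\<bar>g\<bar>\<close>
  (\<open>average_step\<close>). Moreover \<open>K\<close> is close to the identity for the strong norm, uniformly in \<open>g\<close>
  (\<open>average_near_id\<close>). The bound on the ball thus turns into a bound for \<open>T - id\<close> on a ball; as
  \<open>T - id\<close> is linear, the centre of the ball does not matter, and \<open>T - id\<close> is \<open>O(\<bar>g\<bar>)\<close> from the
  strong to the weak norm. Going back through \<open>K\<close> gives the estimate at \<open>q\<close>.
\<close>

section \<open>Normed spaces on a carrier\<close>

lemma nspace_zero: "normed_space E \<Longrightarrow> 0 \<in> sp E"
  and nspace_add: "normed_space E \<Longrightarrow> x \<in> sp E \<Longrightarrow> y \<in> sp E \<Longrightarrow> x + y \<in> sp E"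
  and nspace_diff: "normed_space E \<Longrightarrow> x \<in> sp E \<Longrightarrow> y \<in> sp E \<Longrightarrow> x - y \<in> sp E"
  and nspace_scale: "normed_space E \<Longrightarrow> x \<in> sp E \<Longrightarrow> a *\<^sub>R x \<in> sp E"
  and nspace_minus: "normed_space E \<Longrightarrow> x \<in> sp E \<Longrightarrow> - x \<in> sp E"
  unfolding normed_space_def
  by (auto intro: subspace_0 subspace_add subspace_diff subspace_scale subspace_neg)

lemma nspace_sum: "normed_space E \<Longrightarrow> (\<And>i. i \<in> I \<Longrightarrow> f i \<in> sp E) \<Longrightarrow> sum f I \<in> sp E"
  unfolding normed_space_def by (auto intro: subspace_sum)

lemmas nspace_closed = nspace_zero nspace_add nspace_diff nspace_scale nspace_minus

lemma nrm_nonneg: "normed_space E \<Longrightarrow> x \<in> sp E \<Longrightarrow> 0 \<le> nrm E x"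
  and nrm_eq_0: "normed_space E \<Longrightarrow> x \<in> sp E \<Longrightarrow> nrm E x = 0 \<longleftrightarrow> x = 0"
  and nrm_scale: "normed_space E \<Longrightarrow> x \<in> sp E \<Longrightarrow> nrm E (a *\<^sub>R x) = \<bar>a\<bar> * nrm E x"
  and nrm_triangle: "normed_space E \<Longrightarrow> x \<in> sp E \<Longrightarrow> y \<in> sp E \<Longrightarrow> nrm E (x + y) \<le> nrm E x + nrm E y"
  unfolding normed_space_def by auto

lemma nrm_zero: "normed_space E \<Longrightarrow> nrm E 0 = 0"
  using nrm_eq_0[of E 0] nspace_zero[of E] by auto

lemma nrm_scale_le:
  "normed_space E \<Longrightarrow> x \<in> sp E \<Longrightarrow> 0 \<le> a \<Longrightarrow> nrm E x \<le> c \<Longrightarrow> nrm E (a *\<^sub>R x) \<le> a * c"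
  by (simp add: nrm_scale mult_left_mono)

lemma nrm_minus: "normed_space E \<Longrightarrow> x \<in> sp E \<Longrightarrow> nrm E (- x) = nrm E x"
  using nrm_scale[of E x "-1"] by simp

lemma nrm_minus_commute:
  "normed_space E \<Longrightarrow> x \<in> sp E \<Longrightarrow> y \<in> sp E \<Longrightarrow> nrm E (x - y) = nrm E (y - x)"
  using nrm_minus[of E "x - y"] nspace_diff[of E x y] by simp

lemma nrm_triangle_diff:
  "normed_space E \<Longrightarrow> x \<in> sp E \<Longrightarrow> y \<in> sp E \<Longrightarrow> nrm E (x - y) \<le> nrm E x + nrm E y"
  using nrm_triangle[of E x "- y"] nrm_minus[of E y] nspace_minus[of E y] by simp

lemma nrm_triangle_via:
  assumes "normed_space E" "x \<in> sp E" "y \<in> sp E" "z \<in> sp E"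
  shows "nrm E (x - z) \<le> nrm E (x - y) + nrm E (y - z)"
  using nrm_triangle[of E "x - y" "y - z"] assms nspace_diff by force

lemma nrm_triangle_rev:
  assumes "normed_space E" "x \<in> sp E" "y \<in> sp E"
  shows "nrm E x \<le> nrm E y + nrm E (x - y)"
  using nrm_triangle[of E y "x - y"] assms nspace_diff by force

lemma nrm_sum_le:
  assumes "normed_space E" "\<And>i. i \<in> I \<Longrightarrow> f i \<in> sp E" "\<And>i. i \<in> I \<Longrightarrow> nrm E (f i) \<le> B i"
  shows "nrm E (sum f I) \<le> sum B I"
  using assms(2,3)
proof (induction I rule: infinite_finite_induct)
  case (insert i I)
  have "nrm E (f i + sum f I) \<le> nrm E (f i) + nrm E (sum f I)"
    using insert by (intro nrm_triangle assms(1) nspace_sum) auto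
  then show ?case using insert by (force simp: insert.hyps)
qed (auto simp: nrm_zero assms(1))

definition nball :: "'e::real_vector nspace \<Rightarrow> 'e \<Rightarrow> real \<Rightarrow> 'e set" where
  "nball E x r = {y \<in> sp E. nrm E (y - x) < r}"

lemma nball_sp: "y \<in> nball E x r \<Longrightarrow> y \<in> sp E"
  and nball_mono: "r \<le> r' \<Longrightarrow> nball E x r \<subseteq> nball E x r'"
  by (auto simp: nball_def)

lemma center_in_nball: "normed_space E \<Longrightarrow> x \<in> sp E \<Longrightarrow> 0 < r \<Longrightarrow> x \<in> nball E x r"
  by (auto simp: nball_def nrm_zero)

lemma nball_shift:
  assumes "normed_space E" "x \<in> sp E" "y \<in> sp E" "nrm E (y - x) + s \<le> r"
  shows "nball E y s \<subseteq> nball E x r"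
proof
  fix z assume z: "z \<in> nball E y s"
  then have "nrm E (z - x) \<le> nrm E (z - y) + nrm E (y - x)"
    using assms by (intro nrm_triangle_via) (auto simp: nball_def)
  then show "z \<in> nball E x r" using z assms by (auto simp: nball_def)
qed

lemma nball_in_nball:
  assumes "normed_space E" "x \<in> sp E" "y \<in> nball E x r"
  obtains s where "s > 0" "nball E y s \<subseteq> nball E x r"
proof
  show "r - nrm E (y - x) > 0" using assms(3) by (auto simp: nball_def)
  show "nball E y (r - nrm E (y - x)) \<subseteq> nball E x r"
    using assms by (intro nball_shift) (auto simp: nball_def)
qed

lemma nball_segment:
  assumes "normed_space E" "x \<in> sp E" "y \<in> nball E x r" "z \<in> nball E x r" "0 \<le> t" "t \<le> 1"
  shows "y + t *\<^sub>R (z - y) \<in> nball E x r"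
proof -
  have yz: "y \<in> sp E" "z \<in> sp E" "nrm E (y - x) < r" "nrm E (z - x) < r"
    using assms by (auto simp: nball_def)
  have eq: "y + t *\<^sub>R (z - y) - x = (1 - t) *\<^sub>R (y - x) + t *\<^sub>R (z - x)"
    by (simp add: algebra_simps)
  have "nrm E (y + t *\<^sub>R (z - y) - x) \<le> nrm E ((1 - t) *\<^sub>R (y - x)) + nrm E (t *\<^sub>R (z - x))"
    unfolding eq using assms yz by (intro nrm_triangle nspace_closed)
  also have "\<dots> = (1 - t) * nrm E (y - x) + t * nrm E (z - x)"
    using assms yz by (simp add: nrm_scale nspace_closed)
  also have "\<dots> < r"
    using convex_bound_lt[of "nrm E (y - x)" r "nrm E (z - x)" "1 - t" t] assms yz by auto
  finally show ?thesis using assms yz by (auto simp: nball_def intro!: nspace_closed)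
qed

lemma mball_ndist:
  assumes "normed_space E"
  shows "Metric_space.mball (sp E) (ndist E) x r = (if x \<in> sp E then nball E x r else {})"
  using nrm_minus_commute[OF assms] Metric_space.in_mball[OF Metric_space_ndist[OF assms]]
  by (auto simp: nball_def ndist_def)

lemma openin_ntop:
  assumes "normed_space E"
  shows "openin (ntop E) U \<longleftrightarrow> U \<subseteq> sp E \<and> (\<forall>x\<in>U. \<exists>r>0. nball E x r \<subseteq> U)"
  unfolding ntop_def Metric_space.openin_mtopology[OF Metric_space_ndist[OF assms]]
  by (auto simp: mball_ndist[OF assms] subset_iff)

lemma topspace_ntop: "normed_space E \<Longrightarrow> topspace (ntop E) = sp E"
  unfolding ntop_def by (simp add: Metric_space.topspace_mtopology Metric_space_ndist)

lemma openin_nball: "normed_space E \<Longrightarrow> x \<in> sp E \<Longrightarrow> openin (ntop E) (nball E x r)"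
  unfolding openin_ntop by (meson nball_in_nball nball_sp subsetI)

text \<open>
  The Baire category theorem for a countable cover of a ball. Closedness is only demanded relative
  to the ball, since the sets in question are defined by maps that make sense only there.
\<close>

lemma Baire_nball:
  fixes A :: "nat \<Rightarrow> 'e::real_vector set"
  assumes E: "banach_space E" and x: "x \<in> sp E" and r: "r > 0"
    and cover: "\<And>y. y \<in> nball E x r \<Longrightarrow> \<exists>n. y \<in> A n"
    and closed: "\<And>n y. y \<in> nball E x r \<Longrightarrow> y \<notin> A n \<Longrightarrow>
       \<exists>d>0. \<forall>y'\<in>nball E y d \<inter> nball E x r. y' \<notin> A n"
  obtains n y d where "d > 0" "y \<in> nball E x r" "nball E y d \<subseteq> nball E x r" "nball E y d \<subseteq> A n"
proof -
  have nE: "normed_space E" using E by (simp add: banach_space_def)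
  interpret M: Metric_space "sp E" "ndist E" by (rule Metric_space_ndist[OF nE])
  have top: "M.mtopology = ntop E" by (simp add: ntop_def)
  \<comment> \<open>The relatively closed sets become closed after intersection with a smaller closed ball.\<close>
  define C where "C n = {y \<in> sp E. nrm E (y - x) \<le> r / 2} \<inter> A n" for n
  have sub: "C n \<subseteq> nball E x r" for n using r by (auto simp: C_def nball_def)
  have "closedin (ntop E) (C n)" for n
    unfolding closedin_def topspace_ntop[OF nE] openin_ntop[OF nE]
  proof (intro conjI ballI)
    fix y assume y: "y \<in> sp E - C n"
    show "\<exists>d>0. nball E y d \<subseteq> sp E - C n"
    proof (cases "nrm E (y - x) \<le> r / 2")
      case True
      then have "y \<in> nball E x r" "y \<notin> A n" using y r by (auto simp: C_def nball_def)
      then obtain d where "d > 0" "\<forall>y'\<in>nball E y d \<inter> nball E x r. y' \<notin> A n" using closed by blast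
      then show ?thesis using sub[of n] by (intro exI[of _ d]) (auto simp: nball_def C_def)
    next
      case False
      have "nball E y (nrm E (y - x) - r / 2) \<subseteq> sp E - C n"
      proof
        fix z assume z: "z \<in> nball E y (nrm E (y - x) - r / 2)"
        then have "nrm E (y - x) \<le> nrm E (y - z) + nrm E (z - x)"
          using y x by (intro nrm_triangle_via nE) (auto simp: nball_def)
        then show "z \<in> sp E - C n"
          using z y nrm_minus_commute[OF nE, of y z] by (auto simp: nball_def C_def)
      qed
      then show ?thesis using False by (intro exI[of _ "nrm E (y - x) - r / 2"]) auto
    qed
  qed (auto simp: C_def)
  moreover have "\<not> (ntop E) interior_of (\<Union>n. C n) = {}"
  proof -
    have "nball E x (r/2) \<subseteq> (\<Union>n. C n)"
    proof
      fix y assume y: "y \<in> nball E x (r/2)"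
      then have "y \<in> nball E x r" using r by (auto simp: nball_def)
      then show "y \<in> (\<Union>n. C n)" using cover y by (fastforce simp: C_def nball_def)
    qed
    then have "nball E x (r/2) \<subseteq> (ntop E) interior_of (\<Union>n. C n)"
      using interior_of_maximal openin_nball[OF nE x] by blast
    then show ?thesis using center_in_nball[OF nE x, of "r/2"] r by auto
  qed
  ultimately obtain n where n: "(ntop E) interior_of (C n) \<noteq> {}"
    using M.metric_Baire_category_alt[of "range C"] E by (auto simp: top banach_space_def)
  then obtain y where y: "y \<in> (ntop E) interior_of (C n)" by blast
  then obtain d where "d > 0" "nball E y d \<subseteq> (ntop E) interior_of (C n)"
    using openin_interior_of openin_ntop[OF nE] by metis
  then have d: "d > 0" "nball E y d \<subseteq> C n" using interior_of_subset by (metis subset_trans)+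
  show ?thesis
    using that[of d y n] d sub[of n] y interior_of_subset[of "ntop E" "C n"]
    by (metis C_def Int_subset_iff subset_eq)
qed

lemma normed_space_prod:
  assumes "normed_space E" "normed_space F"
  shows "normed_space (prod_nspace E F)"
proof -
  have s: "subspace (sp E)" "subspace (sp F)" using assms by (auto simp: normed_space_def)
  then have "subspace (sp E \<times> sp F)" by (rule subspace_Times)
  moreover have "max (nrm E (x + x')) (nrm F (y + y')) \<le> max (nrm E x) (nrm F y) + max (nrm E x') (nrm F y')"
    if "x \<in> sp E" "x' \<in> sp E" "y \<in> sp F" "y' \<in> sp F" for x x' y y'
    using nrm_triangle[OF assms(1) that(1,2)] nrm_triangle[OF assms(2) that(3,4)] by linarith
  moreover have "max (nrm E (a *\<^sub>R x)) (nrm F (a *\<^sub>R y)) = \<bar>a\<bar> * max (nrm E x) (nrm F y)"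
    if "x \<in> sp E" "y \<in> sp F" for a x y
    using that assms by (simp add: nrm_scale max_mult_distrib_left)
  moreover have "0 \<le> max (nrm E x) (nrm F y) \<and> (max (nrm E x) (nrm F y) = 0 \<longleftrightarrow> x = 0 \<and> y = 0)"
    if "x \<in> sp E" "y \<in> sp F" for x y
    using nrm_nonneg[OF assms(1) that(1)] nrm_nonneg[OF assms(2) that(2)]
      nrm_eq_0[OF assms(1) that(1)] nrm_eq_0[OF assms(2) that(2)] by (auto simp: max_def)
  ultimately show ?thesis by (auto simp: normed_space_def prod_nspace_def zero_prod_def)
qed

lemma normed_space_real: "normed_space real_nspace"
  by (auto simp: normed_space_def real_nspace_def abs_mult)

section \<open>Strict differentiability\<close>

lemma bounded_linear_onD:
  assumes "bounded_linear_on E F A"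
  shows "x \<in> sp E \<Longrightarrow> A x \<in> sp F"
    and "x \<in> sp E \<Longrightarrow> y \<in> sp E \<Longrightarrow> A (x + y) = A x + A y"
    and "x \<in> sp E \<Longrightarrow> A (a *\<^sub>R x) = a *\<^sub>R A x"
  using assms by (auto simp: bounded_linear_on_def)

lemma bounded_linear_on_bound:
  assumes "bounded_linear_on E F A" "normed_space E"
  obtains K where "K > 0" "\<And>x. x \<in> sp E \<Longrightarrow> nrm F (A x) \<le> K * nrm E x"
proof -
  obtain K where K: "\<And>x. x \<in> sp E \<Longrightarrow> nrm F (A x) \<le> K * nrm E x"
    using assms unfolding bounded_linear_on_def by metis
  show ?thesis
  proof
    show "\<bar>K\<bar> + 1 > 0" by simp
    fix x assume x: "x \<in> sp E"
    have "K * nrm E x \<le> (\<bar>K\<bar> + 1) * nrm E x"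
      by (intro mult_right_mono nrm_nonneg assms x) auto
    then show "nrm F (A x) \<le> (\<bar>K\<bar> + 1) * nrm E x" using K[OF x] by linarith
  qed
qed

lemma bounded_linear_on_diff:
  assumes "bounded_linear_on E F A" "normed_space E" "x \<in> sp E" "y \<in> sp E"
  shows "A (x - y) = A x - A y"
proof -
  have "A (x + (-1) *\<^sub>R y) = A x + (-1) *\<^sub>R A y"
    using assms by (metis bounded_linear_onD(2,3) nspace_scale)
  then show ?thesis by simp
qed

lemma bounded_linear_on_0:
  assumes "bounded_linear_on E F A" "normed_space E"
  shows "A 0 = 0"
  using bounded_linear_onD(3)[OF assms(1) nspace_zero[OF assms(2)], of 0] by simp

lemma bounded_linear_on_sum:
  assumes "bounded_linear_on E F A" "normed_space E" "\<And>i. i \<in> I \<Longrightarrow> f i \<in> sp E"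
  shows "A (sum f I) = (\<Sum>i\<in>I. A (f i))"
  using assms(3)
proof (induction I rule: infinite_finite_induct)
  case (insert i I)
  then have "A (f i + sum f I) = A (f i) + A (sum f I)"
    by (intro bounded_linear_onD(2)[OF assms(1)] nspace_sum assms(2)) auto
  then show ?case using insert by simp
qed (auto simp: bounded_linear_on_0[OF assms(1,2)])

lemma bounded_linear_on_compose:
  assumes "bounded_linear_on E F A" "bounded_linear_on F H B" "normed_space E" "normed_space F"
  shows "bounded_linear_on E H (\<lambda>x. B (A x))"
proof -
  obtain K where K: "\<And>x. x \<in> sp E \<Longrightarrow> nrm F (A x) \<le> K * nrm E x"
    using bounded_linear_on_bound[OF assms(1,3)] by blast
  obtain L where L: "L > 0" "\<And>x. x \<in> sp F \<Longrightarrow> nrm H (B x) \<le> L * nrm F x"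
    using bounded_linear_on_bound[OF assms(2,4)] by blast
  have "nrm H (B (A x)) \<le> L * K * nrm E x" if x: "x \<in> sp E" for x
  proof -
    have "nrm H (B (A x)) \<le> L * nrm F (A x)" using L x assms(1) by (auto simp: bounded_linear_on_def)
    also have "\<dots> \<le> L * (K * nrm E x)" using K[OF x] L by simp
    finally show ?thesis by (simp add: mult.assoc)
  qed
  then show ?thesis using assms(1,2) unfolding bounded_linear_on_def by auto
qed

lemma bounded_linear_on_add:
  assumes "bounded_linear_on E F A" "bounded_linear_on E F B" "normed_space E" "normed_space F"
  shows "bounded_linear_on E F (\<lambda>x. A x + B x)"
proof -
  obtain K where K: "\<And>x. x \<in> sp E \<Longrightarrow> nrm F (A x) \<le> K * nrm E x"
    using bounded_linear_on_bound[OF assms(1,3)] by blast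
  obtain L where L: "\<And>x. x \<in> sp E \<Longrightarrow> nrm F (B x) \<le> L * nrm E x"
    using bounded_linear_on_bound[OF assms(2,3)] by blast
  have "nrm F (A x + B x) \<le> (K + L) * nrm E x" if x: "x \<in> sp E" for x
    using nrm_triangle[OF assms(4), of "A x" "B x"] bounded_linear_onD(1)[OF assms(1) x]
      bounded_linear_onD(1)[OF assms(2) x] K[OF x] L[OF x] by (simp add: distrib_right)
  moreover have "A x + B x \<in> sp F" if "x \<in> sp E" for x
    using that assms by (intro nspace_add bounded_linear_onD(1)[where A = A] bounded_linear_onD(1)[where A = B])
  ultimately show ?thesis using assms(1,2) unfolding bounded_linear_on_def
    by (intro conjI exI[of _ "K + L"]) (auto simp: scaleR_add_right)
qed

text \<open>
  Strict differentiability at a point. It is a local condition on \<open>f\<close> that is stable under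
  composition, and a map is \<open>C\<^sup>1\<close> on an open set iff it is strictly differentiable at each point,
  so that continuity of the derivative never has to be checked separately.
\<close>

definition strict_deriv ::
    "'e::real_vector nspace \<Rightarrow> 'f::real_vector nspace \<Rightarrow> ('e \<Rightarrow> 'f) \<Rightarrow> ('e \<Rightarrow> 'f) \<Rightarrow> 'e \<Rightarrow> bool" where
  "strict_deriv E F f A x \<longleftrightarrow> x \<in> sp E \<and> bounded_linear_on E F A \<and>
     (\<forall>\<epsilon>>0. \<exists>\<delta>>0. \<forall>y\<in>nball E x \<delta>. \<forall>z\<in>nball E x \<delta>.
        f y \<in> sp F \<and> nrm F (f y - f z - A (y - z)) \<le> \<epsilon> * nrm E (y - z))"

lemma strict_derivD:
  assumes "strict_deriv E F f A x"
  shows "x \<in> sp E" "bounded_linear_on E F A"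
    and "\<epsilon> > 0 \<Longrightarrow> \<exists>\<delta>>0. \<forall>y\<in>nball E x \<delta>. \<forall>z\<in>nball E x \<delta>.
        f y \<in> sp F \<and> nrm F (f y - f z - A (y - z)) \<le> \<epsilon> * nrm E (y - z)"
  using assms unfolding strict_deriv_def by auto

lemma strict_derivE:
  assumes "strict_deriv E F f A x" "\<epsilon> > 0"
  obtains \<delta> where "\<delta> > 0" "\<And>y. y \<in> nball E x \<delta> \<Longrightarrow> f y \<in> sp F"
    "\<And>y z. y \<in> nball E x \<delta> \<Longrightarrow> z \<in> nball E x \<delta> \<Longrightarrow>
        nrm F (f y - f z - A (y - z)) \<le> \<epsilon> * nrm E (y - z)"
  using strict_derivD(3)[OF assms] by metis

lemma strict_deriv_Lipschitz:
  assumes "strict_deriv E F f A x" "normed_space E" "normed_space F"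
  obtains K \<delta> where "K > 0" "\<delta> > 0" "\<forall>y\<in>nball E x \<delta>. f y \<in> sp F"
    "\<forall>y\<in>nball E x \<delta>. \<forall>z\<in>nball E x \<delta>. nrm F (f y - f z) \<le> K * nrm E (y - z)"
proof -
  obtain \<delta> where d: "\<delta> > 0" "\<And>y. y \<in> nball E x \<delta> \<Longrightarrow> f y \<in> sp F"
    "\<And>y z. y \<in> nball E x \<delta> \<Longrightarrow> z \<in> nball E x \<delta> \<Longrightarrow>
        nrm F (f y - f z - A (y - z)) \<le> 1 * nrm E (y - z)"
    using strict_derivE[OF assms(1), of 1] by auto
  have A: "bounded_linear_on E F A" using assms(1) by (rule strict_derivD)
  obtain K where K: "K > 0" "\<And>x. x \<in> sp E \<Longrightarrow> nrm F (A x) \<le> K * nrm E x"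
    using bounded_linear_on_bound[OF A assms(2)] by blast
  show ?thesis
  proof
    show "K + 1 > 0" "\<delta> > 0" using K d by auto
    show "\<forall>y\<in>nball E x \<delta>. f y \<in> sp F" using d(2) by blast
    show "\<forall>y\<in>nball E x \<delta>. \<forall>z\<in>nball E x \<delta>. nrm F (f y - f z) \<le> (K + 1) * nrm E (y - z)"
    proof (intro ballI)
    fix y z assume yz: "y \<in> nball E x \<delta>" "z \<in> nball E x \<delta>"
    have s: "y - z \<in> sp E" using yz assms by (auto simp: nball_def intro: nspace_closed)
    have "nrm F (f y - f z) \<le> nrm F (A (y - z)) + nrm F (f y - f z - A (y - z))"
      using s A yz d by (intro nrm_triangle_rev assms nspace_closed) (auto simp: bounded_linear_on_def)
    then show "nrm F (f y - f z) \<le> (K + 1) * nrm E (y - z)"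
      using K(2)[OF s] d(3)[OF yz] by (simp add: distrib_right)
    qed
  qed
qed

lemma strict_deriv_continuous:
  assumes "strict_deriv E F f A x" "normed_space E" "normed_space F" "\<epsilon> > 0"
  obtains \<delta> where "\<delta> > 0" "\<And>y. y \<in> nball E x \<delta> \<Longrightarrow> f y \<in> nball F (f x) \<epsilon>"
proof -
  obtain K \<delta> where K': "K > 0" "\<delta> > 0" "\<forall>y\<in>nball E x \<delta>. f y \<in> sp F"
    "\<forall>y\<in>nball E x \<delta>. \<forall>z\<in>nball E x \<delta>. nrm F (f y - f z) \<le> K * nrm E (y - z)"
    by (rule strict_deriv_Lipschitz[OF assms(1-3)])
  note K = K'[rule_format]
  have x: "x \<in> sp E" using assms(1) by (rule strict_derivD)
  show ?thesis
  proof
    show "min \<delta> (\<epsilon> / K) > 0" using K assms by auto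
    fix y assume y: "y \<in> nball E x (min \<delta> (\<epsilon> / K))"
    then have "nrm F (f y - f x) \<le> K * nrm E (y - x)"
      using K center_in_nball[OF assms(2) x] by (auto simp: nball_def)
    also have "\<dots> < \<epsilon>" using y K by (auto simp: nball_def field_simps)
    finally show "f y \<in> nball F (f x) \<epsilon>" using y K by (auto simp: nball_def)
  qed
qed

lemma strict_deriv_compose:
  assumes f: "strict_deriv E F f A x" and g: "strict_deriv F H g B (f x)"
    and E: "normed_space E" and F: "normed_space F" and H: "normed_space H"
  shows "strict_deriv E H (\<lambda>y. g (f y)) (\<lambda>h. B (A h)) x"
  unfolding strict_deriv_def
proof (intro conjI allI impI)
  show "x \<in> sp E" using f by (rule strict_derivD)
  have A: "bounded_linear_on E F A" and B: "bounded_linear_on F H B"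
    using f g by (auto dest: strict_derivD)
  show "bounded_linear_on E H (\<lambda>h. B (A h))" by (rule bounded_linear_on_compose[OF A B E F])
  fix \<epsilon> :: real assume \<epsilon>: "\<epsilon> > 0"
  obtain K \<delta>1 where K': "K > 0" "\<delta>1 > 0" "\<forall>y\<in>nball E x \<delta>1. f y \<in> sp F"
    "\<forall>y\<in>nball E x \<delta>1. \<forall>z\<in>nball E x \<delta>1. nrm F (f y - f z) \<le> K * nrm E (y - z)"
    by (rule strict_deriv_Lipschitz[OF f E F])
  note K = K'[rule_format]
  obtain L where L: "L > 0" "\<And>x. x \<in> sp F \<Longrightarrow> nrm H (B x) \<le> L * nrm F x"
    using bounded_linear_on_bound[OF B F] by blast
  obtain \<delta>2 where d2: "\<delta>2 > 0" "\<And>y. y \<in> nball F (f x) \<delta>2 \<Longrightarrow> g y \<in> sp H"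
    "\<And>y z. y \<in> nball F (f x) \<delta>2 \<Longrightarrow> z \<in> nball F (f x) \<delta>2 \<Longrightarrow>
        nrm H (g y - g z - B (y - z)) \<le> \<epsilon> / (2 * K) * nrm F (y - z)"
    using strict_derivE[OF g, of "\<epsilon> / (2 * K)"] \<epsilon> K by auto
  obtain \<delta>3 where d3: "\<delta>3 > 0" "\<And>y z. y \<in> nball E x \<delta>3 \<Longrightarrow> z \<in> nball E x \<delta>3 \<Longrightarrow>
        nrm F (f y - f z - A (y - z)) \<le> \<epsilon> / (2 * L) * nrm E (y - z)"
    using strict_derivE[OF f, of "\<epsilon> / (2 * L)"] \<epsilon> L by (metis divide_pos_pos mult_pos_pos zero_less_numeral)
  obtain \<delta>4 where d4: "\<delta>4 > 0" "\<And>y. y \<in> nball E x \<delta>4 \<Longrightarrow> f y \<in> nball F (f x) \<delta>2"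
    using strict_deriv_continuous[OF f E F d2(1)] by blast
  define \<delta> where "\<delta> = min \<delta>1 (min \<delta>3 \<delta>4)"
  have "g (f y) \<in> sp H \<and> nrm H (g (f y) - g (f z) - B (A (y - z))) \<le> \<epsilon> * nrm E (y - z)"
    if yz: "y \<in> nball E x \<delta>" "z \<in> nball E x \<delta>" for y z
  proof -
    have in1: "y \<in> nball E x \<delta>1" "z \<in> nball E x \<delta>1" and in3: "y \<in> nball E x \<delta>3" "z \<in> nball E x \<delta>3"
      and in4: "y \<in> nball E x \<delta>4" "z \<in> nball E x \<delta>4"
      using yz by (auto simp: \<delta>_def nball_def)
    have fs: "f y \<in> sp F" "f z \<in> sp F" using K in1 by auto
    have gs: "g (f y) \<in> sp H" "g (f z) \<in> sp H" using d2 d4 in4 by auto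
    have yzs: "y - z \<in> sp E" using in1 E by (auto simp: nball_def intro: nspace_closed)
    have As: "A (y - z) \<in> sp F" using A yzs by (rule bounded_linear_onD)
    have "nrm H (g (f y) - g (f z) - B (A (y - z))) \<le>
          nrm H (g (f y) - g (f z) - B (f y - f z)) + nrm H (B (f y - f z) - B (A (y - z)))"
      using gs fs As B H F by (intro nrm_triangle_via nspace_closed bounded_linear_onD(1)[OF B])
    also have "nrm H (g (f y) - g (f z) - B (f y - f z)) \<le> \<epsilon> / (2 * K) * nrm F (f y - f z)"
      using d2 d4 in4 by auto
    also have "\<dots> \<le> \<epsilon> / (2 * K) * (K * nrm E (y - z))"
      using K in1 \<epsilon> by (intro mult_left_mono) auto
    also have "B (f y - f z) - B (A (y - z)) = B (f y - f z - A (y - z))"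
      using fs As F by (simp add: bounded_linear_on_diff[OF B F] nspace_closed)
    also have "nrm H \<dots> \<le> L * nrm F (f y - f z - A (y - z))"
      using fs As F by (intro L nspace_closed)
    also have "\<dots> \<le> L * (\<epsilon> / (2 * L) * nrm E (y - z))"
      using L d3 in3 by (intro mult_left_mono) auto
    finally show ?thesis using K L gs by simp
  qed
  moreover have "\<delta> > 0" using K d3 d4 by (auto simp: \<delta>_def)
  ultimately show "\<exists>\<delta>>0. \<forall>y\<in>nball E x \<delta>. \<forall>z\<in>nball E x \<delta>. g (f y) \<in> sp H \<and>
      nrm H (g (f y) - g (f z) - B (A (y - z))) \<le> \<epsilon> * nrm E (y - z)" by blast
qed

lemma strict_deriv_transfer:
  assumes f: "strict_deriv E F f A x" and r: "r > 0" "\<And>y. y \<in> nball E x r \<Longrightarrow> f y = f' y"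
  shows "strict_deriv E F f' A x"
  unfolding strict_deriv_def
proof (intro conjI allI impI)
  fix \<epsilon> :: real assume "\<epsilon> > 0"
  then obtain \<delta> where "\<delta> > 0" "\<And>y. y \<in> nball E x \<delta> \<Longrightarrow> f y \<in> sp F"
    "\<And>y z. y \<in> nball E x \<delta> \<Longrightarrow> z \<in> nball E x \<delta> \<Longrightarrow>
        nrm F (f y - f z - A (y - z)) \<le> \<epsilon> * nrm E (y - z)"
    using strict_derivE[OF f] by metis
  then show "\<exists>\<delta>>0. \<forall>y\<in>nball E x \<delta>. \<forall>z\<in>nball E x \<delta>.
      f' y \<in> sp F \<and> nrm F (f' y - f' z - A (y - z)) \<le> \<epsilon> * nrm E (y - z)"
    using r nball_mono[of "min \<delta> r" \<delta> E x] nball_mono[of "min \<delta> r" r E x]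
    by (intro exI[of _ "min \<delta> r"]) (metis min.cobounded1 min.cobounded2 min_less_iff_conj subsetD)
qed (use f in \<open>auto dest: strict_derivD\<close>)

text \<open>Directional limits identify the derivative, also with respect to a weaker norm.\<close>

lemma strict_deriv_direction:
  assumes f: "strict_deriv E F f A x" and E: "normed_space E" and F: "normed_space F"
    and h: "h \<in> sp E" and \<epsilon>: "\<epsilon> > 0"
  obtains \<tau> where "\<tau> > 0" "\<And>t. 0 < t \<Longrightarrow> t < \<tau> \<Longrightarrow> x + t *\<^sub>R h \<in> nball E x \<epsilon>"
    "\<And>t. 0 < t \<Longrightarrow> t < \<tau> \<Longrightarrow> f (x + t *\<^sub>R h) \<in> sp F"
    "\<And>t. 0 < t \<Longrightarrow> t < \<tau> \<Longrightarrow> nrm F ((1/t) *\<^sub>R (f (x + t *\<^sub>R h) - f x) - A h) \<le> \<epsilon>"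
proof -
  have A: "bounded_linear_on E F A" and x: "x \<in> sp E" using f by (auto dest: strict_derivD)
  define n where "n = nrm E h + 1"
  have n: "n > 0" "nrm E h < n" using nrm_nonneg[OF E h] by (auto simp: n_def)
  obtain \<delta> where d: "\<delta> > 0" "\<And>y. y \<in> nball E x \<delta> \<Longrightarrow> f y \<in> sp F"
    "\<And>y z. y \<in> nball E x \<delta> \<Longrightarrow> z \<in> nball E x \<delta> \<Longrightarrow>
        nrm F (f y - f z - A (y - z)) \<le> \<epsilon> / n * nrm E (y - z)"
    using strict_derivE[OF f, of "\<epsilon> / n"] \<epsilon> n by auto
  define \<tau> where "\<tau> = min \<delta> \<epsilon> / n"
  have near: "x + t *\<^sub>R h \<in> nball E x (min \<delta> \<epsilon>)" if t: "0 < t" "t < \<tau>" for t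
  proof -
    have "t * nrm E h \<le> t * n" using t n by simp
    also have "\<dots> < min \<delta> \<epsilon>" using t n by (simp add: \<tau>_def field_simps)
    finally show ?thesis using t x h E by (auto simp: nball_def nrm_scale intro!: nspace_closed)
  qed
  show ?thesis
  proof
    show "\<tau> > 0" using d \<epsilon> n by (auto simp: \<tau>_def)
    fix t assume t: "0 < t" "t < \<tau>"
    show "x + t *\<^sub>R h \<in> nball E x \<epsilon>" using near[OF t] by (auto simp: nball_def)
    have nd: "x + t *\<^sub>R h \<in> nball E x \<delta>" using near[OF t] by (auto simp: nball_def)
    then show fs: "f (x + t *\<^sub>R h) \<in> sp F" by (rule d)
    have xd: "x \<in> nball E x \<delta>" using E x d by (intro center_in_nball)
    have "nrm F (f (x + t *\<^sub>R h) - f x - A (t *\<^sub>R h)) \<le> \<epsilon> / n * (t * nrm E h)"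
      using d(3)[OF nd xd] t h E by (simp add: nrm_scale)
    also have "\<dots> \<le> \<epsilon> * t" using n t \<epsilon> by (simp add: field_simps)
    finally have *: "nrm F (f (x + t *\<^sub>R h) - f x - A (t *\<^sub>R h)) \<le> \<epsilon> * t" .
    have As: "A h \<in> sp F" by (rule bounded_linear_onD[OF A h])
    have "(1/t) *\<^sub>R (f (x + t *\<^sub>R h) - f x) - A h = (1/t) *\<^sub>R (f (x + t *\<^sub>R h) - f x - A (t *\<^sub>R h))"
      using t by (simp add: bounded_linear_onD(3)[OF A h] algebra_simps)
    then have "nrm F ((1/t) *\<^sub>R (f (x + t *\<^sub>R h) - f x) - A h) =
        (1/t) * nrm F (f (x + t *\<^sub>R h) - f x - A (t *\<^sub>R h))"
      using fs As d(2)[OF xd] F t bounded_linear_onD(3)[OF A h]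
      by (simp add: nrm_scale nspace_closed del: scaleR_diff_right)
    also have "\<dots> \<le> \<epsilon>" using * t by (simp add: field_simps)
    finally show "nrm F ((1/t) *\<^sub>R (f (x + t *\<^sub>R h) - f x) - A h) \<le> \<epsilon>" .
  qed
qed

lemma strict_deriv_unique_weaker:
  assumes f: "strict_deriv E F f A x" and f': "strict_deriv E' F' f A' x"
    and E: "normed_space E" "normed_space F" "normed_space E'" "normed_space F'"
    and C: "\<And>v. v \<in> sp F' \<Longrightarrow> v \<in> sp F \<and> nrm F v \<le> C * nrm F' v"
    and h: "h \<in> sp E" "h \<in> sp E'"
  shows "A h = A' h"
proof -
  have As: "A h \<in> sp F" "A' h \<in> sp F'"
    using f f' h by (auto dest!: strict_derivD(2) intro: bounded_linear_onD)
  have Ad: "A h - A' h \<in> sp F" using As C E by (auto intro: nspace_closed)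
  have "nrm F (A h - A' h) \<le> \<epsilon>" if "\<epsilon> > 0" for \<epsilon>
  proof -
    define \<eta> where "\<eta> = \<epsilon> / (1 + \<bar>C\<bar>)"
    have \<eta>: "\<eta> > 0" using that by (simp add: \<eta>_def)
    obtain \<tau> where t: "\<tau> > 0" "\<And>t. 0 < t \<Longrightarrow> t < \<tau> \<Longrightarrow> f (x + t *\<^sub>R h) \<in> sp F"
      "\<And>t. 0 < t \<Longrightarrow> t < \<tau> \<Longrightarrow> nrm F ((1/t) *\<^sub>R (f (x + t *\<^sub>R h) - f x) - A h) \<le> \<eta>"
      using strict_deriv_direction[OF f E(1,2) h(1) \<eta>] by metis
    obtain \<tau>' where t': "\<tau>' > 0" "\<And>t. 0 < t \<Longrightarrow> t < \<tau>' \<Longrightarrow> f (x + t *\<^sub>R h) \<in> sp F'"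
      "\<And>t. 0 < t \<Longrightarrow> t < \<tau>' \<Longrightarrow> nrm F' ((1/t) *\<^sub>R (f (x + t *\<^sub>R h) - f x) - A' h) \<le> \<eta>"
      using strict_deriv_direction[OF f' E(3,4) h(2) \<eta>] by metis
    define s where "s = min \<tau> \<tau>' / 2"
    have s: "0 < s" "s < \<tau>" "s < \<tau>'" using t t' by (auto simp: s_def)
    have x: "x \<in> sp E'" using f' by (rule strict_derivD)
    obtain d where "d > 0" "\<And>y. y \<in> nball E' x d \<Longrightarrow> f y \<in> sp F'"
      using strict_derivE[OF f', of 1] by (metis zero_less_one)
    then have fx: "f x \<in> sp F'" using center_in_nball[OF E(3) x] by blast
    define w where "w = (1/s) *\<^sub>R (f (x + s *\<^sub>R h) - f x)"
    have ws: "w \<in> sp F'" using fx t' s E by (auto simp: w_def intro!: nspace_closed)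
    have "nrm F (A h - A' h) \<le> nrm F (A h - w) + nrm F (w - A' h)"
      using As ws C E by (intro nrm_triangle_via) auto
    also have "nrm F (A h - w) \<le> \<eta>"
      using nrm_minus_commute[OF E(2), of "A h" w] t s ws As C by (auto simp: w_def)
    also have "nrm F (w - A' h) \<le> C * nrm F' (w - A' h)"
      using C ws As E by (auto intro: nspace_closed)
    also have "\<dots> \<le> \<bar>C\<bar> * nrm F' (w - A' h)"
      using nrm_nonneg[OF E(4), of "w - A' h"] ws As E by (intro mult_right_mono) (auto intro: nspace_closed)
    also have "\<dots> \<le> \<bar>C\<bar> * \<eta>" using t' s by (intro mult_left_mono) (auto simp: w_def)
    finally have "nrm F (A h - A' h) \<le> (1 + \<bar>C\<bar>) * \<eta>" by (simp add: distrib_right)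
    also have "\<dots> = \<epsilon>" by (simp add: \<eta>_def)
    finally show ?thesis .
  qed
  then have "nrm F (A h - A' h) \<le> 0" by (rule field_le_epsilon) simp
  then show ?thesis
    using nrm_nonneg[OF E(2) Ad] nrm_eq_0[OF E(2) Ad] by simp
qed

lemma strict_deriv_unique:
  assumes "strict_deriv E F f A x" "strict_deriv E F f A' x" "normed_space E" "normed_space F"
    "h \<in> sp E"
  shows "A h = A' h"
  by (rule strict_deriv_unique_weaker[OF assms(1,2), where C = 1]) (use assms in auto)

lemma strict_deriv_cong:
  assumes f: "strict_deriv E F f A x" and eq: "\<And>h. h \<in> sp E \<Longrightarrow> A h = B h" and E: "normed_space E"
  shows "strict_deriv E F f B x"
proof -
  have A: "bounded_linear_on E F A" using f by (rule strict_derivD)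
  have B: "bounded_linear_on E F B"
    using A eq nspace_add[OF E] nspace_scale[OF E] unfolding bounded_linear_on_def by simp
  show ?thesis unfolding strict_deriv_def
  proof (intro conjI allI impI B)
    show "x \<in> sp E" using f by (rule strict_derivD)
    fix \<epsilon> :: real assume "\<epsilon> > 0"
    then obtain \<delta> where d: "\<delta> > 0" "\<And>y. y \<in> nball E x \<delta> \<Longrightarrow> f y \<in> sp F"
      "\<And>y z. y \<in> nball E x \<delta> \<Longrightarrow> z \<in> nball E x \<delta> \<Longrightarrow>
        nrm F (f y - f z - A (y - z)) \<le> \<epsilon> * nrm E (y - z)"
      using strict_derivE[OF f] by metis
    have "y - z \<in> sp E" if "y \<in> nball E x \<delta>" "z \<in> nball E x \<delta>" for y z
      using that E by (auto simp: nball_def nspace_closed)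
    then show "\<exists>\<delta>>0. \<forall>y\<in>nball E x \<delta>. \<forall>z\<in>nball E x \<delta>.
        f y \<in> sp F \<and> nrm F (f y - f z - B (y - z)) \<le> \<epsilon> * nrm E (y - z)"
      using d eq by (intro exI[of _ \<delta>]) auto
  qed
qed

lemma strict_deriv_id: "normed_space E \<Longrightarrow> x \<in> sp E \<Longrightarrow> strict_deriv E E (\<lambda>y. y) (\<lambda>h. h) x"
  unfolding strict_deriv_def bounded_linear_on_def
  by (auto simp: nrm_zero nball_def nspace_closed nrm_nonneg intro: exI[of _ 1])

text \<open>
  The range may be restricted to a closed subspace that contains the values of the map:
  derivatives are limits of difference quotients.
\<close>

lemma strict_deriv_subspaces:
  assumes f: "strict_deriv E F f D x" and E': "normed_space E'" and F: "normed_space F"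
    and subE: "sp E' \<subseteq> sp E" "nrm E' = nrm E" and subF: "nrm F' = nrm F"
    and x: "x \<in> sp E'" and E: "normed_space E" and F': "normed_space F'"
    and closed: "\<And>v. v \<in> sp F \<Longrightarrow> (\<And>\<epsilon>. \<epsilon> > 0 \<Longrightarrow> \<exists>w\<in>sp F'. nrm F (w - v) \<le> \<epsilon>) \<Longrightarrow> v \<in> sp F'"
    and r: "r > 0" "\<forall>y\<in>nball E' x r. f y \<in> sp F'"
  shows "strict_deriv E' F' f D x"
proof -
  have lin: "bounded_linear_on E F D" using f by (rule strict_derivD)
  have fx: "f x \<in> sp F'" using r center_in_nball[OF E' x] by blast
  have Ds: "D h \<in> sp F'" if h: "h \<in> sp E'" for h
  proof (rule closed)
    have hE: "h \<in> sp E" using h subE by auto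
    show "D h \<in> sp F" by (rule bounded_linear_onD(1)[OF lin hE])
    fix \<epsilon> :: real assume \<epsilon>: "\<epsilon> > 0"
    define e where "e = min \<epsilon> r"
    have e: "e > 0" using \<epsilon> r by (simp add: e_def)
    obtain \<tau> where t: "\<tau> > 0" "\<And>t. 0 < t \<Longrightarrow> t < \<tau> \<Longrightarrow> x + t *\<^sub>R h \<in> nball E x e"
      "\<And>t. 0 < t \<Longrightarrow> t < \<tau> \<Longrightarrow> nrm F ((1/t) *\<^sub>R (f (x + t *\<^sub>R h) - f x) - D h) \<le> e"
      using strict_deriv_direction[OF f E F hE e] by metis
    define t where "t = \<tau> / 2"
    have t0: "0 < t" "t < \<tau>" using t by (auto simp: t_def)
    have xt: "x + t *\<^sub>R h \<in> sp E'" by (intro nspace_add nspace_scale E' x h)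
    then have "x + t *\<^sub>R h \<in> nball E' x r" using t(2)[OF t0] subE by (auto simp: nball_def e_def)
    then have "f (x + t *\<^sub>R h) \<in> sp F'" using r by blast
    then have "(1/t) *\<^sub>R (f (x + t *\<^sub>R h) - f x) \<in> sp F'" by (intro nspace_scale nspace_diff F' fx)
    moreover have "nrm F ((1/t) *\<^sub>R (f (x + t *\<^sub>R h) - f x) - D h) \<le> \<epsilon>" using t(3)[OF t0] by (simp add: e_def)
    ultimately show "\<exists>w\<in>sp F'. nrm F (w - D h) \<le> \<epsilon>" by blast
  qed
  show ?thesis unfolding strict_deriv_def
  proof (intro conjI allI impI x)
    obtain K where "\<forall>v\<in>sp E. nrm F (D v) \<le> K * nrm E v" using lin unfolding bounded_linear_on_def by blast
    then have "\<exists>K. \<forall>v\<in>sp E'. nrm F' (D v) \<le> K * nrm E' v" using subE subF by (intro exI[of _ K]) auto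
    then show "bounded_linear_on E' F' D"
      using Ds lin subE(1) unfolding bounded_linear_on_def by (simp add: subset_iff)
    fix \<epsilon> :: real assume "\<epsilon> > 0"
    then obtain \<delta> where d: "\<delta> > 0" "\<forall>y\<in>nball E x \<delta>. \<forall>z\<in>nball E x \<delta>.
        f y \<in> sp F \<and> nrm F (f y - f z - D (y - z)) \<le> \<epsilon> * nrm E (y - z)"
      using strict_derivD(3)[OF f] by blast
    have b: "y \<in> nball E x \<delta>" "y \<in> nball E' x r" if "y \<in> nball E' x (min \<delta> r)" for y
      using that subE by (auto simp: nball_def)
    have "f y \<in> sp F' \<and> nrm F' (f y - f z - D (y - z)) \<le> \<epsilon> * nrm E' (y - z)"
      if "y \<in> nball E' x (min \<delta> r)" "z \<in> nball E' x (min \<delta> r)" for y z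
      using d(2) r(2) b[OF that(1)] b[OF that(2)] subE(2) subF by simp
    moreover have "min \<delta> r > 0" using d r by simp
    ultimately show "\<exists>\<delta>>0. \<forall>y\<in>nball E' x \<delta>. \<forall>z\<in>nball E' x \<delta>.
        f y \<in> sp F' \<and> nrm F' (f y - f z - D (y - z)) \<le> \<epsilon> * nrm E' (y - z)" by blast
  qed
qed

section \<open>The mean value inequality and maps of class \<open>C\<^sup>1\<close>\<close>

text \<open>Restricted to the unit interval, because a segment need not extend beyond its end points in the domain.\<close>

definition curve_deriv :: "'f::real_vector nspace \<Rightarrow> (real \<Rightarrow> 'f) \<Rightarrow> 'f \<Rightarrow> real \<Rightarrow> bool" where
  "curve_deriv F c l t \<longleftrightarrow> l \<in> sp F \<and> (\<forall>\<epsilon>>0. \<exists>\<delta>>0. \<forall>\<tau>\<in>{0..1}. \<bar>\<tau> - t\<bar> < \<delta> \<longrightarrow>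
     nrm F (c \<tau> - c t - (\<tau> - t) *\<^sub>R l) \<le> \<epsilon> * \<bar>\<tau> - t\<bar>)"

text \<open>
  For every \<open>e > 0\<close> the bound \<open>M + e\<close> for difference quotients is inherited from two adjacent
  intervals by their union and holds on all short intervals around a point, hence on \<open>{0..1}\<close> by
  bisection.
\<close>

lemma curve_mean_value:
  assumes F: "normed_space F" and c: "\<And>t. t \<in> {0..1} \<Longrightarrow> c t \<in> sp F"
    and l: "\<And>t. t \<in> {0..1} \<Longrightarrow> curve_deriv F c (l t) t"
    and M: "\<And>t. t \<in> {0..1} \<Longrightarrow> nrm F (l t) \<le> M"
  shows "nrm F (c 1 - c 0) \<le> M"
proof (rule field_le_epsilon)
  fix e :: real assume e: "e > 0"
  define P where "P a b \<longleftrightarrow> {a..b} \<subseteq> {0..1} \<longrightarrow> nrm F (c b - c a) \<le> (M + e) * (b - a)" for a b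
  have "P 0 1"
  proof (rule Bolzano)
    fix a b d assume trans: "P a b" "P b d" "a \<le> b" "b \<le> d"
    show "P a d" unfolding P_def
    proof
      assume sub: "{a..d} \<subseteq> {0..1}"
      have abd: "a \<in> {0..1}" "b \<in> {0..1}" "d \<in> {0..1}"
        using sub trans(3,4) by auto
      have "nrm F (c d - c a) \<le> nrm F (c d - c b) + nrm F (c b - c a)"
        using abd by (intro nrm_triangle_via F c)
      moreover have "nrm F (c d - c b) \<le> (M + e) * (d - b)" using trans sub by (auto simp: P_def)
      moreover have "nrm F (c b - c a) \<le> (M + e) * (b - a)" using trans sub by (auto simp: P_def)
      ultimately show "nrm F (c d - c a) \<le> (M + e) * (d - a)" by (simp add: algebra_simps)
    qed
  next
    fix x :: real assume "0 \<le> x" "x \<le> 1"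
    then have x: "x \<in> {0..1}" by auto
    then obtain \<delta> where d: "\<delta> > 0" "\<And>\<tau>. \<tau> \<in> {0..1} \<Longrightarrow> \<bar>\<tau> - x\<bar> < \<delta> \<Longrightarrow>
        nrm F (c \<tau> - c x - (\<tau> - x) *\<^sub>R l x) \<le> e * \<bar>\<tau> - x\<bar>"
      using l e unfolding curve_deriv_def by metis
    have lx: "l x \<in> sp F" using l[OF x] by (simp add: curve_deriv_def)
    have step: "nrm F (c \<tau> - c x) \<le> (M + e) * \<bar>\<tau> - x\<bar>" if "\<tau> \<in> {0..1}" "\<bar>\<tau> - x\<bar> < \<delta>" for \<tau>
    proof -
      have "nrm F (c \<tau> - c x) \<le> nrm F ((\<tau> - x) *\<^sub>R l x) + nrm F (c \<tau> - c x - (\<tau> - x) *\<^sub>R l x)"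
        using that x lx by (intro nrm_triangle_rev F nspace_closed c)
      also have "nrm F ((\<tau> - x) *\<^sub>R l x) = \<bar>\<tau> - x\<bar> * nrm F (l x)" using lx F by (simp add: nrm_scale)
      also have "\<dots> \<le> \<bar>\<tau> - x\<bar> * M" using M[OF x] by (intro mult_left_mono) auto
      also have "nrm F (c \<tau> - c x - (\<tau> - x) *\<^sub>R l x) \<le> e * \<bar>\<tau> - x\<bar>" using d that by auto
      finally show ?thesis by (simp add: algebra_simps)
    qed
    show "\<exists>\<delta>>0. \<forall>a b. a \<le> x \<and> x \<le> b \<and> b - a < \<delta> \<longrightarrow> P a b"
      unfolding P_def
    proof (intro exI[of _ \<delta>] conjI allI impI d)
      fix a b assume ab: "a \<le> x \<and> x \<le> b \<and> b - a < \<delta>" and sub: "{a..b} \<subseteq> {0..1}"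
      have ab01: "a \<in> {0..1}" "b \<in> {0..1}" using ab sub by auto
      have "nrm F (c b - c a) \<le> nrm F (c b - c x) + nrm F (c x - c a)"
        using ab01 x by (intro nrm_triangle_via F c)
      also have "nrm F (c x - c a) = nrm F (c a - c x)"
        using ab01 x by (intro nrm_minus_commute F c)
      also have "nrm F (c b - c x) \<le> (M + e) * \<bar>b - x\<bar>" using ab ab01 by (intro step) auto
      also have "nrm F (c a - c x) \<le> (M + e) * \<bar>a - x\<bar>" using ab ab01 by (intro step) auto
      finally show "nrm F (c b - c a) \<le> (M + e) * (b - a)" using ab by (simp add: algebra_simps)
    qed
  qed simp
  then show "nrm F (c 1 - c 0) \<le> M + e" by (simp add: P_def)
qed

lemma curve_deriv_diff:
  assumes F: "normed_space F" and c: "\<And>t. t \<in> {0..1} \<Longrightarrow> c t \<in> sp F" "\<And>t. t \<in> {0..1} \<Longrightarrow> c' t \<in> sp F"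
    and t: "t \<in> {0..1}" and l: "curve_deriv F c l t" "curve_deriv F c' l' t"
  shows "curve_deriv F (\<lambda>t. c t - c' t) (l - l') t"
  unfolding curve_deriv_def
proof (intro conjI allI impI)
  have ls: "l \<in> sp F" "l' \<in> sp F" using l by (auto simp: curve_deriv_def)
  then show "l - l' \<in> sp F" by (intro nspace_closed F)
  fix \<epsilon> :: real assume "\<epsilon> > 0"
  then have e2: "\<epsilon> / 2 > 0" by simp
  obtain \<delta> where d: "\<delta> > 0" "\<And>\<tau>. \<tau> \<in> {0..1} \<Longrightarrow> \<bar>\<tau> - t\<bar> < \<delta> \<Longrightarrow>
      nrm F (c \<tau> - c t - (\<tau> - t) *\<^sub>R l) \<le> \<epsilon> / 2 * \<bar>\<tau> - t\<bar>"
    using l e2 unfolding curve_deriv_def by metis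
  obtain \<delta>' where d': "\<delta>' > 0" "\<And>\<tau>. \<tau> \<in> {0..1} \<Longrightarrow> \<bar>\<tau> - t\<bar> < \<delta>' \<Longrightarrow>
      nrm F (c' \<tau> - c' t - (\<tau> - t) *\<^sub>R l') \<le> \<epsilon> / 2 * \<bar>\<tau> - t\<bar>"
    using l e2 unfolding curve_deriv_def by metis
  show "\<exists>\<delta>>0. \<forall>\<tau>\<in>{0..1}. \<bar>\<tau> - t\<bar> < \<delta> \<longrightarrow>
      nrm F (c \<tau> - c' \<tau> - (c t - c' t) - (\<tau> - t) *\<^sub>R (l - l')) \<le> \<epsilon> * \<bar>\<tau> - t\<bar>"
  proof (intro exI[of _ "min \<delta> \<delta>'"] conjI ballI impI)
    fix \<tau> :: real assume \<tau>: "\<tau> \<in> {0..1}" "\<bar>\<tau> - t\<bar> < min \<delta> \<delta>'"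
    have "nrm F ((c \<tau> - c t - (\<tau> - t) *\<^sub>R l) - (c' \<tau> - c' t - (\<tau> - t) *\<^sub>R l')) \<le>
      nrm F (c \<tau> - c t - (\<tau> - t) *\<^sub>R l) + nrm F (c' \<tau> - c' t - (\<tau> - t) *\<^sub>R l')"
      using c t \<tau> ls by (intro nrm_triangle_diff F nspace_closed) auto
    also have "\<dots> \<le> \<epsilon> * \<bar>\<tau> - t\<bar>" using d(2)[of \<tau>] d'(2)[of \<tau>] \<tau> by simp
    also have "(c \<tau> - c t - (\<tau> - t) *\<^sub>R l) - (c' \<tau> - c' t - (\<tau> - t) *\<^sub>R l') =
      c \<tau> - c' \<tau> - (c t - c' t) - (\<tau> - t) *\<^sub>R (l - l')" by (simp add: algebra_simps)
    finally show "nrm F (c \<tau> - c' \<tau> - (c t - c' t) - (\<tau> - t) *\<^sub>R (l - l')) \<le> \<epsilon> * \<bar>\<tau> - t\<bar>" .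
  qed (use d d' in auto)
qed

lemma curve_deriv_linear:
  assumes "normed_space F" "l \<in> sp F"
  shows "curve_deriv F (\<lambda>t. t *\<^sub>R l) l t"
  unfolding curve_deriv_def using assms
  by (auto simp: scaleR_diff_left nrm_zero intro!: exI[of _ 1])

lemma has_fderiv_on_curve:
  assumes E: "normed_space E" and F: "normed_space F" and v: "v \<in> sp E"
    and seg: "\<And>\<tau>. \<tau> \<in> {0..1} \<Longrightarrow> z + \<tau> *\<^sub>R v \<in> U"
    and t: "t \<in> {0..1}" and A: "has_fderiv_on E F U g A (z + t *\<^sub>R v)"
  shows "curve_deriv F (\<lambda>\<tau>. g (z + \<tau> *\<^sub>R v)) (A v) t"
  unfolding curve_deriv_def
proof (intro conjI allI impI)
  have bA: "bounded_linear_on E F A" using A by (simp add: has_fderiv_on_def)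
  show "A v \<in> sp F" by (rule bounded_linear_onD[OF bA v])
  fix \<epsilon> :: real assume \<epsilon>: "\<epsilon> > 0"
  define n where "n = nrm E v + 1"
  have n: "n > 0" "nrm E v < n" using nrm_nonneg[OF E v] by (auto simp: n_def)
  obtain \<delta> where d: "\<delta> > 0" "\<And>h. h \<in> sp E \<Longrightarrow> nrm E h < \<delta> \<Longrightarrow> z + t *\<^sub>R v + h \<in> U \<Longrightarrow>
      nrm F (g (z + t *\<^sub>R v + h) - g (z + t *\<^sub>R v) - A h) \<le> \<epsilon> / n * nrm E h"
    using A \<epsilon> n unfolding has_fderiv_on_def by (metis divide_pos_pos)
  show "\<exists>\<delta>>0. \<forall>\<tau>\<in>{0..1}. \<bar>\<tau> - t\<bar> < \<delta> \<longrightarrow>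
      nrm F (g (z + \<tau> *\<^sub>R v) - g (z + t *\<^sub>R v) - (\<tau> - t) *\<^sub>R A v) \<le> \<epsilon> * \<bar>\<tau> - t\<bar>"
  proof (intro exI[of _ "\<delta> / n"] conjI ballI impI)
    fix \<tau> :: real assume \<tau>: "\<tau> \<in> {0..1}" "\<bar>\<tau> - t\<bar> < \<delta> / n"
    have eq: "z + t *\<^sub>R v + (\<tau> - t) *\<^sub>R v = z + \<tau> *\<^sub>R v" by (simp add: algebra_simps)
    have "\<bar>\<tau> - t\<bar> * nrm E v \<le> \<bar>\<tau> - t\<bar> * n" using n by (intro mult_left_mono) auto
    also have "\<dots> < \<delta>" using \<tau> n by (simp add: field_simps)
    finally have "nrm F (g (z + \<tau> *\<^sub>R v) - g (z + t *\<^sub>R v) - A ((\<tau> - t) *\<^sub>R v)) \<le>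
        \<epsilon> / n * (\<bar>\<tau> - t\<bar> * nrm E v)"
      using d(2)[of "(\<tau> - t) *\<^sub>R v"] seg[OF \<tau>(1)] v E unfolding eq
      by (simp add: nrm_scale nspace_scale)
    also have "\<dots> \<le> \<epsilon> * \<bar>\<tau> - t\<bar>"
      using n \<epsilon> mult_left_mono[of "nrm E v" n "\<epsilon> * \<bar>\<tau> - t\<bar>"] by (simp add: field_simps)
    finally show "nrm F (g (z + \<tau> *\<^sub>R v) - g (z + t *\<^sub>R v) - (\<tau> - t) *\<^sub>R A v) \<le> \<epsilon> * \<bar>\<tau> - t\<bar>"
      by (simp add: bounded_linear_onD(3)[OF bA v])
  qed (use d n in auto)
qed

text \<open>Subtracting the fixed linear map \<open>B\<close> gives closeness of increments to \<open>B\<close>, which is what strictness needs.\<close>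

lemma mean_value_nball:
  assumes E: "normed_space E" and F: "normed_space F" and x: "x \<in> sp E"
    and g: "\<And>y. y \<in> nball E x r \<Longrightarrow> g y \<in> sp F"
    and A: "\<And>y. y \<in> nball E x r \<Longrightarrow> has_fderiv_on E F (nball E x r) g (A y) y"
    and B: "bounded_linear_on E F B"
    and K: "\<And>y h. y \<in> nball E x r \<Longrightarrow> h \<in> sp E \<Longrightarrow> nrm F (A y h - B h) \<le> K * nrm E h"
    and yz: "y \<in> nball E x r" "z \<in> nball E x r"
  shows "nrm F (g y - g z - B (y - z)) \<le> K * nrm E (y - z)"
proof -
  have seg: "z + \<tau> *\<^sub>R (y - z) \<in> nball E x r" if "\<tau> \<in> {0..1}" for \<tau>
    using that yz by (intro nball_segment E x) auto
  have v: "y - z \<in> sp E" using yz E by (auto simp: nball_def intro: nspace_closed)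
  have Bv: "B (y - z) \<in> sp F" by (rule bounded_linear_onD[OF B v])
  define c where "c t = g (z + t *\<^sub>R (y - z)) - t *\<^sub>R B (y - z)" for t
  have "nrm F (c 1 - c 0) \<le> K * nrm E (y - z)"
  proof (rule curve_mean_value[OF F])
    fix t :: real assume t: "t \<in> {0..1}"
    show "c t \<in> sp F" unfolding c_def using g seg t Bv by (intro nspace_closed F) auto
    show "curve_deriv F c (A (z + t *\<^sub>R (y - z)) (y - z) - B (y - z)) t" unfolding c_def
      using g seg t Bv
      by (intro curve_deriv_diff curve_deriv_linear F
            has_fderiv_on_curve[OF E F v, where U = "nball E x r" and A = "A (z + t *\<^sub>R (y - z))"] A)
        (auto intro!: nspace_closed F)
    show "nrm F (A (z + t *\<^sub>R (y - z)) (y - z) - B (y - z)) \<le> K * nrm E (y - z)"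
      using seg t v by (intro K) auto
  qed
  then show ?thesis by (simp add: c_def algebra_simps)
qed

lemma bounded_multilinear_onD:
  assumes "bounded_multilinear_on j E F A"
  shows "length vs = j \<Longrightarrow> set vs \<subseteq> sp E \<Longrightarrow> A vs \<in> sp F"
    and "Suc (length us + length ws) = j \<Longrightarrow> set us \<subseteq> sp E \<Longrightarrow> set ws \<subseteq> sp E \<Longrightarrow>
      x \<in> sp E \<Longrightarrow> y \<in> sp E \<Longrightarrow> A (us @ (x + y) # ws) = A (us @ x # ws) + A (us @ y # ws)"
    and "Suc (length us + length ws) = j \<Longrightarrow> set us \<subseteq> sp E \<Longrightarrow> set ws \<subseteq> sp E \<Longrightarrow>
      x \<in> sp E \<Longrightarrow> A (us @ (a *\<^sub>R x) # ws) = a *\<^sub>R A (us @ x # ws)"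
    and "\<exists>K. \<forall>vs. length vs = j \<and> set vs \<subseteq> sp E \<longrightarrow> nrm F (A vs) \<le> K * prod_list (map (nrm E) vs)"
  using assms unfolding bounded_multilinear_on_def by blast+

lemma bounded_multilinear_on_1:
  assumes A: "bounded_multilinear_on 1 E F A"
  shows "bounded_linear_on E F (\<lambda>h. A [h])"
proof -
  have val: "A [x] \<in> sp F" if "x \<in> sp E" for x
    using bounded_multilinear_onD(1)[OF A, of "[x]"] that by simp
  have lin: "A [x + y] = A [x] + A [y]" "A [a *\<^sub>R x] = a *\<^sub>R A [x]" if "x \<in> sp E" "y \<in> sp E" for x y a
    using bounded_multilinear_onD(2,3)[OF A, of "[]" "[]" x] that by auto
  obtain K where K: "\<And>vs. length vs = 1 \<Longrightarrow> set vs \<subseteq> sp E \<Longrightarrow> nrm F (A vs) \<le> K * prod_list (map (nrm E) vs)"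
    using bounded_multilinear_onD(4)[OF A] by blast
  then have "nrm F (A [x]) \<le> K * nrm E x" if "x \<in> sp E" for x using that K[of "[x]"] by simp
  then show ?thesis using val lin unfolding bounded_linear_on_def by blast
qed

lemma bounded_multilinear_on_2:
  assumes A: "bounded_multilinear_on 2 E F A" and w: "w \<in> sp E"
  shows "bounded_linear_on E F (\<lambda>h. A [h, w])"
proof -
  have val: "A [x, w] \<in> sp F" if "x \<in> sp E" for x
    using bounded_multilinear_onD(1)[OF A, of "[x, w]"] that w by simp
  have lin: "A [x + y, w] = A [x, w] + A [y, w]" "A [a *\<^sub>R x, w] = a *\<^sub>R A [x, w]"
    if "x \<in> sp E" "y \<in> sp E" for x y a
    using bounded_multilinear_onD(2,3)[OF A, of "[]" "[w]" x] that w by auto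
  obtain K where K: "\<And>vs. length vs = 2 \<Longrightarrow> set vs \<subseteq> sp E \<Longrightarrow> nrm F (A vs) \<le> K * prod_list (map (nrm E) vs)"
    using bounded_multilinear_onD(4)[OF A] by blast
  have "nrm F (A [x, w]) \<le> (K * nrm E w) * nrm E x" if "x \<in> sp E" for x
    using K[of "[x, w]"] that w by (simp add: ac_simps)
  then show ?thesis using val lin unfolding bounded_linear_on_def by blast
qed

lemma bounded_by_unit_args:
  assumes A: "bounded_linear_on E F A" and E: "normed_space E" and F: "normed_space F"
    and K: "\<And>v. v \<in> sp E \<Longrightarrow> nrm E v \<le> 1 \<Longrightarrow> nrm F (A v) \<le> K" and h: "h \<in> sp E"
  shows "nrm F (A h) \<le> K * nrm E h"
proof (cases "h = 0")
  case True
  then show ?thesis using bounded_linear_on_0[OF A E] F E by (simp add: nrm_zero)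
next
  case False
  then have pos: "nrm E h > 0" using nrm_nonneg[OF E h] nrm_eq_0[OF E h] by simp
  define v where "v = (1 / nrm E h) *\<^sub>R h"
  have v: "v \<in> sp E" "nrm E v = 1" using pos h E by (auto simp: v_def nrm_scale intro: nspace_scale)
  have "A h = nrm E h *\<^sub>R A v"
    using bounded_linear_onD(3)[OF A v(1), of "nrm E h"] pos by (simp add: v_def)
  then have "nrm F (A h) = nrm E h * nrm F (A v)"
    using bounded_linear_onD(1)[OF A v(1)] pos F by (simp add: nrm_scale)
  also have "\<dots> \<le> nrm E h * K" using K[of v] v pos by (intro mult_left_mono) auto
  finally show ?thesis by (simp add: mult.commute)
qed

text \<open>
  Continuity of the derivative in operator norm makes all derivatives near \<open>x\<close> close to the one
  at \<open>x\<close>; the mean value inequality does the rest.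
\<close>

lemma Ck_on_1_strict_deriv:
  assumes C: "Ck_on 1 E F U f" and E: "normed_space E" and F: "normed_space F" and x: "x \<in> U"
  obtains A where "strict_deriv E F f A x"
proof -
  obtain D :: "nat \<Rightarrow> 'a \<Rightarrow> 'a list \<Rightarrow> 'b" where op: "openin (ntop E) U"
    and D0': "\<forall>x\<in>U. D 0 x [] = f x"
    and Dm': "\<forall>j\<le>1. \<forall>x\<in>U. bounded_multilinear_on j E F (D j x)"
    and Dd': "\<forall>j<1. \<forall>x\<in>U. \<forall>\<epsilon>>0. \<exists>\<delta>>0. \<forall>h\<in>sp E. nrm E h < \<delta> \<and> x + h \<in> U \<longrightarrow>
           (\<forall>vs\<in>unit_args j E.
              nrm F (D j (x + h) vs - D j x vs - D (Suc j) x (h # vs)) \<le> \<epsilon> * nrm E h)"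
    and Dc': "\<forall>x\<in>U. \<forall>\<epsilon>>0. \<exists>\<delta>>0. \<forall>y\<in>U. nrm E (y - x) < \<delta> \<longrightarrow>
           (\<forall>vs\<in>unit_args 1 E. nrm F (D 1 y vs - D 1 x vs) \<le> \<epsilon>)"
    using C unfolding Ck_on_def by (elim conjE exE) (rule that; assumption)
  note D0 = D0'[rule_format] and Dm = Dm'[rule_format] and Dd = Dd'[rule_format]
    and Dc = Dc'[rule_format]
  have xs: "x \<in> sp E" using op x E by (auto simp: openin_ntop)
  obtain r where r: "r > 0" "nball E x r \<subseteq> U" using op x E by (auto simp: openin_ntop)
  define A where "A y h = D 1 y [h]" for y h
  have A: "bounded_linear_on E F (A y)" if "y \<in> U" for y
    unfolding A_def by (rule bounded_multilinear_on_1) (use Dm that in auto)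
  have fs: "f y \<in> sp F" if "y \<in> U" for y
    using Dm[of 0 y] D0[OF that] that by (auto simp: bounded_multilinear_on_def)
  have der: "has_fderiv_on E F V f (A y) y" if V: "y \<in> V" "V \<subseteq> U" for y V
    unfolding has_fderiv_on_def
  proof (intro conjI allI impI)
    have y: "y \<in> U" using V by blast
    show "y \<in> V" "bounded_linear_on E F (A y)" using V A by auto
    fix \<epsilon> :: real assume "\<epsilon> > 0"
    then obtain \<delta> where d: "\<delta> > 0" "\<And>h. h \<in> sp E \<Longrightarrow> nrm E h < \<delta> \<Longrightarrow> y + h \<in> U \<Longrightarrow>
           (\<forall>vs\<in>unit_args 0 E.
              nrm F (D 0 (y + h) vs - D 0 y vs - D (Suc 0) y (h # vs)) \<le> \<epsilon> * nrm E h)"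
      using Dd[of 0 y \<epsilon>] y by auto
    have "[] \<in> unit_args 0 E" by (auto simp: unit_args_def)
    then show "\<exists>\<delta>>0. \<forall>h\<in>sp E. nrm E h < \<delta> \<and> y + h \<in> V \<longrightarrow>
        nrm F (f (y + h) - f y - A y h) \<le> \<epsilon> * nrm E h"
      using d V D0[OF y] D0 unfolding A_def by (intro exI[of _ \<delta>]) fastforce
  qed
  show ?thesis
  proof (rule that[of "A x"], unfold strict_deriv_def, intro conjI allI impI)
    show "bounded_linear_on E F (A x)" using A x .
    show "x \<in> sp E" using xs .
    fix \<epsilon> :: real assume \<epsilon>: "\<epsilon> > 0"
    obtain \<delta> where d: "\<delta> > 0" "\<And>y vs. y \<in> U \<Longrightarrow> nrm E (y - x) < \<delta> \<Longrightarrow> vs \<in> unit_args 1 E \<Longrightarrow>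
        nrm F (D 1 y vs - D 1 x vs) \<le> \<epsilon>"
      using Dc[OF x \<epsilon>] by metis
    define \<rho> where "\<rho> = min r \<delta>"
    have sub: "nball E x \<rho> \<subseteq> U" using r by (auto simp: \<rho>_def nball_def)
    have "nrm F (A y h - A x h) \<le> \<epsilon> * nrm E h" if y: "y \<in> nball E x \<rho>" and h: "h \<in> sp E" for y h
    proof -
      have yU: "y \<in> U" using sub y by auto
      have "bounded_linear_on E F (\<lambda>h. A y h + (-1) *\<^sub>R A x h)"
        using A[OF yU] A[OF x] E F
        by (intro bounded_linear_on_add)
          (auto simp: bounded_linear_on_def nrm_minus intro: nspace_closed)
      then have lin: "bounded_linear_on E F (\<lambda>h. A y h - A x h)" by simp
      show ?thesis
      proof (rule bounded_by_unit_args[OF lin E F _ h])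
        fix v assume "v \<in> sp E" "nrm E v \<le> 1"
        then show "nrm F (A y v - A x v) \<le> \<epsilon>"
          using d(2)[OF yU, of "[v]"] y by (auto simp: nball_def \<rho>_def unit_args_def A_def)
      qed
    qed
    then have "nrm F (f y - f z - A x (y - z)) \<le> \<epsilon> * nrm E (y - z)"
      if "y \<in> nball E x \<rho>" "z \<in> nball E x \<rho>" for y z
      using that sub by (intro mean_value_nball[OF E F xs _ _ A[OF x], of \<rho> f A]) (auto intro: fs der)
    then show "\<exists>\<delta>>0. \<forall>y\<in>nball E x \<delta>. \<forall>z\<in>nball E x \<delta>.
        f y \<in> sp F \<and> nrm F (f y - f z - A x (y - z)) \<le> \<epsilon> * nrm E (y - z)"
      using sub fs r d by (intro exI[of _ \<rho>]) (auto simp: \<rho>_def)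
  qed
qed

text \<open>
  Conversely, the condition of strictness at \<open>x\<close> applies to pairs of points near any \<open>y\<close> close to
  \<open>x\<close>, so that the derivatives at \<open>x\<close> and \<open>y\<close> are close to the same difference quotients.
\<close>

lemma Ck_on_1I:
  assumes E: "normed_space E" and F: "normed_space F" and U: "openin (ntop E) U"
    and strict: "\<And>x. x \<in> U \<Longrightarrow> \<exists>A. strict_deriv E F f A x"
  shows "Ck_on 1 E F U f"
proof -
  obtain A where A: "\<And>x. x \<in> U \<Longrightarrow> strict_deriv E F f (A x) x" using strict by metis
  have bA: "bounded_linear_on E F (A x)" if "x \<in> U" for x using A[OF that] by (rule strict_derivD)
  have fs: "f x \<in> sp F" if x: "x \<in> U" for x
  proof -
    obtain d where "d > 0" "\<And>y. y \<in> nball E x d \<Longrightarrow> f y \<in> sp F"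
      using strict_derivE[OF A[OF x], of 1] by (metis zero_less_one)
    then show ?thesis using center_in_nball[OF E strict_derivD(1)[OF A[OF x]]] by blast
  qed
  define D :: "nat \<Rightarrow> 'a \<Rightarrow> 'a list \<Rightarrow> 'b" where
    "D j x vs = (if j = 0 then f x else A x (hd vs))" for j x vs
  have "bounded_multilinear_on j E F (D j x)" if jx: "j \<le> 1" "x \<in> U" for j x
  proof (cases "j = 0")
    case True
    then show ?thesis using fs[OF jx(2)] by (auto simp: bounded_multilinear_on_def D_def)
  next
    case False
    then have j: "j = 1" using jx by simp
    obtain K where "\<forall>v\<in>sp E. nrm F (A x v) \<le> K * nrm E v"
      using bA[OF jx(2)] unfolding bounded_linear_on_def by blast
    then show ?thesis using bA[OF jx(2)] unfolding bounded_multilinear_on_def j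
      by (auto simp: D_def bounded_linear_on_def length_Suc_conv intro!: exI[of _ K])
  qed
  moreover have "\<exists>\<delta>>0. \<forall>h\<in>sp E. nrm E h < \<delta> \<and> x + h \<in> U \<longrightarrow>
      (\<forall>vs\<in>unit_args j E. nrm F (D j (x + h) vs - D j x vs - D (Suc j) x (h # vs)) \<le> \<epsilon> * nrm E h)"
    if j: "j < 1" and xU: "x \<in> U" and \<epsilon>: "\<epsilon> > 0" for j x \<epsilon>
  proof -
    have x: "x \<in> sp E" by (rule strict_derivD(1)[OF A[OF xU]])
    obtain \<delta> where d: "\<delta> > 0" "\<And>y z. y \<in> nball E x \<delta> \<Longrightarrow> z \<in> nball E x \<delta> \<Longrightarrow>
        nrm F (f y - f z - A x (y - z)) \<le> \<epsilon> * nrm E (y - z)"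
      using strict_derivE[OF A[OF xU] \<epsilon>] by metis
    have "nrm F (f (x + h) - f x - A x h) \<le> \<epsilon> * nrm E h" if "h \<in> sp E" "nrm E h < \<delta>" for h
      using d(2)[of "x + h" x] that x d(1) E
      by (auto simp: nball_def nrm_zero intro: nspace_closed)
    then show ?thesis using d(1) j by (intro exI[of _ \<delta>]) (auto simp: D_def)
  qed
  moreover have "\<exists>\<delta>>0. \<forall>y\<in>U. nrm E (y - x) < \<delta> \<longrightarrow>
      (\<forall>vs\<in>unit_args 1 E. nrm F (D 1 y vs - D 1 x vs) \<le> \<epsilon>)" if x: "x \<in> U" and \<epsilon>: "\<epsilon> > 0" for x \<epsilon>
  proof -
    have xs: "x \<in> sp E" by (rule strict_derivD(1)[OF A[OF x]])
    obtain \<delta> where d: "\<delta> > 0" "\<And>y. y \<in> nball E x \<delta> \<Longrightarrow> f y \<in> sp F"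
      "\<And>y z. y \<in> nball E x \<delta> \<Longrightarrow> z \<in> nball E x \<delta> \<Longrightarrow>
        nrm F (f y - f z - A x (y - z)) \<le> \<epsilon> / 2 * nrm E (y - z)"
      using strict_derivE[OF A[OF x], of "\<epsilon> / 2"] \<epsilon> by auto
    have "nrm F (A y v - A x v) \<le> \<epsilon>"
      if y: "y \<in> U" "nrm E (y - x) < \<delta>" and v: "v \<in> sp E" "nrm E v \<le> 1" for y v
    proof (rule field_le_epsilon)
      fix e :: real assume e: "e > 0"
      \<comment> \<open>Both derivatives are close to the same difference quotient at \<open>y\<close>.\<close>
      have ys: "y \<in> sp E" by (rule strict_derivD(1)[OF A[OF y(1)]])
      have yb: "y \<in> nball E x \<delta>" using y ys by (auto simp: nball_def)
      obtain s where s: "s > 0" "nball E y s \<subseteq> nball E x \<delta>" using nball_in_nball[OF E xs yb] .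
      define e' where "e' = min e s"
      have e': "e' > 0" using e s by (simp add: e'_def)
      obtain \<tau> where t: "\<tau> > 0" "\<And>t. 0 < t \<Longrightarrow> t < \<tau> \<Longrightarrow> y + t *\<^sub>R v \<in> nball E y e'"
        "\<And>t. 0 < t \<Longrightarrow> t < \<tau> \<Longrightarrow> f (y + t *\<^sub>R v) \<in> sp F"
        "\<And>t. 0 < t \<Longrightarrow> t < \<tau> \<Longrightarrow> nrm F ((1/t) *\<^sub>R (f (y + t *\<^sub>R v) - f y) - A y v) \<le> e'"
        using strict_deriv_direction[OF A[OF y(1)] E F v(1) e'] by metis
      define t where "t = \<tau> / 2"
      have t0: "0 < t" "t < \<tau>" using t by (auto simp: t_def)
      define w where "w = (1/t) *\<^sub>R (f (y + t *\<^sub>R v) - f y)"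
      have As: "A y v \<in> sp F" "A x v \<in> sp F"
        using bounded_linear_onD(1)[OF bA] v x y by auto
      have ws: "w \<in> sp F" using t t0 fs[OF y(1)] F by (auto simp: w_def intro!: nspace_closed)
      have tv: "y + t *\<^sub>R v \<in> nball E x \<delta>" using t(2)[OF t0] s by (auto simp: e'_def nball_def)
      have "nrm F (f (y + t *\<^sub>R v) - f y - t *\<^sub>R A x v) \<le> \<epsilon> / 2 * (t * nrm E v)"
        using d(3)[OF tv yb] t0 v E bounded_linear_onD(3)[OF bA[OF x] v(1)] by (simp add: nrm_scale)
      moreover have "w - A x v = (1/t) *\<^sub>R (f (y + t *\<^sub>R v) - f y - t *\<^sub>R A x v)"
        using t0 by (simp add: w_def algebra_simps)
      moreover have "f (y + t *\<^sub>R v) - f y - t *\<^sub>R A x v \<in> sp F"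
        using t(3)[OF t0] As fs[OF y(1)] F by (intro nspace_closed)
      ultimately have "nrm F (w - A x v) \<le> (1/t) * (\<epsilon> / 2 * (t * nrm E v))"
        using t0 F by (simp only:) (intro nrm_scale_le, auto)
      also have "\<dots> = \<epsilon> / 2 * nrm E v" using t0 by simp
      also have "\<dots> \<le> \<epsilon>" using v \<epsilon> nrm_nonneg[OF E v(1)] mult_left_le[of "nrm E v" \<epsilon>] by simp
      finally have 1: "nrm F (w - A x v) \<le> \<epsilon>" .
      have "nrm F (A y v - A x v) \<le> nrm F (A y v - w) + nrm F (w - A x v)"
        using As ws by (intro nrm_triangle_via F)
      also have "nrm F (A y v - w) = nrm F (w - A y v)" using As ws by (intro nrm_minus_commute F)
      also have "\<dots> \<le> e" using t(4)[OF t0] by (simp add: w_def e'_def)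
      finally show "nrm F (A y v - A x v) \<le> \<epsilon> + e" using 1 by simp
    qed
    then show ?thesis
      using d(1) by (intro exI[of _ \<delta>]) (auto simp: D_def unit_args_def length_Suc_conv)
  qed
  ultimately show ?thesis unfolding Ck_on_def
    by (intro conjI U exI[of _ D]) (auto simp: D_def)
qed

section \<open>Maps with bounded second differences\<close>

text \<open>
  A Lipschitz bound and a bound on the second differences. Unlike bounds on derivatives, these
  conditions are preserved by pointwise limits, which is what the Baire category argument needs.
\<close>

definition tame ::
    "'e::real_vector nspace \<Rightarrow> 'f::real_vector nspace \<Rightarrow> ('e \<Rightarrow> 'f) \<Rightarrow> 'e \<Rightarrow> real \<Rightarrow> real \<Rightarrow> bool" where
  "tame E F f x r M \<longleftrightarrow>
     (\<forall>y\<in>nball E x r. f y \<in> sp F) \<and>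
     (\<forall>y\<in>nball E x r. \<forall>z\<in>nball E x r. nrm F (f y - f z) \<le> M * nrm E (y - z)) \<and>
     (\<forall>a u v. u \<in> sp E \<and> v \<in> sp E \<and> {a, a + u, a + v, a + u + v} \<subseteq> nball E x r \<longrightarrow>
        nrm F (f (a + u + v) - f (a + u) - (f (a + v) - f a)) \<le> M * nrm E u * nrm E v)"

lemma tameD:
  assumes "tame E F f x r M"
  shows "y \<in> nball E x r \<Longrightarrow> f y \<in> sp F"
    and "y \<in> nball E x r \<Longrightarrow> z \<in> nball E x r \<Longrightarrow> nrm F (f y - f z) \<le> M * nrm E (y - z)"
    and "u \<in> sp E \<Longrightarrow> v \<in> sp E \<Longrightarrow> a \<in> nball E x r \<Longrightarrow> a + u \<in> nball E x r \<Longrightarrow>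
      a + v \<in> nball E x r \<Longrightarrow> a + u + v \<in> nball E x r \<Longrightarrow>
      nrm F (f (a + u + v) - f (a + u) - (f (a + v) - f a)) \<le> M * nrm E u * nrm E v"
  using assms unfolding tame_def by auto

lemma tame_mono:
  assumes t: "tame E F f x r M" and "r' \<le> r" "M \<le> M'" and E: "normed_space E"
  shows "tame E F f x r' M'"
proof -
  have sub: "y \<in> nball E x r" if "y \<in> nball E x r'" for y using that assms(2) by (auto simp: nball_def)
  show ?thesis unfolding tame_def
  proof (intro conjI ballI allI impI)
    fix y z assume yz: "y \<in> nball E x r'" "z \<in> nball E x r'"
    have "M * nrm E (y - z) \<le> M' * nrm E (y - z)"
      using yz assms by (intro mult_right_mono nrm_nonneg nspace_closed) (auto simp: nball_def)
    then show "nrm F (f y - f z) \<le> M' * nrm E (y - z)"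
      using tameD(2)[OF t sub sub, OF yz] by simp
  next
    fix a u v assume a: "u \<in> sp E \<and> v \<in> sp E \<and> {a, a + u, a + v, a + u + v} \<subseteq> nball E x r'"
    have "M * nrm E u * nrm E v \<le> M' * nrm E u * nrm E v"
      using a assms by (intro mult_right_mono nrm_nonneg) auto
    then show "nrm F (f (a + u + v) - f (a + u) - (f (a + v) - f a)) \<le> M' * nrm E u * nrm E v"
      using tameD(3)[OF t, of u v a] sub a by (meson insert_subset order_trans)
  next
    show "f y \<in> sp F" if "y \<in> nball E x r'" for y by (rule tameD(1)[OF t sub[OF that]])
  qed
qed

lemma tame_transfer:
  assumes t: "tame E F f x r M" and eq: "\<And>y. y \<in> nball E x r \<Longrightarrow> f y = f' y"
  shows "tame E F f' x r M"
  using t eq unfolding tame_def by simp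

text \<open>Only finitely many values enter each inequality, so approximation on finite sets is enough.\<close>

lemma tame_limit:
  assumes E: "normed_space E" and F: "normed_space F"
    and fs: "\<And>y. y \<in> nball E x r \<Longrightarrow> f y \<in> sp F"
    and approx: "\<And>S \<epsilon>. finite S \<Longrightarrow> S \<subseteq> nball E x r \<Longrightarrow> \<epsilon> > 0 \<Longrightarrow>
      \<exists>f'. tame E F f' x r M \<and> (\<forall>y\<in>S. nrm F (f' y - f y) \<le> \<epsilon>)"
  shows "tame E F f x r M"
  unfolding tame_def
proof (intro conjI ballI allI impI fs)
  fix y z assume yz: "y \<in> nball E x r" "z \<in> nball E x r"
  show "nrm F (f y - f z) \<le> M * nrm E (y - z)"
  proof (rule field_le_epsilon)
    fix e :: real assume e: "e > 0"
    then obtain f' where f': "tame E F f' x r M" "\<forall>u\<in>{y, z}. nrm F (f' u - f u) \<le> e / 2"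
      using approx[of "{y, z}" "e / 2"] yz by auto
    have s: "f' y \<in> sp F" "f' z \<in> sp F" "f y \<in> sp F" "f z \<in> sp F"
      using tameD(1)[OF f'(1)] fs yz by auto
    have "f y - f z = (f' y - f' z) - ((f' y - f y) - (f' z - f z))" by simp
    also have "nrm F \<dots> \<le> nrm F (f' y - f' z) + nrm F ((f' y - f y) - (f' z - f z))"
      using s F by (intro nrm_triangle_diff nspace_diff)
    also have "nrm F ((f' y - f y) - (f' z - f z)) \<le> nrm F (f' y - f y) + nrm F (f' z - f z)"
      using s F by (intro nrm_triangle_diff nspace_diff)
    finally show "nrm F (f y - f z) \<le> M * nrm E (y - z) + e"
      using tameD(2)[OF f'(1) yz] f'(2) by simp
  qed
next
  fix a u v assume "u \<in> sp E \<and> v \<in> sp E \<and> {a, a + u, a + v, a + u + v} \<subseteq> nball E x r"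
  then have uv: "u \<in> sp E" "v \<in> sp E" and a: "a \<in> nball E x r" "a + u \<in> nball E x r"
    "a + v \<in> nball E x r" "a + u + v \<in> nball E x r" by auto
  show "nrm F (f (a + u + v) - f (a + u) - (f (a + v) - f a)) \<le> M * nrm E u * nrm E v"
  proof (rule field_le_epsilon)
    fix e :: real assume e: "e > 0"
    let ?S = "{a, a + u, a + v, a + u + v}"
    obtain f' where f': "tame E F f' x r M" "\<forall>u\<in>?S. nrm F (f' u - f u) \<le> e / 4"
      using approx[of ?S "e / 4"] a e by auto
    define \<Delta> where "\<Delta> y = f' y - f y" for y
    have s: "f' y \<in> sp F" "f y \<in> sp F" "\<Delta> y \<in> sp F" if "y \<in> ?S" for y
      using tameD(1)[OF f'(1)] fs a that F by (auto simp: \<Delta>_def intro!: nspace_diff)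
    have "f (a + u + v) - f (a + u) - (f (a + v) - f a) =
      (f' (a + u + v) - f' (a + u) - (f' (a + v) - f' a)) - ((\<Delta> (a + u + v) - \<Delta> (a + u)) - (\<Delta> (a + v) - \<Delta> a))"
      by (simp add: \<Delta>_def)
    also have "nrm F \<dots> \<le> nrm F (f' (a + u + v) - f' (a + u) - (f' (a + v) - f' a)) +
        nrm F ((\<Delta> (a + u + v) - \<Delta> (a + u)) - (\<Delta> (a + v) - \<Delta> a))"
      using s F by (intro nrm_triangle_diff nspace_diff) auto
    also have "nrm F ((\<Delta> (a + u + v) - \<Delta> (a + u)) - (\<Delta> (a + v) - \<Delta> a)) \<le>
        nrm F (\<Delta> (a + u + v) - \<Delta> (a + u)) + nrm F (\<Delta> (a + v) - \<Delta> a)"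
      using s F by (intro nrm_triangle_diff nspace_diff) auto
    also have "nrm F (\<Delta> (a + u + v) - \<Delta> (a + u)) \<le> nrm F (\<Delta> (a + u + v)) + nrm F (\<Delta> (a + u))"
      using s F by (intro nrm_triangle_diff) auto
    also have "nrm F (\<Delta> (a + v) - \<Delta> a) \<le> nrm F (\<Delta> (a + v)) + nrm F (\<Delta> a)"
      using s F by (intro nrm_triangle_diff) auto
    finally show "nrm F (f (a + u + v) - f (a + u) - (f (a + v) - f a)) \<le> M * nrm E u * nrm E v + e"
      using tameD(3)[OF f'(1) uv a] f'(2) by (simp add: \<Delta>_def)
  qed
qed

text \<open>
  A local bound for the second derivative makes the first derivative Lipschitz, and a second
  difference is the increment along \<open>v\<close> of the map \<open>f (x + u) - f x\<close>, whose derivative is then of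
  order \<open>u\<close>.
\<close>

lemma smooth_on_tame:
  assumes smooth: "smooth_on E F U f" and E: "normed_space E" and F: "normed_space F" and x: "x \<in> U"
  obtains r M where "r > 0" "M \<ge> 1" "nball E x r \<subseteq> U" "tame E F f x r M"
proof -
  have C: "Ck_on 2 E F U f" using smooth by (simp add: smooth_on_def)
  obtain D :: "nat \<Rightarrow> 'a \<Rightarrow> 'a list \<Rightarrow> 'b" where op: "openin (ntop E) U"
    and D0': "\<forall>x\<in>U. D 0 x [] = f x"
    and Dm': "\<forall>j\<le>2. \<forall>x\<in>U. bounded_multilinear_on j E F (D j x)"
    and Dd': "\<forall>j<2. \<forall>x\<in>U. \<forall>\<epsilon>>0. \<exists>\<delta>>0. \<forall>h\<in>sp E. nrm E h < \<delta> \<and> x + h \<in> U \<longrightarrow>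
           (\<forall>vs\<in>unit_args j E.
              nrm F (D j (x + h) vs - D j x vs - D (Suc j) x (h # vs)) \<le> \<epsilon> * nrm E h)"
    and Dc': "\<forall>x\<in>U. \<forall>\<epsilon>>0. \<exists>\<delta>>0. \<forall>y\<in>U. nrm E (y - x) < \<delta> \<longrightarrow>
           (\<forall>vs\<in>unit_args 2 E. nrm F (D 2 y vs - D 2 x vs) \<le> \<epsilon>)"
    using C unfolding Ck_on_def by (elim conjE exE) (rule that; assumption)
  note D0 = D0'[rule_format] and Dm = Dm'[rule_format] and Dd = Dd'[rule_format]
    and Dc = Dc'[rule_format]
  have xs: "x \<in> sp E" using op x E by (auto simp: openin_ntop)
  obtain r where r: "r > 0" "nball E x r \<subseteq> U" using op x E by (auto simp: openin_ntop)
  have fs: "f y \<in> sp F" if "y \<in> U" for y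
    using Dm[of 0 y] D0[OF that] that by (auto simp: bounded_multilinear_on_def)
  have D1lin: "bounded_linear_on E F (\<lambda>h. D 1 y [h])" if "y \<in> U" for y
    by (rule bounded_multilinear_on_1) (use Dm that in auto)
  have D2lin: "bounded_linear_on E F (\<lambda>h. D 2 y [h, w])" if "y \<in> U" "w \<in> sp E" for y w
    by (rule bounded_multilinear_on_2) (use Dm that in auto)
  obtain K2 where K2: "\<And>vs. length vs = 2 \<Longrightarrow> set vs \<subseteq> sp E \<Longrightarrow>
      nrm F (D 2 x vs) \<le> K2 * prod_list (map (nrm E) vs)"
    using bounded_multilinear_onD(4)[OF Dm[of 2 x]] x by blast
  obtain \<delta> where d: "\<delta> > 0" "\<And>y vs. y \<in> U \<Longrightarrow> nrm E (y - x) < \<delta> \<Longrightarrow> vs \<in> unit_args 2 E \<Longrightarrow>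
      nrm F (D 2 y vs - D 2 x vs) \<le> 1"
    using Dc[OF x, of 1] by (metis zero_less_one)
  define K where "K = \<bar>K2\<bar> + 1"
  define \<rho> where "\<rho> = min r \<delta>"
  have sub: "nball E x \<rho> \<subseteq> U" using r by (auto simp: \<rho>_def nball_def)
  have D2unit: "nrm F (D 2 y [h, w]) \<le> K"
    if y: "y \<in> nball E x \<rho>" and hw: "h \<in> sp E" "nrm E h \<le> 1" "w \<in> sp E" "nrm E w \<le> 1" for y h w
  proof -
    have yU: "y \<in> U" using sub y by auto
    have u: "[h, w] \<in> unit_args 2 E" using hw by (auto simp: unit_args_def)
    have s: "D 2 y [h, w] \<in> sp F" "D 2 x [h, w] \<in> sp F"
      using hw x yU by (auto intro: bounded_linear_onD(1)[OF D2lin])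
    have "nrm E h * nrm E w \<le> 1 * 1"
      using hw E by (intro mult_mono nrm_nonneg) auto
    then have "K2 * (nrm E h * nrm E w) \<le> \<bar>K2\<bar> * 1"
      using hw E by (intro mult_mono) (auto simp: nrm_nonneg)
    then have "nrm F (D 2 x [h, w]) \<le> \<bar>K2\<bar>" using K2[of "[h, w]"] hw by simp
    moreover have "nrm F (D 2 y [h, w] - D 2 x [h, w]) \<le> 1"
      using d(2)[OF yU _ u] y by (auto simp: nball_def \<rho>_def)
    ultimately show ?thesis using nrm_triangle_rev[OF F s] by (simp add: K_def)
  qed
  have D2bound: "nrm F (D 2 y [h, w]) \<le> K * nrm E h"
    if y: "y \<in> nball E x \<rho>" and w: "w \<in> sp E" "nrm E w \<le> 1" and h: "h \<in> sp E" for y h w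
    using y sub w D2unit by (intro bounded_by_unit_args[OF D2lin E F _ h]) auto
  have der0: "has_fderiv_on E F (nball E x \<rho>) f (\<lambda>h. D 1 y [h]) y" if y: "y \<in> nball E x \<rho>" for y
    unfolding has_fderiv_on_def
  proof (intro conjI allI impI y)
    have yU: "y \<in> U" using sub y by auto
    show "bounded_linear_on E F (\<lambda>h. D 1 y [h])" by (rule D1lin[OF yU])
    fix \<epsilon> :: real assume "\<epsilon> > 0"
    then obtain \<delta> where d: "\<delta> > 0" "\<And>h. h \<in> sp E \<Longrightarrow> nrm E h < \<delta> \<Longrightarrow> y + h \<in> U \<Longrightarrow>
           (\<forall>vs\<in>unit_args 0 E.
              nrm F (D 0 (y + h) vs - D 0 y vs - D (Suc 0) y (h # vs)) \<le> \<epsilon> * nrm E h)"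
      using Dd[of 0 y \<epsilon>] yU by auto
    have "[] \<in> unit_args 0 E" by (auto simp: unit_args_def)
    then show "\<exists>\<delta>>0. \<forall>h\<in>sp E. nrm E h < \<delta> \<and> y + h \<in> nball E x \<rho> \<longrightarrow>
        nrm F (f (y + h) - f y - D 1 y [h]) \<le> \<epsilon> * nrm E h"
      using d sub D0[OF yU] D0 by (intro exI[of _ \<delta>]) fastforce
  qed
  have der1: "has_fderiv_on E F (nball E x \<rho>) (\<lambda>y. D 1 y [w]) (\<lambda>h. D 2 y [h, w]) y"
    if y: "y \<in> nball E x \<rho>" and w: "w \<in> sp E" "nrm E w \<le> 1" for y w
    unfolding has_fderiv_on_def
  proof (intro conjI allI impI y)
    have yU: "y \<in> U" using sub y by auto
    show "bounded_linear_on E F (\<lambda>h. D 2 y [h, w])" by (rule D2lin[OF yU w(1)])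
    fix \<epsilon> :: real assume "\<epsilon> > 0"
    then obtain \<delta> where d: "\<delta> > 0" "\<And>h. h \<in> sp E \<Longrightarrow> nrm E h < \<delta> \<Longrightarrow> y + h \<in> U \<Longrightarrow>
           (\<forall>vs\<in>unit_args 1 E.
              nrm F (D 1 (y + h) vs - D 1 y vs - D (Suc 1) y (h # vs)) \<le> \<epsilon> * nrm E h)"
      using Dd[of 1 y \<epsilon>] yU by auto
    have "[w] \<in> unit_args 1 E" using w by (auto simp: unit_args_def)
    then show "\<exists>\<delta>>0. \<forall>h\<in>sp E. nrm E h < \<delta> \<and> y + h \<in> nball E x \<rho> \<longrightarrow>
        nrm F (D 1 (y + h) [w] - D 1 y [w] - D 2 y [h, w]) \<le> \<epsilon> * nrm E h"
      using d sub unfolding numeral_2_eq_2 by (intro exI[of _ \<delta>]) fastforce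
  qed
  have D1Lip: "nrm F (D 1 y [v] - D 1 z [v]) \<le> K * nrm E (y - z) * nrm E v"
    if yz: "y \<in> nball E x \<rho>" "z \<in> nball E x \<rho>" and v: "v \<in> sp E" for y z v
  proof -
    have yzU: "y \<in> U" "z \<in> U" using sub yz by auto
    have "bounded_linear_on E F (\<lambda>h. D 1 y [h] + (-1) *\<^sub>R D 1 z [h])"
      using D1lin[OF yzU(1)] D1lin[OF yzU(2)] E F
      by (intro bounded_linear_on_add)
        (auto simp: bounded_linear_on_def nrm_minus intro: nspace_closed)
    then have lin: "bounded_linear_on E F (\<lambda>h. D 1 y [h] - D 1 z [h])" by simp
    have zero: "bounded_linear_on E F (\<lambda>h. 0)"
      using F E by (auto simp: bounded_linear_on_def nrm_zero nspace_zero intro: exI[of _ 0])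
    show ?thesis
    proof (rule bounded_by_unit_args[OF lin E F _ v])
      fix w assume w: "w \<in> sp E" "nrm E w \<le> 1"
      have "nrm F (D 1 y [w] - D 1 z [w] - 0) \<le> K * nrm E (y - z)"
        by (rule mean_value_nball[OF E F xs, where A = "\<lambda>y h. D 2 y [h, w]" and r = \<rho>])
          (use sub w der1 D2bound yz bounded_linear_onD(1)[OF D1lin] in \<open>auto intro: zero\<close>)
      then show "nrm F (D 1 y [w] - D 1 z [w]) \<le> K * nrm E (y - z)" by simp
    qed
  qed
  have "Ck_on 1 E F U f" using smooth by (auto simp: smooth_on_def)
  then obtain A where "strict_deriv E F f A x" using Ck_on_1_strict_deriv[OF _ E F x] by blast
  from this E F obtain K1 \<delta>1 where K1': "K1 > 0" "\<delta>1 > 0" "\<forall>y\<in>nball E x \<delta>1. f y \<in> sp F"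
    "\<forall>y\<in>nball E x \<delta>1. \<forall>z\<in>nball E x \<delta>1. nrm F (f y - f z) \<le> K1 * nrm E (y - z)"
    by (rule strict_deriv_Lipschitz)
  note K1 = K1'(1,2,4)[rule_format]
  define r' where "r' = min \<rho> \<delta>1"
  define M where "M = max 1 (max K1 K)"
  have sub': "y \<in> nball E x \<rho>" "y \<in> nball E x \<delta>1" "y \<in> U" if "y \<in> nball E x r'" for y
    using that sub by (auto simp: r'_def nball_def)
  show ?thesis
  proof
    show "r' > 0" using r d K1 by (auto simp: r'_def \<rho>_def)
    show "M \<ge> 1" by (simp add: M_def)
    show "nball E x r' \<subseteq> U" using sub' by auto
    show "tame E F f x r' M"
      unfolding tame_def
    proof (intro conjI ballI allI impI)
      show "f y \<in> sp F" if "y \<in> nball E x r'" for y using sub'[OF that] fs by auto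
    next
      fix y z assume yz: "y \<in> nball E x r'" "z \<in> nball E x r'"
      have "K1 * nrm E (y - z) \<le> M * nrm E (y - z)"
        using yz E by (intro mult_right_mono nrm_nonneg nspace_closed) (auto simp: M_def nball_def)
      then show "nrm F (f y - f z) \<le> M * nrm E (y - z)"
        using K1(3)[of y z] sub' yz by force
    next
      fix a u v assume "u \<in> sp E \<and> v \<in> sp E \<and> {a, a + u, a + v, a + u + v} \<subseteq> nball E x r'"
      then have uv: "u \<in> sp E" "v \<in> sp E" and b: "a \<in> nball E x r'" "a + u \<in> nball E x r'"
        "a + v \<in> nball E x r'" "a + u + v \<in> nball E x r'" by auto
      have seg1: "a + t *\<^sub>R v \<in> nball E x \<rho>" if "t \<in> {0..1}" for t
        using nball_segment[OF E xs b(1,3), of t] that sub' by auto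
      have seg2: "a + u + t *\<^sub>R v \<in> nball E x \<rho>" if "t \<in> {0..1}" for t
        using nball_segment[OF E xs b(2,4), of t] that sub' by auto
      define c where "c t = f (a + u + t *\<^sub>R v) - f (a + t *\<^sub>R v)" for t
      have "nrm F (c 1 - c 0) \<le> K * nrm E u * nrm E v"
      proof (rule curve_mean_value[OF F])
        fix t :: real assume t: "t \<in> {0..1}"
        have s: "f (a + u + t *\<^sub>R v) \<in> sp F" "f (a + t *\<^sub>R v) \<in> sp F" if "t \<in> {0..1}" for t
          using seg1[OF that] seg2[OF that] sub fs by auto
        show "c t \<in> sp F" unfolding c_def using s[OF t] by (intro nspace_closed F)
        show "curve_deriv F c (D 1 (a + u + t *\<^sub>R v) [v] - D 1 (a + t *\<^sub>R v) [v]) t"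
          unfolding c_def
          by (intro curve_deriv_diff F s t has_fderiv_on_curve[OF E F uv(2) _ t, where U = "nball E x \<rho>"])
            (use seg1 seg2 t der0 in auto)
        have "nrm F (D 1 (a + u + t *\<^sub>R v) [v] - D 1 (a + t *\<^sub>R v) [v]) \<le>
            K * nrm E ((a + u + t *\<^sub>R v) - (a + t *\<^sub>R v)) * nrm E v"
          by (intro D1Lip seg1 seg2 t uv)
        then show "nrm F (D 1 (a + u + t *\<^sub>R v) [v] - D 1 (a + t *\<^sub>R v) [v]) \<le> K * nrm E u * nrm E v"
          by simp
      qed
      also have "\<dots> \<le> M * nrm E u * nrm E v"
        using uv E by (intro mult_right_mono nrm_nonneg) (auto simp: M_def)
      finally show "nrm F (f (a + u + v) - f (a + u) - (f (a + v) - f a)) \<le> M * nrm E u * nrm E v"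
        by (simp add: c_def algebra_simps)
    qed
  qed
qed

text \<open>
  The image of a parallelogram is one up to an error of second order, which the Lipschitz bound
  of the outer map controls. The factor \<open>3\<close> keeps the fourth corner of that parallelogram in the
  domain of the outer map.
\<close>

lemma tame_compose:
  assumes f: "tame E F f x r M" and g: "tame F H g b r' M'"
    and E: "normed_space E" and F: "normed_space F" and H: "normed_space H"
    and x: "x \<in> sp E" and r: "r > 0" and b: "b \<in> sp F" and M: "M > 0" "M' > 0"
    and small: "nrm F (f x - b) + 3 * M * r \<le> r'"
  shows "tame E H (\<lambda>y. g (f y)) x r (M' * M + M' * M * M)"
proof -
  have xb: "x \<in> nball E x r" by (intro center_in_nball E x r)
  have fx: "f x \<in> sp F" by (rule tameD(1)[OF f xb])
  have fs: "f y \<in> sp F" if "y \<in> nball E x r" for y by (rule tameD(1)[OF f that])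
  have fd: "nrm F (f y - f x) < M * r" if y: "y \<in> nball E x r" for y
  proof -
    have "nrm F (f y - f x) \<le> M * nrm E (y - x)" by (rule tameD(2)[OF f y xb])
    also have "\<dots> < M * r" using y M by (auto simp: nball_def)
    finally show ?thesis .
  qed
  have inb: "w \<in> nball F b r'" if "w \<in> sp F" "nrm F (w - f x) < 3 * M * r" for w
    using nrm_triangle_via[OF F that(1) fx b] that small by (auto simp: nball_def)
  have fin: "f y \<in> nball F b r'" if "y \<in> nball E x r" for y
    using fd[OF that] fs[OF that] mult_pos_pos[OF M(1) r] by (intro inb) linarith+
  have MM: "0 < M' * M" "0 < M' * M * M" using M by auto
  show ?thesis unfolding tame_def
  proof (intro conjI ballI allI impI)
    show "g (f y) \<in> sp H" if "y \<in> nball E x r" for y using tameD(1)[OF g fin[OF that]] .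
  next
    fix y z assume yz: "y \<in> nball E x r" "z \<in> nball E x r"
    have "nrm H (g (f y) - g (f z)) \<le> M' * nrm F (f y - f z)" by (intro tameD(2)[OF g] fin yz)
    also have "\<dots> \<le> M' * (M * nrm E (y - z))" using tameD(2)[OF f yz] M by (intro mult_left_mono) auto
    also have "\<dots> \<le> (M' * M + M' * M * M) * nrm E (y - z)"
      using yz E mult_nonneg_nonneg[OF less_imp_le[OF MM(2)] nrm_nonneg[OF E, of "y - z"]]
      by (auto simp: nball_def nspace_closed algebra_simps)
    finally show "nrm H (g (f y) - g (f z)) \<le> (M' * M + M' * M * M) * nrm E (y - z)" .
  next
    fix a u v assume "u \<in> sp E \<and> v \<in> sp E \<and> {a, a + u, a + v, a + u + v} \<subseteq> nball E x r"
    then have uv: "u \<in> sp E" "v \<in> sp E" and a: "a \<in> nball E x r" "a + u \<in> nball E x r"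
      "a + v \<in> nball E x r" "a + u + v \<in> nball E x r" by auto
    define u' v' c where "u' = f (a + u) - f a" and "v' = f (a + v) - f a" and "c = f a + u' + v'"
    have s: "f a \<in> sp F" "f (a + u) \<in> sp F" "f (a + v) \<in> sp F" "f (a + u + v) \<in> sp F"
      using a fs by auto
    have s': "u' \<in> sp F" "v' \<in> sp F" "c \<in> sp F"
      unfolding u'_def v'_def c_def using s F by (auto intro!: nspace_closed)
    have nu: "nrm F u' \<le> M * nrm E u" using tameD(2)[OF f a(2,1)] by (simp add: u'_def)
    have nv: "nrm F v' \<le> M * nrm E v" using tameD(2)[OF f a(3,1)] by (simp add: v'_def)
    have cin: "c \<in> nball F b r'"
    proof (rule inb[OF s'(3)])
      have "c - f x = (f (a + u) - f x) + ((f (a + v) - f x) - (f a - f x))"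
        by (simp add: c_def u'_def v'_def)
      also have "nrm F \<dots> \<le> nrm F (f (a + u) - f x) + nrm F ((f (a + v) - f x) - (f a - f x))"
        using s fx F by (intro nrm_triangle nspace_closed)
      also have "nrm F ((f (a + v) - f x) - (f a - f x)) \<le> nrm F (f (a + v) - f x) + nrm F (f a - f x)"
        using s fx F by (intro nrm_triangle_diff nspace_closed)
      finally show "nrm F (c - f x) < 3 * M * r" using fd[OF a(1)] fd[OF a(2)] fd[OF a(3)] by simp
    qed
    have gs: "g (f (a + u + v)) \<in> sp H" "g c \<in> sp H" "g (f (a + u)) \<in> sp H" "g (f (a + v)) \<in> sp H"
        "g (f a) \<in> sp H"
      using cin fin a by (auto intro: tameD(1)[OF g])
    have 1: "nrm H (g (f (a + u + v)) - g c) \<le> M' * (M * nrm E u * nrm E v)"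
    proof -
      have "nrm H (g (f (a + u + v)) - g c) \<le> M' * nrm F (f (a + u + v) - c)"
        by (intro tameD(2)[OF g] cin fin a)
      also have "f (a + u + v) - c = f (a + u + v) - f (a + u) - (f (a + v) - f a)"
        by (simp add: c_def u'_def v'_def)
      also have "nrm F \<dots> \<le> M * nrm E u * nrm E v" by (rule tameD(3)[OF f uv a])
      finally show ?thesis using M by simp
    qed
    have 2: "nrm H (g c - g (f (a + u)) - (g (f (a + v)) - g (f a))) \<le> M' * (M * nrm E u) * (M * nrm E v)"
    proof -
      have eq: "f a + u' = f (a + u)" "f a + v' = f (a + v)" by (auto simp: u'_def v'_def)
      have "nrm H (g (f a + u' + v') - g (f a + u') - (g (f a + v') - g (f a))) \<le> M' * nrm F u' * nrm F v'"
        using fin a cin by (intro tameD(3)[OF g s'(1,2)]) (auto simp: eq c_def)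
      also have "\<dots> \<le> M' * (M * nrm E u) * (M * nrm E v)"
        using nu nv M s' F E uv by (intro mult_mono) (auto simp: nrm_nonneg)
      finally show ?thesis by (simp add: c_def eq[symmetric])
    qed
    have "nrm H (g (f (a + u + v)) - g (f (a + u)) - (g (f (a + v)) - g (f a))) =
      nrm H ((g (f (a + u + v)) - g c) + (g c - g (f (a + u)) - (g (f (a + v)) - g (f a))))"
    by (simp add: algebra_simps)
    also have "\<dots> \<le> nrm H (g (f (a + u + v)) - g c) + nrm H (g c - g (f (a + u)) - (g (f (a + v)) - g (f a)))"
      using gs H by (intro nrm_triangle nspace_closed)
    finally show "nrm H (g (f (a + u + v)) - g (f (a + u)) - (g (f (a + v)) - g (f a))) \<le>
        (M' * M + M' * M * M) * nrm E u * nrm E v"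
      using 1 2 by (simp add: algebra_simps)
  qed
qed

lemma tame_deriv_bound:
  assumes f: "tame E F f x r M" and A: "strict_deriv E F f A y" and y: "y \<in> nball E x r"
    and E: "normed_space E" and F: "normed_space F" and x: "x \<in> sp E" and h: "h \<in> sp E"
  shows "nrm F (A h) \<le> M * nrm E h"
proof (rule field_le_epsilon)
  fix e :: real assume e: "e > 0"
  obtain s where s: "s > 0" "nball E y s \<subseteq> nball E x r" using nball_in_nball[OF E x y] .
  define e' where "e' = min e s"
  have e': "e' > 0" using e s by (simp add: e'_def)
  obtain \<tau> where t: "\<tau> > 0" "\<And>t. 0 < t \<Longrightarrow> t < \<tau> \<Longrightarrow> y + t *\<^sub>R h \<in> nball E y e'"
    "\<And>t. 0 < t \<Longrightarrow> t < \<tau> \<Longrightarrow> f (y + t *\<^sub>R h) \<in> sp F"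
    "\<And>t. 0 < t \<Longrightarrow> t < \<tau> \<Longrightarrow> nrm F ((1/t) *\<^sub>R (f (y + t *\<^sub>R h) - f y) - A h) \<le> e'"
    using strict_deriv_direction[OF A E F h e'] by metis
  define t where "t = \<tau> / 2"
  have t0: "0 < t" "t < \<tau>" using t by (auto simp: t_def)
  define w where "w = (1/t) *\<^sub>R (f (y + t *\<^sub>R h) - f y)"
  have b: "y + t *\<^sub>R h \<in> nball E x r" using t(2)[OF t0] s by (auto simp: e'_def nball_def)
  have s': "A h \<in> sp F" "f (y + t *\<^sub>R h) \<in> sp F" "f y \<in> sp F"
    using bounded_linear_onD(1)[OF strict_derivD(2)[OF A] h] tameD(1)[OF f] b y by auto
  have ws: "w \<in> sp F" using s' F by (auto simp: w_def intro!: nspace_closed)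
  have "nrm F (f (y + t *\<^sub>R h) - f y) \<le> M * (t * nrm E h)"
    using tameD(2)[OF f b y] t0 h E by (simp add: nrm_scale)
  then have "nrm F w \<le> (1 / t) * (M * (t * nrm E h))"
    unfolding w_def using t0 s' F by (intro nrm_scale_le nspace_closed) auto
  then have "nrm F w \<le> M * nrm E h" using t0 by simp
  moreover have "nrm F (A h) \<le> nrm F w + nrm F (A h - w)" by (intro nrm_triangle_rev F s' ws)
  moreover have "nrm F (A h - w) \<le> e"
    using t(4)[OF t0] nrm_minus_commute[OF F ws s'(1)] by (simp add: w_def e'_def)
  ultimately show "nrm F (A h) \<le> M * nrm E h + e" by simp
qed

lemma tame_deriv_Lipschitz:
  assumes f: "tame E F f x r M" and A: "strict_deriv E F f A y" "strict_deriv E F f B z"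
    and yz: "y \<in> nball E x r" "z \<in> nball E x r"
    and E: "normed_space E" and F: "normed_space F" and x: "x \<in> sp E" and h: "h \<in> sp E"
  shows "nrm F (A h - B h) \<le> M * nrm E (y - z) * nrm E h"
proof (rule field_le_epsilon)
  fix e :: real assume e: "e > 0"
  obtain s where s: "s > 0" "nball E y s \<subseteq> nball E x r" using nball_in_nball[OF E x yz(1)] .
  obtain s' where s': "s' > 0" "nball E z s' \<subseteq> nball E x r" using nball_in_nball[OF E x yz(2)] .
  define e' where "e' = min (e / 2) (min s s')"
  have e': "e' > 0" using e s s' by (simp add: e'_def)
  obtain \<tau> where t: "\<tau> > 0" "\<And>t. 0 < t \<Longrightarrow> t < \<tau> \<Longrightarrow> y + t *\<^sub>R h \<in> nball E y e'"
    "\<And>t. 0 < t \<Longrightarrow> t < \<tau> \<Longrightarrow> nrm F ((1/t) *\<^sub>R (f (y + t *\<^sub>R h) - f y) - A h) \<le> e'"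
    using strict_deriv_direction[OF A(1) E F h e'] by metis
  obtain \<tau>' where t': "\<tau>' > 0" "\<And>t. 0 < t \<Longrightarrow> t < \<tau>' \<Longrightarrow> z + t *\<^sub>R h \<in> nball E z e'"
    "\<And>t. 0 < t \<Longrightarrow> t < \<tau>' \<Longrightarrow> nrm F ((1/t) *\<^sub>R (f (z + t *\<^sub>R h) - f z) - B h) \<le> e'"
    using strict_deriv_direction[OF A(2) E F h e'] by metis
  define t where "t = min \<tau> \<tau>' / 2"
  have t0: "0 < t" "t < \<tau>" "t < \<tau>'" using t t' by (auto simp: t_def)
  have b: "y + t *\<^sub>R h \<in> nball E x r" "z + t *\<^sub>R h \<in> nball E x r"
    using t(2)[of t] t'(2)[of t] t0 s s' by (auto simp: e'_def nball_def)
  define v w where "v = (1/t) *\<^sub>R (f (y + t *\<^sub>R h) - f y)" and "w = (1/t) *\<^sub>R (f (z + t *\<^sub>R h) - f z)"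
  have fs: "f (y + t *\<^sub>R h) \<in> sp F" "f y \<in> sp F" "f (z + t *\<^sub>R h) \<in> sp F" "f z \<in> sp F"
    using tameD(1)[OF f] b yz by auto
  have As: "A h \<in> sp F" "B h \<in> sp F"
    using bounded_linear_onD(1)[OF strict_derivD(2)[OF A(1)] h]
      bounded_linear_onD(1)[OF strict_derivD(2)[OF A(2)] h] by auto
  have vw: "v \<in> sp F" "w \<in> sp F" using fs F by (auto simp: v_def w_def intro!: nspace_closed)
  have ys: "y \<in> sp E" "z \<in> sp E" using yz by (auto simp: nball_def)
  have "nrm F (f (z + (y - z) + t *\<^sub>R h) - f (z + (y - z)) - (f (z + t *\<^sub>R h) - f z)) \<le>
      M * nrm E (y - z) * nrm E (t *\<^sub>R h)"
    using ys h E b yz by (intro tameD(3)[OF f] nspace_closed) auto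
  moreover have "v - w = (1/t) *\<^sub>R (f (y + t *\<^sub>R h) - f y - (f (z + t *\<^sub>R h) - f z))"
    by (simp add: v_def w_def algebra_simps)
  moreover have "f (y + t *\<^sub>R h) - f y - (f (z + t *\<^sub>R h) - f z) \<in> sp F"
    using fs F by (intro nspace_closed)
  moreover have "nrm E (t *\<^sub>R h) = t * nrm E h" using t0 h E by (simp add: nrm_scale)
  ultimately have "nrm F (v - w) \<le> (1/t) * (M * nrm E (y - z) * (t * nrm E h))"
    using t0 F by (simp only:) (intro nrm_scale_le, auto)
  also have "\<dots> = M * nrm E (y - z) * nrm E h" using t0 by simp
  finally have 1: "nrm F (v - w) \<le> M * nrm E (y - z) * nrm E h" .
  have "nrm F (A h - B h) \<le> nrm F (A h - v) + nrm F (v - B h)" by (intro nrm_triangle_via F As vw)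
  also have "nrm F (v - B h) \<le> nrm F (v - w) + nrm F (w - B h)" by (intro nrm_triangle_via F As vw)
  also have "nrm F (A h - v) = nrm F (v - A h)" by (intro nrm_minus_commute F As vw)
  finally show "nrm F (A h - B h) \<le> M * nrm E (y - z) * nrm E h + e"
    using 1 t(3)[of t] t'(3)[of t] t0 by (simp add: v_def w_def e'_def)
qed

text \<open>
  The increment \<open>f y - f z\<close> is a sum of \<open>n\<close> increments along the segment; each of them differs
  by a second difference from the increment at \<open>u\<close> by the \<open>n\<close>-th part of \<open>y - z\<close>.
\<close>

lemma tame_remainder:
  assumes f: "tame E F f x r M" and A: "strict_deriv E F f A u"
    and b: "y \<in> nball E x r" "z \<in> nball E x r" "u \<in> nball E x r"
    and E: "normed_space E" and F: "normed_space F" and x: "x \<in> sp E" and M: "M \<ge> 0"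
  shows "nrm F (f y - f z - A (y - z)) \<le> M * nrm E (y - z) * (nrm E (z - u) + nrm E (y - z))"
proof (rule field_le_epsilon)
  fix e :: real assume e: "e > 0"
  define w where "w = y - z"
  have ss: "y \<in> sp E" "z \<in> sp E" "u \<in> sp E" using b by (auto simp: nball_def)
  have ws: "w \<in> sp E" using ss E by (auto simp: w_def intro: nspace_closed)
  obtain s where s: "s > 0" "nball E u s \<subseteq> nball E x r" using nball_in_nball[OF E x b(3)] .
  define e' where "e' = min e s"
  have e': "e' > 0" using e s by (simp add: e'_def)
  obtain \<tau> where t: "\<tau> > 0" "\<And>t. 0 < t \<Longrightarrow> t < \<tau> \<Longrightarrow> u + t *\<^sub>R w \<in> nball E u e'"
    "\<And>t. 0 < t \<Longrightarrow> t < \<tau> \<Longrightarrow> nrm F ((1/t) *\<^sub>R (f (u + t *\<^sub>R w) - f u) - A w) \<le> e'"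
    using strict_deriv_direction[OF A E F ws e'] by metis
  obtain m where m: "inverse (real (Suc m)) < \<tau>" using reals_Archimedean[OF t(1)] by blast
  define n where "n = Suc m"
  define t where "t = 1 / real n"
  have t0: "0 < t" "t < \<tau>" using m by (auto simp: t_def n_def inverse_eq_divide)
  have nt: "real n * t = 1" by (simp add: t_def n_def)
  define v where "v = t *\<^sub>R w"
  have vs: "v \<in> sp E" using ws E by (auto simp: v_def intro: nspace_closed)
  have vn: "nrm E v = t * nrm E w" using ws E t0 by (simp add: v_def nrm_scale)
  have uv: "u + v \<in> nball E x r" using t(2)[OF t0] s by (auto simp: e'_def nball_def v_def)
  have seg: "z + real j *\<^sub>R v \<in> nball E x r" if "j \<le> n" for j
  proof -
    have "z + (real j * t) *\<^sub>R (y - z) \<in> nball E x r"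
      using that by (intro nball_segment E x b) (auto simp: t_def n_def)
    then show ?thesis by (simp add: v_def w_def)
  qed
  define q where "q = f (u + v) - f u"
  have qs: "q \<in> sp F" unfolding q_def using uv b by (intro nspace_closed F tameD(1)[OF f])
  define d where "d j = f (z + real (Suc j) *\<^sub>R v) - f (z + real j *\<^sub>R v)" for j
  have ds: "d j \<in> sp F" if "j < n" for j
    unfolding d_def using that by (intro nspace_closed F tameD(1)[OF f] seg) auto
  have dq: "nrm F (d j - q) \<le> M * (nrm E (z - u) + nrm E w) * (t * nrm E w)" if j: "j < n" for j
  proof -
    define U where "U = z + real j *\<^sub>R v - u"
    have Us: "U \<in> sp E" unfolding U_def using ss vs E by (intro nspace_closed)
    have "nrm E U = nrm E ((z - u) + real j *\<^sub>R v)" by (simp add: U_def algebra_simps)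
    also have "\<dots> \<le> nrm E (z - u) + nrm E (real j *\<^sub>R v)" using ss vs E by (intro nrm_triangle nspace_closed)
    also have "nrm E (real j *\<^sub>R v) = (real j * t) * nrm E w" using vs E by (simp add: nrm_scale vn)
    also have "\<dots> \<le> 1 * nrm E w"
      using j by (intro mult_right_mono nrm_nonneg E ws) (auto simp: t_def n_def)
    finally have Un: "nrm E U \<le> nrm E (z - u) + nrm E w" by simp
    have eq: "u + U = z + real j *\<^sub>R v" "z + real j *\<^sub>R v + v = z + real (Suc j) *\<^sub>R v"
      by (auto simp: U_def algebra_simps)
    have "nrm F (f (u + U + v) - f (u + U) - (f (u + v) - f u)) \<le> M * nrm E U * nrm E v"
      using seg[of j] seg[of "Suc j"] j uv b by (intro tameD(3)[OF f Us vs]) (simp_all only: eq Suc_leI less_imp_le)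
    also have "\<dots> \<le> M * (nrm E (z - u) + nrm E w) * nrm E v"
      using Un M vs E by (intro mult_right_mono mult_left_mono nrm_nonneg) auto
    finally show ?thesis unfolding eq by (simp add: d_def q_def vn)
  qed
  have "(\<Sum>j<n. d j) = f (z + real n *\<^sub>R v) - f z"
    unfolding d_def using sum_lessThan_telescope[of "\<lambda>j. f (z + real j *\<^sub>R v)" n] by simp
  also have "z + real n *\<^sub>R v = y" using nt by (simp add: v_def w_def)
  finally have "f y - f z - real n *\<^sub>R q = (\<Sum>j<n. d j - q)"
    by (simp add: sum_subtractf sum_constant_scaleR)
  also have "nrm F \<dots> \<le> (\<Sum>j<n. M * (nrm E (z - u) + nrm E w) * (t * nrm E w))"
    using dq ds qs F by (intro nrm_sum_le) (auto intro: nspace_closed)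
  also have "\<dots> = M * nrm E w * (nrm E (z - u) + nrm E w) * (real n * t)" by simp
  also have "\<dots> = M * nrm E w * (nrm E (z - u) + nrm E w)" unfolding nt by simp
  finally have 1: "nrm F (f y - f z - real n *\<^sub>R q) \<le> M * nrm E w * (nrm E (z - u) + nrm E w)" .
  have 2: "nrm F (real n *\<^sub>R q - A w) \<le> e" using t(3)[OF t0] by (simp add: q_def v_def e'_def t_def)
  have As: "A w \<in> sp F" by (rule bounded_linear_onD(1)[OF strict_derivD(2)[OF A] ws])
  have "nrm F (f y - f z - A w) \<le> nrm F (f y - f z - real n *\<^sub>R q) + nrm F (real n *\<^sub>R q - A w)"
    using b As qs by (intro nrm_triangle_via nspace_closed F tameD(1)[OF f])
  then show "nrm F (f y - f z - A (y - z)) \<le>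
      M * nrm E (y - z) * (nrm E (z - u) + nrm E (y - z)) + e"
    using 1 2 by (simp add: w_def)
qed

section \<open>The two-norm estimate\<close>

text \<open>
  If \<open>L\<close> is bounded by \<open>c\<close> on vectors that approximate those of a ball up to half their
  norm, then the error term is absorbed by the (finite) norm of \<open>L\<close> itself.
\<close>

lemma bound_absorb:
  assumes E: "normed_space E" and F: "normed_space F" and L: "bounded_linear_on E F L"
    and d: "d > 0" and c: "c \<ge> 0"
    and approx: "\<And>w. w \<in> sp E \<Longrightarrow> nrm E w < d \<Longrightarrow>
      \<exists>e\<in>sp E. nrm E e \<le> nrm E w / 2 \<and> nrm F (L (w + e)) \<le> c"
    and w: "w \<in> sp E"
  shows "nrm F (L w) \<le> 4 * c / d * nrm E w"
proof -
  obtain a where a: "a > 0" "\<And>x. x \<in> sp E \<Longrightarrow> nrm F (L x) \<le> a * nrm E x"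
    using bounded_linear_on_bound[OF L E] by blast
  have step: "nrm F (L x) \<le> (2 * c / d + b / 2) * nrm E x"
    if b: "\<And>x. x \<in> sp E \<Longrightarrow> nrm F (L x) \<le> b * nrm E x" "b \<ge> 0" and x: "x \<in> sp E" for b x
  proof (cases "x = 0")
    case True
    then show ?thesis using bounded_linear_on_0[OF L E] by (simp add: nrm_zero E F)
  next
    case False
    then have n: "nrm E x > 0" using nrm_nonneg[OF E x] nrm_eq_0[OF E x] by simp
    define s where "s = d / 2 / nrm E x"
    have s: "s > 0" using d n by (simp add: s_def)
    have sx: "s *\<^sub>R x \<in> sp E" "nrm E (s *\<^sub>R x) = d / 2"
      using x E s n d by (auto simp: nrm_scale nspace_closed s_def)
    obtain e where e: "e \<in> sp E" "nrm E e \<le> d / 4" "nrm F (L (s *\<^sub>R x + e)) \<le> c"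
      using approx[OF sx(1)] sx(2) d by auto
    have Ls: "L (s *\<^sub>R x + e) \<in> sp F" "L e \<in> sp F" "L x \<in> sp F"
      using e sx x E by (auto intro!: bounded_linear_onD(1)[OF L] nspace_closed)
    have eq: "s *\<^sub>R L x = L (s *\<^sub>R x + e) - L e"
      using bounded_linear_onD(2)[OF L sx(1) e(1)] bounded_linear_onD(3)[OF L x] by simp
    have "s * nrm F (L x) = nrm F (s *\<^sub>R L x)" using Ls F s by (simp add: nrm_scale)
    also have "\<dots> \<le> nrm F (L (s *\<^sub>R x + e)) + nrm F (L e)"
      unfolding eq using Ls by (intro nrm_triangle_diff F)
    also have "nrm F (L e) \<le> b * nrm E e" by (rule b(1)[OF e(1)])
    also have "\<dots> \<le> b * (d / 4)" using e b by (intro mult_left_mono) auto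
    finally have "s * nrm F (L x) \<le> c + b * (d / 4)" using e by simp
    then show ?thesis using n d by (simp add: s_def field_simps)
  qed
  have iter: "nrm F (L x) \<le> (4 * c / d + a / 2 ^ n) * nrm E x" if "x \<in> sp E" for n x
    using that
  proof (induction n arbitrary: x)
    case 0
    have "a * nrm E x \<le> (4 * c / d + a) * nrm E x"
      using c d by (intro mult_right_mono nrm_nonneg[OF E 0]) auto
    then show ?case using a(2)[OF 0] by simp
  next
    case (Suc n)
    have "nrm F (L x) \<le> (2 * c / d + (4 * c / d + a / 2 ^ n) / 2) * nrm E x"
      using Suc c d a by (intro step) auto
    also have "2 * c / d + (4 * c / d + a / 2 ^ n) / 2 = 4 * c / d + a / 2 ^ Suc n"
      by (simp add: field_simps)
    finally show ?case .
  qed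
  have lim: "(\<lambda>n. (4 * c / d + a * (1 / 2) ^ n) * nrm E w) \<longlonglongrightarrow> (4 * c / d + a * 0) * nrm E w"
    by (intro tendsto_intros LIMSEQ_power_zero) auto
  have "nrm F (L w) \<le> (4 * c / d + a * (1 / 2) ^ n) * nrm E w" for n
    using iter[OF w, of n] by (simp add: power_divide)
  then have "nrm F (L w) \<le> (4 * c / d + a * 0) * nrm E w"
    by (intro LIMSEQ_le_const[OF lim]) simp
  then show ?thesis by simp
qed

text \<open>
  A local action, read in a chart around \<open>p\<close>: \<open>E1\<close> and \<open>E0\<close> carry the strong and the weak norm,
  and \<open>len\<close> measures the distance from the identity of the group. The maps \<open>F g\<close> are uniformly
  tame for both norms, while in \<open>g\<close> only the orbit maps are controlled, with constants that may
  depend on the point.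
\<close>

locale two_norm_action = group G
  for G :: "'g monoid" (structure) +
  fixes E0 E1 :: "'e::real_vector nspace" and len :: "'g \<Rightarrow> real" and F :: "'g \<Rightarrow> 'e \<Rightarrow> 'e"
    and p :: 'e and \<rho> M C \<eta> :: real
  assumes E0: "normed_space E0" and E1: "banach_space E1"
    and incl: "\<And>x. x \<in> sp E1 \<Longrightarrow> x \<in> sp E0 \<and> nrm E0 x \<le> C * nrm E1 x"
    and p1: "p \<in> sp E1" and \<rho>: "\<rho> > 0" and M: "M \<ge> 1" and C: "C \<ge> 1" and \<eta>: "\<eta> > 0"
    and len_nonneg: "\<And>g. g \<in> carrier G \<Longrightarrow> 0 \<le> len g"
    and len_eq_0: "\<And>g. g \<in> carrier G \<Longrightarrow> len g = 0 \<longleftrightarrow> g = \<one>"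
    and len_mult: "\<And>g h. g \<in> carrier G \<Longrightarrow> h \<in> carrier G \<Longrightarrow> len g < \<eta> \<Longrightarrow> len h < \<eta> \<Longrightarrow>
      len (g \<otimes> h) \<le> len h + 2 * len g"
    and len_inv: "\<And>g. g \<in> carrier G \<Longrightarrow> len g < \<eta> \<Longrightarrow> len (inv g) \<le> 2 * len g"
    and F_one: "\<And>x. x \<in> nball E0 p \<rho> \<Longrightarrow> F \<one> x = x"
    and F_mult: "\<And>g h x. g \<in> carrier G \<Longrightarrow> h \<in> carrier G \<Longrightarrow> len h < \<eta> \<Longrightarrow> x \<in> nball E0 p \<rho> \<Longrightarrow>
      F g (F h x) = F (g \<otimes> h) x"
    and tame_F: "\<And>E g. E \<in> {E0, E1} \<Longrightarrow> g \<in> carrier G \<Longrightarrow> len g < \<eta> \<Longrightarrow> tame E E (F g) p \<rho> M"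
    and deriv_F: "\<And>E g x. E \<in> {E0, E1} \<Longrightarrow> g \<in> carrier G \<Longrightarrow> len g < \<eta> \<Longrightarrow> x \<in> nball E p \<rho> \<Longrightarrow>
      \<exists>T. strict_deriv E E (F g) T x"
    and orbit_continuous: "\<And>\<epsilon>. \<epsilon> > 0 \<Longrightarrow> \<exists>\<delta>>0. \<forall>g\<in>carrier G. len g < \<delta> \<longrightarrow> F g p \<in> nball E1 p \<epsilon>"
    and orbit_Lipschitz: "\<And>x. x \<in> nball E1 p \<rho> \<Longrightarrow>
      \<exists>m \<delta>. \<delta> > 0 \<and> (\<forall>g\<in>carrier G. len g < \<delta> \<longrightarrow> nrm E0 (F g x - x) \<le> m * len g)"

begin

definition V where "V = {g \<in> carrier G. len g < \<eta>}"

definition T where "T g x = (SOME T. strict_deriv E0 E0 (F g) T x)"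

lemma V_D: "g \<in> V \<Longrightarrow> g \<in> carrier G" "g \<in> V \<Longrightarrow> len g < \<eta>"
  by (auto simp: V_def)

lemma nE1: "normed_space E1"
  using E1 by (simp add: banach_space_def)

lemma nE: "E \<in> {E0, E1} \<Longrightarrow> normed_space E"
  using E0 nE1 by auto

lemma pE: "E \<in> {E0, E1} \<Longrightarrow> p \<in> sp E"
  using p1 incl by auto

lemma p_ball: "E \<in> {E0, E1} \<Longrightarrow> p \<in> nball E p \<rho>"
  by (rule center_in_nball[OF nE pE \<rho>])

lemma one_V: "\<one> \<in> V"
  using \<eta> len_eq_0[OF one_closed] by (simp add: V_def)

lemma tame_V: "E \<in> {E0, E1} \<Longrightarrow> g \<in> V \<Longrightarrow> tame E E (F g) p \<rho> M"
  using tame_F by (auto simp: V_def)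

lemma T_strict0: "g \<in> V \<Longrightarrow> x \<in> nball E0 p \<rho> \<Longrightarrow> strict_deriv E0 E0 (F g) (T g x) x"
  unfolding T_def using someI_ex[OF deriv_F[of E0 g x]] V_D[of g] by simp

text \<open>
  Both norms share the operator \<open>T g x\<close>: a directional limit for the stronger norm is also one for
  the weaker norm, and such limits determine the derivative.
\<close>

lemma T_strict:
  assumes E: "E \<in> {E0, E1}" and g: "g \<in> V" and x: "x \<in> nball E0 p \<rho>" "x \<in> nball E p \<rho>"
  shows "strict_deriv E E (F g) (T g x) x"
proof -
  obtain A where A: "strict_deriv E E (F g) A x" using deriv_F[OF E V_D[OF g] x(2)] by blast
  have inc: "v \<in> sp E0 \<and> nrm E0 v \<le> C * nrm E v" if "v \<in> sp E" for v
  proof (cases "E = E0")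
    case True
    then have "1 * nrm E0 v \<le> C * nrm E0 v"
      using that C by (intro mult_right_mono nrm_nonneg E0) auto
    then show ?thesis using that True by simp
  qed (use that E incl in auto)
  have "A h = T g x h" if h: "h \<in> sp E" for h
    using strict_deriv_unique_weaker[where C = C,
        OF T_strict0[OF g x(1)] A E0 E0 nE[OF E] nE[OF E] inc conjunct1[OF inc[OF h]] h] by simp
  then show ?thesis by (rule strict_deriv_cong[OF A _ nE[OF E]])
qed

lemma T_linear:
  assumes "E \<in> {E0, E1}" "g \<in> V" "x \<in> nball E0 p \<rho>" "x \<in> nball E p \<rho>"
  shows "bounded_linear_on E E (T g x)"
  using T_strict[OF assms] by (rule strict_derivD)

lemma T_sp:
  assumes "E \<in> {E0, E1}" "g \<in> V" "x \<in> nball E0 p \<rho>" "x \<in> nball E p \<rho>" "h \<in> sp E"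
  shows "T g x h \<in> sp E"
  by (rule bounded_linear_onD(1)[OF T_linear[OF assms(1-4)] assms(5)])

lemma T_bound:
  assumes E: "E \<in> {E0, E1}" and g: "g \<in> V" and x: "x \<in> nball E0 p \<rho>" "x \<in> nball E p \<rho>"
    and h: "h \<in> sp E"
  shows "nrm E (T g x h) \<le> M * nrm E h"
  by (rule tame_deriv_bound[OF tame_V[OF E g] T_strict[OF E g x] x(2) nE[OF E] nE[OF E] pE[OF E] h])

lemma T_Lipschitz:
  assumes g: "g \<in> V" and x: "x \<in> nball E0 p \<rho>" "y \<in> nball E0 p \<rho>" and h: "h \<in> sp E0"
  shows "nrm E0 (T g x h - T g y h) \<le> M * nrm E0 (x - y) * nrm E0 h"
  by (rule tame_deriv_Lipschitz[OF tame_V[OF _ g] T_strict0[OF g x(1)] T_strict0[OF g x(2)] x E0 E0 pE h])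
    auto

lemma T_remainder:
  assumes E: "E \<in> {E0, E1}" and g: "g \<in> V"
    and b: "p + z \<in> nball E p \<rho>" "p + w \<in> nball E p \<rho>"
  shows "nrm E (F g (p + z) - F g (p + w) - T g p (z - w)) \<le>
    M * nrm E (z - w) * (nrm E w + nrm E (z - w))"
proof -
  have pb: "p \<in> nball E0 p \<rho>" "p \<in> nball E p \<rho>" using p_ball[of E0] p_ball[OF E] by auto
  show ?thesis
    using tame_remainder[OF tame_V[OF E g] T_strict[OF E g pb] b pb(2) nE[OF E] nE[OF E] pE[OF E]] M
    by simp
qed

text \<open>The cocycle identity of the derivatives.\<close>

lemma T_chain:
  assumes g: "g \<in> V" and h: "h \<in> V" and gh: "g \<otimes> h \<in> V"
    and x: "x \<in> nball E0 p \<rho>" "F h x \<in> nball E0 p \<rho>" and v: "v \<in> sp E0"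
  shows "T g (F h x) (T h x v) = T (g \<otimes> h) x v"
proof -
  have xs: "x \<in> sp E0" using x by (simp add: nball_def)
  have 1: "strict_deriv E0 E0 (\<lambda>y. F g (F h y)) (\<lambda>v. T g (F h x) (T h x v)) x"
    by (rule strict_deriv_compose[OF T_strict0[OF h x(1)] T_strict0[OF g x(2)] E0 E0 E0])
  obtain r where r: "r > 0" "nball E0 x r \<subseteq> nball E0 p \<rho>"
    using nball_in_nball[OF E0 pE x(1)] by auto
  have "strict_deriv E0 E0 (F (g \<otimes> h)) (\<lambda>v. T g (F h x) (T h x v)) x"
    by (rule strict_deriv_transfer[OF 1 r(1)]) (use r g h in \<open>auto intro!: F_mult dest: V_D\<close>)
  then show ?thesis
    using strict_deriv_unique[OF _ T_strict0[OF gh x(1)] E0 E0 v] by metis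
qed

lemma T_one:
  assumes x: "x \<in> nball E0 p \<rho>" and v: "v \<in> sp E0"
  shows "T \<one> x v = v"
proof -
  obtain r where r: "r > 0" "nball E0 x r \<subseteq> nball E0 p \<rho>"
    using nball_in_nball[OF E0 pE x(1)] by auto
  have "strict_deriv E0 E0 (F \<one>) (\<lambda>h. h) x"
    by (rule strict_deriv_transfer[OF strict_deriv_id[OF E0] r(1)]) (use r x F_one in \<open>auto simp: nball_def subset_iff\<close>)
  then show ?thesis
    using strict_deriv_unique[OF _ T_strict0[OF one_V x] E0 E0 v] by metis
qed

text \<open>The first \<open>N\<close> powers of \<open>g\<close> and their inverses stay in the region where the bounds are available.\<close>

definition stays_near where
  "stays_near g N \<longleftrightarrow> g \<in> carrier G \<and> 1 \<le> N \<and> (\<forall>k\<le>N. g [^] k \<in> V \<and> inv (g [^] k) \<in> V \<and>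
     F (g [^] k) p \<in> nball E0 p (\<rho> / 2) \<and> F (g [^] k) p \<in> nball E1 p \<rho>)" for N :: nat

lemma stays_nearD:
  assumes "stays_near g N" "k \<le> N"
  shows "g \<in> carrier G" "g [^] k \<in> V" "inv (g [^] k) \<in> V" "F (g [^] k) p \<in> nball E0 p \<rho>"
    "E \<in> {E0, E1} \<Longrightarrow> F (g [^] k) p \<in> nball E p \<rho>"
  using assms \<rho> unfolding stays_near_def by (auto simp: nball_def)

lemma stays_near_pos: "stays_near g N \<Longrightarrow> N > 0"
  unfolding stays_near_def by linarith

definition S where "S g k = T (inv (g [^] k)) (F (g [^] k) p)" for k :: nat

text \<open>The map \<open>F (g [^] k)\<close> at \<open>p\<close>, normalized to fix \<open>0\<close> and to have derivative \<open>id\<close> there.\<close>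

definition normalized where
  "normalized g k z = S g k (F (g [^] k) (p + z) - F (g [^] k) p)" for k :: nat

definition average where
  "average g N z = (1 / real N) *\<^sub>R (\<Sum>k<N. normalized g k z)" for N :: nat

lemma S_linear: "E \<in> {E0, E1} \<Longrightarrow> stays_near g N \<Longrightarrow> k \<le> N \<Longrightarrow> bounded_linear_on E E (S g k)"
  unfolding S_def by (intro T_linear stays_nearD)

lemma S_bound: "E \<in> {E0, E1} \<Longrightarrow> stays_near g N \<Longrightarrow> k \<le> N \<Longrightarrow> h \<in> sp E \<Longrightarrow> nrm E (S g k h) \<le> M * nrm E h"
  unfolding S_def by (intro T_bound stays_nearD)

lemma S_T:
  assumes "stays_near g N" "k \<le> N" "v \<in> sp E0"
  shows "S g k (T (g [^] k) p v) = v"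
proof -
  have c: "g [^] k \<in> carrier G" using stays_nearD(1)[OF assms(1,2)] by simp
  have "T (inv (g [^] k)) (F (g [^] k) p) (T (g [^] k) p v) = T (inv (g [^] k) \<otimes> g [^] k) p v"
    using c one_V by (intro T_chain stays_nearD[OF assms(1,2)] p_ball assms(3)) auto
  then show ?thesis using c T_one[OF p_ball assms(3)] by (simp add: S_def)
qed

lemma F_sp: "E \<in> {E0, E1} \<Longrightarrow> g \<in> V \<Longrightarrow> x \<in> nball E p \<rho> \<Longrightarrow> F g x \<in> sp E"
  using tameD(1)[OF tame_V] .

lemma normalized_sp:
  assumes "E \<in> {E0, E1}" "stays_near g N" "k \<le> N" "p + z \<in> nball E p \<rho>"
  shows "normalized g k z \<in> sp E"
  unfolding normalized_def using assms
  by (intro bounded_linear_onD(1)[OF S_linear[of E g N k]] nspace_diff nE F_sp p_ball stays_nearD[of g N k]) auto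

text \<open>
  The difference from the identity is quadratic, uniformly in \<open>k\<close> and \<open>g\<close>, by the bound on second
  differences.
\<close>

lemma normalized_near_id:
  assumes E: "E \<in> {E0, E1}" and g: "stays_near g N" "k \<le> N"
    and b: "p + z \<in> nball E p \<rho>" "p + w \<in> nball E p \<rho>" and zw: "z \<in> sp E" "w \<in> sp E"
  shows "nrm E (normalized g k z - normalized g k w - (z - w)) \<le>
    M * M * nrm E (z - w) * (nrm E w + nrm E (z - w))"
proof -
  note gk = stays_nearD[OF g]
  define A R where "A = T (g [^] k) p (z - w)" and "R = F (g [^] k) (p + z) - F (g [^] k) (p + w) - A"
  have S: "bounded_linear_on E E (S g k)" by (rule S_linear[OF E g])
  have zws: "z - w \<in> sp E" "z - w \<in> sp E0" using zw E nE[OF E] incl E0 by (auto intro: nspace_closed)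
  have As: "A \<in> sp E" unfolding A_def by (intro T_sp E gk p_ball zws) auto
  have Fs: "F (g [^] k) (p + z) \<in> sp E" "F (g [^] k) (p + w) \<in> sp E" "F (g [^] k) p \<in> sp E"
    using b by (auto intro: F_sp[OF E gk(2)] p_ball[OF E])
  have Rs: "R \<in> sp E" unfolding R_def using Fs As nE[OF E] by (intro nspace_closed)
  have "normalized g k z - normalized g k w =
      S g k ((F (g [^] k) (p + z) - F (g [^] k) p) - (F (g [^] k) (p + w) - F (g [^] k) p))"
    unfolding normalized_def using Fs nE[OF E]
    by (simp add: bounded_linear_on_diff[OF S nE[OF E]] nspace_closed del: diff_diff_eq2)
  also have "\<dots> = S g k (R + A)" by (simp add: R_def)
  also have "\<dots> = S g k R + (z - w)"
    using bounded_linear_onD(2)[OF S Rs As] S_T[OF g zws(2)] by (simp add: A_def)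
  finally have "nrm E (normalized g k z - normalized g k w - (z - w)) = nrm E (S g k R)" by simp
  also have "\<dots> \<le> M * nrm E R" by (rule S_bound[OF E g Rs])
  also have "\<dots> \<le> M * (M * nrm E (z - w) * (nrm E w + nrm E (z - w)))"
    unfolding R_def A_def using M by (intro mult_left_mono T_remainder E gk b) auto
  finally show ?thesis by (simp add: mult.assoc)
qed

lemma normalized_bound:
  assumes E: "E \<in> {E0, E1}" and g: "stays_near g N" "k \<le> N" and b: "p + z \<in> nball E p \<rho>"
  shows "nrm E (normalized g k z) \<le> M * M * nrm E z"
proof -
  note gk = stays_nearD[OF g]
  have Fs: "F (g [^] k) (p + z) \<in> sp E" "F (g [^] k) p \<in> sp E"
    using b by (auto intro: F_sp[OF E gk(2)] p_ball[OF E])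
  have "nrm E (normalized g k z) \<le> M * nrm E (F (g [^] k) (p + z) - F (g [^] k) p)"
    unfolding normalized_def using Fs nE[OF E] by (intro S_bound[OF E g] nspace_closed)
  also have "\<dots> \<le> M * (M * nrm E (p + z - p))"
    using M b by (intro mult_left_mono tameD(2)[OF tame_V[OF E gk(2)]] p_ball E) auto
  finally show ?thesis by (simp add: mult.assoc)
qed

text \<open>
  Transport by \<open>g\<close> turns the normalized map of \<open>g [^] Suc k\<close> at \<open>p\<close> into the normalized map of
  \<open>g [^] k\<close> at \<open>F g p\<close>, which differs from the one at \<open>p\<close> by a multiple of the distance of the two
  base points.
\<close>

lemma normalized_shift:
  assumes g: "stays_near g N" and k: "k < N" and z: "z \<in> sp E0" and z': "z' = F g (p + z) - F g p"
    and small: "M * nrm E0 z < \<rho> / 2"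
  shows "nrm E0 (T g p (normalized g (Suc k) z) - normalized g k z') \<le>
    2 * M ^ 4 * nrm E0 (F g p - p) * nrm E0 z"
proof -
  have k1: "k \<le> N" "Suc k \<le> N" "1 \<le> N" using k by auto
  note gk = stays_nearD[OF g k1(1)] and gsk = stays_nearD[OF g k1(2)]
  have g1: "g \<in> V" "F g p \<in> nball E0 p (\<rho> / 2)"
    using g gk(1) unfolding stays_near_def by (auto dest!: spec[of _ "1::nat"])
  have E: "E0 \<in> {E0, E1}" by simp
  have M0: "M > 0" using M by simp
  have p0: "p \<in> sp E0" by (rule pE[OF E])
  have nz: "nrm E0 z \<le> M * nrm E0 z" using M nrm_nonneg[OF E0 z] by (simp add: mult_right_le_one_le mult_le_cancel_right1)
  have pz: "p + z \<in> nball E0 p \<rho>"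
    using nz small z p0 E0 \<rho> by (auto simp: nball_def nspace_closed)
  have pgp: "F g p \<in> nball E0 p \<rho>" using g1(2) \<rho> by (auto simp: nball_def)
  have Fs: "F g (p + z) \<in> sp E0" "F g p \<in> sp E0" using pz by (auto intro: F_sp[OF E g1(1)] p_ball[OF E])
  have z's: "z' \<in> sp E0" unfolding z' using Fs E0 by (intro nspace_closed)
  have nz': "nrm E0 z' \<le> M * nrm E0 z"
    using tameD(2)[OF tame_V[OF E g1(1)] pz p_ball[OF E]] by (simp add: z')
  have pz': "p + z' \<in> nball E0 p \<rho>"
    using nz' small z's p0 E0 \<rho> by (auto simp: nball_def nspace_closed)
  have q: "F g (p + z) \<in> nball E0 p \<rho>"
  proof -
    have "nrm E0 (F g (p + z) - p) \<le> nrm E0 (F g (p + z) - F g p) + nrm E0 (F g p - p)"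
      using Fs p0 by (intro nrm_triangle_via E0)
    then show ?thesis using nz' small g1(2) Fs by (auto simp: nball_def z')
  qed
  have cg: "g [^] k \<in> carrier G" "g \<in> carrier G" using gk by auto
  define a where "a j = F (g [^] j) p" for j :: nat
  have aS: "F (g [^] k) (F g p) = a (Suc k)"
    using F_mult[OF cg(1,2) V_D(2)[OF g1(1)] p_ball[OF E]] by (simp add: a_def)
  have FS: "F (g [^] k) (F g (p + z)) = F (g [^] Suc k) (p + z)"
    using F_mult[OF cg(1,2) V_D(2)[OF g1(1)] pz] by simp
  define i where "i = inv (g [^] k)"
  have iV: "i \<in> V" using gk by (simp add: i_def)
  have gi: "g \<otimes> inv (g [^] Suc k) = i"
    using cg by (simp add: i_def inv_mult_group m_assoc[symmetric])
  define y where "y = F (g [^] Suc k) (p + z) - a (Suc k)"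
  have ys: "y \<in> sp E0"
    unfolding y_def a_def by (intro nspace_diff E0 F_sp[OF E gsk(2)] pz p_ball[OF E])
  have inv_a: "F (inv (g [^] Suc k)) (a (Suc k)) = p"
    using F_mult[of "inv (g [^] Suc k)" "g [^] Suc k" p] cg V_D(2)[OF gsk(2)] p_ball[OF E] F_one[OF p_ball[OF E]]
    by (simp add: a_def l_inv del: nat_pow_Suc)
  have "T g p (normalized g (Suc k) z) = T g (F (inv (g [^] Suc k)) (a (Suc k))) (T (inv (g [^] Suc k)) (a (Suc k)) y)"
    unfolding inv_a by (simp add: normalized_def S_def y_def a_def)
  also have "\<dots> = T (g \<otimes> inv (g [^] Suc k)) (a (Suc k)) y"
  proof (rule T_chain[OF g1(1) gsk(3) _ _ _ ys])
    show "g \<otimes> inv (g [^] Suc k) \<in> V" unfolding gi by (rule iV)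
    show "a (Suc k) \<in> nball E0 p \<rho>" unfolding a_def by (rule gsk)
    show "F (inv (g [^] Suc k)) (a (Suc k)) \<in> nball E0 p \<rho>" unfolding inv_a by (rule p_ball[OF E])
  qed
  finally have 1: "T g p (normalized g (Suc k) z) = T i (a (Suc k)) y" unfolding gi .
  define y' where "y' = F (g [^] k) (p + z') - F (g [^] k) p"
  have y's: "y' \<in> sp E0"
    unfolding y'_def by (intro nspace_diff E0 F_sp[OF E gk(2)] pz' p_ball[OF E])
  have 2: "normalized g k z' = T i (a k) y'" by (simp add: normalized_def S_def y'_def a_def i_def)
  have ab: "a (Suc k) \<in> nball E0 p \<rho>" "a k \<in> nball E0 p \<rho>" unfolding a_def by (rule gsk gk)+
  define u where "u = F g p - p"
  have us: "u \<in> sp E0" unfolding u_def using Fs p0 E0 by (intro nspace_closed)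
  have yy': "nrm E0 (y - y') \<le> M * nrm E0 u * nrm E0 z'"
  proof -
    have eq: "p + u = F g p" "F g p + z' = F g (p + z)" by (simp_all add: u_def z')
    have "nrm E0 (F (g [^] k) (p + u + z') - F (g [^] k) (p + u) - (F (g [^] k) (p + z') - F (g [^] k) p))
        \<le> M * nrm E0 u * nrm E0 z'"
      by (rule tameD(3)[OF tame_V[OF E gk(2)] us z's p_ball[OF E]]; (unfold eq)?; rule pgp pz' q)
    then show ?thesis unfolding eq y_def y'_def aS FS .
  qed
  have ny': "nrm E0 y' \<le> M * nrm E0 z'"
    using tameD(2)[OF tame_V[OF E gk(2)] pz' p_ball[OF E]] by (simp add: y'_def)
  have na: "nrm E0 (a (Suc k) - a k) \<le> M * nrm E0 u"
    using tameD(2)[OF tame_V[OF E gk(2)] pgp p_ball[OF E]] unfolding aS u_def a_def .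
  have Ts: "T i (a (Suc k)) y \<in> sp E0" "T i (a (Suc k)) y' \<in> sp E0" "T i (a k) y' \<in> sp E0"
    by (intro T_sp[OF E iV] ab ys y's)+
  have lin: "bounded_linear_on E0 E0 (T i (a (Suc k)))" by (intro T_linear[OF E iV] ab)
  have n0: "0 \<le> nrm E0 u" "0 \<le> nrm E0 z'" "0 \<le> nrm E0 z" using us z's z E0 by (auto intro: nrm_nonneg)
  have "nrm E0 (T i (a (Suc k)) y - T i (a k) y') \<le>
      nrm E0 (T i (a (Suc k)) y - T i (a (Suc k)) y') + nrm E0 (T i (a (Suc k)) y' - T i (a k) y')"
    by (intro nrm_triangle_via E0 Ts)
  also have "T i (a (Suc k)) y - T i (a (Suc k)) y' = T i (a (Suc k)) (y - y')"
    by (simp add: bounded_linear_on_diff[OF lin E0 ys y's])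
  also have "nrm E0 \<dots> \<le> M * nrm E0 (y - y')"
    by (intro T_bound[OF E iV] ab nspace_diff E0 ys y's)
  also have "\<dots> \<le> M * (M * nrm E0 u * nrm E0 z')" using yy' M by (intro mult_left_mono) auto
  also have "nrm E0 (T i (a (Suc k)) y' - T i (a k) y') \<le> M * nrm E0 (a (Suc k) - a k) * nrm E0 y'"
    by (intro T_Lipschitz iV ab y's)
  also have "\<dots> \<le> M * (M * nrm E0 u) * (M * nrm E0 z')"
    using na ny' M n0 nrm_nonneg[OF E0 y's]
    by (intro mult_mono mult_left_mono mult_nonneg_nonneg) auto
  finally have "nrm E0 (T i (a (Suc k)) y - T i (a k) y') \<le> (M ^ 2 + M ^ 3) * (nrm E0 u * nrm E0 z')"
    by (simp add: power2_eq_square power3_eq_cube algebra_simps)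
  also have "\<dots> \<le> (2 * M ^ 3) * (nrm E0 u * (M * nrm E0 z))"
    using M n0 nz' power_increasing[of 2 3 M] by (intro mult_mono) auto
  also have "\<dots> = 2 * M ^ 4 * nrm E0 u * nrm E0 z" by (simp add: power4_eq_xxxx power3_eq_cube)
  finally show ?thesis unfolding 1 2 u_def .
qed

text \<open>
  The average of the normalized maps conjugates \<open>F g\<close> to its derivative at \<open>p\<close> approximately:
  applying the derivative to the average shifts the summation index by one, so that only the first
  and the last summand remain uncompensated, with weight \<open>1 / N\<close>. Shifting the index also moves
  the base point from \<open>p\<close> to \<open>F g p\<close>, which is another error term. The term \<open>nrm E0 (z' - z) / 2\<close>
  comes from the nonlinearity of the normalized maps.
\<close>

lemma average_step:
  assumes g: "stays_near g N" and z: "z \<in> sp E0" and z': "z' = F g (p + z) - F g p"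
    and small: "M * nrm E0 z < \<rho> / 2" "6 * M ^ 3 * nrm E0 z \<le> 1"
  shows "nrm E0 (z' - z - (T g p (average g N z) - average g N z)) \<le>
    nrm E0 (z' - z) / 2 + 2 * M ^ 4 * (nrm E0 (F g p - p) + 1 / real N) * nrm E0 z"
proof -
  have E: "E0 \<in> {E0, E1}" by simp
  have N: "N > 0" by (rule stays_near_pos[OF g])
  have "g [^] (1::nat) \<in> V" using g unfolding stays_near_def by blast
  then have gV: "g \<in> V" using stays_nearD(1)[OF g, of 0] by simp
  have p0: "p \<in> sp E0" by (rule pE[OF E])
  have nz0: "0 \<le> nrm E0 z" by (rule nrm_nonneg[OF E0 z])
  have nz: "nrm E0 z \<le> M * nrm E0 z" using M nz0 by (simp add: mult_le_cancel_right1)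
  have pz: "p + z \<in> nball E0 p \<rho>" using nz small z p0 E0 \<rho> by (auto simp: nball_def nspace_closed)
  have Fs: "F g (p + z) \<in> sp E0" "F g p \<in> sp E0" using pz by (auto intro: F_sp[OF E gV] p_ball[OF E])
  have z's: "z' \<in> sp E0" unfolding z' using Fs E0 by (intro nspace_closed)
  have nz': "nrm E0 z' \<le> M * nrm E0 z"
    using tameD(2)[OF tame_V[OF E gV] pz p_ball[OF E]] by (simp add: z')
  have pz': "p + z' \<in> nball E0 p \<rho>"
    using nz' small z's p0 E0 \<rho> by (auto simp: nball_def nspace_closed)
  have p0b: "p + 0 \<in> nball E0 p \<rho>" using p_ball[OF E] by simp
  define d where "d = z' - z"
  have ds: "d \<in> sp E0" unfolding d_def using z z's E0 by (intro nspace_closed)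
  have nd: "nrm E0 d \<le> 2 * M * nrm E0 z"
    using nrm_triangle_diff[OF E0 z's z] nz nz' by (simp add: d_def)
  define \<phi> where "\<phi> k = normalized g k z" for k
  have \<phi>s: "\<phi> k \<in> sp E0" if "k \<le> N" for k unfolding \<phi>_def by (rule normalized_sp[OF E g that pz])
  have Tlin: "bounded_linear_on E0 E0 (T g p)" by (intro T_linear[OF E gV] p_ball[OF E])
  have Ts: "T g p v \<in> sp E0" if "v \<in> sp E0" for v by (rule bounded_linear_onD(1)[OF Tlin that])
  define B where "B = nrm E0 d / 2 + 2 * M ^ 4 * nrm E0 (F g p - p) * nrm E0 z"
  \<comment> \<open>If the shift of the base point were exact, the \<open>r k\<close> would only contain the nonlinearity of the
    normalized maps.\<close>
  define r where "r k = T g p (\<phi> (Suc k)) - \<phi> k - d" for k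
  have rs: "r k \<in> sp E0" if "k < N" for k
    unfolding r_def using \<phi>s[of k] \<phi>s[of "Suc k"] that Ts ds E0 by (intro nspace_diff) auto
  have rB: "nrm E0 (r k) \<le> B" if k: "k < N" for k
  proof -
    have kN: "k \<le> N" using k by simp
    have zs': "normalized g k z' \<in> sp E0" by (rule normalized_sp[OF E g kN pz'])
    have "r k = (T g p (\<phi> (Suc k)) - normalized g k z') + (normalized g k z' - \<phi> k - d)"
      by (simp add: r_def)
    also have "nrm E0 \<dots> \<le> nrm E0 (T g p (\<phi> (Suc k)) - normalized g k z') + nrm E0 (normalized g k z' - \<phi> k - d)"
      using zs' \<phi>s[of "Suc k"] \<phi>s[OF kN] k ds Ts E0 by (intro nrm_triangle nspace_diff) auto
    also have "nrm E0 (T g p (\<phi> (Suc k)) - normalized g k z') \<le> 2 * M ^ 4 * nrm E0 (F g p - p) * nrm E0 z"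
      unfolding \<phi>_def by (rule normalized_shift[OF g k z z' small(1)])
    also have "nrm E0 (normalized g k z' - \<phi> k - d) \<le> M * M * nrm E0 d * (nrm E0 z + nrm E0 d)"
      unfolding d_def \<phi>_def by (rule normalized_near_id[OF E g kN pz' pz z's z])
    also have "\<dots> \<le> M * M * nrm E0 d * (3 * M * nrm E0 z)"
      using nd nz M nrm_nonneg[OF E0 ds] by (intro mult_left_mono) auto
    also have "\<dots> = nrm E0 d * (6 * M ^ 3 * nrm E0 z) / 2" by (simp add: power3_eq_cube)
    also have "\<dots> \<le> nrm E0 d * 1 / 2"
      using small(2) nrm_nonneg[OF E0 ds] by (intro divide_right_mono mult_left_mono) auto
    finally show ?thesis by (simp add: B_def)
  qed
  define e where "e = T g p (\<phi> N - \<phi> 0)"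
  have \<phi>N: "\<phi> N - \<phi> 0 \<in> sp E0" using \<phi>s[of N] \<phi>s[of 0] E0 by (intro nspace_closed) auto
  have es: "e \<in> sp E0" unfolding e_def by (rule Ts[OF \<phi>N])
  have ne: "nrm E0 e \<le> 2 * M ^ 4 * nrm E0 z"
  proof -
    have "nrm E0 e \<le> M * nrm E0 (\<phi> N - \<phi> 0)" unfolding e_def by (intro T_bound[OF E gV] p_ball[OF E] \<phi>N)
    also have "nrm E0 (\<phi> N - \<phi> 0) \<le> nrm E0 (\<phi> N) + nrm E0 (\<phi> 0)"
      using \<phi>s by (intro nrm_triangle_diff E0) auto
    also have "\<dots> \<le> M * M * nrm E0 z + M * M * nrm E0 z"
      unfolding \<phi>_def by (intro add_mono normalized_bound[OF E g _ pz]) auto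
    finally have "nrm E0 e \<le> 2 * M ^ 3 * nrm E0 z"
      using M by (simp add: power3_eq_cube algebra_simps)
    also have "\<dots> \<le> 2 * M ^ 4 * nrm E0 z"
      using M nz0 power_increasing[of 3 4 M] by (intro mult_right_mono) auto
    finally show ?thesis .
  qed
  have sum_s: "(\<Sum>k<N. \<phi> k) \<in> sp E0" using \<phi>s by (intro nspace_sum E0) auto
  have "(\<Sum>k<N. T g p (\<phi> (Suc k))) = T g p (\<Sum>k<N. \<phi> (Suc k))"
    using \<phi>s by (intro bounded_linear_on_sum[OF Tlin E0, symmetric]) auto
  also have "(\<Sum>k<N. \<phi> (Suc k)) = (\<Sum>k<N. \<phi> k) + (\<phi> N - \<phi> 0)"
    using sum_lessThan_telescope[of \<phi> N] by (simp add: sum_subtractf algebra_simps)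
  also have "T g p \<dots> = T g p (\<Sum>k<N. \<phi> k) + e"
    unfolding e_def by (rule bounded_linear_onD(2)[OF Tlin sum_s \<phi>N])
  finally have sumT: "(\<Sum>k<N. T g p (\<phi> (Suc k))) = T g p (\<Sum>k<N. \<phi> k) + e" .
  have "(\<Sum>k<N. r k) = T g p (\<Sum>k<N. \<phi> k) + e - (\<Sum>k<N. \<phi> k) - real N *\<^sub>R d"
    unfolding r_def by (simp add: sum_subtractf sumT sum_constant_scaleR)
  then have "e - (\<Sum>k<N. r k) = real N *\<^sub>R d - (T g p (\<Sum>k<N. \<phi> k) - (\<Sum>k<N. \<phi> k))"
    by simp
  then have "(1 / real N) *\<^sub>R (e - (\<Sum>k<N. r k)) =
      d - ((1 / real N) *\<^sub>R T g p (\<Sum>k<N. \<phi> k) - (1 / real N) *\<^sub>R (\<Sum>k<N. \<phi> k))"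
    using N by (simp add: scaleR_diff_right)
  also have "(1 / real N) *\<^sub>R T g p (\<Sum>k<N. \<phi> k) = T g p (average g N z)"
    by (simp add: average_def \<phi>_def[symmetric] bounded_linear_onD(3)[OF Tlin sum_s])
  also have "(1 / real N) *\<^sub>R (\<Sum>k<N. \<phi> k) = average g N z" by (simp add: average_def \<phi>_def)
  finally have "z' - z - (T g p (average g N z) - average g N z) = (1 / real N) *\<^sub>R (e - (\<Sum>k<N. r k))"
    by (simp add: d_def)
  also have "nrm E0 \<dots> \<le> (1 / real N) * (2 * M ^ 4 * nrm E0 z + real N * B)"
  proof (rule nrm_scale_le[OF E0])
    have rsum: "(\<Sum>k<N. r k) \<in> sp E0" using rs by (intro nspace_sum E0) auto
    show "e - (\<Sum>k<N. r k) \<in> sp E0" using es rsum by (intro nspace_diff E0)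
    have "nrm E0 (\<Sum>k<N. r k) \<le> (\<Sum>k<N. B)" using rs rB by (intro nrm_sum_le E0) auto
    then show "nrm E0 (e - (\<Sum>k<N. r k)) \<le> 2 * M ^ 4 * nrm E0 z + real N * B"
      using nrm_triangle_diff[OF E0 es rsum] ne by simp
  qed simp
  also have "\<dots> = nrm E0 d / 2 + 2 * M ^ 4 * (nrm E0 (F g p - p) + 1 / real N) * nrm E0 z"
    using N by (simp add: B_def field_simps)
  finally show ?thesis by (simp add: d_def)
qed

text \<open>
  The smallness condition is independent of \<open>g\<close> and \<open>N\<close>; this is why averages over a number of
  steps that grows like \<open>1 / len g\<close> can be used.
\<close>

lemma average_near_id:
  assumes g: "stays_near g N" and zw: "z \<in> sp E1" "w \<in> sp E1"
    and b: "nrm E1 z < \<rho>" "nrm E1 w < \<rho>"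
    and small: "6 * M ^ 3 * nrm E1 z \<le> 1" "6 * M ^ 3 * nrm E1 w \<le> 1"
  shows "average g N z \<in> sp E1"
    and "nrm E1 (average g N z - average g N w - (z - w)) \<le> nrm E1 (z - w) / 2"
proof -
  have E: "E1 \<in> {E0, E1}" by simp
  note n1 = nE[OF E]
  have N: "N > 0" by (rule stays_near_pos[OF g])
  have pb: "p + z \<in> nball E1 p \<rho>" "p + w \<in> nball E1 p \<rho>"
    using zw b n1 p1 by (auto simp: nball_def nspace_closed)
  have sps: "normalized g k z \<in> sp E1" "normalized g k w \<in> sp E1" if "k < N" for k
    using that by (auto intro: normalized_sp[OF E g _ pb(1)] normalized_sp[OF E g _ pb(2)])
  show "average g N z \<in> sp E1"
    unfolding average_def using sps by (intro nspace_scale nspace_sum n1) auto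
  have zws: "z - w \<in> sp E1" using zw n1 by (intro nspace_closed)
  define r where "r k = normalized g k z - normalized g k w - (z - w)" for k
  have rs: "r k \<in> sp E1" if "k < N" for k
    unfolding r_def by (intro nspace_diff[OF n1 nspace_diff[OF n1] zws] sps that)
  have rB: "nrm E1 (r k) \<le> nrm E1 (z - w) / 2" if k: "k < N" for k
  proof -
    have "nrm E1 (r k) \<le> M * M * nrm E1 (z - w) * (nrm E1 w + nrm E1 (z - w))"
      unfolding r_def using k by (intro normalized_near_id[OF E g _ pb] zw) auto
    also have "\<dots> \<le> M * M * nrm E1 (z - w) * (1 / (2 * (M * M)))"
    proof (rule mult_left_mono)
      have "6 * (M * M) * nrm E1 v \<le> 1" if "v \<in> sp E1" "6 * M ^ 3 * nrm E1 v \<le> 1" for v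
      proof -
        have "6 * (M * M) * 1 * nrm E1 v \<le> 6 * (M * M) * M * nrm E1 v"
          using M that nrm_nonneg[OF n1] by (intro mult_right_mono mult_left_mono) auto
        then show ?thesis using that by (simp add: power3_eq_cube mult.assoc)
      qed
      then have "6 * (M * M) * nrm E1 z \<le> 1" "6 * (M * M) * nrm E1 w \<le> 1" using zw small by auto
      moreover have "6 * (M * M) * nrm E1 (z - w) \<le> 6 * (M * M) * (nrm E1 z + nrm E1 w)"
        using M by (intro mult_left_mono nrm_triangle_diff n1 zw) auto
      ultimately have "6 * (M * M) * (nrm E1 w + nrm E1 (z - w)) \<le> 3"
        by (simp add: distrib_left)
      then show "nrm E1 w + nrm E1 (z - w) \<le> 1 / (2 * (M * M))"
        using M by (simp add: field_simps)
    qed (use M nrm_nonneg[OF n1 zws] in auto)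
    also have "\<dots> = nrm E1 (z - w) / 2" using M by simp
    finally show ?thesis .
  qed
  define v where "v = z - w"
  have "(\<Sum>k<N. r k) = (\<Sum>k<N. normalized g k z) - (\<Sum>k<N. normalized g k w) - real N *\<^sub>R v"
    unfolding r_def v_def[symmetric] by (simp add: sum_subtractf sum_constant_scaleR)
  then have "average g N z - average g N w - (z - w) = (1 / real N) *\<^sub>R (\<Sum>k<N. r k)"
    using N unfolding average_def v_def[symmetric] by (simp add: scaleR_diff_right)
  also have "nrm E1 \<dots> \<le> (1 / real N) * (\<Sum>k<N. nrm E1 (z - w) / 2)"
    using rs rB by (intro nrm_scale_le nrm_sum_le nspace_sum n1) auto
  also have "\<dots> = nrm E1 (z - w) / 2" using N by simp
  finally show "nrm E1 (average g N z - average g N w - (z - w)) \<le> nrm E1 (z - w) / 2" .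
qed

lemma average_0:
  assumes "stays_near g N"
  shows "average g N 0 = 0"
proof -
  have "normalized g k 0 = 0" if "k < N" for k
    using bounded_linear_on_0[OF S_linear[of E0 g N k] E0] assms that
    by (simp add: normalized_def)
  then show ?thesis by (simp add: average_def)
qed

text \<open>
  An element of length \<open>len g\<close> can be iterated about \<open>1 / len g\<close> times before its powers
  leave a given neighbourhood of the identity.
\<close>

lemma stays_near_exists:
  obtains \<delta> c where "\<delta> > 0" "c > 0"
    "\<forall>g\<in>carrier G. g \<noteq> \<one> \<and> len g < \<delta> \<longrightarrow> (\<exists>N. stays_near g N \<and> 1 / real N \<le> c * len g)"
proof -
  have "min \<rho> (\<rho> / (2 * C)) > 0" using \<rho> C by simp
  then obtain \<delta> where d: "\<delta> > 0" "\<And>g. g \<in> carrier G \<Longrightarrow> len g < \<delta> \<Longrightarrow> F g p \<in> nball E1 p (min \<rho> (\<rho> / (2 * C)))"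
    using orbit_continuous by metis
  define \<mu> where "\<mu> = min \<delta> (\<eta> / 2)"
  have \<mu>: "\<mu> > 0" "\<mu> \<le> \<delta>" "2 * \<mu> \<le> \<eta>" using d \<eta> by (auto simp: \<mu>_def)
  show ?thesis
  proof (rule that[of "\<mu> / 4" "8 / \<mu>"], goal_cases)
    case 3
    show ?case
    proof (intro ballI impI, elim conjE)
    fix g assume g: "g \<in> carrier G" "g \<noteq> \<one>" "len g < \<mu> / 4"
    have pos: "len g > 0" using g len_nonneg[of g] len_eq_0[of g] by force
    \<comment> \<open>Each factor \<open>g\<close> adds at most \<open>2 * len g\<close>, so that \<open>x\<close> steps lead to a length of at most \<open>\<mu> / 2\<close>;
      inversion at most doubles it.\<close>
    define x where "x = \<mu> / (4 * len g)"
    have x: "x \<ge> 1" using g pos by (simp add: x_def)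
    define N where "N = nat \<lfloor>x\<rfloor>"
    have fl: "1 \<le> \<lfloor>x\<rfloor>" "x < real_of_int \<lfloor>x\<rfloor> + 1" using x by (simp_all add: le_floor_iff)
    have N: "1 \<le> N" "real N \<le> x" "x \<le> 2 * real N" unfolding N_def using x fl by linarith+
    have len_pow: "len (g [^] k) \<le> 2 * real k * len g" if "k \<le> N" for k
      using that
    proof (induction k)
      case 0
      then show ?case using len_eq_0[of \<one>] by simp
    next
      case (Suc k)
      have "2 * real k * len g \<le> 2 * x * len g"
        using Suc N pos by (intro mult_right_mono mult_left_mono) auto
      also have "\<dots> = \<mu> / 2" using pos by (simp add: x_def)
      finally have "len (g [^] k) < \<eta>" using Suc \<mu> by auto
      then have "len (g \<otimes> g [^] k) \<le> len (g [^] k) + 2 * len g"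
        using g \<mu> by (intro len_mult) auto
      then show ?case using Suc g by (simp add: nat_pow_Suc2[symmetric] algebra_simps del: nat_pow_Suc)
    qed
    have "g [^] k \<in> V \<and> inv (g [^] k) \<in> V \<and>
        F (g [^] k) p \<in> nball E0 p (\<rho> / 2) \<and> F (g [^] k) p \<in> nball E1 p \<rho>" if k: "k \<le> N" for k
    proof -
      have c: "g [^] k \<in> carrier G" using g by simp
      have "2 * real k * len g \<le> 2 * x * len g"
        using k N pos by (intro mult_right_mono mult_left_mono) auto
      also have "\<dots> = \<mu> / 2" using pos by (simp add: x_def)
      finally have l: "len (g [^] k) \<le> \<mu> / 2" using len_pow[OF k] by simp
      then have li: "len (inv (g [^] k)) \<le> \<mu>" using len_inv[OF c] \<mu> by simp
      have Fb: "F (g [^] k) p \<in> nball E1 p (min \<rho> (\<rho> / (2 * C)))" using l \<mu> by (intro d(2) c) auto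
      have ds: "F (g [^] k) p - p \<in> sp E1" using Fb p1 nE1 by (auto simp: nball_def nspace_closed)
      have "nrm E0 (F (g [^] k) p - p) \<le> C * nrm E1 (F (g [^] k) p - p)" using incl[OF ds] by simp
      also have "\<dots> < \<rho> / 2" using Fb C by (auto simp: nball_def field_simps)
      finally have "F (g [^] k) p \<in> nball E0 p (\<rho> / 2)" using Fb incl by (auto simp: nball_def)
      then show ?thesis using l li \<mu> c Fb by (auto simp: V_def nball_def)
    qed
    then have "stays_near g N" using g N by (simp add: stays_near_def)
    moreover have "1 / real N \<le> 8 / \<mu> * len g"
      using N pos \<mu> by (simp add: x_def field_simps)
    ultimately show "\<exists>N. stays_near g N \<and> 1 / real N \<le> 8 / \<mu> * len g" by blast
    qed
  qed (use \<mu> in auto)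
qed

text \<open>
  Baire's theorem makes the Lipschitz constant along orbits uniform on some ball. The position of
  this ball cannot be prescribed.
\<close>

lemma orbit_Lipschitz_on_ball:
  assumes r: "0 < r" "r \<le> \<rho>"
  obtains m y d \<delta> where "m \<ge> 0" "\<delta> > 0" "d > 0" "y \<in> nball E1 p r" "nball E1 y d \<subseteq> nball E1 p r"
    "\<forall>x\<in>nball E1 y d. \<forall>g\<in>V. len g < \<delta> \<longrightarrow> nrm E0 (F g x - x) \<le> m * len g"
proof -
  have E: "E1 \<in> {E0, E1}" by simp
  have sub: "x \<in> nball E1 p \<rho>" if "x \<in> nball E1 p r" for x using that r by (auto simp: nball_def)
  define A where "A n = {x. \<forall>g\<in>V. len g < 1 / real (Suc n) \<longrightarrow> nrm E0 (F g x - x) \<le> real n * len g}" for n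
  obtain n y d where n: "d > 0" "y \<in> nball E1 p r" "nball E1 y d \<subseteq> nball E1 p r" "nball E1 y d \<subseteq> A n"
  proof (rule Baire_nball[OF E1 p1 r(1), of A])
    fix x assume x: "x \<in> nball E1 p r"
    obtain m \<delta> where m: "\<delta> > 0" "\<And>g. g \<in> carrier G \<Longrightarrow> len g < \<delta> \<Longrightarrow> nrm E0 (F g x - x) \<le> m * len g"
      using orbit_Lipschitz[OF sub[OF x]] by blast
    obtain n1 :: nat where n1: "m \<le> real n1" using real_arch_simple by blast
    obtain n2 where n2: "inverse (real (Suc n2)) < \<delta>" using reals_Archimedean[OF m(1)] by blast
    define n where "n = max n1 n2"
    have "x \<in> A n" unfolding A_def
    proof (intro CollectI ballI impI)
      fix g assume g: "g \<in> V" "len g < 1 / real (Suc n)"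
      have "1 / real (Suc n) \<le> inverse (real (Suc n2))" by (simp add: n_def inverse_eq_divide field_simps)
      then have "nrm E0 (F g x - x) \<le> m * len g" using g n2 by (intro m V_D) auto
      also have "\<dots> \<le> real n * len g" using n1 len_nonneg[OF V_D(1)[OF g(1)]] by (intro mult_right_mono) (auto simp: n_def)
      finally show "nrm E0 (F g x - x) \<le> real n * len g" .
    qed
    then show "\<exists>n. x \<in> A n" by blast
  next
    fix n x assume x: "x \<in> nball E1 p r" "x \<notin> A n"
    then obtain g where g: "g \<in> V" "len g < 1 / real (Suc n)" "nrm E0 (F g x - x) > real n * len g"
      by (auto simp: A_def not_le)
    define e where "e = nrm E0 (F g x - x) - real n * len g"
    have e: "e > 0" using g by (simp add: e_def)
    define d where "d = e / (C * (M + 1))"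
    have CM: "C * (M + 1) > 0" using C M by (intro mult_pos_pos) auto
    have "x' \<notin> A n" if x': "x' \<in> nball E1 x d" "x' \<in> nball E1 p r" for x'
    proof
      assume "x' \<in> A n"
      then have le: "nrm E0 (F g x' - x') \<le> real n * len g" using g by (auto simp: A_def)
      have xs: "x \<in> sp E1" "x' \<in> sp E1" using x x' by (auto simp: nball_def)
      have Fs: "F g x \<in> sp E1" "F g x' \<in> sp E1" using x x' by (auto intro!: F_sp[OF E g(1)] sub)
      have D: "(F g x - x) - (F g x' - x') \<in> sp E1" using xs Fs nE1 by (intro nspace_diff)
      have "nrm E0 (F g x - x) \<le> nrm E0 (F g x' - x') + nrm E0 ((F g x - x) - (F g x' - x'))"
        using xs Fs incl E0 by (intro nrm_triangle_rev nspace_diff) auto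
      also have "nrm E0 ((F g x - x) - (F g x' - x')) \<le> C * nrm E1 ((F g x - x) - (F g x' - x'))"
        using incl[OF D] by simp
      also have "(F g x - x) - (F g x' - x') = (F g x - F g x') - (x - x')" by simp
      also have "nrm E1 \<dots> \<le> nrm E1 (F g x - F g x') + nrm E1 (x - x')"
        using xs Fs nE1 by (intro nrm_triangle_diff nspace_diff)
      also have "nrm E1 (F g x - F g x') \<le> M * nrm E1 (x - x')"
        by (intro tameD(2)[OF tame_V[OF E g(1)]] sub x x')
      also have "C * (M * nrm E1 (x - x') + nrm E1 (x - x')) = C * (M + 1) * nrm E1 (x' - x)"
        using nrm_minus_commute[OF nE1 xs] by (simp add: algebra_simps)
      also have "\<dots> < e" using x' CM by (auto simp: nball_def d_def field_simps)
      finally show False using le C by (simp add: e_def)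
    qed
    moreover have "d > 0" using e CM by (simp add: d_def)
    ultimately show "\<exists>d>0. \<forall>x'\<in>nball E1 x d \<inter> nball E1 p r. x' \<notin> A n" by blast
  qed (rule that)
  show ?thesis
    by (rule that[of "real n" "1 / real (Suc n)" d y]) (use n in \<open>auto simp: A_def\<close>)
qed

text \<open>
  Write \<open>L\<close> for the derivative of \<open>F g\<close> at \<open>p\<close> minus the identity. On the ball where displacements
  are bounded by \<open>m * len g\<close>, \<open>average_step\<close> bounds \<open>L\<close> on the image of the ball under the
  average. This image is almost a ball, so \<open>bound_absorb\<close> bounds \<open>L\<close> everywhere by a
  multiple of \<open>len g\<close>. A second use of \<open>average_step\<close>, now near \<open>p\<close>, returns from \<open>L\<close> to \<open>F g\<close>.
\<close>

lemma two_norm_estimate: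
  obtains K \<delta> where "K > 0" "\<delta> > 0"
    "\<forall>g\<in>carrier G. \<forall>z\<in>sp E1. len g < \<delta> \<and> nrm E1 z < \<delta> \<longrightarrow>
      nrm E0 (F g (p + z) - F g p - z) \<le> K * len g * nrm E1 z"
    "\<forall>g\<in>carrier G. \<forall>z\<in>sp E1. \<forall>w\<in>sp E1. len g < \<delta> \<and> nrm E1 z < \<delta> \<and> nrm E1 w < \<delta> \<longrightarrow>
      nrm E0 (F g (p + z) - F g (p + w) - (z - w)) \<le> K * (len g + nrm E1 z + nrm E1 w) * nrm E1 (z - w)"
proof -
  have Ei: "E0 \<in> {E0, E1}" "E1 \<in> {E0, E1}" by auto
  have M0: "M > 0" "C > 0" using M C by auto
  \<comment> \<open>Inside this radius the smallness conditions of \<open>average_step\<close> (weak norm) and \<open>average_near_id\<close> (strong norm) hold.\<close>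
  define r where "r = min \<rho> (min (\<rho> / (4 * M * C)) (1 / (6 * M ^ 3 * C)))"
  have r: "r > 0" "r \<le> \<rho>" using M0 \<rho> by (auto simp: r_def)
  have small: "M * nrm E0 z < \<rho> / 2" "6 * M ^ 3 * nrm E0 z \<le> 1" "nrm E1 z < \<rho>" "6 * M ^ 3 * nrm E1 z \<le> 1"
      "nrm E0 z \<le> 1" "z \<in> sp E0" "nrm E0 z \<le> C * nrm E1 z"
    if z: "z \<in> sp E1" "nrm E1 z < r" for z
  proof -
    show zs: "z \<in> sp E0" and i: "nrm E0 z \<le> C * nrm E1 z" using incl[OF z(1)] by auto
    have n: "0 \<le> nrm E0 z" "0 \<le> nrm E1 z" using nrm_nonneg[OF E0 zs] nrm_nonneg[OF nE1 z(1)] .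
    show "nrm E1 z < \<rho>" using z r by simp
    have a: "4 * M * C * nrm E1 z \<le> \<rho>" using z M0 by (simp add: r_def field_simps)
    have "M * nrm E0 z \<le> M * (C * nrm E1 z)" using i M0 by (intro mult_left_mono) auto
    then show "M * nrm E0 z < \<rho> / 2" using a \<rho> by simp
    have b: "6 * M ^ 3 * C * nrm E1 z \<le> 1" using z M0 by (simp add: r_def field_simps)
    have "6 * M ^ 3 * nrm E0 z \<le> 6 * M ^ 3 * (C * nrm E1 z)" using i M0 by (intro mult_left_mono) auto
    then show c: "6 * M ^ 3 * nrm E0 z \<le> 1" using b by (simp add: mult.assoc)
    have "6 * M ^ 3 * (1 * nrm E1 z) \<le> 6 * M ^ 3 * (C * nrm E1 z)"
      using n C M0 by (intro mult_left_mono mult_right_mono) auto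
    then show "6 * M ^ 3 * nrm E1 z \<le> 1" using b by (simp add: mult.assoc)
    have "1 * nrm E0 z \<le> 6 * M ^ 3 * nrm E0 z"
    proof (intro mult_right_mono n)
      show "1 \<le> 6 * M ^ 3" using one_le_power[OF M, of 3] by linarith
    qed
    then show "nrm E0 z \<le> 1" using c by simp
  qed
  obtain m y d \<delta>1 where m: "m \<ge> 0" "\<delta>1 > 0" "d > 0" "y \<in> nball E1 p r" "nball E1 y d \<subseteq> nball E1 p r"
    "\<forall>x\<in>nball E1 y d. \<forall>g\<in>V. len g < \<delta>1 \<longrightarrow> nrm E0 (F g x - x) \<le> m * len g"
    by (rule orbit_Lipschitz_on_ball[OF r])
  obtain m' \<delta>2 where m': "\<delta>2 > 0" "\<And>g. g \<in> carrier G \<Longrightarrow> len g < \<delta>2 \<Longrightarrow> nrm E0 (F g p - p) \<le> m' * len g"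
    using orbit_Lipschitz[OF p_ball[OF Ei(2)]] by blast
  obtain \<delta>3 c where c: "\<delta>3 > 0" "c > 0"
    "\<forall>g\<in>carrier G. g \<noteq> \<one> \<and> len g < \<delta>3 \<longrightarrow> (\<exists>N. stays_near g N \<and> 1 / real N \<le> c * len g)"
    by (rule stays_near_exists)
  define \<delta> where "\<delta> = min r (min \<eta> (min \<delta>1 (min \<delta>2 \<delta>3)))"
  define m0 where "m0 = \<bar>m'\<bar>"
  define c1 where "c1 = 2 * M ^ 4 * (m0 + c)"
  define c2 where "c2 = 2 * (m + m0) + c1"
  define c3 where "c3 = 8 * c2 / d"
  have c1: "c1 \<ge> 0" using M0 c by (simp add: c1_def m0_def)
  have c2: "c2 \<ge> 0" using m c1 by (simp add: c2_def m0_def)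
  have c3: "c3 \<ge> 0" using c2 m by (simp add: c3_def)
  have main: "nrm E0 (F g (p + z) - F g p - z) \<le> (3 * c3 + 2 * c1 * C) * len g * nrm E1 z"
      "\<forall>v\<in>sp E1. nrm E0 (T g p v - v) \<le> c3 * len g * nrm E1 v"
    if g: "g \<in> carrier G" "len g < \<delta>" "g \<noteq> \<one>" and z: "z \<in> sp E1" "nrm E1 z < \<delta>" for g z
  proof -
    have gV: "g \<in> V" using g by (simp add: V_def \<delta>_def)
    have l: "0 \<le> len g" by (rule len_nonneg[OF g(1)])
    obtain N where N: "stays_near g N" "1 / real N \<le> c * len g" using c(3) g by (auto simp: \<delta>_def)
    have gp: "nrm E0 (F g p - p) \<le> m0 * len g"
    proof -
      have "nrm E0 (F g p - p) \<le> m' * len g" using g by (intro m') (auto simp: \<delta>_def)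
      also have "\<dots> \<le> m0 * len g" using l by (intro mult_right_mono) (auto simp: m0_def)
      finally show ?thesis .
    qed
    \<comment> \<open>\<open>L\<close> is bounded, though so far with a constant that does not tend to \<open>0\<close> with \<open>len g\<close>.\<close>
    define L where "L v = T g p v - v" for v
    have Tlin: "bounded_linear_on E0 E0 (T g p)" by (intro T_linear[OF Ei(1) gV] p_ball Ei)
    have L_add: "L (v + w) = L v + L w" if "v \<in> sp E0" "w \<in> sp E0" for v w
      unfolding L_def using bounded_linear_onD(2)[OF Tlin that] by simp
    have L_diff: "L (v - w) = L v - L w" if "v \<in> sp E0" "w \<in> sp E0" for v w
      unfolding L_def using bounded_linear_on_diff[OF Tlin E0 that] by simp
    have Ls: "L v \<in> sp E0" if "v \<in> sp E0" for v
      unfolding L_def by (intro nspace_diff E0 that bounded_linear_onD(1)[OF Tlin])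
    have Llin: "bounded_linear_on E1 E0 L"
      unfolding bounded_linear_on_def
    proof (intro conjI ballI allI)
      show "L v \<in> sp E0" if "v \<in> sp E1" for v using incl that by (intro Ls) auto
      show "L (v + w) = L v + L w" if "v \<in> sp E1" "w \<in> sp E1" for v w
        using incl that by (intro L_add) auto
      show "L (a *\<^sub>R v) = a *\<^sub>R L v" if "v \<in> sp E1" for a v
        using bounded_linear_onD(3)[OF Tlin, of v a] incl[OF that] by (simp add: L_def scaleR_diff_right)
      show "\<exists>K. \<forall>v\<in>sp E1. nrm E0 (L v) \<le> K * nrm E1 v"
      proof (intro exI[of _ "(M + 1) * C"] ballI)
        fix v assume "v \<in> sp E1"
        then have v: "v \<in> sp E0" "nrm E0 v \<le> C * nrm E1 v" using incl by auto
        have "nrm E0 (L v) \<le> nrm E0 (T g p v) + nrm E0 v"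
          unfolding L_def by (intro nrm_triangle_diff E0 v bounded_linear_onD(1)[OF Tlin])
        also have "nrm E0 (T g p v) \<le> M * nrm E0 v" by (intro T_bound[OF Ei(1) gV] p_ball Ei v)
        also have "M * nrm E0 v + nrm E0 v = (M + 1) * nrm E0 v" by (simp add: algebra_simps)
        also have "\<dots> \<le> (M + 1) * (C * nrm E1 v)" using v M0 by (intro mult_left_mono) auto
        finally show "nrm E0 (L v) \<le> (M + 1) * C * nrm E1 v" by (simp add: mult.assoc)
      qed
    qed
    define \<Delta> where "\<Delta> z = F g (p + z) - F g p - z" for z
    have ball: "p + z \<in> nball E0 p \<rho>" if "z \<in> sp E1" "nrm E1 z < r" for z
    proof -
      have "1 * nrm E0 z \<le> M * nrm E0 z"
        using M small(6)[OF that] by (intro mult_right_mono nrm_nonneg E0) auto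
      then show ?thesis using small[OF that] pE[OF Ei(1)] E0 \<rho> by (auto simp: nball_def nspace_closed)
    qed
    have \<Delta>s: "\<Delta> z \<in> sp E0" if "z \<in> sp E1" "nrm E1 z < r" for z
      unfolding \<Delta>_def using small(6)[OF that]
      by (intro nspace_diff E0 F_sp[OF Ei(1) gV] ball that p_ball Ei)
    have Ks: "average g N z \<in> sp E1" if "z \<in> sp E1" "nrm E1 z < r" for z
      using small[OF that] that by (intro average_near_id(1)[OF N(1), of z z])
    have step: "nrm E0 (\<Delta> z - L (average g N z)) \<le> nrm E0 (\<Delta> z) / 2 + c1 * len g * nrm E0 z"
      if z: "z \<in> sp E1" "nrm E1 z < r" for z
    proof -
      have "nrm E0 (\<Delta> z - L (average g N z)) \<le>
          nrm E0 (\<Delta> z) / 2 + 2 * M ^ 4 * (nrm E0 (F g p - p) + 1 / real N) * nrm E0 z"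
        unfolding \<Delta>_def L_def using small[OF z] by (intro average_step N) auto
      also have "2 * M ^ 4 * (nrm E0 (F g p - p) + 1 / real N) * nrm E0 z \<le>
          2 * M ^ 4 * (m0 * len g + c * len g) * nrm E0 z"
        using gp N M0 small(6)[OF z] by (intro mult_right_mono mult_left_mono add_mono nrm_nonneg E0) auto
      finally show ?thesis by (simp add: c1_def algebra_simps)
    qed
    have L_avg: "nrm E0 (L (average g N z)) \<le> c2 * len g" if z: "z \<in> sp E1" "p + z \<in> nball E1 y d" for z
    proof -
      have pz: "p + z \<in> nball E1 p r" using z m by auto
      then have zr: "nrm E1 z < r" by (simp add: nball_def)
      have "\<Delta> z = (F g (p + z) - (p + z)) - (F g p - p)" by (simp add: \<Delta>_def)
      also have "nrm E0 \<dots> \<le> nrm E0 (F g (p + z) - (p + z)) + nrm E0 (F g p - p)"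
        using ball[OF z(1) zr] small(6)[OF z(1) zr] pE[OF Ei(1)] E0
        by (intro nrm_triangle_diff nspace_diff nspace_add F_sp[OF Ei(1) gV] p_ball Ei)
      also have "nrm E0 (F g (p + z) - (p + z)) \<le> m * len g"
        using g by (intro m(6)[rule_format] z gV) (simp add: \<delta>_def)
      finally have D: "nrm E0 (\<Delta> z) \<le> (m + m0) * len g" using gp by (simp add: distrib_right)
      have "nrm E0 (L (average g N z)) \<le> nrm E0 (\<Delta> z) + nrm E0 (L (average g N z) - \<Delta> z)"
        using Ks[OF z(1) zr] incl by (intro nrm_triangle_rev E0 Ls \<Delta>s z(1) zr) auto
      also have "nrm E0 (L (average g N z) - \<Delta> z) = nrm E0 (\<Delta> z - L (average g N z))"
        using Ks[OF z(1) zr] incl by (intro nrm_minus_commute E0 Ls \<Delta>s z(1) zr) auto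
      also have "\<dots> \<le> nrm E0 (\<Delta> z) / 2 + c1 * len g * nrm E0 z" by (rule step[OF z(1) zr])
      also have "c1 * len g * nrm E0 z \<le> c1 * len g * 1"
        using c1 l small(5)[OF z(1) zr] by (intro mult_left_mono) auto
      finally have "nrm E0 (L (average g N z)) \<le> nrm E0 (\<Delta> z) + (nrm E0 (\<Delta> z) / 2 + c1 * len g)" by simp
      moreover have "0 \<le> (m + m0) * len g" using m(1) l by (intro mult_nonneg_nonneg) (auto simp: m0_def)
      ultimately have "nrm E0 (L (average g N z)) \<le> 2 * ((m + m0) * len g) + c1 * len g" using D by linarith
      then show ?thesis by (simp add: c2_def algebra_simps)
    qed
    \<comment> \<open>Differences of two vectors of the ball around \<open>z1\<close> fill a ball around \<open>0\<close>; this removes the centre.\<close>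
    define z1 where "z1 = y - p"
    have y1: "y \<in> sp E1" using m(4) by (simp add: nball_def)
    have z1: "z1 \<in> sp E1" "p + z1 = y" "p + z1 \<in> nball E1 y d"
      using y1 p1 nE1 m(3) by (auto simp: z1_def nspace_closed center_in_nball)
    have L_bound: "nrm E0 (L v) \<le> c3 * len g * nrm E1 v" if v: "v \<in> sp E1" for v
    proof -
      have "nrm E0 (L v) \<le> 4 * (2 * c2 * len g) / d * nrm E1 v"
      proof (rule bound_absorb[OF nE1 E0 Llin m(3) _ _ v])
        fix w assume w: "w \<in> sp E1" "nrm E1 w < d"
        define e where "e = average g N (z1 + w) - average g N z1 - w"
        have zw: "z1 + w \<in> sp E1" using z1 w nE1 by (intro nspace_add)
        have zwb: "p + (z1 + w) \<in> nball E1 y d"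
          using w y1 nE1 z1(2) by (auto simp: nball_def add.assoc[symmetric] nspace_closed)
        have zr: "nrm E1 z1 < r" "nrm E1 (z1 + w) < r"
          using z1(3) zwb m(5) by (auto simp: nball_def subset_iff dest: spec[of _ "p + z1"] spec[of _ "p + (z1 + w)"])
        have "nrm E1 (average g N (z1 + w) - average g N z1 - ((z1 + w) - z1)) \<le> nrm E1 ((z1 + w) - z1) / 2"
          using small[OF zw zr(2)] small[OF z1(1) zr(1)] by (intro average_near_id(2) N zw z1(1))
        then have en: "nrm E1 e \<le> nrm E1 w / 2" by (simp add: e_def)
        have es: "e \<in> sp E1" unfolding e_def by (intro nspace_diff nE1 Ks zw z1 zr w)
        have Ks': "average g N (z1 + w) \<in> sp E0" "average g N z1 \<in> sp E0"
          using Ks[OF zw zr(2)] Ks[OF z1(1) zr(1)] incl by auto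
        have "L (w + e) = L (average g N (z1 + w)) - L (average g N z1)"
          using L_diff[OF Ks'] by (simp add: e_def)
        also have "nrm E0 \<dots> \<le> nrm E0 (L (average g N (z1 + w))) + nrm E0 (L (average g N z1))"
          by (intro nrm_triangle_diff E0 Ls Ks')
        also have "\<dots> \<le> c2 * len g + c2 * len g" by (intro add_mono L_avg zw zwb z1)
        finally have "nrm E0 (L (w + e)) \<le> 2 * c2 * len g" by simp
        then show "\<exists>e\<in>sp E1. nrm E1 e \<le> nrm E1 w / 2 \<and> nrm E0 (L (w + e)) \<le> 2 * c2 * len g"
          using es en by blast
      qed (use c2 l in auto)
      then show ?thesis by (simp add: c3_def)
    qed
    show "\<forall>v\<in>sp E1. nrm E0 (T g p v - v) \<le> c3 * len g * nrm E1 v"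
      using L_bound by (simp add: L_def)
    have zr: "nrm E1 z < r" using z by (simp add: \<delta>_def)
    have zero: "0 \<in> sp E1" "nrm E1 0 < r" using nE1 r by (auto simp: nspace_closed nrm_zero)
    have nK: "nrm E1 (average g N z) \<le> 3 / 2 * nrm E1 z"
    proof -
      have "nrm E1 (average g N z - average g N 0 - (z - 0)) \<le> nrm E1 (z - 0) / 2"
        using small[OF z(1) zr] small[OF zero] by (intro average_near_id(2) N z zero)
      then have "nrm E1 (average g N z - z) \<le> nrm E1 z / 2" by (simp add: average_0[OF N(1)])
      then show ?thesis using nrm_triangle_rev[OF nE1 Ks[OF z(1) zr] z(1)] by simp
    qed
    have "nrm E0 (\<Delta> z) \<le> nrm E0 (L (average g N z)) + nrm E0 (\<Delta> z - L (average g N z))"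
      using Ks[OF z(1) zr] incl by (intro nrm_triangle_rev E0 Ls \<Delta>s z(1) zr) auto
    also have "nrm E0 (L (average g N z)) \<le> c3 * len g * nrm E1 (average g N z)"
      by (rule L_bound[OF Ks[OF z(1) zr]])
    also have "\<dots> \<le> c3 * len g * (3 / 2 * nrm E1 z)" using nK c3 l by (intro mult_left_mono) auto
    also have "nrm E0 (\<Delta> z - L (average g N z)) \<le> nrm E0 (\<Delta> z) / 2 + c1 * len g * nrm E0 z"
      by (rule step[OF z(1) zr])
    also have "c1 * len g * nrm E0 z \<le> c1 * len g * (C * nrm E1 z)"
      using small(7)[OF z(1) zr] c1 l by (intro mult_left_mono) auto
    finally have "nrm E0 (\<Delta> z) \<le> 2 * (c3 * len g * (3 / 2 * nrm E1 z) + c1 * len g * (C * nrm E1 z))"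
      by simp
    then show "nrm E0 (F g (p + z) - F g p - z) \<le> (3 * c3 + 2 * c1 * C) * len g * nrm E1 z"
      by (simp add: \<Delta>_def algebra_simps)
  qed
  define K where "K = 4 * c3 + 2 * c1 * C + 2 * C * M + 1"
  have K: "K > 0" "3 * c3 + 2 * c1 * C \<le> K" using c1 c3 M0 by (auto simp: K_def add_nonneg_pos)
  have est1: "nrm E0 (F g (p + z) - F g p - z) \<le> K * len g * nrm E1 z"
    if g: "g \<in> carrier G" "len g < \<delta>" and z: "z \<in> sp E1" "nrm E1 z < \<delta>" for g z
  proof -
    have zr: "nrm E1 z < r" using z by (simp add: \<delta>_def)
    have n: "0 \<le> len g" "0 \<le> nrm E1 z" using g z nE1 by (auto intro: len_nonneg nrm_nonneg)
    show "nrm E0 (F g (p + z) - F g p - z) \<le> K * len g * nrm E1 z"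
    proof (cases "g = \<one>")
      case True
      have "1 * nrm E0 z \<le> M * nrm E0 z"
        using M small(6)[OF z(1) zr] by (intro mult_right_mono nrm_nonneg E0) auto
      then have "p + z \<in> nball E0 p \<rho>"
        using small[OF z(1) zr] pE[OF Ei(1)] E0 \<rho> by (auto simp: nball_def nspace_closed)
      then show ?thesis using F_one p_ball[OF Ei(1)] True n K nrm_zero[OF E0] by simp
    next
      case False
      have "(3 * c3 + 2 * c1 * C) * len g * nrm E1 z \<le> K * len g * nrm E1 z"
        using K n by (intro mult_right_mono) auto
      then show ?thesis using main(1)[OF g False z] by simp
    qed
  qed
  have est2: "nrm E0 (F g (p + z) - F g (p + w) - (z - w)) \<le> K * (len g + nrm E1 z + nrm E1 w) * nrm E1 (z - w)"
    if g: "g \<in> carrier G" "len g < \<delta>" and z: "z \<in> sp E1" "nrm E1 z < \<delta>"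
      and w: "w \<in> sp E1" "nrm E1 w < \<delta>" for g z w
  proof -
    have zr: "nrm E1 z < r" "nrm E1 w < r" using z w by (simp_all add: \<delta>_def)
    have gV: "g \<in> V" using g by (simp add: V_def \<delta>_def)
    have zws: "z - w \<in> sp E1" by (intro nspace_diff nE1 z w)
    have n: "0 \<le> len g" "0 \<le> nrm E1 z" "0 \<le> nrm E1 w" "0 \<le> nrm E1 (z - w)"
      using g z w zws nE1 by (auto intro: len_nonneg nrm_nonneg)
    have b: "p + z \<in> nball E1 p \<rho>" "p + w \<in> nball E1 p \<rho>"
      using small(3)[OF z(1) zr(1)] small(3)[OF w(1) zr(2)] z w p1 nE1 by (auto simp: nball_def nspace_closed)
    have Tid: "nrm E0 (T g p v - v) \<le> c3 * len g * nrm E1 v" if v: "v \<in> sp E1" for v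
    proof (cases "g = \<one>")
      case True
      then show ?thesis
        using T_one[OF p_ball[OF Ei(1)], of v] incl[OF v] nrm_zero[OF E0] c3 n nrm_nonneg[OF nE1 v] by simp
    next
      case False
      then show ?thesis using main(2)[OF g False z] v by blast
    qed
    have Ts: "T g p (z - w) \<in> sp E1" by (intro T_sp[OF Ei(2) gV] p_ball Ei zws)
    define R where "R = F g (p + z) - F g (p + w) - T g p (z - w)"
    have Rs: "R \<in> sp E1" unfolding R_def by (intro nspace_diff nE1 Ts F_sp[OF Ei(2) gV] b)
    have "F g (p + z) - F g (p + w) - (z - w) = R + (T g p (z - w) - (z - w))" by (simp add: R_def)
    also have "nrm E0 \<dots> \<le> nrm E0 R + nrm E0 (T g p (z - w) - (z - w))"
      using incl[OF Rs] incl[OF Ts] incl[OF zws] E0 by (intro nrm_triangle) (auto intro: nspace_diff)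
    also have "nrm E0 (T g p (z - w) - (z - w)) \<le> c3 * len g * nrm E1 (z - w)" by (rule Tid[OF zws])
    also have "nrm E0 R \<le> C * nrm E1 R" using incl[OF Rs] by simp
    also have "\<dots> \<le> C * (M * nrm E1 (z - w) * (nrm E1 w + nrm E1 (z - w)))"
      unfolding R_def using M0 by (intro mult_left_mono T_remainder[OF Ei(2) gV b]) auto
    also have "\<dots> \<le> C * (M * nrm E1 (z - w) * (2 * (nrm E1 z + nrm E1 w)))"
      using nrm_triangle_diff[OF nE1 z(1) w(1)] n M0 by (intro mult_left_mono) auto
    finally have "nrm E0 (F g (p + z) - F g (p + w) - (z - w)) \<le>
        (2 * C * M * (nrm E1 z + nrm E1 w) + c3 * len g) * nrm E1 (z - w)"
      by (simp add: algebra_simps)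
    also have "\<dots> \<le> (K * (nrm E1 z + nrm E1 w) + K * len g) * nrm E1 (z - w)"
      using n c1 c3 M0 by (intro mult_right_mono add_mono) (auto simp: K_def)
    finally show "nrm E0 (F g (p + z) - F g (p + w) - (z - w)) \<le> K * (len g + nrm E1 z + nrm E1 w) * nrm E1 (z - w)"
      by (simp add: algebra_simps)
  qed
  have "\<delta> > 0" using r \<eta> m m' c by (simp add: \<delta>_def)
  then show ?thesis using K(1) est1 est2 by (intro that[of K \<delta>]) auto
qed

end

section \<open>Charts and representatives\<close>

lemma banach_manifold_tangent:
  "banach_manifold M \<Longrightarrow> b \<in> points M \<Longrightarrow> banach_space (tangent M b)"
  "banach_manifold M \<Longrightarrow> b \<in> points M \<Longrightarrow> normed_space (tangent M b)"
  "banach_manifold M \<Longrightarrow> b \<in> points M \<Longrightarrow> ref M b \<in> charts M b"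
  by (simp_all add: banach_manifold_def banach_space_def)

lemma chart_facts:
  assumes "banach_manifold M" "b \<in> points M" "c \<in> charts M b"
  shows "openin (mtop M) (cdom c)" "b \<in> cdom c" "cdom c \<subseteq> points M"
    and "openin (ntop (tangent M b)) (cmap c ` cdom c)"
    and "homeomorphic_map (subtopology (mtop M) (cdom c))
             (subtopology (ntop (tangent M b)) (cmap c ` cdom c)) (cmap c)"
    and "inj_on (cmap c) (cdom c)"
    and "x \<in> cdom c \<Longrightarrow> cmap c x \<in> sp (tangent M b)"
proof -
  show 1: "openin (mtop M) (cdom c)" "b \<in> cdom c" "openin (ntop (tangent M b)) (cmap c ` cdom c)"
    "homeomorphic_map (subtopology (mtop M) (cdom c))
             (subtopology (ntop (tangent M b)) (cmap c ` cdom c)) (cmap c)"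
    using assms by (auto simp: banach_manifold_def)
  show 2: "cdom c \<subseteq> points M" using 1(1) by (rule openin_subset)
  show "inj_on (cmap c) (cdom c)"
    using homeomorphic_imp_injective_map[OF 1(4)] 2 by (simp add: inf_absorb2)
  show "x \<in> cdom c \<Longrightarrow> cmap c x \<in> sp (tangent M b)"
    using openin_subset[OF 1(3)] topspace_ntop[OF banach_manifold_tangent(2)[OF assms(1,2)]] by auto
qed

lemma cinv_cmap: "inj_on (cmap c) (cdom c) \<Longrightarrow> x \<in> cdom c \<Longrightarrow> cinv c (cmap c x) = x"
  by (simp add: cinv_def)

lemma cmap_cinv: "x \<in> cmap c ` cdom c \<Longrightarrow> cmap c (cinv c x) = x"
  and cinv_in_cdom: "x \<in> cmap c ` cdom c \<Longrightarrow> cinv c x \<in> cdom c"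
  by (simp_all add: cinv_def f_inv_into_f inv_into_into)

text \<open>
  Chart images are open, so that a whole ball around a chart value consists of chart values and
  \<open>cinv c\<close> is a genuine inverse there.
\<close>

lemma cinv_continuous:
  assumes M: "banach_manifold M" "b \<in> points M" "c \<in> charts M b"
    and W: "openin (mtop M) W" "x \<in> W" "x \<in> cdom c"
  obtains r where "r > 0" "\<forall>y\<in>nball (tangent M b) (cmap c x) r.
    cinv c y \<in> W \<and> cinv c y \<in> cdom c \<and> cmap c (cinv c y) = y"
proof -
  note cf = chart_facts[OF M]
  have "openin (subtopology (mtop M) (cdom c)) (cdom c \<inter> W)"
    using W by (metis openin_subtopology inf_commute)
  then have "openin (subtopology (ntop (tangent M b)) (cmap c ` cdom c)) (cmap c ` (cdom c \<inter> W))"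
    using homeomorphic_map_openness_eq[OF cf(5)] by blast
  then have "openin (ntop (tangent M b)) (cmap c ` (cdom c \<inter> W))"
    using openin_trans_full[OF _ cf(4)] by blast
  then obtain r where r: "r > 0" "nball (tangent M b) (cmap c x) r \<subseteq> cmap c ` (cdom c \<inter> W)"
    using W openin_ntop[OF banach_manifold_tangent(2)[OF M(1,2)]] by blast
  have "cinv c y \<in> W \<and> cinv c y \<in> cdom c \<and> cmap c (cinv c y) = y"
    if "y \<in> nball (tangent M b) (cmap c x) r" for y
  proof -
    have "y \<in> cmap c ` (cdom c \<inter> W)" using r(2) that by blast
    then obtain z where "z \<in> cdom c" "z \<in> W" "y = cmap c z" by blast
    then show ?thesis using cinv_cmap[OF cf(6)] by simp
  qed
  then show ?thesis using that r(1) by blast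
qed

lemma chart_ball_open:
  assumes M: "banach_manifold M" "b \<in> points M" "c \<in> charts M b" and x: "x \<in> cdom c"
  shows "openin (mtop M) {y \<in> cdom c. cmap c y \<in> nball (tangent M b) (cmap c x) r}"
proof -
  note cf = chart_facts[OF M]
  let ?X = "subtopology (mtop M) (cdom c)"
  have "continuous_map ?X (ntop (tangent M b)) (cmap c)"
    using homeomorphic_imp_continuous_map[OF cf(5)] continuous_map_into_fulltopology by blast
  then have "openin ?X {y \<in> topspace ?X. cmap c y \<in> nball (tangent M b) (cmap c x) r}"
    using openin_nball[OF banach_manifold_tangent(2)[OF M(1,2)] cf(7)[OF x]]
    by (rule openin_continuous_map_preimage)
  moreover have "topspace ?X = cdom c" using cf(3) by auto
  ultimately show ?thesis using openin_trans_full[OF _ cf(1)] by metis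
qed

lemma rep_dom_ball:
  assumes U: "openin (ntop E) (rep_dom c d W f)" and E: "normed_space E"
    and inj: "inj_on (cmap c) (cdom c)" and x: "x \<in> cdom c" "x \<in> W" "f x \<in> cdom d"
  obtains r where "cmap c x \<in> rep_dom c d W f" "r > 0" "\<forall>y\<in>nball E (cmap c x) r.
    cinv c y \<in> W \<and> cinv c y \<in> cdom c \<and> cmap c (cinv c y) = y \<and> f (cinv c y) \<in> cdom d"
proof -
  have 1: "cmap c x \<in> rep_dom c d W f" using x by (auto simp: rep_dom_def)
  then obtain r where r: "r > 0" "nball E (cmap c x) r \<subseteq> rep_dom c d W f"
    using U openin_ntop[OF E] by blast
  have "cinv c y \<in> W \<and> cinv c y \<in> cdom c \<and> cmap c (cinv c y) = y \<and> f (cinv c y) \<in> cdom d"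
    if "y \<in> nball E (cmap c x) r" for y
  proof -
    obtain z where "z \<in> cdom c" "z \<in> W" "f z \<in> cdom d" "y = cmap c z"
      using r(2) \<open>y \<in> nball E (cmap c x) r\<close> by (auto simp: rep_dom_def)
    then show ?thesis using cinv_cmap[OF inj] by simp
  qed
  then show ?thesis using that 1 r(1) by blast
qed

lemma Ck_map_on_strict_deriv:
  assumes M: "banach_manifold M" "b \<in> points M" "c \<in> charts M b"
    and N: "banach_manifold N" "b' \<in> points N" "d \<in> charts N b'"
    and f: "Ck_map_on 1 M N W f" and x: "x \<in> cdom c" "x \<in> W" "f x \<in> cdom d"
  obtains A where "strict_deriv (tangent M b) (tangent N b') (\<lambda>y. cmap d (f (cinv c y))) A (cmap c x)"
proof -
  note nM = banach_manifold_tangent(2)[OF M(1,2)] and nN = banach_manifold_tangent(2)[OF N(1,2)]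
  have C: "Ck_on 1 (tangent M b) (tangent N b') (rep_dom c d W f) (rep c d f)"
    using f M N by (simp add: Ck_map_on_def)
  have "cmap c x \<in> rep_dom c d W f" using x by (auto simp: rep_dom_def)
  then obtain A where "strict_deriv (tangent M b) (tangent N b') (rep c d f) A (cmap c x)"
    using Ck_on_1_strict_deriv[OF C nM nN] by blast
  then show ?thesis using that by (simp add: rep_def comp_def)
qed

lemma smooth_map_tame:
  assumes M: "banach_manifold M" "b \<in> points M" "c \<in> charts M b"
    and N: "banach_manifold N" "b' \<in> points N" "d \<in> charts N b'"
    and f: "smooth_map M N f" and x: "x \<in> cdom c" "f x \<in> cdom d"
  obtains r R where "r > 0" "R \<ge> 1"
    "tame (tangent M b) (tangent N b') (\<lambda>y. cmap d (f (cinv c y))) (cmap c x) r R"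
proof -
  note nM = banach_manifold_tangent(2)[OF M(1,2)] and nN = banach_manifold_tangent(2)[OF N(1,2)]
  have C: "smooth_on (tangent M b) (tangent N b') (rep_dom c d (points M) f) (rep c d f)"
    using f M N by (simp add: smooth_map_def Ck_map_def Ck_map_on_def smooth_on_def)
  have "cmap c x \<in> rep_dom c d (points M) f"
    using x chart_facts(3)[OF M] by (auto simp: rep_dom_def)
  then show ?thesis
    using smooth_on_tame[OF C nM nN] that by (metis (mono_tags, lifting) rep_def comp_def tame_transfer)
qed

lemma smooth_map_C1: "smooth_map M N f \<Longrightarrow> Ck_map_on 1 M N (points M) f"
  by (simp add: smooth_map_def Ck_map_def)

lemma smooth_map_continuous: "smooth_map M N f \<Longrightarrow> continuous_map (mtop M) (mtop N) f"
  using smooth_map_C1[of M N f] by (simp add: Ck_map_on_def)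

section \<open>Lengths in a Lie group\<close>

locale lie_group_chart =
  fixes G :: "'g monoid" (structure) and L :: "('g, 'l::real_vector) manifold"
  assumes lie: "lie_group G L"

begin

sublocale group G
  using lie by (simp add: lie_group_def)

lemma L_manifold: "banach_manifold L" and L_points: "points L = carrier G"
  using lie by (auto simp: lie_group_def)

abbreviation \<kappa> where "\<kappa> \<equiv> ref L \<one>"

abbreviation EL where "EL \<equiv> tangent L \<one>"

lemma one_point: "\<one> \<in> points L"
  by (simp add: L_points)

lemma kappa_chart: "\<kappa> \<in> charts L \<one>"
  by (rule banach_manifold_tangent(3)[OF L_manifold one_point])

lemmas \<kappa>_facts = chart_facts[OF L_manifold one_point kappa_chart]

lemma EL: "normed_space EL" "banach_space EL"
  using banach_manifold_tangent[OF L_manifold one_point] by auto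

text \<open>The value outside of the chart keeps such elements away from the identity.\<close>

definition len :: "'g \<Rightarrow> real" where
  "len g = (if g \<in> cdom \<kappa> then nrm EL (cmap \<kappa> g - cmap \<kappa> \<one>) else 1)"

lemma \<kappa>_sp: "g \<in> cdom \<kappa> \<Longrightarrow> cmap \<kappa> g \<in> sp EL"
  by (rule \<kappa>_facts(7))

lemma len_nonneg: "0 \<le> len g"
  using EL \<kappa>_sp \<kappa>_facts(2) by (auto simp: len_def intro!: nrm_nonneg nspace_diff)

lemma len_one: "len \<one> = 0"
  using EL \<kappa>_facts(2) by (simp add: len_def nrm_zero)

lemma len_eq_0: "len g = 0 \<longleftrightarrow> g = \<one>"
proof
  assume l: "len g = 0"
  then have g: "g \<in> cdom \<kappa>" by (auto simp: len_def split: if_splits)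
  then have "cmap \<kappa> g = cmap \<kappa> \<one>"
    using l nrm_eq_0[OF EL(1), of "cmap \<kappa> g - cmap \<kappa> \<one>"] nspace_diff[OF EL(1) \<kappa>_sp \<kappa>_sp] \<kappa>_facts(2)
    by (simp add: len_def)
  then show "g = \<one>" using g \<kappa>_facts(2,6) by (auto dest: inj_onD)
qed (simp add: len_one)

lemma len_less_1: "len g < 1 \<Longrightarrow> g \<in> cdom \<kappa> \<and> nrm EL (cmap \<kappa> g - cmap \<kappa> \<one>) = len g"
  by (auto simp: len_def split: if_splits)

lemma len_small_in_open:
  assumes "openin (mtop L) W" "\<one> \<in> W"
  obtains \<delta> where "\<delta> > 0" "\<delta> \<le> 1" "\<forall>g. len g < \<delta> \<longrightarrow> g \<in> W"
proof -
  obtain r where r: "r > 0" "\<forall>y\<in>nball EL (cmap \<kappa> \<one>) r. cinv \<kappa> y \<in> W \<and> cinv \<kappa> y \<in> cdom \<kappa> \<and> cmap \<kappa> (cinv \<kappa> y) = y"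
    by (rule cinv_continuous[OF L_manifold one_point kappa_chart assms \<kappa>_facts(2)])
  have "g \<in> W" if "len g < min r 1" for g
  proof -
    have g: "g \<in> cdom \<kappa>" "nrm EL (cmap \<kappa> g - cmap \<kappa> \<one>) < r" using len_less_1[of g] that by auto
    then have "cmap \<kappa> g \<in> nball EL (cmap \<kappa> \<one>) r" using \<kappa>_sp by (simp add: nball_def)
    then have "cinv \<kappa> (cmap \<kappa> g) \<in> W" using r by blast
    then show ?thesis using cinv_cmap[OF \<kappa>_facts(6) g(1)] by simp
  qed
  then show ?thesis using r by (intro that[of "min r 1"]) auto
qed

lemma open_len_small:
  assumes "\<delta> > 0"
  obtains W where "openin (mtop L) W" "\<one> \<in> W" "\<forall>g\<in>W. g \<in> cdom \<kappa> \<and> len g < \<delta>"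
proof (rule that)
  show "openin (mtop L) {y \<in> cdom \<kappa>. cmap \<kappa> y \<in> nball EL (cmap \<kappa> \<one>) \<delta>}"
    by (rule chart_ball_open[OF L_manifold one_point kappa_chart \<kappa>_facts(2)])
  show "\<one> \<in> {y \<in> cdom \<kappa>. cmap \<kappa> y \<in> nball EL (cmap \<kappa> \<one>) \<delta>}"
    using \<kappa>_facts(2) \<kappa>_sp EL assms by (simp add: center_in_nball)
  show "\<forall>g\<in>{y \<in> cdom \<kappa>. cmap \<kappa> y \<in> nball EL (cmap \<kappa> \<one>) \<delta>}. g \<in> cdom \<kappa> \<and> len g < \<delta>"
    by (auto simp: len_def nball_def)
qed

lemma left_translation_continuous:
  assumes "openin (mtop L) W" "h \<in> W"
  obtains \<delta> where "\<delta> > 0" "\<forall>g\<in>carrier G. len g < \<delta> \<longrightarrow> h \<otimes> g \<in> W"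
proof -
  have h: "h \<in> carrier G" using openin_subset[OF assms(1)] assms(2) L_points by auto
  have mc: "continuous_map (prod_topology (mtop L) (mtop L)) (mtop L) (\<lambda>(g, h). g \<otimes> h)"
    using lie smooth_map_continuous[of "prod_manifold L L" L] by (simp add: lie_group_def prod_manifold_def)
  have "continuous_map (mtop L) (prod_topology (mtop L) (mtop L)) (\<lambda>g. (h, g))"
    using h L_points by (intro continuous_map_pairedI) auto
  then have "continuous_map (mtop L) (mtop L) (\<lambda>g. h \<otimes> g)"
    using continuous_map_compose[OF _ mc] by (fastforce simp: comp_def)
  then have "openin (mtop L) {g \<in> points L. h \<otimes> g \<in> W}"
    using assms(1) by (rule openin_continuous_map_preimage)
  moreover have "\<one> \<in> {g \<in> points L. h \<otimes> g \<in> W}" using assms h L_points by simp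
  ultimately obtain \<delta> where "\<delta> > 0" "\<forall>g. len g < \<delta> \<longrightarrow> g \<in> {g \<in> points L. h \<otimes> g \<in> W}"
    by (rule len_small_in_open)
  then show ?thesis by (intro that[of \<delta>]) auto
qed

text \<open>To first order, multiplication near the identity is addition in the chart.\<close>

lemma mult_first_order:
  assumes \<epsilon>: "\<epsilon> > 0"
  obtains \<delta> where "\<delta> > 0" "\<delta> \<le> 1" "\<forall>g\<in>carrier G. \<forall>h\<in>carrier G. len g < \<delta> \<and> len h < \<delta> \<longrightarrow>
    g \<otimes> h \<in> cdom \<kappa> \<and> nrm EL (cmap \<kappa> (g \<otimes> h) - cmap \<kappa> h - (cmap \<kappa> g - cmap \<kappa> \<one>)) \<le> \<epsilon> * len g"
proof -
  define P where "P = prod_nspace EL EL"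
  define k2 where "k2 = prod_chart \<kappa> \<kappa>"
  define W where "W = points (prod_manifold L L)"
  define f where "f = (\<lambda>(g, h). g \<otimes> h)"
  have P: "normed_space P" unfolding P_def by (intro normed_space_prod EL)
  have W: "W = carrier G \<times> carrier G" by (simp add: W_def prod_manifold_def L_points)
  have dom: "cdom k2 = cdom \<kappa> \<times> cdom \<kappa>" and map: "cmap k2 (g, h) = (cmap \<kappa> g, cmap \<kappa> h)" for g h
    by (auto simp: k2_def prod_chart_def)
  have inj: "inj_on (cmap k2) (cdom k2)"
    using \<kappa>_facts(6) by (auto simp: dom map inj_on_def)
  have "smooth_map (prod_manifold L L) L f" using lie by (simp add: lie_group_def f_def)
  then have "Ck_map_on 1 (prod_manifold L L) L W f" unfolding W_def by (rule smooth_map_C1)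
  moreover have "(\<one>, \<one>) \<in> points (prod_manifold L L)" using W W_def by simp
  moreover have "k2 \<in> charts (prod_manifold L L) (\<one>, \<one>)"
    using kappa_chart by (auto simp: prod_manifold_def k2_def)
  moreover have "tangent (prod_manifold L L) (\<one>, \<one>) = P" by (simp add: prod_manifold_def P_def)
  ultimately have C: "Ck_on 1 P EL (rep_dom k2 \<kappa> W f) (rep k2 \<kappa> f)"
    using one_point kappa_chart unfolding Ck_map_on_def by metis
  have one: "(\<one>, \<one>) \<in> cdom k2" "(\<one>, \<one>) \<in> W" "f (\<one>, \<one>) \<in> cdom \<kappa>"
    using \<kappa>_facts(2) by (auto simp: dom W f_def)
  have op: "openin (ntop P) (rep_dom k2 \<kappa> W f)" using C by (simp add: Ck_on_def)
  obtain r where r: "cmap k2 (\<one>, \<one>) \<in> rep_dom k2 \<kappa> W f" "r > 0"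
    "\<forall>y\<in>nball P (cmap k2 (\<one>, \<one>)) r. cinv k2 y \<in> W \<and> cinv k2 y \<in> cdom k2 \<and>
       cmap k2 (cinv k2 y) = y \<and> f (cinv k2 y) \<in> cdom \<kappa>"
    by (rule rep_dom_ball[OF op P inj one])
  obtain A where A: "strict_deriv P EL (rep k2 \<kappa> f) A (cmap k2 (\<one>, \<one>))"
    by (rule Ck_on_1_strict_deriv[OF C P EL(1) r(1)])
  have "\<epsilon> / 2 > 0" using \<epsilon> by simp
  from strict_derivD(3)[OF A this] obtain d where d: "d > 0"
    "\<forall>y\<in>nball P (cmap k2 (\<one>, \<one>)) d. \<forall>z\<in>nball P (cmap k2 (\<one>, \<one>)) d. rep k2 \<kappa> f y \<in> sp EL \<and>
       nrm EL (rep k2 \<kappa> f y - rep k2 \<kappa> f z - A (y - z)) \<le> \<epsilon> / 2 * nrm P (y - z)"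
    by blast
  define \<delta> where "\<delta> = min 1 (min r d)"
  have "g \<otimes> h \<in> cdom \<kappa> \<and> nrm EL (cmap \<kappa> (g \<otimes> h) - cmap \<kappa> h - (cmap \<kappa> g - cmap \<kappa> \<one>)) \<le> \<epsilon> * len g"
    if gh: "g \<in> carrier G" "h \<in> carrier G" "len g < \<delta>" "len h < \<delta>" for g h
  proof -
    have g: "g \<in> cdom \<kappa>" "nrm EL (cmap \<kappa> g - cmap \<kappa> \<one>) = len g"
      and h: "h \<in> cdom \<kappa>" "nrm EL (cmap \<kappa> h - cmap \<kappa> \<one>) = len h"
      using len_less_1[of g] len_less_1[of h] gh by (auto simp: \<delta>_def)
    have ball: "cmap k2 (a, b) \<in> nball P (cmap k2 (\<one>, \<one>)) \<delta>" if "a \<in> {g, \<one>}" "b \<in> {h, \<one>}" for a b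
      using that g h gh \<kappa>_sp \<kappa>_facts(2) EL r d nrm_zero[OF EL(1)]
      by (auto simp: nball_def map P_def prod_nspace_def \<delta>_def)
    have dk2: "(a, b) \<in> cdom k2" if "a \<in> {g, \<one>}" "b \<in> {h, \<one>}" for a b
      using that g h \<kappa>_facts(2) by (auto simp: dom)
    have rep: "rep k2 \<kappa> f (cmap k2 (a, b)) = cmap \<kappa> (a \<otimes> b)" if "a \<in> {g, \<one>}" "b \<in> {h, \<one>}" for a b
      using cinv_cmap[OF inj dk2[OF that]] by (simp add: rep_def f_def)
    have "cmap k2 (g, h) \<in> nball P (cmap k2 (\<one>, \<one>)) r" using ball[of g h] by (auto simp: nball_def \<delta>_def)
    then have in\<kappa>: "g \<otimes> h \<in> cdom \<kappa>" using r(3) cinv_cmap[OF inj dk2[of g h]] by (fastforce simp: f_def)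
    define a where "a = A (cmap \<kappa> g - cmap \<kappa> \<one>, 0)"
    have as: "a \<in> sp EL" unfolding a_def
      using g \<kappa>_sp \<kappa>_facts(2) EL
      by (intro bounded_linear_onD(1)[OF strict_derivD(2)[OF A]]) (auto simp: P_def prod_nspace_def nspace_closed)
    have est: "nrm EL (cmap \<kappa> (g \<otimes> b) - cmap \<kappa> (\<one> \<otimes> b) - a) \<le> \<epsilon> / 2 * len g" if b: "b \<in> {h, \<one>}" for b
    proof -
      have "cmap k2 (g, b) \<in> nball P (cmap k2 (\<one>, \<one>)) d" "cmap k2 (\<one>, b) \<in> nball P (cmap k2 (\<one>, \<one>)) d"
        using ball[of g b] ball[of \<one> b] b by (auto simp: nball_def \<delta>_def)
      then have "nrm EL (rep k2 \<kappa> f (cmap k2 (g, b)) - rep k2 \<kappa> f (cmap k2 (\<one>, b)) - A (cmap k2 (g, b) - cmap k2 (\<one>, b)))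
          \<le> \<epsilon> / 2 * nrm P (cmap k2 (g, b) - cmap k2 (\<one>, b))"
        using d(2) by blast
      also have "cmap k2 (g, b) - cmap k2 (\<one>, b) = (cmap \<kappa> g - cmap \<kappa> \<one>, 0)" by (simp add: map)
      also have "nrm P (cmap \<kappa> g - cmap \<kappa> \<one>, 0) = len g"
        using g(2) len_nonneg[of g] nrm_zero[OF EL(1)] by (simp add: P_def prod_nspace_def)
      finally show ?thesis using b by (simp add: rep a_def)
    qed
    have s: "cmap \<kappa> (g \<otimes> h) \<in> sp EL" "cmap \<kappa> h \<in> sp EL" "cmap \<kappa> g \<in> sp EL" "cmap \<kappa> \<one> \<in> sp EL"
      using in\<kappa> g h \<kappa>_facts(2) \<kappa>_sp by auto
    have "cmap \<kappa> (g \<otimes> h) - cmap \<kappa> h - (cmap \<kappa> g - cmap \<kappa> \<one>) =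
        (cmap \<kappa> (g \<otimes> h) - cmap \<kappa> h - a) - (cmap \<kappa> g - cmap \<kappa> \<one> - a)" by simp
    also have "nrm EL \<dots> \<le> nrm EL (cmap \<kappa> (g \<otimes> h) - cmap \<kappa> h - a) + nrm EL (cmap \<kappa> g - cmap \<kappa> \<one> - a)"
      using s as EL by (intro nrm_triangle_diff nspace_diff) auto
    also have "\<dots> \<le> \<epsilon> / 2 * len g + \<epsilon> / 2 * len g"
      using est[of h] est[of \<one>] gh by (intro add_mono) auto
    finally show ?thesis using in\<kappa> by simp
  qed
  then have "\<forall>g\<in>carrier G. \<forall>h\<in>carrier G. len g < \<delta> \<and> len h < \<delta> \<longrightarrow>
    g \<otimes> h \<in> cdom \<kappa> \<and> nrm EL (cmap \<kappa> (g \<otimes> h) - cmap \<kappa> h - (cmap \<kappa> g - cmap \<kappa> \<one>)) \<le> \<epsilon> * len g"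
    by blast
  moreover have "\<delta> > 0" "\<delta> \<le> 1" using r(2) d(1) by (auto simp: \<delta>_def)
  ultimately show ?thesis using that by blast
qed

text \<open>The factors \<open>2\<close> leave room for the error term of \<open>mult_first_order\<close>.\<close>

lemma len_mult_inv:
  obtains \<eta> where "\<eta> > 0" "\<eta> \<le> 1"
    "\<forall>g\<in>carrier G. \<forall>h\<in>carrier G. len g < \<eta> \<and> len h < \<eta> \<longrightarrow> len (g \<otimes> h) \<le> len h + 2 * len g"
    "\<forall>g\<in>carrier G. len g < \<eta> \<longrightarrow> len (inv g) \<le> 2 * len g"
proof -
  obtain \<delta> where d: "\<delta> > 0" "\<delta> \<le> 1" "\<forall>g\<in>carrier G. \<forall>h\<in>carrier G. len g < \<delta> \<and> len h < \<delta> \<longrightarrow>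
    g \<otimes> h \<in> cdom \<kappa> \<and> nrm EL (cmap \<kappa> (g \<otimes> h) - cmap \<kappa> h - (cmap \<kappa> g - cmap \<kappa> \<one>)) \<le> 1 / 2 * len g"
    by (rule mult_first_order[of "1/2"]) auto
  have ic: "continuous_map (mtop L) (mtop L) (\<lambda>g. inv g)"
    using lie smooth_map_continuous[of L L "\<lambda>g. inv g"] by (simp add: lie_group_def)
  obtain W where W: "openin (mtop L) W" "\<one> \<in> W" "\<forall>g\<in>W. g \<in> cdom \<kappa> \<and> len g < \<delta>"
    by (rule open_len_small[OF d(1)])
  have "openin (mtop L) {g \<in> points L. inv g \<in> W}" using ic W(1) by (rule openin_continuous_map_preimage)
  moreover have "\<one> \<in> {g \<in> points L. inv g \<in> W}" using W by (simp add: L_points)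
  ultimately obtain \<delta>' where d': "\<delta>' > 0" "\<delta>' \<le> 1" "\<forall>g. len g < \<delta>' \<longrightarrow> g \<in> {g \<in> points L. inv g \<in> W}"
    by (rule len_small_in_open)
  define \<eta> where "\<eta> = min \<delta> \<delta>'"
  have 1: "len (g \<otimes> h) \<le> len h + 2 * len g"
    if gh: "g \<in> carrier G" "h \<in> carrier G" "len g < \<eta>" "len h < \<eta>" for g h
  proof -
    have p: "g \<otimes> h \<in> cdom \<kappa>" "nrm EL (cmap \<kappa> (g \<otimes> h) - cmap \<kappa> h - (cmap \<kappa> g - cmap \<kappa> \<one>)) \<le> 1 / 2 * len g"
      using d(3) gh by (auto simp: \<eta>_def)
    have g: "g \<in> cdom \<kappa>" "nrm EL (cmap \<kappa> g - cmap \<kappa> \<one>) = len g"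
      and h: "h \<in> cdom \<kappa>" "nrm EL (cmap \<kappa> h - cmap \<kappa> \<one>) = len h"
      using len_less_1[of g] len_less_1[of h] gh d by (auto simp: \<eta>_def)
    note s = \<kappa>_sp[OF p(1)] \<kappa>_sp[OF g(1)] \<kappa>_sp[OF h(1)] \<kappa>_sp[OF \<kappa>_facts(2)]
    define u v w where "u = cmap \<kappa> g - cmap \<kappa> \<one>" and "v = cmap \<kappa> h - cmap \<kappa> \<one>"
      and "w = cmap \<kappa> (g \<otimes> h) - cmap \<kappa> h - (cmap \<kappa> g - cmap \<kappa> \<one>)"
    have uvw: "u \<in> sp EL" "v \<in> sp EL" "w \<in> sp EL"
      unfolding u_def v_def w_def by (intro nspace_diff EL(1) s)+
    have "len (g \<otimes> h) = nrm EL (w + (u + v))" using p(1) by (simp add: len_def u_def v_def w_def)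
    also have "\<dots> \<le> nrm EL w + nrm EL (u + v)" by (intro nrm_triangle nspace_add EL(1) uvw)
    also have "nrm EL (u + v) \<le> nrm EL u + nrm EL v" by (intro nrm_triangle EL(1) uvw)
    finally show ?thesis using p(2) g(2) h(2) len_nonneg[of g] unfolding u_def v_def w_def by linarith
  qed
  have 2: "len (inv g) \<le> 2 * len g" if gc: "g \<in> carrier G" "len g < \<eta>" for g
  proof -
    have iW: "inv g \<in> W" using d' gc by (auto simp: \<eta>_def)
    have g: "g \<in> cdom \<kappa>" "nrm EL (cmap \<kappa> g - cmap \<kappa> \<one>) = len g"
      using len_less_1[of g] gc d by (auto simp: \<eta>_def)
    have i: "inv g \<in> cdom \<kappa>" "len (inv g) < \<delta>" using W(3) iW by auto
    then have i': "nrm EL (cmap \<kappa> (inv g) - cmap \<kappa> \<one>) = len (inv g)" by (simp add: len_def)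
    note s = \<kappa>_sp[OF g(1)] \<kappa>_sp[OF i(1)] \<kappa>_sp[OF \<kappa>_facts(2)]
    have lg: "len g < \<delta>" using gc by (simp add: \<eta>_def)
    have "nrm EL (cmap \<kappa> (inv g \<otimes> g) - cmap \<kappa> g - (cmap \<kappa> (inv g) - cmap \<kappa> \<one>)) \<le> 1 / 2 * len (inv g)"
      using d(3) gc(1) inv_closed[OF gc(1)] i(2) lg by blast
    then have e: "nrm EL (cmap \<kappa> \<one> - cmap \<kappa> g - (cmap \<kappa> (inv g) - cmap \<kappa> \<one>)) \<le> 1 / 2 * len (inv g)"
      unfolding l_inv[OF gc(1)] .
    have "nrm EL (cmap \<kappa> (inv g) - cmap \<kappa> \<one>) \<le> nrm EL (cmap \<kappa> \<one> - cmap \<kappa> g) +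
        nrm EL ((cmap \<kappa> (inv g) - cmap \<kappa> \<one>) - (cmap \<kappa> \<one> - cmap \<kappa> g))"
      using s EL by (intro nrm_triangle_rev nspace_diff) auto
    also have "nrm EL ((cmap \<kappa> (inv g) - cmap \<kappa> \<one>) - (cmap \<kappa> \<one> - cmap \<kappa> g)) =
        nrm EL (cmap \<kappa> \<one> - cmap \<kappa> g - (cmap \<kappa> (inv g) - cmap \<kappa> \<one>))"
      using s EL by (intro nrm_minus_commute nspace_diff) auto
    also have "nrm EL (cmap \<kappa> \<one> - cmap \<kappa> g) = len g"
      using nrm_minus_commute[OF EL(1) s(3,1)] g by simp
    finally show ?thesis using e i' by simp
  qed
  have "\<eta> > 0" "\<eta> \<le> 1" using d(1,2) d'(1) by (auto simp: \<eta>_def)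
  moreover have "\<forall>g\<in>carrier G. \<forall>h\<in>carrier G. len g < \<eta> \<and> len h < \<eta> \<longrightarrow> len (g \<otimes> h) \<le> len h + 2 * len g"
    using 1 by blast
  moreover have "\<forall>g\<in>carrier G. len g < \<eta> \<longrightarrow> len (inv g) \<le> 2 * len g" using 2 by blast
  ultimately show ?thesis by (rule that)
qed

lemma right_translation_continuous:
  assumes a: "a \<in> carrier G"
  shows "continuous_map (mtop L) (mtop L) (\<lambda>g. g \<otimes> a)"
proof -
  have mc: "continuous_map (prod_topology (mtop L) (mtop L)) (mtop L) (\<lambda>(g, h). g \<otimes> h)"
    using lie smooth_map_continuous[of "prod_manifold L L" L] by (simp add: lie_group_def prod_manifold_def)
  have "continuous_map (mtop L) (prod_topology (mtop L) (mtop L)) (\<lambda>g. (g, a))"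
    using a L_points by (intro continuous_map_pairedI) auto
  then show ?thesis using continuous_map_compose[OF _ mc] by (fastforce simp: comp_def)
qed

text \<open>
  Only the chart at the target is the one at the identity: right translation by \<open>a\<close> takes a
  neighbourhood of \<open>h\<close>, with its own chart, to a neighbourhood of \<open>\<one>\<close>.
\<close>

lemma right_translation_strict:
  assumes h: "h \<in> carrier G" and a: "a \<in> carrier G" and ha: "h \<otimes> a = \<one>"
  shows "\<exists>A. strict_deriv (tangent L h) EL (\<lambda>\<xi>. cmap \<kappa> (cinv (ref L h) \<xi> \<otimes> a)) A (cmap (ref L h) h)"
proof -
  define l m where "l = ref L h" and "m = ref L a"
  define Eh Ea where "Eh = tangent L h" and "Ea = tangent L a"
  have hL: "h \<in> points L" and aL: "a \<in> points L" using h a by (auto simp: L_points)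
  have l: "l \<in> charts L h" and m: "m \<in> charts L a"
    unfolding l_def m_def using banach_manifold_tangent(3)[OF L_manifold] hL aL by auto
  note lf = chart_facts[OF L_manifold hL l] and mf = chart_facts[OF L_manifold aL m]
  have nE: "normed_space Eh" "normed_space Ea"
    unfolding Eh_def Ea_def using banach_manifold_tangent(2)[OF L_manifold] hL aL by auto
  define P where "P = prod_nspace Eh Ea"
  have P: "normed_space P" unfolding P_def by (intro normed_space_prod nE)
  define c where "c = prod_chart l m"
  define W where "W = points (prod_manifold L L)"
  define f where "f = (\<lambda>(g, h). g \<otimes> h)"
  have W: "W = carrier G \<times> carrier G" by (simp add: W_def prod_manifold_def L_points)
  have dom: "cdom c = cdom l \<times> cdom m" and map: "cmap c (x, y) = (cmap l x, cmap m y)" for x y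
    by (auto simp: c_def prod_chart_def)
  have inj: "inj_on (cmap c) (cdom c)" using lf(6) mf(6) by (auto simp: dom map inj_on_def)
  have "smooth_map (prod_manifold L L) L f" using lie by (simp add: lie_group_def f_def)
  then have "Ck_map_on 1 (prod_manifold L L) L W f" unfolding W_def by (rule smooth_map_C1)
  moreover have "(h, a) \<in> points (prod_manifold L L)" using W W_def h a by simp
  moreover have "c \<in> charts (prod_manifold L L) (h, a)"
    using l m by (auto simp: prod_manifold_def c_def)
  moreover have "tangent (prod_manifold L L) (h, a) = P" by (simp add: prod_manifold_def P_def Eh_def Ea_def)
  ultimately have C: "Ck_on 1 P EL (rep_dom c \<kappa> W f) (rep c \<kappa> f)"
    using one_point kappa_chart unfolding Ck_map_on_def by metis
  have "(h, a) \<in> cdom c" "(h, a) \<in> W" "f (h, a) \<in> cdom \<kappa>"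
    using lf(2) mf(2) h a ha \<kappa>_facts(2) by (auto simp: dom W f_def)
  then have "cmap c (h, a) \<in> rep_dom c \<kappa> W f" by (auto simp: rep_dom_def)
  then obtain B where B: "strict_deriv P EL (rep c \<kappa> f) B (cmap l h, cmap m a)"
    using Ck_on_1_strict_deriv[OF C P EL(1)] unfolding map by blast
  have ms: "cmap m a \<in> sp Ea" "cmap l h \<in> sp Eh"
    using lf(7)[OF lf(2)] mf(7)[OF mf(2)] by (auto simp: Eh_def Ea_def)
  have i: "strict_deriv Eh P (\<lambda>\<xi>. (\<xi>, cmap m a)) (\<lambda>\<xi>. (\<xi>, 0)) (cmap l h)"
    unfolding strict_deriv_def bounded_linear_on_def
    using ms nE nrm_zero[OF nE(2)] nspace_zero[OF nE(2)]
    by (auto simp: P_def prod_nspace_def nball_def nrm_zero nrm_nonneg nspace_diff zero_prod_def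
        intro!: exI[of _ 1] max.boundedI)
  have s: "strict_deriv Eh EL (\<lambda>\<xi>. rep c \<kappa> f (\<xi>, cmap m a)) (\<lambda>\<xi>. B (\<xi>, 0)) (cmap l h)"
    by (rule strict_deriv_compose[OF i B nE(1) P EL(1)])
  obtain r where r: "r > 0" "\<forall>y\<in>nball Eh (cmap l h) r. cinv l y \<in> points L \<and> cinv l y \<in> cdom l \<and> cmap l (cinv l y) = y"
    using cinv_continuous[OF L_manifold hL l openin_topspace hL lf(2)] unfolding Eh_def by blast
  have "rep c \<kappa> f (\<xi>, cmap m a) = cmap \<kappa> (cinv l \<xi> \<otimes> a)" if "\<xi> \<in> nball Eh (cmap l h) r" for \<xi>
  proof -
    have x: "cinv l \<xi> \<in> cdom l" "cmap l (cinv l \<xi>) = \<xi>" using r(2) that by auto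
    have "cinv c (cmap c (cinv l \<xi>, a)) = (cinv l \<xi>, a)"
      by (rule cinv_cmap[OF inj]) (use x mf(2) in \<open>auto simp: dom\<close>)
    then show ?thesis using x by (simp add: rep_def f_def map)
  qed
  then have "strict_deriv Eh EL (\<lambda>\<xi>. cmap \<kappa> (cinv l \<xi> \<otimes> a)) (\<lambda>\<xi>. B (\<xi>, 0)) (cmap l h)"
    by (rule strict_deriv_transfer[OF s r(1)])
  then show ?thesis unfolding l_def Eh_def by blast
qed

end

section \<open>Uniform bounds for the action near the identity\<close>

locale smooth_action = lie_group_chart G L
  for G :: "'g monoid" (structure) and L :: "('g, 'l::real_vector) manifold" +
  fixes M :: "('q, 'e::real_vector) manifold" and \<Phi> :: "'g \<Rightarrow> 'q \<Rightarrow> 'q"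
  assumes M: "banach_manifold M"
    and act_closed: "\<And>g x. g \<in> carrier G \<Longrightarrow> x \<in> points M \<Longrightarrow> \<Phi> g x \<in> points M"
    and act_one: "\<And>x. x \<in> points M \<Longrightarrow> \<Phi> \<one> x = x"
    and act_mult: "\<And>g h x. g \<in> carrier G \<Longrightarrow> h \<in> carrier G \<Longrightarrow> x \<in> points M \<Longrightarrow>
      \<Phi> (g \<otimes> h) x = \<Phi> g (\<Phi> h x)"
    and act_continuous: "continuous_map (prod_topology (mtop L) (mtop M)) (mtop M) (\<lambda>(g, x). \<Phi> g x)"
    and act_smooth: "\<And>g. g \<in> carrier G \<Longrightarrow> smooth_map M M (\<Phi> g)"

begin

text \<open>Joint continuity at \<open>(\<one>, q)\<close>.\<close>

lemma act_near_identity: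
  assumes W: "openin (mtop M) W" "q \<in> W"
  obtains \<delta> W' where "\<delta> > 0" "\<delta> \<le> 1" "openin (mtop M) W'" "q \<in> W'"
    "\<forall>g. len g < \<delta> \<longrightarrow> (\<forall>x\<in>W'. \<Phi> g x \<in> W)"
proof -
  have q: "q \<in> points M" using openin_subset[OF W(1)] W(2) by auto
  define S where "S = {y \<in> topspace (prod_topology (mtop L) (mtop M)). (\<lambda>(g, x). \<Phi> g x) y \<in> W}"
  have S: "openin (prod_topology (mtop L) (mtop M)) S"
    unfolding S_def using act_continuous W(1) by (rule openin_continuous_map_preimage)
  have 1: "(\<one>, q) \<in> S" using q W one_point act_one by (simp add: S_def)
  obtain V W' where VW: "openin (mtop L) V" "openin (mtop M) W'" "\<one> \<in> V" "q \<in> W'" "V \<times> W' \<subseteq> S"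
    using iffD1[OF openin_prod_topology_alt S, rule_format, OF 1] by blast
  obtain \<delta> where d: "\<delta> > 0" "\<delta> \<le> 1" "\<forall>g. len g < \<delta> \<longrightarrow> g \<in> V"
    by (rule len_small_in_open[OF VW(1,3)])
  have "\<Phi> g x \<in> W" if "len g < \<delta>" "x \<in> W'" for g x
  proof -
    have "(g, x) \<in> S" using VW(5) d(3) that by blast
    then show ?thesis by (simp add: S_def)
  qed
  then show ?thesis using d(1,2) VW(2,4) by (intro that[of \<delta> W']) blast+
qed

lemma orbit_map_continuous:
  assumes x: "x \<in> points M"
  shows "continuous_map (mtop L) (mtop M) (\<lambda>g. \<Phi> g x)"
proof -
  have "continuous_map (mtop L) (prod_topology (mtop L) (mtop M)) (\<lambda>g. (g, x))"
    using x by (intro continuous_map_pairedI) auto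
  then show ?thesis using continuous_map_compose[OF _ act_continuous] by (fastforce simp: comp_def)
qed

text \<open>
  By Baire's theorem some common bound holds for all group elements near a suitable \<open>g1\<close>;
  composition with \<open>inv g1\<close> moves this neighbourhood to the identity.
\<close>

lemma uniform_tame:
  assumes b: "b \<in> points M" and c: "c \<in> charts M b" and q: "q \<in> cdom c"
  obtains \<eta> \<rho> R where "\<eta> > 0" "\<eta> \<le> 1" "\<rho> > 0" "R \<ge> 1"
    "\<forall>x\<in>nball (tangent M b) (cmap c q) \<rho>. cinv c x \<in> cdom c \<and> cmap c (cinv c x) = x"
    "\<forall>g\<in>carrier G. len g < \<eta> \<longrightarrow>
       (\<forall>x\<in>nball (tangent M b) (cmap c q) \<rho>. \<Phi> g (cinv c x) \<in> cdom c) \<and>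
       tame (tangent M b) (tangent M b) (\<lambda>x. cmap c (\<Phi> g (cinv c x))) (cmap c q) \<rho> R"
proof -
  define E p where "E = tangent M b" and "p = cmap c q"
  define F where "F g x = cmap c (\<Phi> g (cinv c x))" for g x
  note cf = chart_facts[OF M b c]
  have nE: "normed_space E" unfolding E_def by (rule banach_manifold_tangent[OF M b])
  have ps: "p \<in> sp E" unfolding p_def E_def by (rule cf(7)[OF q])
  have qM: "q \<in> points M" using q cf(3) by auto
  obtain \<eta>1 W where W: "\<eta>1 > 0" "\<eta>1 \<le> 1" "openin (mtop M) W" "q \<in> W"
    "\<forall>g. len g < \<eta>1 \<longrightarrow> (\<forall>x\<in>W. \<Phi> g x \<in> cdom c)"
    by (rule act_near_identity[OF cf(1) q])
  obtain \<rho>1 where r1: "\<rho>1 > 0"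
    "\<forall>y\<in>nball E p \<rho>1. cinv c y \<in> W \<and> cinv c y \<in> cdom c \<and> cmap c (cinv c y) = y"
    unfolding E_def p_def by (rule cinv_continuous[OF M b c W(3,4) q])
  have \<Phi>_dom: "\<Phi> g (cinv c x) \<in> cdom c" if "len g < \<eta>1" "x \<in> nball E p \<rho>1" for g x
    using W(5) r1(2) that by blast
  have F_sp: "F g x \<in> sp E" if "len g < \<eta>1" "x \<in> nball E p \<rho>1" for g x
    unfolding F_def E_def by (rule cf(7)[OF \<Phi>_dom[OF that]])
  define x1 where "x1 = cmap \<kappa> \<one>"
  have x1: "x1 \<in> sp EL" unfolding x1_def by (rule \<kappa>_sp[OF \<kappa>_facts(2)])
  obtain r2 where r2: "r2 > 0"
    "\<forall>y\<in>nball EL x1 r2. cinv \<kappa> y \<in> carrier G \<and> cinv \<kappa> y \<in> cdom \<kappa> \<and> cmap \<kappa> (cinv \<kappa> y) = y"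
    unfolding x1_def using cinv_continuous[OF L_manifold one_point kappa_chart openin_topspace one_point \<kappa>_facts(2)]
    by (auto simp: L_points)
  define \<eta>2 where "\<eta>2 = min \<eta>1 r2"
  have \<eta>2: "\<eta>2 > 0" using W r2 by (simp add: \<eta>2_def)
  have \<xi>: "cinv \<kappa> y \<in> carrier G" "cinv \<kappa> y \<in> cdom \<kappa>" "cmap \<kappa> (cinv \<kappa> y) = y" "len (cinv \<kappa> y) < \<eta>1"
    if "y \<in> nball EL x1 \<eta>2" for y
  proof -
    have "y \<in> nball EL x1 r2" using that by (auto simp: nball_def \<eta>2_def)
    then show k: "cinv \<kappa> y \<in> carrier G" "cinv \<kappa> y \<in> cdom \<kappa>" "cmap \<kappa> (cinv \<kappa> y) = y" using r2 by auto
    show "len (cinv \<kappa> y) < \<eta>1" using that k by (auto simp: len_def nball_def \<eta>2_def x1_def)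
  qed
  define rad where "rad n = \<rho>1 / real (Suc n)" for n
  have rad: "rad n > 0" "rad n \<le> \<rho>1" for n using r1 by (auto simp: rad_def field_simps)
  have rad_ball: "x \<in> nball E p \<rho>1" if "x \<in> nball E p (rad n)" for x n
    using that rad(2)[of n] by (auto simp: nball_def)
  define A where "A n = {y. tame E E (F (cinv \<kappa> y)) p (rad n) (real (Suc n))}" for n
  obtain n y1 d where n: "d > 0" "y1 \<in> nball EL x1 \<eta>2" "nball EL y1 d \<subseteq> nball EL x1 \<eta>2" "nball EL y1 d \<subseteq> A n"
  proof (rule Baire_nball[OF EL(2) x1 \<eta>2, of A])
    fix y assume y: "y \<in> nball EL x1 \<eta>2"
    define g where "g = cinv \<kappa> y"
    have g: "g \<in> carrier G" "len g < \<eta>1" using \<xi>[OF y] by (auto simp: g_def)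
    have gq: "\<Phi> g q \<in> cdom c" using W g by blast
    obtain r R where rR: "r > 0" "R \<ge> 1" "tame E E (F g) p r R"
      unfolding E_def F_def p_def
      by (rule smooth_map_tame[OF M b c M b c act_smooth[OF g(1)] q gq])
    obtain n1 :: nat where n1: "R \<le> real n1" using real_arch_simple by blast
    obtain n2 where n2: "inverse (real (Suc n2)) < r / \<rho>1" using reals_Archimedean[of "r / \<rho>1"] rR r1 by auto
    define n where "n = max n1 n2"
    have "rad n \<le> rad n2" using r1 unfolding rad_def by (intro divide_left_mono) (auto simp: n_def)
    also have "rad n2 \<le> r" using n2 r1 by (simp add: rad_def field_simps)
    finally have "tame E E (F g) p (rad n) (real (Suc n))"
      using n1 by (intro tame_mono[OF rR(3)] nE) (auto simp: n_def)
    then show "\<exists>n. y \<in> A n" by (auto simp: A_def g_def)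
  next
    fix n y assume y: "y \<in> nball EL x1 \<eta>2" "y \<notin> A n"
    show "\<exists>d>0. \<forall>y'\<in>nball EL y d \<inter> nball EL x1 \<eta>2. y' \<notin> A n"
    proof (rule ccontr)
      assume no: "\<not> ?thesis"
      define g where "g = cinv \<kappa> y"
      have g: "g \<in> carrier G" "g \<in> cdom \<kappa>" "cmap \<kappa> g = y" "len g < \<eta>1" using \<xi>[OF y(1)] by (auto simp: g_def)
      have cont: "\<exists>d>0. \<forall>y'\<in>nball EL y d. nrm E (F (cinv \<kappa> y') x - F g x) \<le> \<epsilon>"
        if x: "x \<in> nball E p \<rho>1" and \<epsilon>: "\<epsilon> > 0" for x \<epsilon>
      proof -
        define z where "z = cinv c x"
        have z: "z \<in> points M" using r1(2) x cf(3) by (auto simp: z_def)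
        have gz: "\<Phi> g z \<in> cdom c" unfolding z_def by (rule \<Phi>_dom[OF g(4) x])
        define O' where "O' = {u \<in> cdom c. cmap c u \<in> nball E (cmap c (\<Phi> g z)) \<epsilon>}"
        have O': "openin (mtop M) O'" unfolding O'_def E_def by (rule chart_ball_open[OF M b c gz])
        have op: "openin (mtop L) {h \<in> points L. \<Phi> h z \<in> O'}"
          using orbit_map_continuous[OF z] O' by (rule openin_continuous_map_preimage)
        have gO: "g \<in> {h \<in> points L. \<Phi> h z \<in> O'}"
          using g gz cf(7)[OF gz] nE \<epsilon> by (auto simp: L_points O'_def center_in_nball E_def)
        obtain d where "d > 0" "\<forall>y'\<in>nball EL (cmap \<kappa> g) d. cinv \<kappa> y' \<in> {h \<in> points L. \<Phi> h z \<in> O'} \<and>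
            cinv \<kappa> y' \<in> cdom \<kappa> \<and> cmap \<kappa> (cinv \<kappa> y') = y'"
          by (rule cinv_continuous[OF L_manifold one_point kappa_chart op gO g(2)])
        then show ?thesis using g(3) by (intro exI[of _ d]) (auto simp: O'_def nball_def F_def z_def)
      qed
      have "tame E E (F g) p (rad n) (real (Suc n))"
      proof (rule tame_limit[OF nE nE])
        show "F g x \<in> sp E" if "x \<in> nball E p (rad n)" for x by (rule F_sp[OF g(4) rad_ball[OF that]])
        fix S and \<epsilon> :: real assume S: "finite S" "S \<subseteq> nball E p (rad n)" "\<epsilon> > 0"
        have "\<exists>d>0. \<forall>x\<in>S. \<forall>y'\<in>nball EL y d. nrm E (F (cinv \<kappa> y') x - F g x) \<le> \<epsilon>"
          using S(1,2)
        proof (induction S rule: finite_induct)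
          case empty
          then show ?case by (auto intro: exI[of _ 1])
        next
          case (insert x S)
          then obtain d1 where d1: "d1 > 0" "\<forall>x\<in>S. \<forall>y'\<in>nball EL y d1. nrm E (F (cinv \<kappa> y') x - F g x) \<le> \<epsilon>" by auto
          have "x \<in> nball E p \<rho>1" using insert.prems by (intro rad_ball[of x n]) auto
          then obtain d2 where d2: "d2 > 0" "\<forall>y'\<in>nball EL y d2. nrm E (F (cinv \<kappa> y') x - F g x) \<le> \<epsilon>"
            using cont S(3) by blast
          show ?case using d1 d2 by (intro exI[of _ "min d1 d2"]) (auto simp: nball_def)
        qed
        then obtain d where d: "d > 0" "\<forall>x\<in>S. \<forall>y'\<in>nball EL y d. nrm E (F (cinv \<kappa> y') x - F g x) \<le> \<epsilon>" by blast
        then obtain y' where "y' \<in> nball EL y d" "y' \<in> A n" using no by blast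
        then show "\<exists>f'. tame E E f' p (rad n) (real (Suc n)) \<and> (\<forall>x\<in>S. nrm E (f' x - F g x) \<le> \<epsilon>)"
          using d by (intro exI[of _ "F (cinv \<kappa> y')"]) (auto simp: A_def)
      qed
      then show False using y(2) by (simp add: A_def g_def)
    qed
  qed (rule that)
  define g1 where "g1 = cinv \<kappa> y1"
  have g1: "g1 \<in> carrier G" "g1 \<in> cdom \<kappa>" "cmap \<kappa> g1 = y1" "len g1 < \<eta>1" using \<xi>[OF n(2)] by (auto simp: g1_def)
  have y1s: "y1 \<in> sp EL" using n(2) by (simp add: nball_def)
  have g1q: "\<Phi> g1 q \<in> cdom c" using W g1 by blast
  have cq: "cinv c p = q" unfolding p_def by (rule cinv_cmap[OF cf(6) q])
  define b1 where "b1 = cmap c (\<Phi> g1 q)"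
  have b1s: "b1 \<in> sp E" unfolding b1_def E_def by (rule cf(7)[OF g1q])
  have invg1: "\<Phi> (inv g1) (\<Phi> g1 x) = x" if "x \<in> points M" for x
    using act_mult[of "inv g1" g1 x] g1 act_one[OF that] that by simp
  have "\<Phi> (inv g1) (\<Phi> g1 q) \<in> cdom c" using invg1[OF qM] q by simp
  from smooth_map_tame[OF M b c M b c act_smooth[OF inv_closed[OF g1(1)]] g1q this]
  obtain r' R' where r': "r' > 0" "R' \<ge> 1" "tame E E (F (inv g1)) b1 r' R'"
    unfolding E_def F_def b1_def
    by blast
  \<comment> \<open>Group elements \<open>h = g1 \<otimes> g\<close> near \<open>g1\<close>: covered by the common bound, and \<open>F h p\<close> is near \<open>b1\<close>.\<close>
  define O1 where "O1 = {h \<in> cdom \<kappa>. cmap \<kappa> h \<in> nball EL y1 d}"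
  have "openin (mtop L) O1" unfolding O1_def g1(3)[symmetric]
    by (rule chart_ball_open[OF L_manifold one_point kappa_chart g1(2)])
  moreover have "g1 \<in> O1" using g1 n(1) y1s EL by (simp add: O1_def center_in_nball)
  ultimately obtain \<eta>3 where \<eta>3: "\<eta>3 > 0" "\<forall>g\<in>carrier G. len g < \<eta>3 \<longrightarrow> g1 \<otimes> g \<in> O1"
    by (rule left_translation_continuous)
  define O2 where "O2 = {h \<in> points L. \<Phi> h q \<in> {u \<in> cdom c. cmap c u \<in> nball E b1 (r' / 2)}}"
  have "openin (mtop L) O2" unfolding O2_def b1_def E_def
    using orbit_map_continuous[OF qM] chart_ball_open[OF M b c g1q] by (rule openin_continuous_map_preimage)
  moreover have "g1 \<in> O2" using g1 g1q b1s nE r' by (auto simp: O2_def L_points b1_def[symmetric] center_in_nball)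
  ultimately obtain \<eta>4 where \<eta>4: "\<eta>4 > 0" "\<forall>g\<in>carrier G. len g < \<eta>4 \<longrightarrow> g1 \<otimes> g \<in> O2"
    by (rule left_translation_continuous)
  define \<eta> where "\<eta> = min \<eta>1 (min \<eta>3 \<eta>4)"
  define K where "K = real (Suc n)"
  have K: "K > 0" by (simp add: K_def)
  define \<rho> where "\<rho> = min (rad n) (r' / (6 * K))"
  have \<rho>: "\<rho> > 0" "\<rho> \<le> rad n" "6 * K * \<rho> \<le> r'" using rad(1)[of n] r' K by (auto simp: \<rho>_def field_simps min_def)
  have \<rho>ball: "x \<in> nball E p \<rho>1" if "x \<in> nball E p \<rho>" for x
    using that \<rho>(2) rad(2)[of n] by (auto simp: nball_def)
  define R where "R = max 1 (R' * K + R' * K * K)"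
  have tame: "tame E E (F g) p \<rho> R" if g: "g \<in> carrier G" "len g < \<eta>" for g
  proof -
    define h where "h = g1 \<otimes> g"
    have hG: "h \<in> carrier G" using g g1 by (simp add: h_def)
    have "h \<in> O1" using \<eta>3 g by (auto simp: h_def \<eta>_def)
    then have h1: "h \<in> cdom \<kappa>" "cmap \<kappa> h \<in> nball EL y1 d" by (auto simp: O1_def)
    then have hA: "cmap \<kappa> h \<in> A n" "cmap \<kappa> h \<in> nball EL x1 \<eta>2" using n by auto
    have ch: "cinv \<kappa> (cmap \<kappa> h) = h" by (rule cinv_cmap[OF \<kappa>_facts(6) h1(1)])
    have hl: "len h < \<eta>1" using \<xi>(4)[OF hA(2)] by (simp add: ch)
    have t: "tame E E (F h) p \<rho> K"
      using hA(1) ch by (intro tame_mono[OF _ \<rho>(2) order_refl nE]) (simp add: A_def K_def)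
    have "h \<in> O2" using \<eta>4 g by (auto simp: h_def \<eta>_def)
    then have "nrm E (F h p - b1) < r' / 2" by (auto simp: O2_def F_def cq nball_def)
    then have "tame E E (\<lambda>x. F (inv g1) (F h x)) p \<rho> (R' * K + R' * K * K)"
      using \<rho> r' K by (intro tame_compose[OF t r'(3) nE nE nE ps \<rho>(1) b1s]) auto
    then have "tame E E (F g) p \<rho> (R' * K + R' * K * K)"
    proof (rule tame_transfer)
      fix x assume x: "x \<in> nball E p \<rho>"
      then have x1: "x \<in> nball E p \<rho>1" by (rule \<rho>ball)
      have z: "cinv c x \<in> points M" using r1(2) x1 cf(3) by auto
      have "cinv c (cmap c (\<Phi> h (cinv c x))) = \<Phi> h (cinv c x)"
        by (rule cinv_cmap[OF cf(6) \<Phi>_dom[OF hl x1]])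
      then show "F (inv g1) (F h x) = F g x"
        using g g1 act_mult[of g1 g "cinv c x"] z invg1[OF act_closed[OF g(1) z]] by (simp add: F_def h_def)
    qed
    then show ?thesis by (rule tame_mono) (use nE in \<open>auto simp: R_def\<close>)
  qed
  show ?thesis
  proof (rule that[of \<eta> \<rho> R])
    show "\<eta> > 0" "\<eta> \<le> 1" using W \<eta>3 \<eta>4 by (auto simp: \<eta>_def)
    show "\<rho> > 0" "R \<ge> 1" using \<rho> by (auto simp: R_def)
    show "\<forall>x\<in>nball (tangent M b) (cmap c q) \<rho>. cinv c x \<in> cdom c \<and> cmap c (cinv c x) = x"
      using r1(2) \<rho>ball by (auto simp: E_def p_def)
    show "\<forall>g\<in>carrier G. len g < \<eta> \<longrightarrow>
       (\<forall>x\<in>nball (tangent M b) (cmap c q) \<rho>. \<Phi> g (cinv c x) \<in> cdom c) \<and>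
       tame (tangent M b) (tangent M b) (\<lambda>x. cmap c (\<Phi> g (cinv c x))) (cmap c q) \<rho> R"
      using tame \<Phi>_dom \<rho>ball unfolding E_def p_def F_def by (auto simp: \<eta>_def)
  qed
qed

end

section \<open>Joint differentiability of the action\<close>

text \<open>
  In a chart and its restriction the inclusion is represented by the identity, which is therefore
  differentiable, hence Lipschitz, from the strong to the weak norm.
\<close>

lemma inclusion_bounded:
  assumes M1: "banach_manifold M1" and M0: "banach_manifold M0"
    and smooth: "smooth_map M1 M0 (\<lambda>q. q)" and b: "b \<in> points M1" "b \<in> points M0"
    and c: "c \<in> charts M0 b" and c1: "\<lparr>cdom = cdom c \<inter> points M1, cmap = cmap c\<rparr> \<in> charts M1 b"
  obtains C where "C \<ge> 1" "\<forall>v\<in>sp (tangent M1 b). nrm (tangent M0 b) v \<le> C * nrm (tangent M1 b) v"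
proof -
  define E1 E0 c' p where "E1 = tangent M1 b" and "E0 = tangent M0 b"
    and "c' = \<lparr>cdom = cdom c \<inter> points M1, cmap = cmap c\<rparr>" and "p = cmap c b"
  have nE: "normed_space E1" "normed_space E0"
    unfolding E1_def E0_def using banach_manifold_tangent[OF M1 b(1)] banach_manifold_tangent[OF M0 b(2)] by auto
  have c': "c' \<in> charts M1 b" using c1 by (simp add: c'_def)
  have bc: "b \<in> cdom c'" "b \<in> cdom c" using chart_facts(2)[OF M1 b(1) c'] by (auto simp: c'_def)
  have p: "cmap c' b = p" by (simp add: c'_def p_def)
  obtain A where A: "strict_deriv E1 E0 (\<lambda>y. cmap c (cinv c' y)) A p"
    using Ck_map_on_strict_deriv[OF M1 b(1) c' M0 b(2) c smooth_map_C1[OF smooth] bc(1) b(1) bc(2)]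
    unfolding E1_def E0_def p by blast
  obtain K \<delta> where K: "K > 0" "\<delta> > 0" "\<forall>y\<in>nball E1 p \<delta>. cmap c (cinv c' y) \<in> sp E0"
    "\<forall>y\<in>nball E1 p \<delta>. \<forall>z\<in>nball E1 p \<delta>. nrm E0 (cmap c (cinv c' y) - cmap c (cinv c' z)) \<le> K * nrm E1 (y - z)"
    by (rule strict_deriv_Lipschitz[OF A nE])
  obtain r where r: "r > 0" "\<forall>y\<in>nball E1 p r. cinv c' y \<in> points M1 \<and> cinv c' y \<in> cdom c' \<and> cmap c' (cinv c' y) = y"
    using cinv_continuous[OF M1 b(1) c' openin_topspace b(1) bc(1)] unfolding E1_def p by blast
  define \<rho> where "\<rho> = min \<delta> r"
  have \<rho>: "\<rho> > 0" using K r by (simp add: \<rho>_def)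
  have ps: "p \<in> sp E1" using chart_facts(7)[OF M1 b(1) c' bc(1)] by (simp add: E1_def p)
  have step: "nrm E0 (y - z) \<le> K * nrm E1 (y - z)" if yz: "y \<in> nball E1 p \<rho>" "z \<in> nball E1 p \<rho>" for y z
  proof -
    have "y \<in> nball E1 p r" "z \<in> nball E1 p r" "y \<in> nball E1 p \<delta>" "z \<in> nball E1 p \<delta>"
      using yz by (auto simp: \<rho>_def nball_def)
    then show ?thesis using K(4)[rule_format, of y z] r(2) by (simp add: c'_def)
  qed
  have "nrm E0 v \<le> max 1 K * nrm E1 v" if v: "v \<in> sp E1" for v
  proof -
    have nv: "0 \<le> nrm E1 v" by (rule nrm_nonneg[OF nE(1) v])
    define t where "t = \<rho> / (nrm E1 v + 1)"
    have t: "t > 0" "t * nrm E1 v < \<rho>" using nv \<rho> by (auto simp: t_def field_simps)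
    have tv: "t *\<^sub>R v \<in> sp E1" "nrm E1 (t *\<^sub>R v) = t * nrm E1 v"
      using v nE t by (auto simp: nspace_scale nrm_scale)
    have "p + t *\<^sub>R v \<in> nball E1 p \<rho>" using t tv ps nE by (auto simp: nball_def intro: nspace_add)
    moreover have pb: "p \<in> nball E1 p \<rho>" by (rule center_in_nball[OF nE(1) ps \<rho>])
    ultimately have "nrm E0 (t *\<^sub>R v) \<le> K * (t * nrm E1 v)" using step[of "p + t *\<^sub>R v" p] tv by simp
    moreover have "v \<in> sp E0"
    proof -
      have "cmap c (cinv c' y) \<in> sp E0" if "y \<in> nball E1 p \<rho>" for y
      proof -
        have "y \<in> nball E1 p r" using that by (auto simp: \<rho>_def nball_def)
        then have "cinv c' y \<in> cdom c" using r(2) by (auto simp: c'_def)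
        then show ?thesis unfolding E0_def by (rule chart_facts(7)[OF M0 b(2) c])
      qed
      moreover have "cmap c (cinv c' y) = y" if "y \<in> nball E1 p \<rho>" for y
      proof -
        have "y \<in> nball E1 p r" using that by (auto simp: \<rho>_def nball_def)
        then show ?thesis using r(2) by (simp add: c'_def)
      qed
      ultimately have "p + t *\<^sub>R v - p \<in> sp E0"
        using \<open>p + t *\<^sub>R v \<in> nball E1 p \<rho>\<close> pb by (intro nspace_diff nE(2)) metis+
      then have "(1 / t) *\<^sub>R (p + t *\<^sub>R v - p) \<in> sp E0" by (rule nspace_scale[OF nE(2)])
      moreover have "(1 / t) *\<^sub>R (p + t *\<^sub>R v - p) = v" using t by simp
      ultimately show ?thesis by (simp only:)
    qed
    ultimately have "t * nrm E0 v \<le> t * (K * nrm E1 v)" using t nE by (simp add: nrm_scale algebra_simps)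
    then have "nrm E0 v \<le> K * nrm E1 v" using t by simp
    also have "\<dots> \<le> max 1 K * nrm E1 v" using nv by (intro mult_right_mono) auto
    finally show ?thesis .
  qed
  then show ?thesis using that[of "max 1 K"] by (simp add: E0_def E1_def)
qed

text \<open>Two neighbouring members \<open>M1 = Q s\<close> and \<open>M0 = Q (s - 1)\<close> of a chain, with the action on them.\<close>

locale two_level_action = lie_group_chart G L
  for G :: "'g monoid" (structure) and L :: "('g, 'l::real_vector) manifold" +
  fixes M1 M0 :: "('q, 'e::real_vector) manifold" and \<Phi> :: "'g \<Rightarrow> 'q \<Rightarrow> 'q"
  assumes action1: "smooth_action G L M1 \<Phi>" and action0: "smooth_action G L M0 \<Phi>"
    and points_sub: "points M1 \<subseteq> points M0"
    and inclusion_smooth: "smooth_map M1 M0 (\<lambda>q. q)"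
    and tangent_sub: "\<And>b. b \<in> points M1 \<Longrightarrow> sp (tangent M1 b) \<subseteq> sp (tangent M0 b)"
    and chart_restrict: "\<And>b c. b \<in> points M1 \<Longrightarrow> c \<in> charts M0 b \<Longrightarrow>
      \<lparr>cdom = cdom c \<inter> points M1, cmap = cmap c\<rparr> \<in> charts M1 b"
    and orbit_C1: "\<And>x. x \<in> points M1 \<Longrightarrow> Ck_map 1 L M0 (\<lambda>g. \<Phi> g x)"

begin

sublocale A1: smooth_action G L M1 \<Phi> by (rule action1)

sublocale A0: smooth_action G L M0 \<Phi> by (rule action0)

text \<open>
  The derivative of \<open>(g, x) \<mapsto> \<Phi> g x\<close> at \<open>(\<one>, q)\<close>, as a map from the stronger to the weaker
  manifold. The term in \<open>g\<close> is controlled by the group law, which reduces it to the differential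
  of the orbit map at \<open>q\<close> alone.
\<close>

lemma action_strict:
  assumes b: "b \<in> points M1" and c: "c \<in> charts M0 b" and q: "q \<in> cdom c" "q \<in> points M1"
  obtains X where "bounded_linear_on EL (tangent M0 b) X"
    "\<forall>\<epsilon>>0. \<exists>\<delta>>0. \<forall>g\<in>carrier G. \<forall>h\<in>carrier G. len g < \<delta> \<and> len h < \<delta> \<longrightarrow>
      (\<forall>w\<in>nball (tangent M1 b) (cmap c q) \<delta>. \<forall>w'\<in>nball (tangent M1 b) (cmap c q) \<delta>.
        cmap c (\<Phi> g (cinv c w)) \<in> sp (tangent M0 b) \<and>
        nrm (tangent M0 b) (cmap c (\<Phi> g (cinv c w)) - cmap c (\<Phi> h (cinv c w')) -
          X (cmap \<kappa> g - cmap \<kappa> h) - (w - w')) \<le>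
        \<epsilon> * (nrm EL (cmap \<kappa> g - cmap \<kappa> h) + nrm (tangent M1 b) (w - w')))"
proof -
  define E1 E0 c1 p where "E1 = tangent M1 b" and "E0 = tangent M0 b"
    and "c1 = \<lparr>cdom = cdom c \<inter> points M1, cmap = cmap c\<rparr>" and "p = cmap c q"
  define F where "F g x = cmap c (\<Phi> g (cinv c x))" for g x
  have b0: "b \<in> points M0" using b points_sub by auto
  have c1: "c1 \<in> charts M1 b" unfolding c1_def by (rule chart_restrict[OF b c])
  have q1: "q \<in> cdom c1" using q by (simp add: c1_def)
  have bE: "banach_space E1" "normed_space E1" "normed_space E0"
    unfolding E1_def E0_def using banach_manifold_tangent[OF A1.M b] banach_manifold_tangent[OF A0.M b0] by auto
  have p: "p \<in> sp E1" using chart_facts(7)[OF A1.M b c1 q1] by (simp add: E1_def p_def c1_def)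
  have pp: "cmap c1 q = p" by (simp add: c1_def p_def)
  note inj0 = chart_facts(6)[OF A0.M b0 c] and inj1 = chart_facts(6)[OF A1.M b c1]
  obtain C where C: "C \<ge> 1" "\<forall>v\<in>sp E1. nrm E0 v \<le> C * nrm E1 v"
    using inclusion_bounded[OF A1.M A0.M inclusion_smooth b b0 c chart_restrict[OF b c]]
    unfolding E1_def E0_def by blast
  have incl: "v \<in> sp E0 \<and> nrm E0 v \<le> C * nrm E1 v" if "v \<in> sp E1" for v
    using that C tangent_sub[OF b] by (auto simp: E1_def E0_def)
  obtain \<eta>0 \<rho>0 R0 where U0: "\<eta>0 > 0" "\<eta>0 \<le> 1" "\<rho>0 > 0" "R0 \<ge> 1"
    "\<forall>x\<in>nball E0 p \<rho>0. cinv c x \<in> cdom c \<and> cmap c (cinv c x) = x"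
    "\<forall>g\<in>carrier G. len g < \<eta>0 \<longrightarrow>
       (\<forall>x\<in>nball E0 p \<rho>0. \<Phi> g (cinv c x) \<in> cdom c) \<and>
       tame E0 E0 (\<lambda>x. cmap c (\<Phi> g (cinv c x))) p \<rho>0 R0"
    unfolding E0_def p_def by (rule A0.uniform_tame[OF b0 c q(1)])
  obtain \<eta>1 \<rho>1 R1 where U1: "\<eta>1 > 0" "\<eta>1 \<le> 1" "\<rho>1 > 0" "R1 \<ge> 1"
    "\<forall>x\<in>nball E1 p \<rho>1. cinv c1 x \<in> cdom c1 \<and> cmap c1 (cinv c1 x) = x"
    "\<forall>g\<in>carrier G. len g < \<eta>1 \<longrightarrow>
       (\<forall>x\<in>nball E1 p \<rho>1. \<Phi> g (cinv c1 x) \<in> cdom c1) \<and>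
       tame E1 E1 (\<lambda>x. cmap c1 (\<Phi> g (cinv c1 x))) p \<rho>1 R1"
    unfolding E1_def pp[symmetric] by (rule A1.uniform_tame[OF b c1 q1])
  obtain \<eta>2 where U2: "\<eta>2 > 0" "\<eta>2 \<le> 1"
    "\<forall>g\<in>carrier G. \<forall>h\<in>carrier G. len g < \<eta>2 \<and> len h < \<eta>2 \<longrightarrow> len (g \<otimes> h) \<le> len h + 2 * len g"
    "\<forall>g\<in>carrier G. len g < \<eta>2 \<longrightarrow> len (inv g) \<le> 2 * len g"
    by (rule len_mult_inv)
  define \<eta> \<rho> R where "\<eta> = min \<eta>0 (min \<eta>1 \<eta>2)" and "\<rho> = min \<rho>0 \<rho>1" and "R = max R0 R1"
  have \<eta>: "\<eta> > 0" "\<eta> \<le> \<eta>0" "\<eta> \<le> \<eta>1" "\<eta> \<le> \<eta>2" using U0(1) U1(1) U2(1) by (auto simp: \<eta>_def)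
  have \<rho>: "\<rho> > 0" using U0(3) U1(3) by (simp add: \<rho>_def)
  have R: "R \<ge> 1" "R0 \<le> R" "R1 \<le> R" using U0(4) by (auto simp: R_def)
  have ball0: "x \<in> nball E0 p \<rho>0" if "x \<in> nball E0 p \<rho>" for x using that by (auto simp: \<rho>_def nball_def)
  have ball1: "x \<in> nball E1 p \<rho>1" if "x \<in> nball E1 p \<rho>" for x using that by (auto simp: \<rho>_def nball_def)
  have cinv1: "cinv c1 x = cinv c x" "cinv c x \<in> points M1" "cinv c x \<in> cdom c" "cmap c (cinv c x) = x"
    if "x \<in> nball E1 p \<rho>" for x
  proof -
    have x: "cinv c1 x \<in> cdom c1" "cmap c1 (cinv c1 x) = x" using U1(5) ball1[OF that] by auto
    have "cinv c (cmap c (cinv c1 x)) = cinv c1 x" using x by (intro cinv_cmap[OF inj0]) (simp add: c1_def)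
    then show "cinv c1 x = cinv c x" using x(2) by (simp add: c1_def)
    then show "cinv c x \<in> points M1" "cinv c x \<in> cdom c" "cmap c (cinv c x) = x"
      using x by (auto simp: c1_def)
  qed
  have cinv0: "cinv c x \<in> points M0" "cinv c x \<in> cdom c" "cmap c (cinv c x) = x"
    if "x \<in> nball E0 p \<rho>" for x
    using U0(5) ball0[OF that] chart_facts(3)[OF A0.M b0 c] by auto
  have dom0: "\<Phi> g (cinv c x) \<in> cdom c" if "g \<in> carrier G" "len g < \<eta>" "x \<in> nball E0 p \<rho>" for g x
    using U0(6) that \<eta>(2) ball0 by auto
  have dom1: "\<Phi> g (cinv c x) \<in> cdom c1" if "g \<in> carrier G" "len g < \<eta>" "x \<in> nball E1 p \<rho>" for g x
    using U1(6) that \<eta>(3) ball1 cinv1(1)[OF that(3)] by (metis less_le_trans)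
  have cq: "cinv c p = q" unfolding p_def by (rule cinv_cmap[OF inj0 q(1)])
  have orbit_strict: "\<exists>A. strict_deriv EL E0 (\<lambda>y. cmap c (\<Phi> (cinv \<kappa> y) x)) A (cmap \<kappa> \<one>)"
    if x: "x \<in> points M1" "x \<in> cdom c" for x
  proof -
    have "Ck_map_on 1 L M0 (points L) (\<lambda>g. \<Phi> g x)" using orbit_C1[OF x(1)] by (simp add: Ck_map_def)
    moreover have "\<Phi> \<one> x \<in> cdom c" using A1.act_one[OF x(1)] x(2) by simp
    ultimately show ?thesis
      using Ck_map_on_strict_deriv[OF L_manifold one_point kappa_chart A0.M b0 c _ \<kappa>_facts(2) one_point]
      unfolding E0_def by blast
  qed
  interpret two_norm_action G E0 E1 len F p \<rho> R C \<eta>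
  proof unfold_locales
    show "normed_space E0" "banach_space E1" "p \<in> sp E1" "0 < \<rho>" "1 \<le> R" "1 \<le> C" "0 < \<eta>"
      by (rule bE p \<rho> R C(1) \<eta>)+
    show "x \<in> sp E0 \<and> nrm E0 x \<le> C * nrm E1 x" if "x \<in> sp E1" for x by (rule incl[OF that])
    show "0 \<le> len g" for g by (rule len_nonneg)
    show "(len g = 0) = (g = \<one>)" for g by (rule len_eq_0)
    show "len (g \<otimes> h) \<le> len h + 2 * len g"
      if "g \<in> carrier G" "h \<in> carrier G" "len g < \<eta>" "len h < \<eta>" for g h
    proof -
      have "len g < \<eta>2" "len h < \<eta>2" using that(3,4) \<eta>(4) by auto
      then show ?thesis using U2(3) that(1,2) by blast
    qed
    show "len (inv g) \<le> 2 * len g" if "g \<in> carrier G" "len g < \<eta>" for g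
    proof -
      have "len g < \<eta>2" using that(2) \<eta>(4) by auto
      then show ?thesis using U2(4) that(1) by blast
    qed
    show "F \<one> x = x" if "x \<in> nball E0 p \<rho>" for x
      using cinv0[OF that] A0.act_one by (simp add: F_def)
    show "F g (F h x) = F (g \<otimes> h) x"
      if "g \<in> carrier G" "h \<in> carrier G" "len h < \<eta>" "x \<in> nball E0 p \<rho>" for g h x
      using cinv_cmap[OF inj0 dom0[OF that(2-4)]] A0.act_mult[OF that(1,2) cinv0(1)[OF that(4)]]
      by (simp add: F_def)
    show "tame E E (F g) p \<rho> R" if E: "E \<in> {E0, E1}" and g: "g \<in> carrier G" "len g < \<eta>" for E g
    proof -
      have t0: "tame E0 E0 (F g) p \<rho> R"
      proof -
        have "tame E0 E0 (F g) p \<rho>0 R0" using U0(6) g \<eta>(2) unfolding F_def by auto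
        then show ?thesis by (rule tame_mono) (auto simp: \<rho>_def R bE)
      qed
      have t1: "tame E1 E1 (F g) p \<rho> R"
      proof -
        have "tame E1 E1 (\<lambda>x. cmap c1 (\<Phi> g (cinv c1 x))) p \<rho>1 R1" using U1(6) g \<eta>(3) by auto
        then have "tame E1 E1 (\<lambda>x. cmap c1 (\<Phi> g (cinv c1 x))) p \<rho> R"
          by (rule tame_mono) (auto simp: \<rho>_def R bE)
        then show ?thesis by (rule tame_transfer) (simp add: F_def cinv1(1), simp add: c1_def)
      qed
      show ?thesis using E t0 t1 by blast
    qed
    show "\<exists>T. strict_deriv E E (F g) T x"
      if E: "E \<in> {E0, E1}" and g: "g \<in> carrier G" "len g < \<eta>" and x: "x \<in> nball E p \<rho>" for E g x
    proof (cases "E = E0")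
      case True
      then have x0: "x \<in> nball E0 p \<rho>" using x by simp
      obtain T where "strict_deriv E0 E0 (F g) T (cmap c (cinv c x))"
        using Ck_map_on_strict_deriv[OF A0.M b0 c A0.M b0 c smooth_map_C1[OF A0.act_smooth[OF g(1)]]
            cinv0(2)[OF x0] cinv0(1)[OF x0] dom0[OF g x0]]
        unfolding E0_def F_def by blast
      then show ?thesis using True cinv0(3)[OF x0] by auto
    next
      case False
      then have E1: "E = E1" using E by simp
      then have x1: "x \<in> nball E1 p \<rho>" using x by simp
      have xc1: "cinv c x \<in> cdom c1" using cinv1[OF x1] by (simp add: c1_def)
      obtain T where T: "strict_deriv E1 E1 (\<lambda>y. cmap c1 (\<Phi> g (cinv c1 y))) T (cmap c1 (cinv c x))"
        using Ck_map_on_strict_deriv[OF A1.M b c1 A1.M b c1 smooth_map_C1[OF A1.act_smooth[OF g(1)]]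
            xc1 cinv1(2)[OF x1] dom1[OF g x1]]
        unfolding E1_def by blast
      have "cmap c1 (cinv c x) = x" using cinv1(4)[OF x1] by (simp add: c1_def)
      then have T': "strict_deriv E1 E1 (\<lambda>y. cmap c1 (\<Phi> g (cinv c1 y))) T x" using T by simp
      obtain r where r: "r > 0" "nball E1 x r \<subseteq> nball E1 p \<rho>" by (rule nball_in_nball[OF bE(2) p x1])
      have "cmap c1 (\<Phi> g (cinv c1 y)) = F g y" if "y \<in> nball E1 x r" for y
      proof -
        have "y \<in> nball E1 p \<rho>" using r(2) that by blast
        then show ?thesis using cinv1(1)[of y] by (simp add: F_def c1_def)
      qed
      then have "strict_deriv E1 E1 (F g) T x" by (rule strict_deriv_transfer[OF T' r(1)])
      then show ?thesis using E1 by blast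
    qed
    show "\<exists>\<delta>>0. \<forall>g\<in>carrier G. len g < \<delta> \<longrightarrow> F g p \<in> nball E1 p \<epsilon>" if \<epsilon>: "\<epsilon> > 0" for \<epsilon>
    proof -
      define W where "W = {y \<in> cdom c1. cmap c1 y \<in> nball E1 (cmap c1 q) \<epsilon>}"
      have W: "openin (mtop M1) W" unfolding W_def E1_def by (rule chart_ball_open[OF A1.M b c1 q1])
      have qW: "q \<in> W" using q1 center_in_nball[OF bE(2) p \<epsilon>] by (simp add: W_def pp)
      obtain \<delta> W' where d: "\<delta> > 0" "\<delta> \<le> 1" "openin (mtop M1) W'" "q \<in> W'"
        "\<forall>g. len g < \<delta> \<longrightarrow> (\<forall>x\<in>W'. \<Phi> g x \<in> W)"
        by (rule A1.act_near_identity[OF W qW])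
      have "F g p \<in> nball E1 p \<epsilon>" if "len g < \<delta>" for g
      proof -
        have "\<Phi> g q \<in> W" using d(4,5) that by blast
        then show ?thesis using pp by (simp add: W_def F_def cq c1_def)
      qed
      then show ?thesis using d(1) by blast
    qed
    show "\<exists>m \<delta>. \<delta> > 0 \<and> (\<forall>g\<in>carrier G. len g < \<delta> \<longrightarrow> nrm E0 (F g x - x) \<le> m * len g)"
      if x: "x \<in> nball E1 p \<rho>" for x
    proof -
      obtain A where A: "strict_deriv EL E0 (\<lambda>y. cmap c (\<Phi> (cinv \<kappa> y) (cinv c x))) A (cmap \<kappa> \<one>)"
        using orbit_strict[OF cinv1(2,3)[OF x]] by blast
      obtain K d where K: "K > 0" "d > 0" "\<forall>y\<in>nball EL (cmap \<kappa> \<one>) d. cmap c (\<Phi> (cinv \<kappa> y) (cinv c x)) \<in> sp E0"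
          "\<forall>y\<in>nball EL (cmap \<kappa> \<one>) d. \<forall>z\<in>nball EL (cmap \<kappa> \<one>) d. nrm E0 (cmap c (\<Phi> (cinv \<kappa> y) (cinv c x)) - cmap c (\<Phi> (cinv \<kappa> z) (cinv c x))) \<le> K * nrm EL (y - z)"
        by (rule strict_deriv_Lipschitz[OF A EL(1) bE(3)])
      have "nrm E0 (F g x - x) \<le> K * len g" if g: "len g < min 1 d" for g
      proof -
        have gk: "g \<in> cdom \<kappa>" "nrm EL (cmap \<kappa> g - cmap \<kappa> \<one>) = len g" using len_less_1[of g] g by auto
        then have "cmap \<kappa> g \<in> nball EL (cmap \<kappa> \<one>) d" using g \<kappa>_sp by (simp add: nball_def)
        moreover have "cmap \<kappa> \<one> \<in> nball EL (cmap \<kappa> \<one>) d"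
          by (rule center_in_nball[OF EL(1) \<kappa>_sp[OF \<kappa>_facts(2)] K(2)])
        ultimately have "nrm E0 (F g x - cmap c (\<Phi> \<one> (cinv c x))) \<le> K * len g"
          using K(4)[rule_format, of "cmap \<kappa> g" "cmap \<kappa> \<one>"] cinv_cmap[OF \<kappa>_facts(6) gk(1)]
            cinv_cmap[OF \<kappa>_facts(6) \<kappa>_facts(2)] gk(2) by (simp add: F_def)
        then show ?thesis using A1.act_one[OF cinv1(2)[OF x]] cinv1(4)[OF x] by simp
      qed
      then show ?thesis using K(2) by (intro exI[of _ K] exI[of _ "min 1 d"]) auto
    qed
  qed
  obtain K \<delta>0 where K: "K > 0" "\<delta>0 > 0"
    "\<forall>g\<in>carrier G. \<forall>z\<in>sp E1. len g < \<delta>0 \<and> nrm E1 z < \<delta>0 \<longrightarrow>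
      nrm E0 (F g (p + z) - F g p - z) \<le> K * len g * nrm E1 z"
    "\<forall>g\<in>carrier G. \<forall>z\<in>sp E1. \<forall>w\<in>sp E1. len g < \<delta>0 \<and> nrm E1 z < \<delta>0 \<and> nrm E1 w < \<delta>0 \<longrightarrow>
      nrm E0 (F g (p + z) - F g (p + w) - (z - w)) \<le> K * (len g + nrm E1 z + nrm E1 w) * nrm E1 (z - w)"
    by (rule two_norm_estimate)
  obtain X where X: "strict_deriv EL E0 (\<lambda>y. cmap c (\<Phi> (cinv \<kappa> y) q)) X (cmap \<kappa> \<one>)"
    using orbit_strict[OF q(2,1)] by blast
  have Xlin: "bounded_linear_on EL E0 X" using X by (rule strict_derivD)
  obtain B where B: "B > 0" "\<And>x. x \<in> sp EL \<Longrightarrow> nrm E0 (X x) \<le> B * nrm EL x"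
    using bounded_linear_on_bound[OF Xlin EL(1)] by blast
  have "\<exists>\<delta>>0. \<forall>g\<in>carrier G. \<forall>h\<in>carrier G. len g < \<delta> \<and> len h < \<delta> \<longrightarrow>
      (\<forall>w\<in>nball E1 p \<delta>. \<forall>w'\<in>nball E1 p \<delta>. F g w \<in> sp E0 \<and>
        nrm E0 (F g w - F h w' - X (cmap \<kappa> g - cmap \<kappa> h) - (w - w')) \<le>
        \<epsilon> * (nrm EL (cmap \<kappa> g - cmap \<kappa> h) + nrm E1 (w - w')))" if \<epsilon>: "\<epsilon> > 0" for \<epsilon>
  proof -
    define \<epsilon>1 where "\<epsilon>1 = min (1 / 2) (\<epsilon> / (8 * B))"
    have \<epsilon>1: "\<epsilon>1 > 0" "\<epsilon>1 \<le> 1 / 2" "B * \<epsilon>1 \<le> \<epsilon> / 8"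
      using \<epsilon> B(1) by (auto simp: \<epsilon>1_def field_simps min_def)
    obtain \<delta>1 where d1: "\<delta>1 > 0" "\<delta>1 \<le> 1" "\<forall>g\<in>carrier G. \<forall>h\<in>carrier G. len g < \<delta>1 \<and> len h < \<delta>1 \<longrightarrow>
      g \<otimes> h \<in> cdom \<kappa> \<and> nrm EL (cmap \<kappa> (g \<otimes> h) - cmap \<kappa> h - (cmap \<kappa> g - cmap \<kappa> \<one>)) \<le> \<epsilon>1 * len g"
      by (rule mult_first_order[OF \<epsilon>1(1)])
    have "\<epsilon> / 8 > 0" using \<epsilon> by simp
    from strict_derivD(3)[OF X this] obtain \<delta>2 where d2: "\<delta>2 > 0"
      "\<forall>y\<in>nball EL (cmap \<kappa> \<one>) \<delta>2. \<forall>z\<in>nball EL (cmap \<kappa> \<one>) \<delta>2. cmap c (\<Phi> (cinv \<kappa> y) q) \<in> sp E0 \<and>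
        nrm E0 (cmap c (\<Phi> (cinv \<kappa> y) q) - cmap c (\<Phi> (cinv \<kappa> z) q) - X (y - z)) \<le> \<epsilon> / 8 * nrm EL (y - z)"
      by blast
    define \<epsilon>2 where "\<epsilon>2 = min \<rho> (min \<delta>0 (\<epsilon> / (8 * K)))"
    have \<epsilon>2: "\<epsilon>2 > 0" "\<epsilon>2 \<le> \<rho>" "\<epsilon>2 \<le> \<delta>0" "K * \<epsilon>2 \<le> \<epsilon> / 8"
    proof -
      show "\<epsilon>2 > 0" using \<rho> K(1,2) \<epsilon> by (simp add: \<epsilon>2_def)
      show "\<epsilon>2 \<le> \<rho>" "\<epsilon>2 \<le> \<delta>0" unfolding \<epsilon>2_def by linarith+
      have "\<epsilon>2 \<le> \<epsilon> / (8 * K)" unfolding \<epsilon>2_def by linarith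
      then show "K * \<epsilon>2 \<le> \<epsilon> / 8" using K(1) by (simp add: field_simps)
    qed
    have "\<epsilon>2 / 2 > 0" using \<epsilon>2 by simp
    then obtain \<delta>3 where d3: "\<delta>3 > 0" "\<forall>g\<in>carrier G. len g < \<delta>3 \<longrightarrow> F g p \<in> nball E1 p (\<epsilon>2 / 2)"
      using orbit_continuous by blast
    define \<delta> where "\<delta> = min (min \<delta>0 (min \<delta>1 (min \<delta>2 \<eta>)) / 4) (min \<delta>3 (min (\<epsilon>2 / (2 * R)) (\<epsilon> / (3 * K))))"
    have R0: "R > 0" using R by simp
    have \<delta>: "\<delta> > 0" "4 * \<delta> \<le> \<delta>0" "4 * \<delta> \<le> \<delta>1" "4 * \<delta> \<le> \<delta>2" "4 * \<delta> \<le> \<eta>" "\<delta> \<le> \<delta>3"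
      "R * \<delta> \<le> \<epsilon>2 / 2" "3 * K * \<delta> \<le> \<epsilon>"
    proof -
      show "\<delta> > 0" using K(1,2) d1(1) d2(1) \<eta>(1) d3(1) \<epsilon>2(1) R0 \<epsilon> by (simp add: \<delta>_def)
      show "4 * \<delta> \<le> \<delta>0" "4 * \<delta> \<le> \<delta>1" "4 * \<delta> \<le> \<delta>2" "4 * \<delta> \<le> \<eta>" "\<delta> \<le> \<delta>3" unfolding \<delta>_def by linarith+
      have "\<delta> \<le> \<epsilon>2 / (2 * R)" "\<delta> \<le> \<epsilon> / (3 * K)" unfolding \<delta>_def by linarith+
      then show "R * \<delta> \<le> \<epsilon>2 / 2" "3 * K * \<delta> \<le> \<epsilon>" using R0 K(1) by (simp_all add: field_simps)
    qed
    have "\<epsilon>2 / (2 * R) \<le> \<epsilon>2 / 2" using R \<epsilon>2(1) by (intro divide_left_mono) auto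
    then have \<delta>\<epsilon>2: "\<delta> \<le> \<epsilon>2 / 2" unfolding \<delta>_def by linarith
    have main: "F g w \<in> sp E0 \<and> nrm E0 (F g w - F h w' - X (cmap \<kappa> g - cmap \<kappa> h) - (w - w')) \<le>
        \<epsilon> * (nrm EL (cmap \<kappa> g - cmap \<kappa> h) + nrm E1 (w - w'))"
      if g: "g \<in> carrier G" "len g < \<delta>" and h: "h \<in> carrier G" "len h < \<delta>"
        and w: "w \<in> nball E1 p \<delta>" "w' \<in> nball E1 p \<delta>" for g h w w'
    proof -
      have ws: "w \<in> sp E1" "w' \<in> sp E1" using w by (auto simp: nball_def)
      have wb: "w \<in> nball E1 p \<rho>" "w' \<in> nball E1 p \<rho>" using w \<delta>\<epsilon>2 \<epsilon>2(1,2) by (auto simp: nball_def)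
      have V: "g \<in> V" "h \<in> V" using g h \<delta>(1,5) by (auto simp: V_def)
      have z: "w - p \<in> sp E1" "w' - p \<in> sp E1" using ws p bE(2) by (auto intro: nspace_diff)
      have zn: "nrm E1 (w - p) < \<delta>" "nrm E1 (w' - p) < \<delta>" using w by (auto simp: nball_def)
      have Fs1: "F g w \<in> sp E1" "F h w \<in> sp E1" "F h w' \<in> sp E1" "F h p \<in> sp E1"
        using F_sp[of E1] V wb p_ball[of E1] by auto
      \<comment> \<open>Comparing \<open>g\<close> with \<open>h\<close> at \<open>w\<close> amounts to comparing \<open>k\<close> with \<open>\<one>\<close> at \<open>F h w\<close>, a point near \<open>p\<close>.\<close>
      define k where "k = g \<otimes> inv h"
      have k: "k \<in> carrier G" "k \<otimes> h = g" using g h by (simp_all add: k_def m_assoc)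
      have lk: "len k < 4 * \<delta>"
      proof -
        have 1: "len (inv h) \<le> 2 * len h" using h \<delta>(1,5) by (intro len_inv) auto
        then have "len k \<le> len (inv h) + 2 * len g"
          unfolding k_def using g h \<delta>(1,5) by (intro len_mult) auto
        then show ?thesis using 1 g h by simp
      qed
      have kV: "k \<in> V" using k lk \<delta>(5) by (simp add: V_def)
      have lk1: "len k < 1" using lk \<delta>(3) d1(2) by simp
      have k\<kappa>: "k \<in> cdom \<kappa>" "nrm EL (cmap \<kappa> k - cmap \<kappa> \<one>) = len k" using len_less_1[OF lk1] by auto
      have "len g < 1" "len h < 1" using g h \<delta>(1,3) d1(2) by auto
      then have gh\<kappa>: "g \<in> cdom \<kappa>" "h \<in> cdom \<kappa>" using len_less_1 by blast+
      define v d where "v = cmap \<kappa> k - cmap \<kappa> \<one>" and "d = cmap \<kappa> g - cmap \<kappa> h"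
      have vd: "v \<in> sp EL" "d \<in> sp EL"
        unfolding v_def d_def by (intro nspace_diff EL(1) \<kappa>_sp k\<kappa> gh\<kappa> \<kappa>_facts(2))+
      have dv: "nrm EL (d - v) \<le> \<epsilon>1 * len k"
      proof -
        have "len k < \<delta>1" "len h < \<delta>1" using lk h \<delta>(1,3) by auto
        then show ?thesis using d1(3) k h(1) unfolding d_def v_def by metis
      qed
      have lk0: "0 \<le> len k" by (rule len_nonneg[OF k(1)])
      have nk: "len k \<le> 2 * nrm EL d"
      proof -
        have "nrm EL v \<le> nrm EL d + nrm EL (v - d)" by (rule nrm_triangle_rev[OF EL(1) vd])
        also have "nrm EL (v - d) = nrm EL (d - v)" by (rule nrm_minus_commute[OF EL(1) vd])
        also have "\<dots> \<le> 1 / 2 * len k"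
          using dv \<epsilon>1(2) lk0 mult_right_mono[OF \<epsilon>1(2), of "len k"] by linarith
        finally show ?thesis using k\<kappa>(2) by (simp add: v_def)
      qed
      define u where "u = F h w"
      have us: "u - p \<in> sp E1" using Fs1 p bE(2) by (auto simp: u_def intro: nspace_diff)
      have un: "nrm E1 (u - p) < \<epsilon>2"
      proof -
        have "nrm E1 (u - p) \<le> nrm E1 (F h w - F h p) + nrm E1 (F h p - p)"
          unfolding u_def by (intro nrm_triangle_via bE Fs1 p)
        also have "nrm E1 (F h w - F h p) \<le> R * nrm E1 (w - p)"
          using tameD(2)[OF tame_V[of E1 h] wb(1) p_ball[of E1]] V by simp
        also have "\<dots> \<le> R * \<delta>" using zn R0 by (intro mult_left_mono) auto
        also have "\<dots> \<le> \<epsilon>2 / 2" by (rule \<delta>)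
        also have "nrm E1 (F h p - p) < \<epsilon>2 / 2" using d3(2) h \<delta>(6) by (auto simp: nball_def)
        finally show ?thesis by simp
      qed
      have F_gw: "F g w = F k u"
      proof -
        have "cinv c (cmap c (\<Phi> h (cinv c w))) = \<Phi> h (cinv c w)"
          using dom1[OF h(1) _ wb(1)] V by (intro cinv_cmap[OF inj0]) (auto simp: c1_def V_def)
        then show ?thesis
          using A1.act_mult[OF k(1) h(1) cinv1(2)[OF wb(1)]] by (simp add: F_def u_def k(2))
      qed
      have up: "p + (u - p) = u" by simp
      have Fk: "F k u \<in> sp E0" "F k p \<in> sp E0" "u \<in> sp E0" "p \<in> sp E0"
        using Fs1 incl F_gw p F_sp[of E1 k p] p_ball[of E1] kV by (auto simp: u_def)
      have Xs: "X v \<in> sp E0" "X d \<in> sp E0" by (rule bounded_linear_onD(1)[OF Xlin vd(1)] bounded_linear_onD(1)[OF Xlin vd(2)])+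
      have t1: "nrm E0 (F k u - F k p - (u - p)) \<le> \<epsilon> / 8 * len k"
      proof -
        have "nrm E0 (F k (p + (u - p)) - F k p - (u - p)) \<le> K * len k * nrm E1 (u - p)"
          using K(3) k(1) us un lk \<delta>(2) \<epsilon>2(3) by (meson less_le_trans)
        also have "\<dots> \<le> K * len k * \<epsilon>2" using un K(1) lk0 by (intro mult_left_mono) auto
        also have "\<dots> = K * \<epsilon>2 * len k" by simp
        also have "\<dots> \<le> \<epsilon> / 8 * len k" by (intro mult_right_mono \<epsilon>2 lk0)
        finally show ?thesis unfolding up .
      qed
      have t2: "nrm E0 (F k p - p - X v) \<le> \<epsilon> / 8 * len k"
      proof -
        have "cmap \<kappa> k \<in> nball EL (cmap \<kappa> \<one>) \<delta>2" "cmap \<kappa> \<one> \<in> nball EL (cmap \<kappa> \<one>) \<delta>2"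
          using k\<kappa> lk \<delta>(4) \<kappa>_sp \<kappa>_facts(2) d2(1) EL by (auto simp: nball_def nrm_zero)
        then have "nrm E0 (cmap c (\<Phi> (cinv \<kappa> (cmap \<kappa> k)) q) - cmap c (\<Phi> (cinv \<kappa> (cmap \<kappa> \<one>)) q) - X v) \<le> \<epsilon> / 8 * nrm EL v"
          using d2(2) unfolding v_def by blast
        then show ?thesis
          using cinv_cmap[OF \<kappa>_facts(6) k\<kappa>(1)] cinv_cmap[OF \<kappa>_facts(6) \<kappa>_facts(2)] A1.act_one[OF q(2)] k\<kappa>(2)
          by (simp add: F_def cq p_def[symmetric] v_def)
      qed
      have t3: "nrm E0 (X v - X d) \<le> \<epsilon> / 8 * len k"
      proof -
        have "nrm E0 (X v - X d) = nrm E0 (X (v - d))" by (simp add: bounded_linear_on_diff[OF Xlin EL(1) vd])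
        also have "\<dots> \<le> B * nrm EL (v - d)" by (intro B(2) nspace_diff EL(1) vd)
        also have "nrm EL (v - d) = nrm EL (d - v)" by (rule nrm_minus_commute[OF EL(1) vd])
        also have "B * \<dots> \<le> B * (\<epsilon>1 * len k)" using dv B(1) by (intro mult_left_mono) auto
        also have "\<dots> = (B * \<epsilon>1) * len k" by simp
        also have "\<dots> \<le> \<epsilon> / 8 * len k" by (intro mult_right_mono \<epsilon>1 lk0)
        finally show ?thesis .
      qed
      have t4: "nrm E0 (F h w - F h w' - (w - w')) \<le> \<epsilon> * nrm E1 (w - w')"
      proof -
        have "nrm E0 (F h (p + (w - p)) - F h (p + (w' - p)) - ((w - p) - (w' - p))) \<le>
            K * (len h + nrm E1 (w - p) + nrm E1 (w' - p)) * nrm E1 ((w - p) - (w' - p))"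
        proof -
          have "len h < \<delta>0" "nrm E1 (w - p) < \<delta>0" "nrm E1 (w' - p) < \<delta>0" using h zn \<delta>(1,2) by auto
          then show ?thesis using K(4) h(1) z by blast
        qed
        also have "\<dots> \<le> K * (3 * \<delta>) * nrm E1 ((w - p) - (w' - p))"
          using h zn K(1) by (intro mult_right_mono mult_left_mono nrm_nonneg[OF bE(2) nspace_diff[OF bE(2) z]]) auto
        also have "\<dots> \<le> \<epsilon> * nrm E1 ((w - p) - (w' - p))"
          using \<delta>(8) by (intro mult_right_mono nrm_nonneg[OF bE(2) nspace_diff[OF bE(2) z]]) (auto simp: ac_simps)
        finally show ?thesis by simp
      qed
      define x1 x2 x3 x4 where "x1 = F k u - F k p - (u - p)" and "x2 = F k p - p - X v"
        and "x3 = X v - X d" and "x4 = F h w - F h w' - (w - w')"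
      have xs: "x1 \<in> sp E0" "x2 \<in> sp E0" "x3 \<in> sp E0" "x4 \<in> sp E0"
        unfolding x1_def x2_def x3_def x4_def using Fk Xs Fs1 incl ws bE(3)
        by (auto intro!: nspace_diff)
      \<comment> \<open>The errors: moving the base point to \<open>p\<close>, the orbit map at \<open>p\<close>, the group chart, and \<open>F h\<close> alone.\<close>
      have "F g w - F h w' - X d - (w - w') = (x1 + x2) + (x3 + x4)"
        by (simp add: F_gw x1_def x2_def x3_def x4_def u_def)
      then have "nrm E0 (F g w - F h w' - X d - (w - w')) \<le> (nrm E0 x1 + nrm E0 x2) + (nrm E0 x3 + nrm E0 x4)"
        using nrm_triangle[OF bE(3) nspace_add[OF bE(3) xs(1,2)] nspace_add[OF bE(3) xs(3,4)]]
          nrm_triangle[OF bE(3) xs(1,2)] nrm_triangle[OF bE(3) xs(3,4)] by simp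
      also have "\<dots> \<le> 3 * (\<epsilon> / 8 * len k) + \<epsilon> * nrm E1 (w - w')"
        using t1 t2 t3 t4 by (simp add: x1_def x2_def x3_def x4_def)
      also have "\<epsilon> / 8 * len k \<le> \<epsilon> / 8 * (2 * nrm EL d)" using nk \<epsilon> by (intro mult_left_mono) auto
      also have "3 * (\<epsilon> / 8 * (2 * nrm EL d)) \<le> \<epsilon> * nrm EL d"
        using \<epsilon> nrm_nonneg[OF EL(1) vd(2)] by simp
      finally have "nrm E0 (F g w - F h w' - X d - (w - w')) \<le> \<epsilon> * (nrm EL d + nrm E1 (w - w'))"
        by (simp add: distrib_left)
      moreover have "F g w \<in> sp E0" using Fk F_gw by simp
      ultimately show ?thesis by (simp add: d_def)
    qed
    then show ?thesis using \<delta>(1) by blast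
  qed
  then show ?thesis using that[of X] Xlin unfolding E0_def E1_def F_def p_def by blast
qed

text \<open>
  The chain rule for \<open>x \<mapsto> \<Phi> (k x) (f x)\<close>. It mixes two levels: \<open>f\<close> is differentiable into the
  strong manifold, the composite only into the weak one. The value \<open>\<one>\<close> of \<open>k\<close> at \<open>x0\<close> is where
  \<open>action_strict\<close> applies.
\<close>

lemma action_compose_strict:
  assumes b: "b \<in> points M1" and c: "c \<in> charts M0 b" and q: "q \<in> cdom c" "q \<in> points M1"
    and E: "normed_space E" and k: "strict_deriv E EL (\<lambda>x. cmap \<kappa> (k x)) A x0" "k x0 = \<one>"
    and f: "strict_deriv E (tangent M1 b) (\<lambda>x. cmap c (f x)) B x0" "f x0 = q"
    and r: "r > 0" "\<And>x. x \<in> nball E x0 r \<Longrightarrow> k x \<in> carrier G \<and> k x \<in> cdom \<kappa> \<and> f x \<in> cdom c"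
  shows "\<exists>D. strict_deriv E (tangent M0 b) (\<lambda>x. cmap c (\<Phi> (k x) (f x))) D x0"
proof -
  define E1 E0 where "E1 = tangent M1 b" and "E0 = tangent M0 b"
  have b0: "b \<in> points M0" using b points_sub by auto
  have nE: "normed_space E1" "normed_space E0"
    unfolding E1_def E0_def using banach_manifold_tangent[OF A1.M b] banach_manifold_tangent[OF A0.M b0] by auto
  note f1 = f(1)[folded E1_def]
  obtain C where C: "C \<ge> 1" "\<forall>v\<in>sp E1. nrm E0 v \<le> C * nrm E1 v"
    using inclusion_bounded[OF A1.M A0.M inclusion_smooth b b0 c chart_restrict[OF b c]]
    unfolding E1_def E0_def by blast
  have E10: "v \<in> sp E0" if "v \<in> sp E1" for v using that tangent_sub[OF b] by (auto simp: E1_def E0_def)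
  obtain X where X: "bounded_linear_on EL E0 X"
    "\<forall>\<epsilon>>0. \<exists>\<delta>>0. \<forall>g\<in>carrier G. \<forall>h\<in>carrier G. len g < \<delta> \<and> len h < \<delta> \<longrightarrow>
      (\<forall>w\<in>nball E1 (cmap c q) \<delta>. \<forall>w'\<in>nball E1 (cmap c q) \<delta>.
        cmap c (\<Phi> g (cinv c w)) \<in> sp E0 \<and>
        nrm E0 (cmap c (\<Phi> g (cinv c w)) - cmap c (\<Phi> h (cinv c w')) -
          X (cmap \<kappa> g - cmap \<kappa> h) - (w - w')) \<le>
        \<epsilon> * (nrm EL (cmap \<kappa> g - cmap \<kappa> h) + nrm E1 (w - w')))"
    unfolding E0_def E1_def by (rule action_strict[OF b c q])
  note A = strict_derivD(2)[OF k(1)] and B = strict_derivD(2)[OF f1]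
  have x0: "x0 \<in> sp E" using k(1) by (rule strict_derivD)
  obtain KA where KA: "KA > 0" "\<And>v. v \<in> sp EL \<Longrightarrow> nrm E0 (X v) \<le> KA * nrm EL v"
    using bounded_linear_on_bound[OF X(1) EL(1)] by blast
  obtain K1 \<delta>1 where K1': "K1 > 0" "\<delta>1 > 0" "\<forall>y\<in>nball E x0 \<delta>1. cmap \<kappa> (k y) \<in> sp EL"
    "\<forall>y\<in>nball E x0 \<delta>1. \<forall>z\<in>nball E x0 \<delta>1. nrm EL (cmap \<kappa> (k y) - cmap \<kappa> (k z)) \<le> K1 * nrm E (y - z)"
    by (rule strict_deriv_Lipschitz[OF k(1) E EL(1)])
  note K1 = K1'[rule_format]
  obtain K2 \<delta>2 where K2': "K2 > 0" "\<delta>2 > 0" "\<forall>y\<in>nball E x0 \<delta>2. cmap c (f y) \<in> sp E1"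
    "\<forall>y\<in>nball E x0 \<delta>2. \<forall>z\<in>nball E x0 \<delta>2. nrm E1 (cmap c (f y) - cmap c (f z)) \<le> K2 * nrm E (y - z)"
    by (rule strict_deriv_Lipschitz[OF f1 E nE(1)])
  note K2 = K2'[rule_format]
  have B0: "bounded_linear_on E E0 B"
  proof -
    obtain KB where KB: "KB > 0" "\<And>v. v \<in> sp E \<Longrightarrow> nrm E1 (B v) \<le> KB * nrm E v"
      using bounded_linear_on_bound[OF B E] by blast
    have "nrm E0 (B v) \<le> (C * KB) * nrm E v" if v: "v \<in> sp E" for v
    proof -
      have "nrm E0 (B v) \<le> C * nrm E1 (B v)" using C(2) bounded_linear_onD(1)[OF B v] by blast
      also have "\<dots> \<le> C * (KB * nrm E v)" using KB(2)[OF v] C(1) by (intro mult_left_mono) auto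
      finally show ?thesis by simp
    qed
    then show ?thesis using B E10 unfolding bounded_linear_on_def by blast
  qed
  have D: "bounded_linear_on E E0 (\<lambda>v. X (A v) + B v)"
    by (intro bounded_linear_on_add bounded_linear_on_compose[OF A X(1) E EL(1)] B0 E nE)
  have inj0: "inj_on (cmap c) (cdom c)" by (rule chart_facts(6)[OF A0.M b0 c])
  have "strict_deriv E E0 (\<lambda>x. cmap c (\<Phi> (k x) (f x))) (\<lambda>v. X (A v) + B v) x0"
    unfolding strict_deriv_def
  proof (intro conjI allI impI x0 D)
    fix \<epsilon> :: real assume \<epsilon>: "\<epsilon> > 0"
    define KK where "KK = K1 + K2"
    have KK: "KK > 0" using K1(1) K2(1) by (simp add: KK_def)
    define e1 e2 e3 where "e1 = \<epsilon> / (3 * KK)" and "e2 = \<epsilon> / (3 * KA)" and "e3 = \<epsilon> / (3 * C)"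
    have e: "e1 > 0" "e2 > 0" "e3 > 0" using \<epsilon> KK KA(1) C(1) by (auto simp: e1_def e2_def e3_def)
    obtain d where d: "d > 0" "\<forall>g\<in>carrier G. \<forall>h\<in>carrier G. len g < d \<and> len h < d \<longrightarrow>
      (\<forall>w\<in>nball E1 (cmap c q) d. \<forall>w'\<in>nball E1 (cmap c q) d.
        cmap c (\<Phi> g (cinv c w)) \<in> sp E0 \<and>
        nrm E0 (cmap c (\<Phi> g (cinv c w)) - cmap c (\<Phi> h (cinv c w')) -
          X (cmap \<kappa> g - cmap \<kappa> h) - (w - w')) \<le>
        e1 * (nrm EL (cmap \<kappa> g - cmap \<kappa> h) + nrm E1 (w - w')))"
      using X(2) e(1) by blast
    obtain d1 where d1: "d1 > 0" "\<forall>y\<in>nball E x0 d1. \<forall>z\<in>nball E x0 d1. cmap \<kappa> (k y) \<in> sp EL \<and>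
        nrm EL (cmap \<kappa> (k y) - cmap \<kappa> (k z) - A (y - z)) \<le> e2 * nrm E (y - z)"
      using strict_derivD(3)[OF k(1) e(2)] by blast
    obtain d2 where d2: "d2 > 0" "\<forall>y\<in>nball E x0 d2. \<forall>z\<in>nball E x0 d2. cmap c (f y) \<in> sp E1 \<and>
        nrm E1 (cmap c (f y) - cmap c (f z) - B (y - z)) \<le> e3 * nrm E (y - z)"
      using strict_derivD(3)[OF f1 e(3)] by blast
    define \<delta> where "\<delta> = Min {r, \<delta>1, \<delta>2, d1, d2, d / K1, d / K2}"
    have \<delta>: "\<delta> > 0" "\<delta> \<le> r" "\<delta> \<le> \<delta>1" "\<delta> \<le> \<delta>2" "\<delta> \<le> d1" "\<delta> \<le> d2" "\<delta> \<le> d / K1" "\<delta> \<le> d / K2"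
    proof -
      show "\<delta> > 0" using r(1) K1(1,2) K2(1,2) d(1) d1(1) d2(1) by (simp add: \<delta>_def)
    qed (unfold \<delta>_def, (rule Min_le; simp)+)
    have sub: "y \<in> nball E x0 s" if "y \<in> nball E x0 \<delta>" "\<delta> \<le> s" for y s
      using that by (auto simp: nball_def)
    have xb: "x0 \<in> nball E x0 \<delta>" by (rule center_in_nball[OF E x0 \<delta>(1)])
    have near: "len (k y) < d" "cmap c (f y) \<in> nball E1 (cmap c q) d" "k y \<in> carrier G" "f y \<in> cdom c"
      "cmap \<kappa> (k y) \<in> sp EL" "cmap c (f y) \<in> sp E1" if y: "y \<in> nball E x0 \<delta>" for y
    proof -
      have kr: "k y \<in> carrier G \<and> k y \<in> cdom \<kappa> \<and> f y \<in> cdom c" by (rule r(2)[OF sub[OF y \<delta>(2)]])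
      then show "k y \<in> carrier G" "f y \<in> cdom c" by auto
      show "cmap \<kappa> (k y) \<in> sp EL" "cmap c (f y) \<in> sp E1"
        by (rule K1(3)[OF sub[OF y \<delta>(3)]] K2(3)[OF sub[OF y \<delta>(4)]])+
      have ny: "nrm E (y - x0) < \<delta>" using y by (simp add: nball_def)
      have "nrm EL (cmap \<kappa> (k y) - cmap \<kappa> (k x0)) \<le> K1 * nrm E (y - x0)"
        by (rule K1(4)[OF sub[OF y \<delta>(3)] sub[OF xb \<delta>(3)]])
      also have "\<dots> < K1 * (d / K1)" using ny \<delta>(7) K1(1) by (intro mult_strict_left_mono) auto
      finally show "len (k y) < d" using kr K1(1) by (simp add: len_def k(2))
      have "nrm E1 (cmap c (f y) - cmap c (f x0)) \<le> K2 * nrm E (y - x0)"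
        by (rule K2(4)[OF sub[OF y \<delta>(4)] sub[OF xb \<delta>(4)]])
      also have "\<dots> < K2 * (d / K2)" using ny \<delta>(8) K2(1) by (intro mult_strict_left_mono) auto
      finally show "cmap c (f y) \<in> nball E1 (cmap c q) d"
        using K2(1) K2(3)[OF sub[OF y \<delta>(4)]] by (simp add: nball_def f(2))
    qed
    have "cmap c (\<Phi> (k y) (f y)) \<in> sp E0 \<and>
        nrm E0 (cmap c (\<Phi> (k y) (f y)) - cmap c (\<Phi> (k z) (f z)) - (X (A (y - z)) + B (y - z))) \<le> \<epsilon> * nrm E (y - z)"
      if y: "y \<in> nball E x0 \<delta>" and z: "z \<in> nball E x0 \<delta>" for y z
    proof -
      note ny = near[OF y] and nz = near[OF z]
      define P where "P y = cmap c (\<Phi> (k y) (f y))" for y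
      define a where "a = cmap \<kappa> (k y) - cmap \<kappa> (k z)"
      define w where "w = cmap c (f y) - cmap c (f z)"
      define v where "v = y - z"
      have vs: "v \<in> sp E" using y z E by (auto simp: v_def nball_def intro: nspace_diff)
      have nv: "0 \<le> nrm E v" by (rule nrm_nonneg[OF E vs])
      have as: "a \<in> sp EL" "A v \<in> sp EL" unfolding a_def
        by (rule nspace_diff[OF EL(1) ny(5) nz(5)] bounded_linear_onD(1)[OF A vs])+
      have ws: "w \<in> sp E1" "B v \<in> sp E1" unfolding w_def
        by (rule nspace_diff[OF nE(1) ny(6) nz(6)] bounded_linear_onD(1)[OF B vs])+
      have Pc: "P y = cmap c (\<Phi> (k y) (cinv c (cmap c (f y))))" "P z = cmap c (\<Phi> (k z) (cinv c (cmap c (f z))))"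
        using cinv_cmap[OF inj0 ny(4)] cinv_cmap[OF inj0 nz(4)] by (simp_all add: P_def)
      have P: "P y \<in> sp E0" "nrm E0 (P y - P z - X a - w) \<le> e1 * (nrm EL a + nrm E1 w)"
        using d(2) ny(1-3) nz(1-3) unfolding Pc a_def w_def by blast+
      have Pz: "P z \<in> sp E0" using d(2) ny(1-3) nz(1-3) unfolding Pc by blast
      have na: "nrm EL a \<le> K1 * nrm E v" unfolding a_def v_def
        by (rule K1(4)[OF sub[OF y \<delta>(3)] sub[OF z \<delta>(3)]])
      have nw: "nrm E1 w \<le> K2 * nrm E v" unfolding w_def v_def
        by (rule K2(4)[OF sub[OF y \<delta>(4)] sub[OF z \<delta>(4)]])
      have t1: "nrm E0 (P y - P z - X a - w) \<le> \<epsilon> / 3 * nrm E v"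
      proof -
        have "e1 * (nrm EL a + nrm E1 w) \<le> e1 * (KK * nrm E v)"
          using na nw e(1) by (intro mult_left_mono) (auto simp: distrib_right KK_def)
        also have "\<dots> = \<epsilon> / 3 * nrm E v" using KK by (simp add: e1_def)
        finally show ?thesis using P(2) by simp
      qed
      have t2: "nrm E0 (X a - X (A v)) \<le> \<epsilon> / 3 * nrm E v"
      proof -
        have "nrm E0 (X a - X (A v)) = nrm E0 (X (a - A v))" by (simp add: bounded_linear_on_diff[OF X(1) EL(1) as])
        also have "\<dots> \<le> KA * nrm EL (a - A v)" by (intro KA(2) nspace_diff EL(1) as)
        also have "\<dots> \<le> KA * (e2 * nrm E v)"
          using d1(2) sub[OF y \<delta>(5)] sub[OF z \<delta>(5)] KA(1) unfolding a_def v_def by (intro mult_left_mono) auto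
        also have "\<dots> = \<epsilon> / 3 * nrm E v" using KA(1) by (simp add: e2_def)
        finally show ?thesis .
      qed
      have t3: "nrm E0 (w - B v) \<le> \<epsilon> / 3 * nrm E v"
      proof -
        have "nrm E0 (w - B v) \<le> C * nrm E1 (w - B v)" using C(2) nspace_diff[OF nE(1) ws] by blast
        also have "\<dots> \<le> C * (e3 * nrm E v)"
          using d2(2) sub[OF y \<delta>(6)] sub[OF z \<delta>(6)] C(1) unfolding w_def v_def by (intro mult_left_mono) auto
        also have "\<dots> = \<epsilon> / 3 * nrm E v" using C(1) by (simp add: e3_def)
        finally show ?thesis .
      qed
      have Xs: "X a \<in> sp E0" "X (A v) \<in> sp E0"
        by (rule bounded_linear_onD(1)[OF X(1) as(1)] bounded_linear_onD(1)[OF X(1) as(2)])+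
      have s: "P y - P z - X a - w \<in> sp E0" "X a - X (A v) \<in> sp E0" "w - B v \<in> sp E0"
        by (intro nspace_diff nE(2) P(1) Pz Xs E10 ws)+
      have eq: "P y - P z - (X (A v) + B v) = (P y - P z - X a - w) + ((X a - X (A v)) + (w - B v))" by simp
      have "nrm E0 (P y - P z - (X (A v) + B v)) \<le>
          nrm E0 (P y - P z - X a - w) + (nrm E0 (X a - X (A v)) + nrm E0 (w - B v))"
        unfolding eq using nrm_triangle[OF nE(2) s(1) nspace_add[OF nE(2) s(2,3)]] nrm_triangle[OF nE(2) s(2,3)]
        by linarith
      also have "\<dots> \<le> \<epsilon> * nrm E v" using t1 t2 t3 by simp
      finally show ?thesis using P(1) by (simp add: P_def v_def)
    qed
    then show "\<exists>\<delta>>0. \<forall>y\<in>nball E x0 \<delta>. \<forall>z\<in>nball E x0 \<delta>. cmap c (\<Phi> (k y) (f y)) \<in> sp E0 \<and>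
        nrm E0 (cmap c (\<Phi> (k y) (f y)) - cmap c (\<Phi> (k z) (f z)) - (X (A (y - z)) + B (y - z))) \<le> \<epsilon> * nrm E (y - z)"
      using \<delta>(1) by blast
  qed
  then show ?thesis unfolding E0_def by blast
qed

end

section \<open>Normal spaces of orbits\<close>

lemma has_fderiv_on_of_strict:
  assumes A: "strict_deriv E F f A x" and x: "x \<in> U" and E: "normed_space E"
  shows "has_fderiv_on E F U f A x"
  unfolding has_fderiv_on_def
proof (intro conjI allI impI x)
  have xs: "x \<in> sp E" using A by (rule strict_derivD)
  show "bounded_linear_on E F A" using A by (rule strict_derivD)
  fix \<epsilon> :: real assume "\<epsilon> > 0"
  then obtain \<delta> where d: "\<delta> > 0" "\<forall>y\<in>nball E x \<delta>. \<forall>z\<in>nball E x \<delta>.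
        f y \<in> sp F \<and> nrm F (f y - f z - A (y - z)) \<le> \<epsilon> * nrm E (y - z)"
    using strict_derivD(3)[OF A] by blast
  have "nrm F (f (x + h) - f x - A h) \<le> \<epsilon> * nrm E h" if "h \<in> sp E" "nrm E h < \<delta>" for h
  proof -
    have "x + h \<in> nball E x \<delta>" "x \<in> nball E x \<delta>"
      using that xs d(1) E by (auto simp: nball_def nrm_zero intro: nspace_add)
    then show ?thesis using d(2)[rule_format, of "x + h" x] by simp
  qed
  then show "\<exists>\<delta>>0. \<forall>h\<in>sp E. nrm E h < \<delta> \<and> x + h \<in> U \<longrightarrow> nrm F (f (x + h) - f x - A h) \<le> \<epsilon> * nrm E h"
    using d(1) by blast
qed

lemma fderiv_has_fderiv_on:
  "strict_deriv E F f A x \<Longrightarrow> x \<in> U \<Longrightarrow> normed_space E \<Longrightarrow> has_fderiv_on E F U f (fderiv E F U f x) x"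
  unfolding fderiv_def
  using someI[where P = "\<lambda>f'. has_fderiv_on E F U f f' x", OF has_fderiv_on_of_strict[of E F f A x U]] by simp

text \<open>In its reference chart the identity has derivative \<open>id\<close>, as the tangent space demands.\<close>

lemma chart_inv_tangent_ref:
  assumes M: "banach_manifold M" and q: "q \<in> points M" and v: "v \<in> sp (tangent M q)"
  shows "chart_inv_tangent M q (ref M q) q v = v"
proof -
  define c E p U where "c = ref M q" and "E = tangent M q" and "p = cmap c q" and "U = cmap c ` cdom c"
  have c: "c \<in> charts M q" unfolding c_def by (rule banach_manifold_tangent(3)[OF M q])
  note cf = chart_facts[OF M q c]
  have E: "normed_space E" unfolding E_def by (rule banach_manifold_tangent(2)[OF M q])
  have ps: "p \<in> sp E" unfolding p_def E_def by (rule cf(7)[OF cf(2)])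
  have pU: "p \<in> U" using cf(2) by (auto simp: p_def U_def)
  obtain r where r: "r > 0" "nball E p r \<subseteq> U"
    using cf(4) pU openin_ntop[OF E] unfolding U_def E_def by blast
  define f where "f = cmap c \<circ> cinv c"
  have f: "f y = y" if "y \<in> nball E p r" for y
    using r(2) that cmap_cinv[of y c] by (auto simp: U_def f_def)
  have "strict_deriv E E f (\<lambda>h. h) p"
    by (rule strict_deriv_transfer[OF strict_deriv_id[OF E ps] r(1)]) (simp add: f)
  then have "has_fderiv_on E E U f (fderiv E E U f p) p" by (rule fderiv_has_fderiv_on[OF _ pU E])
  moreover define A where "A = fderiv E E U f p"
  ultimately have A: "has_fderiv_on E E U f A p" by simp
  then have lin: "bounded_linear_on E E A" by (simp add: has_fderiv_on_def)
  have vE: "v \<in> sp E" using v by (simp add: E_def)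
  have Av: "v - A v \<in> sp E" by (intro nspace_diff E vE bounded_linear_onD(1)[OF lin])
  have nv: "0 \<le> nrm E v" by (rule nrm_nonneg[OF E vE])
  have "nrm E (v - A v) \<le> 0 + e" if e: "e > 0" for e
  proof -
    define e1 where "e1 = e / (nrm E v + 1)"
    have "e1 > 0" using e nv by (simp add: e1_def)
    then obtain \<delta> where d: "\<delta> > 0" "\<forall>h\<in>sp E. nrm E h < \<delta> \<and> p + h \<in> U \<longrightarrow>
        nrm E (f (p + h) - f p - A h) \<le> e1 * nrm E h"
      using A unfolding has_fderiv_on_def by blast
    define t where "t = min r \<delta> / (nrm E v + 1)"
    have t: "t > 0" using r(1) d(1) nv by (simp add: t_def)
    have "t * nrm E v < t * (nrm E v + 1)" using t by simp
    also have "\<dots> = min r \<delta>" using nv by (simp add: t_def)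
    finally have tn: "nrm E (t *\<^sub>R v) < min r \<delta>" using t vE E by (simp add: nrm_scale)
    have tv: "t *\<^sub>R v \<in> sp E" by (rule nspace_scale[OF E vE])
    have b: "p + t *\<^sub>R v \<in> nball E p r" using tn tv ps E by (auto simp: nball_def intro: nspace_add)
    have pb: "p \<in> nball E p r" by (rule center_in_nball[OF E ps r(1)])
    have "nrm E (f (p + t *\<^sub>R v) - f p - A (t *\<^sub>R v)) \<le> e1 * nrm E (t *\<^sub>R v)"
      using d(2) tv tn b r(2) by auto
    also have "f (p + t *\<^sub>R v) - f p - A (t *\<^sub>R v) = t *\<^sub>R (v - A v)"
      using f[OF b] f[OF pb] bounded_linear_onD(3)[OF lin vE] by (simp add: scaleR_diff_right)
    finally have "t * nrm E (v - A v) \<le> t * (e1 * nrm E v)"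
      using t E vE Av by (simp add: nrm_scale mult.left_commute)
    then have "nrm E (v - A v) \<le> e1 * nrm E v" using t by simp
    also have "\<dots> \<le> e" using e nv by (simp add: e1_def field_simps)
    finally show ?thesis by simp
  qed
  then have "nrm E (v - A v) \<le> 0" by (rule field_le_epsilon)
  then have "A v = v" using nrm_nonneg[OF E Av] nrm_eq_0[OF E Av] by simp
  then show ?thesis by (simp add: chart_inv_tangent_def A_def c_def E_def U_def f_def p_def)
qed

text \<open>
  A weak metric is continuous in each argument for the strong norm, since it is smooth in charts.
\<close>

lemma weak_metric_continuous:
  assumes M: "banach_manifold M" and \<gamma>: "weak_riemannian_metric M \<gamma>" and q: "q \<in> points M"
    and v: "v \<in> sp (tangent M q)" and w: "w \<in> sp (tangent M q)" and \<epsilon>: "\<epsilon> > 0"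
  obtains \<delta> where "\<delta> > 0" "\<forall>v'\<in>nball (tangent M q) v \<delta>. \<bar>\<gamma> q v' w - \<gamma> q v w\<bar> < \<epsilon>"
proof -
  define c E p where "c = ref M q" and "E = tangent M q" and "p = cmap c q"
  define P where "P = prod_nspace E (prod_nspace E E)"
  define f where "f = (\<lambda>(x, v, w). let y = cinv c x in \<gamma> y (chart_inv_tangent M q c y v) (chart_inv_tangent M q c y w))"
  have c: "c \<in> charts M q" unfolding c_def by (rule banach_manifold_tangent(3)[OF M q])
  note cf = chart_facts[OF M q c]
  have E: "normed_space E" unfolding E_def by (rule banach_manifold_tangent(2)[OF M q])
  have P: "normed_space P" unfolding P_def by (intro normed_space_prod E)
  have "smooth_on P real_nspace ((cmap c ` cdom c) \<times> sp E \<times> sp E) f"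
    using bspec[OF bspec[OF conjunct2[OF \<gamma>[unfolded weak_riemannian_metric_def]] q] c]
    unfolding P_def E_def f_def .
  then have C: "Ck_on 1 P real_nspace ((cmap c ` cdom c) \<times> sp E \<times> sp E) f" by (simp add: smooth_on_def)
  have "(p, v, w) \<in> (cmap c ` cdom c) \<times> sp E \<times> sp E" using cf(2) v w by (auto simp: p_def E_def)
  then obtain A where A: "strict_deriv P real_nspace f A (p, v, w)"
    using Ck_on_1_strict_deriv[OF C P normed_space_real] by blast
  obtain \<delta> where d: "\<delta> > 0" "\<And>y. y \<in> nball P (p, v, w) \<delta> \<Longrightarrow> f y \<in> nball real_nspace (f (p, v, w)) \<epsilon>"
    using strict_deriv_continuous[OF A P normed_space_real \<epsilon>] by blast
  have cp: "cinv c p = q" unfolding p_def by (rule cinv_cmap[OF cf(6,2)])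
  have f: "f (p, v', w) = \<gamma> q v' w" if "v' \<in> sp E" for v'
    using chart_inv_tangent_ref[OF M q, folded c_def E_def] that w[folded E_def] by (simp add: f_def cp)
  have "\<bar>\<gamma> q v' w - \<gamma> q v w\<bar> < \<epsilon>" if v': "v' \<in> nball E v \<delta>" for v'
  proof -
    have ps: "p \<in> sp E" unfolding p_def E_def by (rule cf(7)[OF cf(2)])
    have "(p, v', w) \<in> nball P (p, v, w) \<delta>"
      using v' d(1) ps w nrm_zero[OF E] by (auto simp: nball_def P_def prod_nspace_def E_def[symmetric])
    then have "f (p, v', w) \<in> nball real_nspace (f (p, v, w)) \<epsilon>" by (rule d(2))
    then show ?thesis using f v' v by (auto simp: nball_def real_nspace_def E_def)
  qed
  then show ?thesis using that d(1) unfolding E_def by blast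
qed

lemma orthogonal_subspace_normed:
  assumes E: "normed_space E" and sub: "sp E \<subseteq> S"
    and lin: "\<And>e u v a b. e \<in> I \<Longrightarrow> u \<in> S \<Longrightarrow> v \<in> S \<Longrightarrow> f e (a *\<^sub>R u + b *\<^sub>R v) = a * f e u + (b * f e v :: real)"
  shows "normed_space \<lparr>sp = {v \<in> sp E. \<forall>e\<in>I. f e v = 0}, nrm = nrm E\<rparr>"
proof -
  have sE: "subspace (sp E)" using E by (simp add: normed_space_def)
  have "subspace {v \<in> sp E. \<forall>e\<in>I. f e v = 0}"
  proof (rule subspaceI)
    have "f e 0 = 0" if "e \<in> I" for e
      using lin[OF that, of 0 0 0 0] sub subspace_0[OF sE] by auto
    then show "0 \<in> {v \<in> sp E. \<forall>e\<in>I. f e v = 0}" using subspace_0[OF sE] by simp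
  next
    fix x y assume "x \<in> {v \<in> sp E. \<forall>e\<in>I. f e v = 0}" "y \<in> {v \<in> sp E. \<forall>e\<in>I. f e v = 0}"
    then have x: "x \<in> sp E" "\<forall>e\<in>I. f e x = 0" and y: "y \<in> sp E" "\<forall>e\<in>I. f e y = 0" by auto
    have "f e (x + y) = 0" if "e \<in> I" for e
      using lin[OF that, of x y 1 1] x y sub that by auto
    then show "x + y \<in> {v \<in> sp E. \<forall>e\<in>I. f e v = 0}" using x y subspace_add[OF sE] by simp
  next
    fix c x assume "x \<in> {v \<in> sp E. \<forall>e\<in>I. f e v = 0}"
    then have x: "x \<in> sp E" "\<forall>e\<in>I. f e x = 0" by auto
    have "f e (c *\<^sub>R x) = 0" if "e \<in> I" for e
      using lin[OF that, of x x c 0] x sub that by auto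
    then show "c *\<^sub>R x \<in> {v \<in> sp E. \<forall>e\<in>I. f e v = 0}" using x subspace_scale[OF sE] by simp
  qed
  then show ?thesis using E unfolding normed_space_def by simp
qed

context two_level_action
begin

text \<open>
  A fundamental vector is a value of the derivative of an orbit map, and orbit maps are
  differentiable into the weak manifold.
\<close>

lemma fundamental_vector_tangent:
  assumes q: "q \<in> points M1" and e: "e \<in> sp EL"
  shows "tangent_map L M0 (\<lambda>g. \<Phi> g q) \<one> e \<in> sp (tangent M0 q)"
proof -
  have q0: "q \<in> points M0" using q points_sub by auto
  have one: "\<Phi> \<one> q = q" by (rule A1.act_one[OF q])
  define d where "d = ref M0 q"
  have d: "d \<in> charts M0 q" unfolding d_def by (rule banach_manifold_tangent(3)[OF A0.M q0])
  note df = chart_facts[OF A0.M q0 d]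
  have n0: "normed_space (tangent M0 q)" by (rule banach_manifold_tangent(2)[OF A0.M q0])
  have "Ck_map_on 1 L M0 (points L) (\<lambda>g. \<Phi> g q)" using orbit_C1[OF q] by (simp add: Ck_map_def)
  moreover have "\<Phi> \<one> q \<in> cdom d" using one df(2) by simp
  ultimately obtain A where A: "strict_deriv EL (tangent M0 q) (\<lambda>y. cmap d (\<Phi> (cinv \<kappa> y) q)) A (cmap \<kappa> \<one>)"
    using Ck_map_on_strict_deriv[OF L_manifold one_point kappa_chart A0.M q0 d _ \<kappa>_facts(2) one_point] by blast
  then have A': "strict_deriv EL (tangent M0 q) (rep \<kappa> d (\<lambda>g. \<Phi> g q)) A (cmap \<kappa> \<one>)" by (simp add: rep_def comp_def)
  have "cmap \<kappa> \<one> \<in> rep_dom \<kappa> d (points L) (\<lambda>g. \<Phi> g q)"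
    using one df(2) one_point \<kappa>_facts(2) by (auto simp: rep_dom_def)
  from fderiv_has_fderiv_on[OF A' this EL(1)]
  have "bounded_linear_on EL (tangent M0 q) (tangent_map L M0 (\<lambda>g. \<Phi> g q) \<one>)"
    by (simp add: tangent_map_def one has_fderiv_on_def d_def)
  then show ?thesis using e by (rule bounded_linear_onD)
qed

end

section \<open>Orbits and slices\<close>

context smooth_action
begin

lemma orbit_act:
  assumes g: "g \<in> carrier G" and x: "x \<in> points M"
  shows "orbit G \<Phi> (\<Phi> g x) = orbit G \<Phi> x"
proof -
  have "\<exists>k\<in>carrier G. \<Phi> h x = \<Phi> k (\<Phi> g x)" if h: "h \<in> carrier G" for h
  proof -
    have "\<Phi> h x = \<Phi> ((h \<otimes> inv g) \<otimes> g) x" using h g by (simp add: m_assoc)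
    also have "\<dots> = \<Phi> (h \<otimes> inv g) (\<Phi> g x)" using h g x by (intro act_mult) auto
    finally show ?thesis using h g by blast
  qed
  moreover have "\<exists>k\<in>carrier G. \<Phi> h (\<Phi> g x) = \<Phi> k x" if h: "h \<in> carrier G" for h
    using act_mult[OF h g x] h g by (metis m_closed)
  ultimately show ?thesis unfolding orbit_def by (auto; metis)
qed

lemma orbit_eqD:
  assumes "orbit G \<Phi> x = orbit G \<Phi> y" "y \<in> points M"
  obtains g where "g \<in> carrier G" "\<Phi> g x = y"
proof -
  have "y = \<Phi> \<one> y" using act_one assms(2) by simp
  then have "y \<in> orbit G \<Phi> y" unfolding orbit_def using one_closed by blast
  then have "y \<in> orbit G \<Phi> x" using assms(1) by simp
  then show ?thesis using that by (auto simp: orbit_def)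
qed

lemma act_continuous1:
  assumes "g \<in> carrier G"
  shows "continuous_map (mtop M) (mtop M) (\<Phi> g)"
  by (rule smooth_map_continuous[OF act_smooth[OF assms]])

lemma topspace_orbit_space: "topspace (orbit_space M G \<Phi>) = orbit G \<Phi> ` points M"
  using quotient_imp_surjective_map[OF quotient_map_orbit_space] by metis

text \<open>The orbits that meet \<open>U\<close> fill the union of the preimages of \<open>U\<close> under all \<open>\<Phi> g\<close>.\<close>

lemma openin_orbit_image:
  assumes U: "openin (mtop M) U"
  shows "openin (orbit_space M G \<Phi>) (orbit G \<Phi> ` U)"
proof -
  have UM: "U \<subseteq> points M" by (rule openin_subset[OF U])
  have "{q \<in> points M. orbit G \<Phi> q \<in> orbit G \<Phi> ` U} = (\<Union>g\<in>carrier G. {q \<in> points M. \<Phi> g q \<in> U})"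
  proof (intro equalityI subsetI)
    fix q assume "q \<in> {q \<in> points M. orbit G \<Phi> q \<in> orbit G \<Phi> ` U}"
    then obtain u where u: "q \<in> points M" "u \<in> U" "orbit G \<Phi> q = orbit G \<Phi> u" by blast
    have "u \<in> points M" using u(2) UM by blast
    then obtain g where "g \<in> carrier G" "\<Phi> g q = u" by (rule orbit_eqD[OF u(3)])
    then show "q \<in> (\<Union>g\<in>carrier G. {q \<in> points M. \<Phi> g q \<in> U})" using u(1,2) by blast
  next
    fix q assume "q \<in> (\<Union>g\<in>carrier G. {q \<in> points M. \<Phi> g q \<in> U})"
    then obtain g where g: "g \<in> carrier G" "q \<in> points M" "\<Phi> g q \<in> U" by blast
    have "orbit G \<Phi> q = orbit G \<Phi> (\<Phi> g q)" using orbit_act[OF g(1,2)] by simp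
    then show "q \<in> {q \<in> points M. orbit G \<Phi> q \<in> orbit G \<Phi> ` U}" using g by blast
  qed
  moreover have "openin (mtop M) (\<Union>g\<in>carrier G. {q \<in> points M. \<Phi> g q \<in> U})"
  proof (rule openin_Union)
    fix S assume "S \<in> (\<lambda>g. {q \<in> points M. \<Phi> g q \<in> U}) ` carrier G"
    then show "openin (mtop M) S"
      using openin_continuous_map_preimage[OF act_continuous1 U] by blast
  qed
  ultimately have "openin (mtop M) {q \<in> points M. orbit G \<Phi> q \<in> orbit G \<Phi> ` U}" by simp
  moreover have "orbit G \<Phi> ` U \<subseteq> topspace (orbit_space M G \<Phi>)" using UM by (auto simp: topspace_orbit_space)
  ultimately show ?thesis
    using quotient_map_orbit_space[of M G \<Phi>] unfolding quotient_map_def by blast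
qed

end

context two_level_action
begin

text \<open>
  The map \<open>y \<mapsto> \<Phi> (\<beta> (\<Phi> g y)) (\<Phi> g y)\<close> that moves points into a slice is read in a chart. With
  \<open>h = \<beta> (\<Phi> g y0)\<close> it equals \<open>\<Phi> (k y) (\<Phi> (h \<otimes> g) y)\<close> for \<open>k y = \<beta> (\<Phi> g y) \<otimes> inv h\<close>, and
  \<open>k y0 = \<one>\<close>. Here \<open>\<Phi> (h \<otimes> g)\<close> is smooth on the strong manifold, and differentiability of the
  action in both arguments is needed only where the group element is \<open>\<one>\<close>.
\<close>

lemma slice_map_strict:
  assumes a: "a \<in> points M1" "ca \<in> charts M0 a" and y0: "y0 \<in> cdom ca" "y0 \<in> points M1"
    and b: "b \<in> points M1" "cb \<in> charts M0 b"
    and U: "openin (mtop M1) U" and \<beta>: "Ck_map_on 1 M1 L U \<beta>" "\<beta> ` U \<subseteq> carrier G"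
    and slice: "\<forall>x\<in>U. x \<in> cdom cb \<and> \<Phi> (\<beta> x) x \<in> cdom cb"
    and g: "g \<in> carrier G" "\<Phi> g y0 \<in> U"
    and y_def: "y = cinv \<lparr>cdom = cdom ca \<inter> points M1, cmap = cmap ca\<rparr>"
  obtains D r where "r > 0"
    "strict_deriv (tangent M1 a) (tangent M0 b) (\<lambda>x. cmap cb (\<Phi> (\<beta> (\<Phi> g (y x))) (\<Phi> g (y x)))) D (cmap ca y0)"
    "\<forall>x\<in>nball (tangent M1 a) (cmap ca y0) r. \<Phi> g (y x) \<in> U \<and> y x \<in> points M1"
proof -
  define c1 d1 where "c1 = \<lparr>cdom = cdom ca \<inter> points M1, cmap = cmap ca\<rparr>"
    and "d1 = \<lparr>cdom = cdom cb \<inter> points M1, cmap = cmap cb\<rparr>"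
  have c1: "c1 \<in> charts M1 a" unfolding c1_def by (rule chart_restrict[OF a])
  have d1: "d1 \<in> charts M1 b" unfolding d1_def by (rule chart_restrict[OF b])
  have y: "y = cinv c1" by (simp add: y_def c1_def)
  note cf = chart_facts[OF A1.M a(1) c1] and df = chart_facts[OF A1.M b(1) d1]
  have UM: "U \<subseteq> points M1" by (rule openin_subset[OF U])
  define E1 where "E1 = tangent M1 a"
  define x0 where "x0 = cmap ca y0"
  have nE: "normed_space E1" unfolding E1_def by (rule banach_manifold_tangent(2)[OF A1.M a(1)])
  have nb: "normed_space (tangent M1 b)" by (rule banach_manifold_tangent(2)[OF A1.M b(1)])
  have y0c: "y0 \<in> cdom c1" using y0 by (simp add: c1_def)
  have cx0: "cmap c1 y0 = x0" by (simp add: c1_def x0_def)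
  have yx0: "y x0 = y0" unfolding y cx0[symmetric] by (rule cinv_cmap[OF cf(6) y0c])
  define r' where "r' = \<Phi> g y0"
  define h where "h = \<beta> r'"
  have r'U: "r' \<in> U" using g by (simp add: r'_def)
  have h: "h \<in> carrier G" using \<beta>(2) r'U by (auto simp: h_def)
  have ih: "inv h \<in> carrier G" using h by simp
  define q where "q = \<Phi> (h \<otimes> g) y0"
  have q': "q = \<Phi> h r'" unfolding q_def r'_def by (rule A1.act_mult[OF h g(1) y0(2)])
  have qd: "q \<in> cdom cb" using slice r'U by (simp add: q' h_def)
  have qM: "q \<in> points M1" unfolding q_def using h g y0 by (intro A1.act_closed) auto
  have hg: "h \<otimes> g \<in> carrier G" using h g by simp
  define l where "l = ref L h"
  have hL: "h \<in> points L" using h by (simp add: L_points)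
  have l: "l \<in> charts L h" unfolding l_def by (rule banach_manifold_tangent(3)[OF L_manifold hL])
  note lf = chart_facts[OF L_manifold hL l]
  have nl: "normed_space (tangent L h)" by (rule banach_manifold_tangent(2)[OF L_manifold hL])
  \<comment> \<open>A neighbourhood of \<open>y0\<close> on which all the chart representatives below are meaningful.\<close>
  define V1 where "V1 = {k \<in> points L. k \<otimes> inv h \<in> cdom \<kappa>} \<inter> cdom l"
  have V1: "openin (mtop L) V1" unfolding V1_def
    by (intro openin_Int lf(1) openin_continuous_map_preimage[OF right_translation_continuous[OF ih]] \<kappa>_facts(1))
  have hV1: "h \<in> V1" using hL h lf(2) \<kappa>_facts(2) by (simp add: V1_def)
  define V2 where "V2 = {x \<in> U. \<beta> x \<in> V1} \<inter> cdom d1"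
  have V2: "openin (mtop M1) V2"
  proof -
    have "continuous_map (subtopology (mtop M1) U) (mtop L) \<beta>" using \<beta>(1) by (simp add: Ck_map_on_def)
    then have "openin (subtopology (mtop M1) U) {x \<in> topspace (subtopology (mtop M1) U). \<beta> x \<in> V1}"
      using V1 by (rule openin_continuous_map_preimage)
    moreover have "topspace (subtopology (mtop M1) U) = U" using UM by auto
    ultimately have "openin (mtop M1) {x \<in> U. \<beta> x \<in> V1}" using openin_trans_full[OF _ U] by metis
    then show ?thesis unfolding V2_def using df(1) by (rule openin_Int)
  qed
  have r'V2: "r' \<in> V2" using r'U hV1 slice UM by (auto simp: V2_def h_def d1_def)
  define W where "W = {x \<in> points M1. \<Phi> g x \<in> V2} \<inter> {x \<in> points M1. \<Phi> (h \<otimes> g) x \<in> cdom d1}"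
  have W: "openin (mtop M1) W" unfolding W_def
    by (intro openin_Int openin_continuous_map_preimage[OF A1.act_continuous1] V2 df(1) g(1) hg)
  have y0W: "y0 \<in> W" using y0 r'V2 qd qM by (auto simp: W_def r'_def q_def d1_def)
  obtain \<rho> where \<rho>: "\<rho> > 0" "\<forall>x\<in>nball E1 x0 \<rho>. y x \<in> W \<and> y x \<in> cdom c1 \<and> cmap c1 (y x) = x"
    using cinv_continuous[OF A1.M a(1) c1 W y0W y0c] unfolding E1_def[symmetric] cx0 y[symmetric] by blast
  define k where "k x = \<beta> (\<Phi> g (y x)) \<otimes> inv h" for x
  define f where "f x = \<Phi> (h \<otimes> g) (y x)" for x
  have near: "\<Phi> g (y x) \<in> U" "\<beta> (\<Phi> g (y x)) \<in> cdom l" "\<beta> (\<Phi> g (y x)) \<in> carrier G" "k x \<in> cdom \<kappa>" "\<Phi> g (y x) \<in> cdom d1"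
    "f x \<in> cdom d1" "y x \<in> points M1" "k x \<in> carrier G" if "x \<in> nball E1 x0 \<rho>" for x
  proof -
    have w: "y x \<in> W" using \<rho>(2) that by blast
    then show "\<Phi> g (y x) \<in> U" "\<beta> (\<Phi> g (y x)) \<in> cdom l" "k x \<in> cdom \<kappa>" "\<Phi> g (y x) \<in> cdom d1"
      "f x \<in> cdom d1" "y x \<in> points M1" by (auto simp: W_def V2_def V1_def k_def f_def)
    then show "\<beta> (\<Phi> g (y x)) \<in> carrier G" using \<beta>(2) by blast
    then show "k x \<in> carrier G" using ih by (simp add: k_def)
  qed
  have r'd: "r' \<in> cdom d1" using r'V2 by (simp add: V2_def)
  have qd1: "q \<in> cdom d1" using qd qM by (simp add: d1_def)
  obtain A1' where s1: "strict_deriv E1 (tangent M1 b) (\<lambda>x. cmap d1 (\<Phi> g (cinv c1 x))) A1' (cmap c1 y0)"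
    using Ck_map_on_strict_deriv[OF A1.M a(1) c1 A1.M b(1) d1 smooth_map_C1[OF A1.act_smooth[OF g(1)]] y0c y0(2)]
      r'd unfolding E1_def r'_def by blast
  obtain A2 where s2: "strict_deriv (tangent M1 b) (tangent L h) (\<lambda>z. cmap l (\<beta> (cinv d1 z))) A2 (cmap d1 r')"
    using Ck_map_on_strict_deriv[OF A1.M b(1) d1 L_manifold hL l \<beta>(1) r'd r'U] lf(2) unfolding h_def by blast
  obtain A3 where s3: "strict_deriv (tangent L h) EL (\<lambda>\<xi>. cmap \<kappa> (cinv l \<xi> \<otimes> inv h)) A3 (cmap l h)"
    using right_translation_strict[OF h ih r_inv[OF h]] unfolding l_def by blast
  have cr': "cinv d1 (cmap d1 r') = r'" by (rule cinv_cmap[OF df(6) r'd])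
  have s1': "strict_deriv E1 (tangent M1 b) (\<lambda>x. cmap d1 (\<Phi> g (y x))) A1' x0" using s1 by (simp add: y cx0)
  have s2': "strict_deriv (tangent M1 b) (tangent L h) (\<lambda>z. cmap l (\<beta> (cinv d1 z))) A2 (cmap d1 (\<Phi> g (y x0)))"
    using s2 by (simp add: yx0 r'_def)
  have s12: "strict_deriv E1 (tangent L h) (\<lambda>x. cmap l (\<beta> (cinv d1 (cmap d1 (\<Phi> g (y x)))))) (\<lambda>v. A2 (A1' v)) x0"
    by (rule strict_deriv_compose[OF s1' s2' nE nb nl])
  have "cmap l (\<beta> (cinv d1 (cmap d1 (\<Phi> g (y x0))))) = cmap l h" using cr' by (simp add: yx0 r'_def[symmetric] h_def)
  then have s3': "strict_deriv (tangent L h) EL (\<lambda>\<xi>. cmap \<kappa> (cinv l \<xi> \<otimes> inv h)) A3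
      (cmap l (\<beta> (cinv d1 (cmap d1 (\<Phi> g (y x0))))))" using s3 by simp
  have s123: "strict_deriv E1 EL (\<lambda>x. cmap \<kappa> (cinv l (cmap l (\<beta> (cinv d1 (cmap d1 (\<Phi> g (y x)))))) \<otimes> inv h))
      (\<lambda>v. A3 (A2 (A1' v))) x0"
    by (rule strict_deriv_compose[OF s12 s3' nE nl EL(1)])
  have ks: "strict_deriv E1 EL (\<lambda>x. cmap \<kappa> (k x)) (\<lambda>v. A3 (A2 (A1' v))) x0"
  proof (rule strict_deriv_transfer[OF s123 \<rho>(1)])
    fix x assume x: "x \<in> nball E1 x0 \<rho>"
    have "cinv d1 (cmap d1 (\<Phi> g (y x))) = \<Phi> g (y x)" by (rule cinv_cmap[OF df(6) near(5)[OF x]])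
    moreover have "cinv l (cmap l (\<beta> (\<Phi> g (y x)))) = \<beta> (\<Phi> g (y x))" by (rule cinv_cmap[OF lf(6) near(2)[OF x]])
    ultimately show "cmap \<kappa> (cinv l (cmap l (\<beta> (cinv d1 (cmap d1 (\<Phi> g (y x)))))) \<otimes> inv h) = cmap \<kappa> (k x)"
      by (simp add: k_def)
  qed
  have kx0: "k x0 = \<one>" using r_inv[OF h] by (simp add: k_def yx0 r'_def[symmetric] h_def[symmetric])
  obtain B where "strict_deriv E1 (tangent M1 b) (\<lambda>x. cmap d1 (\<Phi> (h \<otimes> g) (cinv c1 x))) B (cmap c1 y0)"
    using Ck_map_on_strict_deriv[OF A1.M a(1) c1 A1.M b(1) d1 smooth_map_C1[OF A1.act_smooth[OF hg]] y0c y0(2)]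
      qd1 unfolding E1_def q_def by blast
  then have fs: "strict_deriv E1 (tangent M1 b) (\<lambda>x. cmap cb (f x)) B x0"
    by (simp add: f_def y cx0 d1_def)
  have fx0: "f x0 = q" by (simp add: f_def yx0 q_def)
  have "\<exists>D. strict_deriv E1 (tangent M0 b) (\<lambda>x. cmap cb (\<Phi> (k x) (f x))) D x0"
    using near by (intro action_compose_strict[OF b qd qM nE ks kx0 fs fx0 \<rho>(1)]) (simp add: d1_def)
  then obtain D where D: "strict_deriv E1 (tangent M0 b) (\<lambda>x. cmap cb (\<Phi> (k x) (f x))) D x0" by blast
  have "strict_deriv E1 (tangent M0 b) (\<lambda>x. cmap cb (\<Phi> (\<beta> (\<Phi> g (y x))) (\<Phi> g (y x)))) D x0"
  proof (rule strict_deriv_transfer[OF D \<rho>(1)])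
    fix x assume x: "x \<in> nball E1 x0 \<rho>"
    note n = near[OF x]
    have gy: "\<Phi> g (y x) \<in> points M1" using n(1) UM by auto
    have "\<Phi> (k x) (f x) = \<Phi> (k x) (\<Phi> h (\<Phi> g (y x)))"
      unfolding f_def by (simp add: A1.act_mult[OF h g(1) n(7)])
    also have "\<dots> = \<Phi> (k x \<otimes> h) (\<Phi> g (y x))" by (rule A1.act_mult[OF n(8) h gy, symmetric])
    also have "k x \<otimes> h = \<beta> (\<Phi> g (y x))" using n(3) h by (simp add: k_def m_assoc)
    finally show "cmap cb (\<Phi> (k x) (f x)) = cmap cb (\<Phi> (\<beta> (\<Phi> g (y x))) (\<Phi> g (y x)))" by simp
  qed
  moreover have "\<forall>x\<in>nball E1 x0 \<rho>. \<Phi> g (y x) \<in> U \<and> y x \<in> points M1" using near(1,7) by blast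
  ultimately show ?thesis using that \<rho>(1) unfolding E1_def x0_def by blast
qed

end

section \<open>The change of charts\<close>

lemma chain_two_level_action:
  assumes chain: "banach_manifold_chain s0 Q" and lie: "lie_group G L"
    and act: "chain_action s0 Q G L \<Phi>" and s: "s > s0 + 1"
  shows "two_level_action G L (Q s) (Q (s - 1)) \<Phi>"
proof -
  have sm: "smooth_action G L (Q t) \<Phi>" if t: "t > s0" for t
  proof -
    have M: "banach_manifold (Q t)" using chain t by (simp add: banach_manifold_chain_def)
    have a: "\<forall>g\<in>carrier G. \<forall>q\<in>points (Q t). \<Phi> g q \<in> points (Q t)"
        "\<forall>q\<in>points (Q t). \<Phi> \<one>\<^bsub>G\<^esub> q = q"
        "\<forall>g\<in>carrier G. \<forall>h\<in>carrier G. \<forall>q\<in>points (Q t). \<Phi> (g \<otimes>\<^bsub>G\<^esub> h) q = \<Phi> g (\<Phi> h q)"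
        "continuous_map (prod_topology (mtop L) (mtop (Q t))) (mtop (Q t)) (\<lambda>(g, q). \<Phi> g q)"
        "\<forall>g\<in>carrier G. smooth_map (Q t) (Q t) (\<Phi> g)"
      using act[unfolded chain_action_def, THEN conjunct1, rule_format, OF t] by - (elim conjE, assumption)+
    show ?thesis
      by unfold_locales (use lie M a in \<open>simp_all\<close>)
  qed
  have t: "s - 1 > s0" "s > s0" "s - 1 < s" using s by auto
  note ch = chain[unfolded banach_manifold_chain_def, THEN conjunct2, rule_format, OF t(1,3)]
  have c1: "points (Q s) \<subseteq> points (Q (s - 1))" "smooth_map (Q s) (Q (s - 1)) (\<lambda>q. q)"
    using ch by - (elim conjE, assumption)+
  have c2: "sp (tangent (Q s) q) \<subseteq> sp (tangent (Q (s - 1)) q)"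
    "c \<in> charts (Q (s - 1)) q \<Longrightarrow> \<lparr>cdom = cdom c \<inter> points (Q s), cmap = cmap c\<rparr> \<in> charts (Q s) q"
    if "q \<in> points (Q s)" for q c
    using ch that by blast+
  have C1: "Ck_map 1 L (Q (s - 1)) (\<lambda>g. \<Phi> g x)" if "x \<in> points (Q s)" for x
    using act[unfolded chain_action_def, THEN conjunct2, rule_format, OF s that] .
  show ?thesis
    by (intro two_level_action.intro two_level_action_axioms.intro lie_group_chart.intro lie sm t c1 c2 C1)
qed

text \<open>
  The charts of the orbit space take values in the normal spaces, whose norms are those of the
  tangent spaces. So the local formula of \<open>slice_map_strict\<close> is restricted to the normal space of
  the first chart, and its derivative takes values in the normal space of the second chart because
  that space is closed for the weak norm.
\<close>

theorem theorem4p6: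
  fixes s0 s :: real
    and Q :: "real \<Rightarrow> ('q, 'e::real_vector) manifold"
    and \<gamma> :: "'q \<Rightarrow> 'e \<Rightarrow> 'e \<Rightarrow> real"
    and G :: "'g monoid"
    and L :: "('g, 'l::real_vector) manifold"
    and \<Phi> :: "'g \<Rightarrow> 'q \<Rightarrow> 'q"
    and es :: "'l list"
    and \<omega> \<upsilon> :: "'q set"
    and q\<^sub>\<omega> q\<^sub>\<upsilon> :: 'q
    and \<U>\<^sub>1 \<U>\<^sub>2 :: "'q set set"
    and \<B>\<^sub>\<omega> \<B>\<^sub>\<upsilon> :: "'q set \<Rightarrow> 'e"
  assumes "banach_manifold_chain s0 Q"
    and "chain_metric s0 Q \<gamma>"
    and "lie_group G L"
    and "chain_action s0 Q G L \<Phi>"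
    and "free_on_chain s0 Q G \<Phi>"
    and "lie_algebra_basis G L es"
    and "s > s0 + 2"
    and "\<omega> \<in> topspace (orbit_space (Q s) G \<Phi>)" and "\<upsilon> \<in> topspace (orbit_space (Q s) G \<Phi>)"
    and "q\<^sub>\<omega> \<in> points (Q s)" and "orbit G \<Phi> q\<^sub>\<omega> = \<omega>"
    and "q\<^sub>\<upsilon> \<in> points (Q s)" and "orbit G \<Phi> q\<^sub>\<upsilon> = \<upsilon>"
    and "quotient_chart Q G L \<Phi> \<gamma> es s q\<^sub>\<omega> \<U>\<^sub>1 \<B>\<^sub>\<omega>"
    and "quotient_chart Q G L \<Phi> \<gamma> es s q\<^sub>\<upsilon> \<U>\<^sub>2 \<B>\<^sub>\<upsilon>"
    and "\<U>\<^sub>1 \<inter> \<U>\<^sub>2 \<noteq> {}"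
  shows "Ck_on 1
           (orbit_normal_space Q G L \<Phi> \<gamma> es s s q\<^sub>\<omega>)
           (orbit_normal_space Q G L \<Phi> \<gamma> es s (s - 1) q\<^sub>\<upsilon>)
           (\<B>\<^sub>\<omega> ` (\<U>\<^sub>1 \<inter> \<U>\<^sub>2))
           (\<B>\<^sub>\<upsilon> \<circ> inv_into \<U>\<^sub>1 \<B>\<^sub>\<omega>)"
proof -
  have s1: "s > s0 + 1" "s - 1 > s0" using assms(7) by auto
  interpret A: two_level_action G L "Q s" "Q (s - 1)" \<Phi>
    by (rule chain_two_level_action[OF assms(1,3,4) s1(1)])
  have metric: "weak_riemannian_metric (Q (s - 1)) \<gamma>" using assms(2) s1 by (simp add: chain_metric_def)
  define N where "N t q = orbit_normal_space Q G L \<Phi> \<gamma> es s t q" for t q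
  have spN: "sp (N t q) = {v \<in> sp (tangent (Q t) q). \<forall>e\<in>set es. \<gamma> q v (fund_vec Q G L \<Phi> s e q) = 0}"
    and nrmN: "nrm (N t q) = nrm (tangent (Q t) q)" for t q
    by (simp_all add: N_def orbit_normal_space_def)
  have pts: "q \<in> points (Q (s - 1))" if "q \<in> points (Q s)" for q using A.points_sub that by auto
  have nE: "normed_space (tangent (Q s) q)" "normed_space (tangent (Q (s - 1)) q)" if "q \<in> points (Q s)" for q
    using banach_manifold_tangent(2)[OF A.A1.M that] banach_manifold_tangent(2)[OF A.A0.M pts[OF that]] by auto
  have fund: "fund_vec Q G L \<Phi> s e q \<in> sp (tangent (Q (s - 1)) q)" if "e \<in> set es" "q \<in> points (Q s)" for e q
  proof -
    have "e \<in> sp (tangent L \<one>\<^bsub>G\<^esub>)" using assms(6) that(1) span_base by (force simp: lie_algebra_basis_def)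
    then show ?thesis unfolding fund_vec_def by (rule A.fundamental_vector_tangent[OF that(2)])
  qed
  have \<gamma>_lin: "\<gamma> q (a *\<^sub>R u + b *\<^sub>R v) w = a * \<gamma> q u w + b * \<gamma> q v w"
    if "q \<in> points (Q (s - 1))" "u \<in> sp (tangent (Q (s - 1)) q)" "v \<in> sp (tangent (Q (s - 1)) q)"
      "w \<in> sp (tangent (Q (s - 1)) q)" for q a b u v w
    using metric that unfolding weak_riemannian_metric_def by blast
  have nN: "normed_space (N s q)" "normed_space (N (s - 1) q)" if q: "q \<in> points (Q s)" for q
  proof -
    have lin: "\<gamma> q (a *\<^sub>R u + b *\<^sub>R v) (fund_vec Q G L \<Phi> s e q) =
        a * \<gamma> q u (fund_vec Q G L \<Phi> s e q) + b * \<gamma> q v (fund_vec Q G L \<Phi> s e q)"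
      if "e \<in> set es" "u \<in> sp (tangent (Q (s - 1)) q)" "v \<in> sp (tangent (Q (s - 1)) q)" for e u v a b
      by (rule \<gamma>_lin[OF pts[OF q] that(2,3) fund[OF that(1) q]])
    show "normed_space (N s q)" unfolding N_def orbit_normal_space_def
      by (rule orthogonal_subspace_normed[OF nE(1)[OF q] A.tangent_sub[OF q]]) (rule lin)
    show "normed_space (N (s - 1) q)" unfolding N_def orbit_normal_space_def
      by (rule orthogonal_subspace_normed[OF nE(2)[OF q] order_refl]) (rule lin)
  qed
  have N_sub: "sp (N s q) \<subseteq> sp (N (s - 1) q)" if "q \<in> points (Q s)" for q
    using A.tangent_sub[OF that] by (auto simp: spN)
  have N_closed: "v \<in> sp (N (s - 1) q)"
    if q: "q \<in> points (Q s)" and v: "v \<in> sp (tangent (Q (s - 1)) q)"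
      and ap: "\<And>\<epsilon>. \<epsilon> > 0 \<Longrightarrow> \<exists>w\<in>sp (N (s - 1) q). nrm (tangent (Q (s - 1)) q) (w - v) \<le> \<epsilon>" for q v
  proof -
    have "\<gamma> q v (fund_vec Q G L \<Phi> s e q) = 0" if e: "e \<in> set es" for e
    proof (rule ccontr)
      let ?w = "fund_vec Q G L \<Phi> s e q"
      assume "\<gamma> q v ?w \<noteq> 0"
      then have pos: "\<bar>\<gamma> q v ?w\<bar> > 0" by simp
      obtain \<delta> where d: "\<delta> > 0" "\<forall>v'\<in>nball (tangent (Q (s - 1)) q) v \<delta>. \<bar>\<gamma> q v' ?w - \<gamma> q v ?w\<bar> < \<bar>\<gamma> q v ?w\<bar>"
        by (rule weak_metric_continuous[OF A.A0.M metric pts[OF q] v fund[OF e q] pos])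
      have "\<delta> / 2 > 0" using d by simp
      from ap[OF this] obtain v' where v': "v' \<in> sp (N (s - 1) q)" "nrm (tangent (Q (s - 1)) q) (v' - v) \<le> \<delta> / 2" by blast
      have "v' \<in> nball (tangent (Q (s - 1)) q) v \<delta>" using v' d(1) by (auto simp: nball_def spN)
      then have "\<bar>\<gamma> q v' ?w - \<gamma> q v ?w\<bar> < \<bar>\<gamma> q v ?w\<bar>" using d(2) by blast
      moreover have "\<gamma> q v' ?w = 0" using v' e by (auto simp: spN)
      ultimately show False by simp
    qed
    then show ?thesis using v by (simp add: spN)
  qed
  note qw = assms(10) and qv = assms(12)
  obtain c V U \<beta> where c: "c \<in> charts (Q (s - 1)) q\<^sub>\<omega>" and V: "openin (mtop L) V"
    and U: "openin (mtop (Q s)) U" and \<beta>V: "\<beta> ` U \<subseteq> V"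
    and sl: "\<forall>g\<in>V. \<forall>r\<in>U. \<Phi> g r \<in> cdom c \<and>
           (cmap c (\<Phi> g r) \<in> sp (orbit_normal_space Q G L \<Phi> \<gamma> es s s q\<^sub>\<omega>) \<longleftrightarrow> g = \<beta> r)"
    and U1: "\<U>\<^sub>1 = orbit G \<Phi> ` U" and B1: "\<forall>r\<in>U. \<B>\<^sub>\<omega> (orbit G \<Phi> r) = cmap c (\<Phi> (\<beta> r) r)"
    and op: "openin (ntop (orbit_normal_space Q G L \<Phi> \<gamma> es s s q\<^sub>\<omega>)) (\<B>\<^sub>\<omega> ` \<U>\<^sub>1)"
    and hom: "homeomorphic_maps
          (subtopology (orbit_space (Q s) G \<Phi>) \<U>\<^sub>1)
          (subtopology (ntop (orbit_normal_space Q G L \<Phi> \<gamma> es s s q\<^sub>\<omega>)) (\<B>\<^sub>\<omega> ` \<U>\<^sub>1))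
          \<B>\<^sub>\<omega> (orbit G \<Phi> \<circ> inv_into (cdom c \<inter> points (Q s)) (cmap c))"
    using assms(14) unfolding quotient_chart_def by (elim conjE exE) (rule that; assumption)
  obtain c' V' U' \<beta>' where c': "c' \<in> charts (Q (s - 1)) q\<^sub>\<upsilon>" and V': "openin (mtop L) V'" "\<one>\<^bsub>G\<^esub> \<in> V'"
    and U': "openin (mtop (Q s)) U'" and \<beta>': "Ck_map_on 1 (Q s) L U' \<beta>'" and \<beta>V': "\<beta>' ` U' \<subseteq> V'"
    and sl': "\<forall>g\<in>V'. \<forall>r\<in>U'. \<Phi> g r \<in> cdom c' \<and>
           (cmap c' (\<Phi> g r) \<in> sp (orbit_normal_space Q G L \<Phi> \<gamma> es s s q\<^sub>\<upsilon>) \<longleftrightarrow> g = \<beta>' r)"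
    and U2: "\<U>\<^sub>2 = orbit G \<Phi> ` U'" and B2: "\<forall>r\<in>U'. \<B>\<^sub>\<upsilon> (orbit G \<Phi> r) = cmap c' (\<Phi> (\<beta>' r) r)"
    using assms(15) unfolding quotient_chart_def by (elim conjE exE) (rule that; assumption)
  have VG: "V \<subseteq> carrier G" "V' \<subseteq> carrier G"
    using openin_subset[OF V] openin_subset[OF V'(1)] A.L_points by auto
  have UM: "U \<subseteq> points (Q s)" "U' \<subseteq> points (Q s)" using openin_subset[OF U] openin_subset[OF U'] .
  define c1 where "c1 = \<lparr>cdom = cdom c \<inter> points (Q s), cmap = cmap c\<rparr>"
  define y where "y = cinv c1"
  have y_eq: "inv_into (cdom c \<inter> points (Q s)) (cmap c) = y" by (simp add: y_def cinv_def c1_def)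
  define N1 where "N1 = N s q\<^sub>\<omega>"
  define W where "W = \<B>\<^sub>\<omega> ` (\<U>\<^sub>1 \<inter> \<U>\<^sub>2)"
  have hom': "homeomorphic_maps (subtopology (orbit_space (Q s) G \<Phi>) \<U>\<^sub>1) (subtopology (ntop N1) (\<B>\<^sub>\<omega> ` \<U>\<^sub>1))
      \<B>\<^sub>\<omega> (orbit G \<Phi> \<circ> y)" and op': "openin (ntop N1) (\<B>\<^sub>\<omega> ` \<U>\<^sub>1)"
    using hom op by (simp_all add: N1_def N_def y_eq)
  have U1o: "openin (orbit_space (Q s) G \<Phi>) \<U>\<^sub>1" and U2o: "openin (orbit_space (Q s) G \<Phi>) \<U>\<^sub>2"
    unfolding U1 U2 by (rule A.A1.openin_orbit_image[OF U] A.A1.openin_orbit_image[OF U'])+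
  have tU1: "topspace (subtopology (orbit_space (Q s) G \<Phi>) \<U>\<^sub>1) = \<U>\<^sub>1" using openin_subset[OF U1o] by auto
  have tW1: "topspace (subtopology (ntop N1) (\<B>\<^sub>\<omega> ` \<U>\<^sub>1)) = \<B>\<^sub>\<omega> ` \<U>\<^sub>1" using openin_subset[OF op'] by auto
  have inv: "orbit G \<Phi> (y (\<B>\<^sub>\<omega> u)) = u" if "u \<in> \<U>\<^sub>1" for u
    using hom' that tU1 unfolding homeomorphic_maps_def by auto
  have inj: "inj_on \<B>\<^sub>\<omega> \<U>\<^sub>1" by (rule inj_on_inverseI[of _ "\<lambda>x. orbit G \<Phi> (y x)"]) (rule inv)
  have chart_pt: "y x \<in> cdom c1 \<and> cmap c1 (y x) = x" if x: "x \<in> \<B>\<^sub>\<omega> ` \<U>\<^sub>1" for x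
  proof -
    obtain r where r: "r \<in> U" "x = \<B>\<^sub>\<omega> (orbit G \<Phi> r)" using x unfolding U1 by blast
    have \<beta>r: "\<beta> r \<in> V" "\<beta> r \<in> carrier G" using r(1) \<beta>V VG by auto
    have "\<Phi> (\<beta> r) r \<in> cdom c1" using sl \<beta>r r(1) UM A.A1.act_closed by (auto simp: c1_def)
    moreover have "x = cmap c1 (\<Phi> (\<beta> r) r)" using B1 r by (simp add: c1_def)
    ultimately have "x \<in> cmap c1 ` cdom c1" by blast
    then show ?thesis unfolding y_def by (intro conjI cinv_in_cdom cmap_cinv)
  qed
  have Wo: "openin (ntop N1) W"
  proof -
    have cont: "continuous_map (subtopology (ntop N1) (\<B>\<^sub>\<omega> ` \<U>\<^sub>1)) (subtopology (orbit_space (Q s) G \<Phi>) \<U>\<^sub>1) (orbit G \<Phi> \<circ> y)"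
      using hom' by (simp add: homeomorphic_maps_def)
    have "openin (subtopology (orbit_space (Q s) G \<Phi>) \<U>\<^sub>1) (\<U>\<^sub>1 \<inter> \<U>\<^sub>2)"
      by (rule openin_subtopology_Int2[OF U2o])
    from openin_continuous_map_preimage[OF cont this]
    have "openin (subtopology (ntop N1) (\<B>\<^sub>\<omega> ` \<U>\<^sub>1)) {x \<in> \<B>\<^sub>\<omega> ` \<U>\<^sub>1. (orbit G \<Phi> \<circ> y) x \<in> \<U>\<^sub>1 \<inter> \<U>\<^sub>2}"
      unfolding tW1 .
    moreover have "{x \<in> \<B>\<^sub>\<omega> ` \<U>\<^sub>1. (orbit G \<Phi> \<circ> y) x \<in> \<U>\<^sub>1 \<inter> \<U>\<^sub>2} = W" using inv by (auto simp: W_def)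
    ultimately show ?thesis using openin_trans_full[OF _ op'] by metis
  qed
  have N1: "normed_space N1" unfolding N1_def by (rule nN[OF qw])
  have "\<exists>D. strict_deriv N1 (N (s - 1) q\<^sub>\<upsilon>) (\<B>\<^sub>\<upsilon> \<circ> inv_into \<U>\<^sub>1 \<B>\<^sub>\<omega>) D x0" if x0: "x0 \<in> W" for x0
  proof -
    have Wsub: "W \<subseteq> \<B>\<^sub>\<omega> ` \<U>\<^sub>1" by (auto simp: W_def)
    have cy0: "y x0 \<in> cdom c1" "cmap c1 (y x0) = x0" using chart_pt x0 Wsub by auto
    then have y0: "y x0 \<in> cdom c" "y x0 \<in> points (Q s)" "cmap c (y x0) = x0" by (auto simp: c1_def)
    obtain u where u: "u \<in> \<U>\<^sub>1" "u \<in> \<U>\<^sub>2" "x0 = \<B>\<^sub>\<omega> u" using x0 by (auto simp: W_def)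
    obtain r where r: "r \<in> U'" "u = orbit G \<Phi> r" using u(2) unfolding U2 by blast
    have "orbit G \<Phi> (y x0) = orbit G \<Phi> r" using inv[OF u(1)] u(3) r(2) by simp
    moreover have "r \<in> points (Q s)" using r UM by auto
    ultimately obtain g where g: "g \<in> carrier G" "\<Phi> g (y x0) = r" by (rule A.A1.orbit_eqD)
    have gU: "\<Phi> g (y x0) \<in> U'" using g r by simp
    have \<beta>G: "\<beta>' ` U' \<subseteq> carrier G" using \<beta>V' VG by auto
    have slice: "\<forall>x\<in>U'. x \<in> cdom c' \<and> \<Phi> (\<beta>' x) x \<in> cdom c'"
    proof
      fix x assume x: "x \<in> U'"
      have "\<Phi> \<one>\<^bsub>G\<^esub> x = x" using x UM by (intro A.A1.act_one) auto
      moreover have "\<Phi> \<one>\<^bsub>G\<^esub> x \<in> cdom c'" using sl' V'(2) x by blast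
      moreover have "\<Phi> (\<beta>' x) x \<in> cdom c'" using sl' \<beta>V' x by blast
      ultimately show "x \<in> cdom c' \<and> \<Phi> (\<beta>' x) x \<in> cdom c'" by simp
    qed
    obtain D \<rho> where D: "\<rho> > 0"
      "strict_deriv (tangent (Q s) q\<^sub>\<omega>) (tangent (Q (s - 1)) q\<^sub>\<upsilon>) (\<lambda>x. cmap c' (\<Phi> (\<beta>' (\<Phi> g (y x))) (\<Phi> g (y x)))) D (cmap c (y x0))"
      "\<forall>x\<in>nball (tangent (Q s) q\<^sub>\<omega>) (cmap c (y x0)) \<rho>. \<Phi> g (y x) \<in> U' \<and> y x \<in> points (Q s)"
      by (rule A.slice_map_strict[OF qw c y0(1,2) qv c' U' \<beta>' \<beta>G slice g(1) gU y_def[unfolded c1_def]])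
    have x0N: "x0 \<in> sp N1" using Wo x0 openin_ntop[OF N1] by blast
    obtain \<sigma> where \<sigma>: "\<sigma> > 0" "nball N1 x0 \<sigma> \<subseteq> W" using Wo x0 openin_ntop[OF N1] by blast
    define r0 where "r0 = min \<rho> \<sigma>"
    have r0: "r0 > 0" using D(1) \<sigma>(1) by (simp add: r0_def)
    have near: "\<Phi> g (y x) \<in> U'" "y x \<in> points (Q s)" "x \<in> W" if "x \<in> nball N1 x0 r0" for x
    proof -
      have "x \<in> nball (tangent (Q s) q\<^sub>\<omega>) (cmap c (y x0)) \<rho>"
        using that y0(3) by (auto simp: nball_def r0_def N1_def spN nrmN)
      then show "\<Phi> g (y x) \<in> U'" "y x \<in> points (Q s)" using D(3) by auto
      show "x \<in> W" using \<sigma>(2) that by (auto simp: nball_def r0_def)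
    qed
    have D': "strict_deriv N1 (N (s - 1) q\<^sub>\<upsilon>) (\<lambda>x. cmap c' (\<Phi> (\<beta>' (\<Phi> g (y x))) (\<Phi> g (y x)))) D x0"
    proof (rule strict_deriv_subspaces[OF D(2)[unfolded y0(3)] N1 nE(2)[OF qv] _ _ _ x0N nE(1)[OF qw] nN(2)[OF qv] _ r0])
      show "sp N1 \<subseteq> sp (tangent (Q s) q\<^sub>\<omega>)" "nrm N1 = nrm (tangent (Q s) q\<^sub>\<omega>)"
        "nrm (N (s - 1) q\<^sub>\<upsilon>) = nrm (tangent (Q (s - 1)) q\<^sub>\<upsilon>)"
        by (auto simp: N1_def spN nrmN)
      show "v \<in> sp (N (s - 1) q\<^sub>\<upsilon>)" if "v \<in> sp (tangent (Q (s - 1)) q\<^sub>\<upsilon>)"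
        "\<And>\<epsilon>. \<epsilon> > 0 \<Longrightarrow> \<exists>w\<in>sp (N (s - 1) q\<^sub>\<upsilon>). nrm (tangent (Q (s - 1)) q\<^sub>\<upsilon>) (w - v) \<le> \<epsilon>" for v
        by (rule N_closed[OF qv that])
      show "\<forall>x\<in>nball N1 x0 r0. cmap c' (\<Phi> (\<beta>' (\<Phi> g (y x))) (\<Phi> g (y x))) \<in> sp (N (s - 1) q\<^sub>\<upsilon>)"
      proof
        fix x assume "x \<in> nball N1 x0 r0"
        then have z: "\<Phi> g (y x) \<in> U'" by (rule near)
        then have "cmap c' (\<Phi> (\<beta>' (\<Phi> g (y x))) (\<Phi> g (y x))) \<in> sp (N s q\<^sub>\<upsilon>)"
          unfolding N_def using sl' \<beta>V' by blast
        then show "cmap c' (\<Phi> (\<beta>' (\<Phi> g (y x))) (\<Phi> g (y x))) \<in> sp (N (s - 1) q\<^sub>\<upsilon>)" using N_sub[OF qv] by blast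
      qed
    qed
    have "strict_deriv N1 (N (s - 1) q\<^sub>\<upsilon>) (\<B>\<^sub>\<upsilon> \<circ> inv_into \<U>\<^sub>1 \<B>\<^sub>\<omega>) D x0"
    proof (rule strict_deriv_transfer[OF D' r0])
      fix x assume x: "x \<in> nball N1 x0 r0"
      note n = near[OF x]
      obtain u where u: "u \<in> \<U>\<^sub>1" "x = \<B>\<^sub>\<omega> u" using n(3) by (auto simp: W_def)
      have "inv_into \<U>\<^sub>1 \<B>\<^sub>\<omega> x = u" using inj u by simp
      also have "u = orbit G \<Phi> (\<Phi> g (y x))" using inv[OF u(1)] A.A1.orbit_act[OF g(1) n(2)] u(2) by simp
      finally show "cmap c' (\<Phi> (\<beta>' (\<Phi> g (y x))) (\<Phi> g (y x))) = (\<B>\<^sub>\<upsilon> \<circ> inv_into \<U>\<^sub>1 \<B>\<^sub>\<omega>) x"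
        using B2 n(1) by simp
    qed
    then show ?thesis by blast
  qed
  then have "Ck_on 1 N1 (N (s - 1) q\<^sub>\<upsilon>) W (\<B>\<^sub>\<upsilon> \<circ> inv_into \<U>\<^sub>1 \<B>\<^sub>\<omega>)"
    by (rule Ck_on_1I[OF N1 nN(2)[OF qv] Wo])
  then show ?thesis by (simp add: N1_def N_def W_def)
qed

end
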